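(* Let $2\le m<N$ and fix a unit vector $e\in\mathbb{R}^N$. Let $h\in C^2(\mathbb{R}^2\setminus\{0\},\mathbb{R}_+)$ be an absolute norm, meaning that $h(x,y)=h(|x|,|y|)$, $h$ is $1$-homogeneous, and $h$ is convex. Define $$\Psi_h(T):=h\bigl(|Te|,|T^\perp e|\bigr),\qquad T\in\mathbb{G}(N,m),$$ and set $H(\theta):=h(\cos\theta,\sin\theta)$ for $0\le\theta\le\frac\pi2$. Then $\Psi_h$ satisfies USAC if and only if $$H(\theta)+H''(\theta)>0\qquad\text{for every }\theta\in[0,\tfrac\pi2].$$ Furthermore, if this condition holds, then $\Psi_h$ supports a Michael-Simon inequality.
   Context: $\mathbb{G}(N,m)$ is the Grassmannian of $m$-dimensional linear subspaces of $\mathbb{R}^N$, identified with orthogonal projections $\{T\in\mathbb{R}^{N\times N}:T=T^t,\ T^2=T,\ \operatorname{tr}T=m\}$; $T^\perp=I-T$. $\langle A,B\rangle=\operatorname{tr}(A^tB)$ and $\|\cdot\|$ is the Frobenius norm. For $\Psi\in C^1(\mathbb{G}(N,m),(0,\infty))$, extended to a $C^1$ function near $\mathbb{G}(N,m)$ in $\mathbb{R}^{N\times N}$, set $d\Psi(T):=D\Psi(T)+D\Psi(T)^t$ and $B_\Psi(T)=\Psi(T)T+T^\perp\,d\Psi(T)\,T$. The dual integrand is $\Psi^*(P):=\Psi(P^\perp)$ for $P\in\mathbb{G}(N,N-m)$, with $B_{\Psi^*}(S^\perp)=\Psi(S)S^\perp-S\,d\Psi(S)\,S^\perp$ for $S\in\mathbb{G}(N,m)$.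 USAC: there is $c_\Psi>0$ such that $\langle B_\Psi(T),B_{\Psi^*}(S^\perp)\rangle\ge c_\Psi\|T-S\|^2$ for all $S,T\in\mathbb{G}(N,m)$. An $m$-varifold $V$ in $\mathbb{R}^N$ is a Radon measure on $\mathbb{R}^N\times\mathbb{G}(N,m)$, with weight $\|V\|(A)=V(A\times\mathbb{G}(N,m))$ and anisotropic first variation $[\delta_\Psi V](g)=\int\langle B_\Psi(T),Dg(x)\rangle\,dV(x,T)$, with total variation measure $|\delta_\Psi V|$. $\Psi$ supports a Michael-Simon inequality if there is a constant $C(m,N,\Psi)<\infty$ such that every $m$-varifold $V$ with finite mass, finite first variation with respect to $\Psi$, and density $\Theta^m(\|V\|,x)\ge\theta_0>0$ for $\|V\|$-a.e. $x$ satisfies $\|V\|(\mathbb{R}^N)^{\frac{m-1}m}\le C(m,N,\Psi)\,\theta_0^{-\frac1m}\,|\delta_\Psi V|(\mathbb{R}^N)$. *)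

theory Defs
  imports "HOL-Analysis.Analysis"
begin

section \<open>The Grassmannian\<close>

text \<open>
  Matrices in $\mathbb{R}^{N\times N}$ have type \<open>real^'n^'n\<close> with \<open>N = CARD('n)\<close>. The library's
  inner product \<open>\<bullet>\<close> and \<open>norm\<close> on this type are entrywise, so they are
  $\langle A,B\rangle=\operatorname{tr}(A^tB)$ and the Frobenius norm (see \<open>inner_eq_trace\<close> below).
\<close>

definition grassmannian :: "nat \<Rightarrow> (real^'n^'n) set" where
  "grassmannian m = {T. transpose T = T \<and> T ** T = T \<and> trace T = real m}"

definition perp :: "real^'n^'n \<Rightarrow> real^'n^'n" where
  "perp T = mat 1 - T"

lemma inner_eq_trace: "(A :: real^'n^'n) \<bullet> B = trace (transpose A ** B)"
proof -
  have "trace (transpose A ** B) = (\<Sum>j\<in>UNIV. \<Sum>i\<in>UNIV. A $ i $ j * B $ i $ j)"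
    by (simp add: trace_def transpose_def matrix_matrix_mult_def)
  also have "\<dots> = (\<Sum>i\<in>UNIV. \<Sum>j\<in>UNIV. A $ i $ j * B $ i $ j)"
    by (rule sum.swap)
  finally show ?thesis by (simp add: inner_vec_def)
qed


section \<open>Differentiability classes\<close>

definition C1_on :: "'a::real_normed_vector set \<Rightarrow> ('a \<Rightarrow> 'b::real_normed_vector) \<Rightarrow> bool" where
  "C1_on U f \<longleftrightarrow> (\<exists>D. (\<forall>x\<in>U. (f has_derivative blinfun_apply (D x)) (at x)) \<and> continuous_on U D)"

definition C2_on :: "'a::real_normed_vector set \<Rightarrow> ('a \<Rightarrow> 'b::real_normed_vector) \<Rightarrow> bool" where
  "C2_on U f \<longleftrightarrow> (\<exists>D. (\<forall>x\<in>U. (f has_derivative blinfun_apply (D x)) (at x)) \<and> C1_on U D)"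


section \<open>Anisotropic integrands\<close>

text \<open>
  \<open>C1_extension m \<Psi> F DF\<close>: \<open>F\<close> is $C^1$ on a neighbourhood of the Grassmannian, with gradient
  \<open>DF\<close> (with respect to the Frobenius inner product), and it agrees with \<open>\<Psi>\<close> on the Grassmannian.
  The values of \<open>\<Psi>\<close> outside the Grassmannian play no role.
\<close>

definition C1_extension ::
    "nat \<Rightarrow> (real^'n^'n \<Rightarrow> real) \<Rightarrow> (real^'n^'n \<Rightarrow> real) \<Rightarrow> (real^'n^'n \<Rightarrow> real^'n^'n) \<Rightarrow> bool" where
  "C1_extension m \<Psi> F DF \<longleftrightarrow>
     (\<exists>U. open U \<and> grassmannian m \<subseteq> U \<and> (\<forall>X\<in>U. GDERIV F X :> DF X) \<and> continuous_on U DF) \<and>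
     (\<forall>T\<in>grassmannian m. F T = \<Psi> T)"

definition C1_integrand :: "nat \<Rightarrow> (real^'n^'n \<Rightarrow> real) \<Rightarrow> bool" where
  "C1_integrand m \<Psi> \<longleftrightarrow> (\<forall>T\<in>grassmannian m. \<Psi> T > 0) \<and> (\<exists>F DF. C1_extension m \<Psi> F DF)"

text \<open>
  The gradient of some fixed $C^1$ extension. It depends on the extension, but \<open>B_int\<close> does not:
  see \<open>B_int_eq\<close> and \<open>B_int_dual\<close> below.
\<close>

definition D_int :: "nat \<Rightarrow> (real^'n^'n \<Rightarrow> real) \<Rightarrow> real^'n^'n \<Rightarrow> real^'n^'n" where
  "D_int m \<Psi> = (SOME DF. \<exists>F. C1_extension m \<Psi> F DF)"

definition d_int :: "nat \<Rightarrow> (real^'n^'n \<Rightarrow> real) \<Rightarrow> real^'n^'n \<Rightarrow> real^'n^'n" where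
  "d_int m \<Psi> T = D_int m \<Psi> T + transpose (D_int m \<Psi> T)"

definition B_int :: "nat \<Rightarrow> (real^'n^'n \<Rightarrow> real) \<Rightarrow> real^'n^'n \<Rightarrow> real^'n^'n" where
  "B_int m \<Psi> T = \<Psi> T *\<^sub>R T + perp T ** d_int m \<Psi> T ** T"

text \<open>If \<open>\<Psi>\<close> is an integrand on \<open>grassmannian m\<close>, its dual is one on \<open>grassmannian (N - m)\<close>.\<close>

definition dual_integrand :: "(real^'n^'n \<Rightarrow> real) \<Rightarrow> real^'n^'n \<Rightarrow> real" where
  "dual_integrand \<Psi> P = \<Psi> (perp P)"

definition USAC :: "nat \<Rightarrow> (real^'n^'n \<Rightarrow> real) \<Rightarrow> bool" where
  "USAC m \<Psi> \<longleftrightarrow> C1_integrand m \<Psi> \<and>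
     (\<exists>c>0. \<forall>S\<in>grassmannian m. \<forall>T\<in>grassmannian m.
        B_int m \<Psi> T \<bullet> B_int (CARD('n) - m) (dual_integrand \<Psi>) (perp S) \<ge> c * (norm (T - S))\<^sup>2)"
  for \<Psi> :: "real^'n^'n \<Rightarrow> real"


section \<open>Varifolds and the Michael-Simon inequality\<close>

text \<open>
  On the locally compact, second countable space $\mathbb{R}^N\times\mathbb{G}(N,m)$ a Radon measure
  is a Borel measure that is finite on compact sets.
\<close>

definition varifold :: "nat \<Rightarrow> ((real^'n) \<times> (real^'n^'n)) measure \<Rightarrow> bool" where
  "varifold m V \<longleftrightarrow> sets V = sets (restrict_space borel (UNIV \<times> grassmannian m)) \<and>
     (\<forall>K. compact K \<and> K \<subseteq> UNIV \<times> grassmannian m \<longrightarrow> emeasure V K < \<infinity>)"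

definition weight :: "((real^'n) \<times> (real^'n^'n)) measure \<Rightarrow> (real^'n) measure" where
  "weight V = distr V borel fst"

text \<open>
  \<open>matrix (frechet_derivative g (at x))\<close> is the Jacobian matrix with entries $\partial_j g_i(x)$.
\<close>

definition first_variation ::
    "nat \<Rightarrow> (real^'n^'n \<Rightarrow> real) \<Rightarrow> ((real^'n) \<times> (real^'n^'n)) measure \<Rightarrow> (real^'n \<Rightarrow> real^'n) \<Rightarrow> real" where
  "first_variation m \<Psi> V g =
     (\<integral>(x, T). B_int m \<Psi> T \<bullet> matrix (frechet_derivative g (at x)) \<partial>V)"

definition test_fields :: "(real^'n) set \<Rightarrow> (real^'n \<Rightarrow> real^'n) set" where
  "test_fields U = {g. C1_on UNIV g \<and> compact (closure {x. g x \<noteq> 0}) \<and> closure {x. g x \<noteq> 0} \<subseteq> U}"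

text \<open>
  The total variation measure $|\delta_\Psi V|$ on open sets \<open>U\<close>. The supremum is nonnegative because
  of \<open>g = 0\<close>, so truncating negative values to zero by \<open>ennreal\<close> does not affect it.
\<close>

definition total_variation ::
    "nat \<Rightarrow> (real^'n^'n \<Rightarrow> real) \<Rightarrow> ((real^'n) \<times> (real^'n^'n)) measure \<Rightarrow> (real^'n) set \<Rightarrow> ennreal" where
  "total_variation m \<Psi> V U =
     (SUP g \<in> {g \<in> test_fields U. \<forall>x. norm (g x) \<le> 1}. ennreal (first_variation m \<Psi> V g))"

text \<open>The density $\Theta^m(\mu,x)$ is a limit; \<open>has_density m \<mu> x d\<close> says that it exists and equals \<open>d\<close>.\<close>

definition has_density :: "nat \<Rightarrow> (real^'n) measure \<Rightarrow> real^'n \<Rightarrow> ennreal \<Rightarrow> bool" where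
  "has_density m \<mu> x d \<longleftrightarrow>
     ((\<lambda>r. emeasure \<mu> (cball x r) / ennreal (unit_ball_vol (real m) * r ^ m)) \<longlongrightarrow> d) (at_right 0)"

definition supports_Michael_Simon :: "nat \<Rightarrow> (real^'n^'n \<Rightarrow> real) \<Rightarrow> bool" where
  "supports_Michael_Simon m \<Psi> \<longleftrightarrow> C1_integrand m \<Psi> \<and>
     (\<exists>C::real. \<forall>V. \<forall>\<theta>\<^sub>0>0.
        varifold m V \<and>
        emeasure (weight V) UNIV < \<infinity> \<and>
        total_variation m \<Psi> V UNIV < \<infinity> \<and>
        (AE x in weight V. \<exists>d\<ge>ennreal \<theta>\<^sub>0. has_density m (weight V) x d)
        \<longrightarrow> measure (weight V) UNIV powr ((real m - 1) / real m)
            \<le> C * \<theta>\<^sub>0 powr (- 1 / real m) * enn2real (total_variation m \<Psi> V UNIV))"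


section \<open>Integrands induced by absolute norms of the plane\<close>

text \<open>Smoothness away from the origin is not part of this notion.\<close>

definition absolute_norm :: "(real \<times> real \<Rightarrow> real) \<Rightarrow> bool" where
  "absolute_norm h \<longleftrightarrow>
     (\<forall>p. p \<noteq> 0 \<longrightarrow> h p > 0) \<and>
     (\<forall>x y. h (x, y) = h (\<bar>x\<bar>, \<bar>y\<bar>)) \<and>
     (\<forall>t\<ge>0. \<forall>p. h (t *\<^sub>R p) = t * h p) \<and>
     convex_on UNIV h"

definition Psi_of :: "(real \<times> real \<Rightarrow> real) \<Rightarrow> real^'n \<Rightarrow> real^'n^'n \<Rightarrow> real" where
  "Psi_of h e T = h (norm (T *v e), norm (perp T *v e))"

text \<open>
  The formula makes sense for all real angles. For \<open>h\<close> of class $C^2$ off the origin, \<open>polar h\<close> is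
  $C^2$ on the real line, so at the endpoints of $[0,\pi/2]$ its two-sided second derivative
  is also the one-sided one.
\<close>

definition polar :: "(real \<times> real \<Rightarrow> real) \<Rightarrow> real \<Rightarrow> real" where
  "polar h \<theta> = h (cos \<theta>, sin \<theta>)"


section \<open>The tensor \<open>B_int\<close> does not depend on the extension\<close>

definition outer :: "real^'n \<Rightarrow> real^'n \<Rightarrow> real^'n^'n" where
  "outer u v = (\<chi> i j. u $ i * v $ j)"

lemma outer_mult_vec: "outer u v *v x = (v \<bullet> x) *\<^sub>R u"
  by (simp add: outer_def matrix_vector_mult_def vec_eq_iff inner_vec_def sum_distrib_left
      sum_distrib_right algebra_simps)

lemma transpose_outer: "transpose (outer u v) = outer v u"
  by (simp add: outer_def transpose_def vec_eq_iff)

lemma trace_outer: "trace (outer u v) = u \<bullet> v"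
  by (simp add: outer_def trace_def inner_vec_def)

lemma inner_outer: "A \<bullet> outer u v = u \<bullet> (A *v v)"
  by (simp add: outer_def inner_vec_def matrix_vector_mult_def sum_distrib_left algebra_simps)

lemma outer_scaleR: "outer (a *\<^sub>R u) (b *\<^sub>R v) = (a * b) *\<^sub>R outer u v"
  by (simp add: outer_def vec_eq_iff)

lemma transpose_add: "transpose (A + B) = transpose A + transpose (B :: real^'n^'m)"
  by (simp add: transpose_def vec_eq_iff)

lemma transpose_diff: "transpose (A - B) = transpose A - transpose (B :: real^'n^'m)"
  by (simp add: transpose_def vec_eq_iff)

lemma matrix_sub_ldistrib: "A ** (B - C) = A ** B - A ** (C :: real^'n^'n)"
  by (simp add: matrix_matrix_mult_def vec_eq_iff sum_subtractf algebra_simps)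

lemma matrix_sub_rdistrib: "(A - B) ** C = A ** C - B ** (C :: real^'n^'n)"
  by (simp add: matrix_matrix_mult_def vec_eq_iff sum_subtractf algebra_simps)

lemma sym_inner: "transpose (T :: real^'n^'n) = T \<Longrightarrow> x \<bullet> (T *v y) = (T *v x) \<bullet> y"
  by (metis dot_lmul_matrix vector_transpose_matrix)

lemma rotation_in_grassmannian:
  fixes T :: "real^'n^'n"
  assumes T: "T \<in> grassmannian m" and "T *v v = v" "T *v u = 0" and "norm u = 1" "norm v = 1"
  defines "w \<equiv> \<lambda>t::real. cos t *\<^sub>R v + sin t *\<^sub>R u"
  shows "T - outer v v + outer (w t) (w t) \<in> grassmannian m"
proof -
  let ?p = "T - outer v v + outer (w t) (w t)"
  have sym: "transpose T = T" and idem: "T ** T = T" and tr: "trace T = real m"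
    using T by (auto simp: grassmannian_def)
  have idem': "T *v (T *v x) = T *v x" for x
    by (simp add: idem matrix_vector_mul_assoc)
  have vv: "v \<bullet> v = 1" and uu: "u \<bullet> u = 1"
    using assms by (simp_all add: dot_square_norm)
  have uv: "u \<bullet> v = 0"
    using sym_inner[OF sym, of u v] assms by simp
  have vu: "v \<bullet> u = 0" using uv by (simp add: inner_commute)
  have ww: "w t \<bullet> w t = 1"
    by (simp add: w_def inner_add_left inner_add_right vv uu uv vu)
  have vw: "v \<bullet> w t = cos t" "w t \<bullet> v = cos t"
    by (simp_all add: w_def inner_add_left inner_add_right vv uv vu)
  have Tw: "T *v w t = cos t *\<^sub>R v"
    by (simp add: w_def matrix_vector_right_distrib matrix_vector_mult_scaleR assms)
  have p: "?p *v x = T *v x - (v \<bullet> x) *\<^sub>R v + (w t \<bullet> x) *\<^sub>R w t" for x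
    by (simp add: matrix_vector_mult_add_rdistrib matrix_vector_mult_diff_rdistrib outer_mult_vec)
  have vT: "v \<bullet> (T *v x) = v \<bullet> x" for x using sym_inner[OF sym, of v x] assms by simp
  have wT: "w t \<bullet> (T *v x) = cos t * (v \<bullet> x)" for x using sym_inner[OF sym, of "w t" x] Tw by simp
  have "?p *v (?p *v x) = ?p *v x" for x
  proof -
    have a: "T *v (?p *v x) = T *v x - (v \<bullet> x) *\<^sub>R v + (w t \<bullet> x) *\<^sub>R cos t *\<^sub>R v"
      unfolding p by (simp add: matrix_vector_right_distrib matrix_vector_mult_diff_distrib
          matrix_vector_mult_scaleR assms Tw idem')
    have b: "v \<bullet> (?p *v x) = (w t \<bullet> x) * cos t"
      unfolding p by (simp add: inner_add_right inner_diff_right vT vv vw)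
    have c: "w t \<bullet> (?p *v x) = w t \<bullet> x"
      unfolding p by (simp add: inner_add_right inner_diff_right wT ww vw)
    have "?p *v (?p *v x) = T *v (?p *v x) - (v \<bullet> (?p *v x)) *\<^sub>R v + (w t \<bullet> (?p *v x)) *\<^sub>R w t"
      by (rule p)
    also have "\<dots> = ?p *v x"
      unfolding a b c by (simp add: p)
    finally show ?thesis .
  qed
  then have "?p ** ?p = ?p"
    by (simp add: matrix_eq flip: matrix_vector_mul_assoc)
  moreover have "transpose ?p = ?p"
    by (simp add: transpose_add transpose_diff transpose_outer sym)
  moreover have "trace ?p = real m"
    by (simp add: trace_add trace_sub trace_outer vv ww tr)
  ultimately show ?thesis by (simp add: grassmannian_def)
qed

lemma extension_tangent_unit:
  fixes T :: "real^'n^'n"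
  assumes E: "C1_extension m \<Psi> F DF" and T: "T \<in> grassmannian m"
    and "T *v v = v" "T *v u = 0" and "norm u = 1" "norm v = 1"
    and E': "C1_extension m \<Psi> G DG"
  shows "DF T \<bullet> (outer u v + outer v u) = DG T \<bullet> (outer u v + outer v u)"
proof -
  define p where "p = (\<lambda>t::real. T - outer v v +
     outer (cos t *\<^sub>R v + sin t *\<^sub>R u) (cos t *\<^sub>R v + sin t *\<^sub>R u))"
  have pG: "p t \<in> grassmannian m" for t
    unfolding p_def using rotation_in_grassmannian[OF T] assms by blast
  have p0: "p 0 = T" by (simp add: p_def)
  have lin: "p t = T - outer v v + ((cos t)\<^sup>2 *\<^sub>R outer v v + (cos t * sin t) *\<^sub>R (outer u v + outer v u)
      + (sin t)\<^sup>2 *\<^sub>R outer u u)" for t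
    by (simp add: p_def outer_def vec_eq_iff algebra_simps power2_eq_square)
  have dp: "(p has_vector_derivative (outer u v + outer v u)) (at 0)"
    unfolding lin[abs_def]
    by (auto intro!: derivative_eq_intros)
  have D: "((\<lambda>t. K (p t)) has_real_derivative DK T \<bullet> (outer u v + outer v u)) (at 0)"
    if "C1_extension m \<Psi> K DK" for K DK
  proof -
    have "(K has_derivative (\<lambda>X. X \<bullet> DK T)) (at (p 0))"
      using that T unfolding C1_extension_def gderiv_def p0 by blast
    from has_derivative_compose[OF dp[unfolded has_vector_derivative_def] this]
    show ?thesis
      by (simp add: has_field_derivative_def inner_commute mult.commute[of _ "DK T \<bullet> _"] fun_eq_iff
          del: inner_add_right inner_add_left) 
  qed
  have "F (p t) = G (p t)" for t
    using E E' pG unfolding C1_extension_def by metis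
  with D[OF E] D[OF E'] show ?thesis by (auto intro: DERIV_unique)
qed

lemma extension_tangent:
  fixes T :: "real^'n^'n"
  assumes E: "C1_extension m \<Psi> F DF" and E': "C1_extension m \<Psi> G DG"
    and T: "T \<in> grassmannian m" and v: "T *v v = v" and u: "T *v u = 0"
  shows "DF T \<bullet> (outer u v + outer v u) = DG T \<bullet> (outer u v + outer v u)"
proof (cases "u = 0 \<or> v = 0")
  case True
  then show ?thesis by (auto simp: outer_def zero_vec_def[symmetric])
next
  case False
  let ?u = "u /\<^sub>R norm u" and ?v = "v /\<^sub>R norm v"
  have s: "outer u v + outer v u = (norm u * norm v) *\<^sub>R (outer ?u ?v + outer ?v ?u)"
    using False by (simp add: outer_scaleR scaleR_add_right field_simps)
  have "DF T \<bullet> (outer ?u ?v + outer ?v ?u) = DG T \<bullet> (outer ?u ?v + outer ?v ?u)"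
    by (rule extension_tangent_unit[OF E T _ _ _ _ E'])
       (use False u v in \<open>simp_all add: matrix_vector_mult_scaleR\<close>)
  then show ?thesis unfolding s by (simp only: inner_scaleR_right)
qed

lemma perp_perp [simp]: "perp (perp T) = T"
  by (simp add: perp_def)

lemma perp_in_grassmannian:
  fixes T :: "real^'n^'n"
  assumes "m \<le> CARD('n)" "T \<in> grassmannian m"
  shows "perp T \<in> grassmannian (CARD('n) - m)"
  using assms
  by (auto simp: grassmannian_def perp_def transpose_diff transpose_mat trace_sub trace_I
      matrix_sub_ldistrib matrix_sub_rdistrib of_nat_diff)

lemma B_int_eq:
  fixes T :: "real^'n^'n"
  assumes E: "C1_extension m \<Psi> F DF" and T: "T \<in> grassmannian m"
  shows "B_int m \<Psi> T = \<Psi> T *\<^sub>R T + perp T ** (DF T + transpose (DF T)) ** T"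
proof -
  have sym: "transpose T = T" and idem: "T ** T = T" using T by (auto simp: grassmannian_def)
  have E': "\<exists>G. C1_extension m \<Psi> G (D_int m \<Psi>)"
    unfolding D_int_def using E someI_ex[of "\<lambda>DF. \<exists>F. C1_extension m \<Psi> F DF"] by blast
  have symp: "transpose (perp T) = perp T"
    by (simp add: perp_def transpose_diff transpose_mat sym)
  have Tp: "T ** perp T = 0"
    by (simp add: perp_def matrix_sub_ldistrib idem)
  have key: "x \<bullet> ((perp T ** (D + transpose D) ** T) *v y) =
      D \<bullet> (outer (perp T *v x) (T *v y) + outer (T *v y) (perp T *v x))" for D :: "real^'n^'n" and x y
  proof -
    have "x \<bullet> ((perp T ** (D + transpose D) ** T) *v y) =
        (perp T *v x) \<bullet> ((D + transpose D) *v (T *v y))"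
      by (simp add: sym_inner[OF symp] flip: matrix_vector_mul_assoc)
    also have "\<dots> = (perp T *v x) \<bullet> (D *v (T *v y)) + (T *v y) \<bullet> (D *v (perp T *v x))"
      by (simp add: matrix_vector_mult_add_rdistrib inner_add_right)
         (metis dot_lmul_matrix inner_commute transpose_matrix_vector)
    finally show ?thesis by (simp add: inner_add_right inner_outer)
  qed
  have "x \<bullet> ((perp T ** (DF T + transpose (DF T)) ** T) *v y) =
        x \<bullet> ((perp T ** d_int m \<Psi> T ** T) *v y)" for x y
    unfolding key d_int_def using E' extension_tangent[OF E _ T]
    by (metis Tp idem matrix_vector_mul_assoc matrix_vector_mult_0)
  then have "perp T ** (DF T + transpose (DF T)) ** T = perp T ** d_int m \<Psi> T ** T"
    by (metis matrix_eq vector_eq_ldot)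
  then show ?thesis by (simp add: B_int_def)
qed

lemma B_int_dual:
  fixes S :: "real^'n^'n"
  assumes m: "m \<le> CARD('n)" and I: "C1_integrand m \<Psi>" and S: "S \<in> grassmannian m"
  shows "B_int (CARD('n) - m) (dual_integrand \<Psi>) (perp S) =
           \<Psi> S *\<^sub>R perp S - S ** d_int m \<Psi> S ** perp S"
proof -
  obtain F where E: "C1_extension m \<Psi> F (D_int m \<Psi>)"
    using I someI_ex[of "\<lambda>DF. \<exists>F. C1_extension m \<Psi> F DF"]
    unfolding C1_integrand_def D_int_def by blast
  define DF where "DF = D_int m \<Psi>"
  obtain U where U: "open U" "grassmannian m \<subseteq> U" "\<And>X. X \<in> U \<Longrightarrow> GDERIV F X :> DF X"
      "continuous_on U DF" and F: "\<And>T. T \<in> grassmannian m \<Longrightarrow> F T = \<Psi> T"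
    using E unfolding C1_extension_def DF_def by blast
  have G: "perp P \<in> grassmannian m" if "P \<in> grassmannian (CARD('n) - m)" for P :: "real^'n^'n"
    using perp_in_grassmannian[of "CARD('n) - m" P] that m by simp
  have cont: "continuous_on A (perp :: real^'n^'n \<Rightarrow> _)" for A
    unfolding perp_def by (intro continuous_intros)
  have "C1_extension (CARD('n) - m) (dual_integrand \<Psi>) (\<lambda>P. F (perp P)) (\<lambda>P. - DF (perp P))"
    unfolding C1_extension_def
  proof (intro conjI ballI exI[of _ "perp -` U"])
    show "open (perp -` U)" using U(1) cont by (simp add: open_vimage)
    show "grassmannian (CARD('n) - m) \<subseteq> perp -` U" using G U by blast
    show "continuous_on (perp -` U) (\<lambda>P. - DF (perp P))"
      by (intro continuous_on_minus continuous_on_compose2[OF U(4) cont]) auto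
    show "F (perp P) = dual_integrand \<Psi> P" if "P \<in> grassmannian (CARD('n) - m)" for P
      using F[OF G[OF that]] by (simp add: dual_integrand_def)
    show "GDERIV (\<lambda>P. F (perp P)) P :> - DF (perp P)" if "P \<in> perp -` U" for P
    proof -
      have "(perp has_derivative (\<lambda>X. - X)) (at P)"
        unfolding perp_def by (auto intro!: derivative_eq_intros)
      moreover have "(F has_derivative (\<lambda>X. X \<bullet> DF (perp P))) (at (perp P))"
        using U(3) that by (simp add: gderiv_def)
      ultimately show ?thesis
        unfolding gderiv_def using has_derivative_compose by fastforce
    qed
  qed
  from B_int_eq[OF this perp_in_grassmannian[OF m S]] show ?thesis
  proof -
    have "S ** (- DF S + transpose (- DF S)) ** perp S = - (S ** d_int m \<Psi> S ** perp S)"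
    proof -
      have "- DF S + transpose (- DF S) = 0 - d_int m \<Psi> S"
        by (simp add: d_int_def DF_def transpose_def vec_eq_iff)
      then show ?thesis
        by (simp add: matrix_sub_ldistrib matrix_sub_rdistrib del: diff_0)
    qed
    with \<open>B_int (CARD('n) - m) (dual_integrand \<Psi>) (perp S) = _\<close> show ?thesis
      by (simp add: dual_integrand_def)
  qed
qed

end

theory Submission
  imports Defs "HOL-Probability.Probability"
begin

text \<open>
  Write a plane as $T = T' + a\otimes a$ with $a = \cos\theta\, e + \sin\theta\, g$, where \<open>g\<close> is a unit
  vector orthogonal to \<open>e\<close> and $T'$ annihilates \<open>e\<close> and \<open>g\<close>. With $H = h(\cos\theta,\sin\theta)$,
  $X = H\cos\theta - H'\sin\theta$, $Y = H\sin\theta + H'\cos\theta$ one gets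
  $B(T) = H\,T' + (Xe+Yg)\otimes a$, and the USAC pairing of two planes becomes a combination with nonnegative
  coefficients (traces of products of projections) of products of $X, Y, \cos, \sin$, plus
  $\sin(\theta-\phi)\,(Y_\theta X_\phi - X_\theta Y_\phi)$. For $H = 1$ the same expression is
  $\frac12|T-S|^2$. Since $X' = -(H+H'')\sin\theta$ and $Y' = (H+H'')\cos\theta$, the bound
  $H+H''\ge k$ compares the two expressions term by term; conversely, varying only the angle shows
  that USAC forces $(H+H'')H > 0$.

  The Michael-Simon inequality holds for every integrand satisfying USAC. Let $\mu$ and $A$ be the Gaussian
  mollifications at time \<open>t\<close> of the weight and of the measure with density \<open>B\<close>, and $E = A/\mu$.
  By USAC the convex hull of the values of \<open>B\<close> consists of matrices of rank at least \<open>m\<close>, so there is a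
  smooth $M(E)$ such that $\Pi = E^tM(E)E$ is an average of orthogonal projections of rank \<open>m\<close>.
  Cauchy-Schwarz gives $-tD^2\log\mu\le I$. Hence the time derivative of the entropy
  $\mu\log(t^{(N-m)/2}\mu+\eta)$ is bounded below by $\Pi : D^2\log\mu$ up to a positive factor and a divergence,
  and two integrations by parts express this term through $\operatorname{div} A$ and $\mu|DE|^2$. The
  latter is absorbed by the dissipation of $|A|^2/\mu$, and $\int|\operatorname{div}A|$ is at most a
  multiple of the first variation. The entropy is large at small times because of the lower density
  bound and small at time $R^2$, and choosing \<open>R\<close> with $\theta_0R^m$ a large multiple of the mass gives the inequality.
\<close>

section \<open>Integration on Euclidean space\<close>

text \<open>The obstacle is a quadratic term. Testing the Hessian of log \<mu> against \<Pi>
  produces products of E grad log \<mu>, and grad log \<mu> is of size t^(-1/2) with no smallness.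
  The way out is div A = \<mu> (E grad log \<mu> + div E): a factor E grad log \<mu> is traded for
  the divergence of A, which the first variation pays for, or for DE, which the dissipation pays
  for. This is why \<Pi> carries a factor E on both sides, and why M has to be C1: DM enters the
  errors. Picking m rows of E cannot be done smoothly by a single choice, so M averages over all
  choices. The second obstacle is the time integral. The first variation bounds div A only in L^1,
  and the pointwise bound gives the rate 1/t, not integrable at 0; interpolating between the two
  gives t^(-3/4). Apart from the regularity of the integrand, USAC enters the inequality only
  through the rank bound. That bound is needed on the whole convex hull because E is an average of
  values of B.\<close>

lemma lborel_translation_integral:
  fixes F :: "'a::euclidean_space \<Rightarrow> real"
  shows "(\<integral>x. F (x + c) \<partial>lborel) = (\<integral>x. F x \<partial>lborel)"
    and "integrable lborel (\<lambda>x. F (x + c)) \<longleftrightarrow> integrable lborel F"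
proof -
  have d: "distr lborel borel ((+) c) = (lborel :: 'a measure)" by (rule lborel_distr_plus)
  show "(\<integral>x. F (x + c) \<partial>lborel) = (\<integral>x. F x \<partial>lborel)"
  \<comment> \<open>There is no measurability hypothesis: a nonmeasurable function has a
    nonmeasurable translate, and the Bochner integral is then 0 by default on both sides.\<close>
  proof (cases "F \<in> borel_measurable borel")
    case True
    show ?thesis
      by (subst (2) d[symmetric], subst integral_distr) (use True in \<open>auto simp: add.commute\<close>)
  next
    case False
    have "(\<lambda>x. F (x + c)) \<notin> borel_measurable borel"
    proof
      assume "(\<lambda>x. F (x + c)) \<in> borel_measurable borel"
      then have "(\<lambda>x. F ((x - c) + c)) \<in> borel_measurable borel"
        by (rule measurable_compose[rotated]) measurable
      with False show False by simp
    qed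
    then have "\<not> integrable lborel F" "\<not> integrable lborel (\<lambda>x. F (x + c))"
      using False by (auto dest: borel_measurable_integrable)
    then show ?thesis by (simp add: not_integrable_integral_eq)
  qed
  show "integrable lborel (\<lambda>x. F (x + c)) \<longleftrightarrow> integrable lborel F"
  proof
    assume "integrable lborel F"
    then show "integrable lborel (\<lambda>x. F (x + c))"
      by (subst (asm) d[symmetric], subst (asm) integrable_distr_eq)
        (auto dest: borel_measurable_integrable simp: add.commute)
  next
    assume a: "integrable lborel (\<lambda>x. F (x + c))"
    then have m: "(\<lambda>x. F (x + c)) \<in> borel_measurable borel"
      using borel_measurable_integrable by fastforce
    have d': "distr lborel borel ((+) (-c)) = (lborel :: 'a measure)" by (rule lborel_distr_plus)
    have "integrable (distr lborel borel ((+) (-c))) (\<lambda>x. F (x + c))" unfolding d' by (rule a)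
    then have "integrable lborel (\<lambda>x. F ((- c + x) + c))"
      using m by (subst (asm) integrable_distr_eq) auto
    then show "integrable lborel F" by simp
  qed
qed

text \<open>Integrate F(x + v) - F(x), which is the integral of F' along the segment, over all x.
  Translation invariance makes the result 0, Fubini makes it the integral of F'. Integrability thus
  takes the place of decay at infinity.\<close>

lemma integral_directional_derivative_eq_0:
  fixes F F' :: "'a::euclidean_space \<Rightarrow> real"
  assumes D: "\<And>x. ((\<lambda>s. F (x + s *\<^sub>R v)) has_real_derivative F' x) (at 0)"
    and F: "integrable lborel F" and F': "integrable lborel F'" and c: "continuous_on UNIV F'"
  shows "(\<integral>x. F' x \<partial>lborel) = 0"
proof -
  have D': "((\<lambda>s. F (x + s *\<^sub>R v)) has_real_derivative F' (x + s *\<^sub>R v)) (at s)" for x s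
  proof -
    have "((\<lambda>r. F ((x + s *\<^sub>R v) + (r - s) *\<^sub>R v)) has_real_derivative F' (x + s *\<^sub>R v) * 1) (at s)"
      by (rule DERIV_chain2[where g="\<lambda>r. r - s"])
        (use D[of "x + s *\<^sub>R v"] in \<open>auto intro!: derivative_eq_intros\<close>)
    then show ?thesis by (simp add: algebra_simps)
  qed
  let ?P = "\<lambda>s x. indicator {0..1::real} s * F' (x + s *\<^sub>R v)"
  have contc: "continuous_on UNIV (\<lambda>p. F' (snd p + fst p *\<^sub>R v))"
    by (intro continuous_on_compose2[OF c] continuous_intros) auto
  have m0: "(\<lambda>p::real\<times>'a. F' (snd p + fst p *\<^sub>R v)) \<in> borel_measurable borel"
    using contc borel_measurable_continuous_onI by blast
  moreover have "sets (lborel \<Otimes>\<^sub>M lborel) = sets (borel :: (real \<times> 'a) measure)"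
    by (metis borel_prod sets_lborel sets_pair_measure_cong)
  ultimately have m1: "(\<lambda>p::real\<times>'a. F' (snd p + fst p *\<^sub>R v)) \<in> borel_measurable (lborel \<Otimes>\<^sub>M lborel)"
    by (simp cong: measurable_cong_sets)
  have m: "case_prod ?P \<in> borel_measurable (lborel \<Otimes>\<^sub>M lborel)"
    using m1 by (auto simp: case_prod_beta intro!: borel_measurable_times)
  have intP: "integrable (lborel \<Otimes>\<^sub>M lborel) (case_prod ?P)"
  proof (rule lborel_pair.Fubini_integrable[OF m])
    have "(\<integral>x. norm (case (s,x) of (s, x) \<Rightarrow> ?P s x) \<partial>lborel) = indicator {0..1} s * (\<integral>x. \<bar>F' x\<bar> \<partial>lborel)" for s
      using lborel_translation_integral(1)[of "\<lambda>x. \<bar>F' x\<bar>" "s *\<^sub>R v"] by (simp add: abs_mult)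
    moreover have "integrable lborel (\<lambda>s. indicator {0..1::real} s * (\<integral>x. \<bar>F' x\<bar> \<partial>lborel))"
      by (intro integrable_mult_left integrable_real_indicator) auto
    ultimately show "integrable lborel (\<lambda>s. \<integral>x. norm (case (s,x) of (s, x) \<Rightarrow> ?P s x) \<partial>lborel)"
      by (simp only:)
    show "AE s in lborel. integrable lborel (\<lambda>x. case (s,x) of (s, x) \<Rightarrow> ?P s x)"
      using F' by (auto simp: lborel_translation_integral(2) intro!: integrable_mult_right)
  qed
  have "(\<integral>s. (\<integral>x. ?P s x \<partial>lborel) \<partial>lborel) = (\<integral>s. indicator {0..1::real} s * (\<integral>x. F' x \<partial>lborel) \<partial>lborel)"
    by (simp add: lborel_translation_integral(1))
  also have "\<dots> = (\<integral>x. F' x \<partial>lborel)" by simp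
  finally have 1: "(\<integral>s. (\<integral>x. ?P s x \<partial>lborel) \<partial>lborel) = (\<integral>x. F' x \<partial>lborel)" .
  have "(\<integral>s. ?P s x \<partial>lborel) = F (x + v) - F x" for x
  proof -
    have "(\<integral>s. F' (x + s *\<^sub>R v) * indicator {0..1} s \<partial>lborel) = F (x + 1 *\<^sub>R v) - F (x + 0 *\<^sub>R v)"
      by (rule integral_FTC_Icc_real)
        (auto intro: D' intro!: continuous_on_interior[OF continuous_on_subset] 
           continuous_on_compose2[OF c] continuous_intros simp: continuous_on_eq_continuous_at[OF open_UNIV]
           isCont_o2[where g=F'] c[unfolded continuous_on_eq_continuous_at[OF open_UNIV]])
    then show ?thesis by (simp add: mult.commute)
  qed
  then have "(\<integral>x. (\<integral>s. ?P s x \<partial>lborel) \<partial>lborel) = (\<integral>x. F (x + v) - F x \<partial>lborel)" by simp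
  also have "\<dots> = 0"
    using F by (subst Bochner_Integration.integral_diff) (auto simp: lborel_translation_integral)
  finally show ?thesis using 1 lborel_pair.Fubini_integral[OF intP] by simp
qed

text \<open>The mean value theorem bounds the difference quotients by K, and constants are
  integrable for a finite measure, so dominated convergence applies.\<close>

lemma has_real_derivative_integral:
  fixes f f' :: "'w \<Rightarrow> real \<Rightarrow> real"
  assumes M: "finite_measure M" and S: "open S" "s \<in> S"
    and D: "\<And>w r. w \<in> space M \<Longrightarrow> r \<in> S \<Longrightarrow> (f w has_real_derivative f' w r) (at r)"
    and K: "\<And>w r. w \<in> space M \<Longrightarrow> r \<in> S \<Longrightarrow> \<bar>f' w r\<bar> \<le> K"
    and I: "\<And>r. r \<in> S \<Longrightarrow> integrable M (\<lambda>w. f w r)" and ms: "(\<lambda>w. f' w s) \<in> borel_measurable M"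
  shows "((\<lambda>r. \<integral>w. f w r \<partial>M) has_real_derivative (\<integral>w. f' w s \<partial>M)) (at s)"
proof -
  interpret finite_measure M by fact
  obtain e where e: "e > 0" "ball s e \<subseteq> S" using S openE by blast
  have bound: "\<bar>(f w (s + h) - f w s) / h\<bar> \<le> K" if w: "w \<in> space M" and h: "\<bar>h\<bar> < e" "h \<noteq> 0" for w h
  proof -
    have "norm (f w (s + h) - f w s) \<le> K * norm (s + h - s)"
    proof (rule field_differentiable_bound[where S="ball s e" and f'="f' w"])
      show "(f w has_field_derivative f' w z) (at z within ball s e)" if "z \<in> ball s e" for z
        using D[OF w] e that by (blast intro: has_field_derivative_at_within)
    qed (use e h K[OF w] in \<open>auto simp: dist_real_def\<close>)
    then show ?thesis using h by (simp add: divide_simps abs_mult)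
  qed
  have "((\<lambda>h. ((\<integral>w. f w (s + h) \<partial>M) - (\<integral>w. f w s \<partial>M)) / h) \<longlongrightarrow> (\<integral>w. f' w s \<partial>M)) (at 0)"
    unfolding tendsto_at_iff_sequentially comp_def
  proof safe
    fix h :: "nat \<Rightarrow> real"
    assume h0: "\<forall>i. h i \<in> UNIV - {0}" and h: "h \<longlonglongrightarrow> 0"
    have "\<forall>\<^sub>F i in sequentially. \<bar>h i\<bar> < e"
      using tendstoD[OF h e(1)] by (simp add: dist_real_def)
    \<comment> \<open>The bound holds only inside the ball, so the first \<open>i0\<close> terms of
      the sequence are dropped and restored at the end by \<open>LIMSEQ_offset\<close>.\<close>
    then obtain i0 where i0: "\<And>i. i \<ge> i0 \<Longrightarrow> \<bar>h i\<bar> < e" unfolding eventually_sequentially by blast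
    have "(\<lambda>i. \<integral>w. (f w (s + h (i + i0)) - f w s) / h (i + i0) \<partial>M) \<longlonglongrightarrow> (\<integral>w. f' w s \<partial>M)"
    proof (rule integral_dominated_convergence[where w="\<lambda>_. K"])
      show "AE w in M. (\<lambda>i. (f w (s + h (i + i0)) - f w s) / h (i + i0)) \<longlonglongrightarrow> f' w s"
      proof (rule AE_I2)
        fix w assume "w \<in> space M"
        then have "((\<lambda>h. (f w (s + h) - f w s) / h) \<longlongrightarrow> f' w s) (at 0)"
          using D S unfolding DERIV_def by blast
        then have "(\<lambda>i. (f w (s + h i) - f w s) / h i) \<longlonglongrightarrow> f' w s"
          using h0 h unfolding tendsto_at_iff_sequentially comp_def by blast
        then show "(\<lambda>i. (f w (s + h (i + i0)) - f w s) / h (i + i0)) \<longlonglongrightarrow> f' w s"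
          by (rule LIMSEQ_ignore_initial_segment)
      qed
      show "AE w in M. norm ((f w (s + h (i + i0)) - f w s) / h (i + i0)) \<le> K" for i
        using bound[of _ "h (i + i0)"] i0[of "i + i0"] h0 by auto
      show "(\<lambda>w. (f w (s + h (i + i0)) - f w s) / h (i + i0)) \<in> borel_measurable M" for i
        using I[of "s + h (i + i0)"] I[OF S(2)] i0[of "i + i0"] e
        by (auto simp: dist_real_def subset_iff)
    qed (auto intro: ms)
    then have "(\<lambda>i. ((\<integral>w. f w (s + h (i + i0)) \<partial>M) - (\<integral>w. f w s \<partial>M)) / h (i + i0)) \<longlonglongrightarrow> (\<integral>w. f' w s \<partial>M)"
    proof (rule filterlim_cong[THEN iffD1, rotated 3])
      show "\<forall>\<^sub>F i in sequentially. (\<integral>w. (f w (s + h (i + i0)) - f w s) / h (i + i0) \<partial>M) =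
          ((\<integral>w. f w (s + h (i + i0)) \<partial>M) - (\<integral>w. f w s \<partial>M)) / h (i + i0)"
        using I[of "s + h (_ + i0)"] I[OF S(2)] i0[of "_ + i0"] e
        by (auto simp: dist_real_def subset_iff intro!: always_eventually)
    qed auto
    then show "(\<lambda>i. ((\<integral>w. f w (s + h i) \<partial>M) - (\<integral>w. f w s \<partial>M)) / h i) \<longlonglongrightarrow> (\<integral>w. f' w s \<partial>M)"
      by (rule LIMSEQ_offset)
  qed
  then show ?thesis by (simp add: DERIV_def)
qed

lemma continuous_at_integral:
  fixes f :: "'w \<Rightarrow> 'p::metric_space \<Rightarrow> real"
  assumes M: "finite_measure M" and S: "open S" "p \<in> S"
    and D: "\<And>w. w \<in> space M \<Longrightarrow> isCont (f w) p"
    and K: "\<And>w r. w \<in> space M \<Longrightarrow> r \<in> S \<Longrightarrow> \<bar>f w r\<bar> \<le> K"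
    and ms: "\<And>r. r \<in> S \<Longrightarrow> (\<lambda>w. f w r) \<in> borel_measurable M"
  shows "isCont (\<lambda>r. \<integral>w. f w r \<partial>M) p"
  unfolding continuous_at_sequentially comp_def
proof safe
  interpret finite_measure M by fact
  fix x assume x: "x \<longlonglongrightarrow> p"
  then have "\<forall>\<^sub>F i in sequentially. x i \<in> S" using S topological_tendstoD by blast
  then obtain i0 where i0: "\<And>i. i \<ge> i0 \<Longrightarrow> x i \<in> S" unfolding eventually_sequentially by blast
  have "(\<lambda>i. \<integral>w. f w (x (i + i0)) \<partial>M) \<longlonglongrightarrow> (\<integral>w. f w p \<partial>M)"
  proof (rule integral_dominated_convergence[where w="\<lambda>_. K"])
    show "AE w in M. (\<lambda>i. f w (x (i + i0))) \<longlonglongrightarrow> f w p"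
      using D x unfolding continuous_at_sequentially comp_def
      by (intro AE_I2 LIMSEQ_ignore_initial_segment[where f="\<lambda>i. f _ (x i)"]) blast
    show "AE w in M. norm (f w (x (i + i0))) \<le> K" for i using K i0[of "i+i0"] by auto
  qed (use ms i0 S in auto)
  then show "(\<lambda>i. \<integral>w. f w (x i) \<partial>M) \<longlonglongrightarrow> (\<integral>w. f w p \<partial>M)"
    by (rule LIMSEQ_offset)
qed

section \<open>The heat kernel\<close>

text \<open>In one variable this is a normal density of variance 1/(2c). The general case is a
  product over the basis, since \<open>lborel\<close> is by definition the image of a product
  measure.\<close>

lemma integrable_exp_norm_square:
  assumes c: "c > 0"
  shows "integrable lborel (\<lambda>z::'a::euclidean_space. exp (- c * (norm z)\<^sup>2))"
proof -
  have 1: "integrable lborel (\<lambda>x::real. exp (- c * x\<^sup>2))"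
  proof -
    define \<sigma> where "\<sigma> = sqrt (1 / (2 * c))"
    have s: "\<sigma> > 0" "\<sigma>\<^sup>2 = 1 / (2 * c)" using c by (auto simp: \<sigma>_def)
    have "exp (- c * x\<^sup>2) = sqrt (2 * pi * \<sigma>\<^sup>2) * normal_density 0 \<sigma> x" for x
      using s c by (simp add: normal_density_def field_simps)
    then show ?thesis using s by (auto simp: integrable_mult_right)
  qed
  interpret product_sigma_finite "\<lambda>_::'a. lborel :: real measure" by standard
  have eq: "exp (- c * (norm (\<Sum>b\<in>Basis. f b *\<^sub>R b))\<^sup>2) = (\<Prod>b\<in>Basis. exp (- c * (f b)\<^sup>2))" for f :: "'a \<Rightarrow> real"
  proof -
    have "(norm (\<Sum>b\<in>Basis. f b *\<^sub>R b))\<^sup>2 = (\<Sum>b\<in>Basis. (f b)\<^sup>2)"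
      unfolding power2_norm_eq_inner
      by (subst euclidean_inner) (simp add: power2_eq_square)
    then show ?thesis by (simp add: exp_sum[symmetric] sum_distrib_left sum_negf)
  qed
  have "integrable (Pi\<^sub>M Basis (\<lambda>_::'a. lborel)) (\<lambda>f. \<Prod>b\<in>Basis. exp (- c * (f b)\<^sup>2))"
    by (intro product_integrable_prod 1) auto
  then show ?thesis
    unfolding lborel_def[where 'a='a] lborel_eq_real[symmetric]
    by (subst integrable_distr_eq) (simp_all add: eq[unfolded mult_minus_left])
qed

text \<open>For y at least 1 the power is at most (y^2)^(k+1). This is absorbed by (1 + x/n)^n \<le>
  exp x with n = k + 1 and x = c y^2 / 2, which also produces the constant.\<close>

lemma power_le_exp_square:
  fixes y c :: real
  assumes c: "c > 0" and y: "y \<ge> 0"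
  shows "y ^ k \<le> (1 + (2 * real (Suc k) / c) ^ (Suc k)) * exp (c * y\<^sup>2 / 2)"
proof -
  have "y ^ k \<le> 1 + (y\<^sup>2) ^ Suc k"
  proof (cases "y \<le> 1")
    case True then show ?thesis using y power_le_one[of y k] by (simp add: add_increasing2)
  next
    case False
    then have "y ^ k \<le> y ^ (2 * Suc k)" by (intro power_increasing) auto
    then have "y ^ k \<le> (y\<^sup>2) ^ Suc k" by (simp only: power_mult)
    then show ?thesis by simp
  qed
  moreover have "(y\<^sup>2) ^ Suc k \<le> (2 * real (Suc k) / c) ^ Suc k * exp (c * y\<^sup>2 / 2)"
  proof -
    have "((c * y\<^sup>2 / 2) / real (Suc k)) ^ Suc k \<le> (1 + (c * y\<^sup>2 / 2) / real (Suc k)) ^ Suc k"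
      using c by (intro power_mono) auto
    also have "\<dots> \<le> exp (c * y\<^sup>2 / 2)"
      using c by (intro exp_ge_one_plus_x_over_n_power_n) (auto intro: order_trans[of _ 0])
    finally have a: "((c * y\<^sup>2 / 2) / real (Suc k)) ^ Suc k \<le> exp (c * y\<^sup>2 / 2)" .
    have "(y\<^sup>2) = (2 * real (Suc k) / c) * ((c * y\<^sup>2 / 2) / real (Suc k))" using c by simp
    then have "(y\<^sup>2) ^ Suc k = (2 * real (Suc k) / c) ^ Suc k * ((c * y\<^sup>2 / 2) / real (Suc k)) ^ Suc k"
      by (metis power_mult_distrib)
    then show ?thesis using a c by (simp add: mult_left_mono del: power_Suc)
  qed
  moreover have "1 \<le> exp (c * y\<^sup>2 / 2)" using c by simp
  ultimately show ?thesis unfolding distrib_right by linarith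
qed

lemma integrable_norm_power_exp:
  assumes c: "c > 0"
  shows "integrable lborel (\<lambda>z::'a::euclidean_space. norm z ^ k * exp (- c * (norm z)\<^sup>2))"
proof (rule Bochner_Integration.integrable_bound)
  show "integrable lborel (\<lambda>z::'a. (1 + (2 * real (Suc k) / c) ^ (Suc k)) * exp (- (c/2) * (norm z)\<^sup>2))"
    using c by (intro integrable_mult_right integrable_exp_norm_square) auto
  show "AE z::'a in lborel. norm (norm z ^ k * exp (- c * (norm z)\<^sup>2))
      \<le> norm ((1 + (2 * real (Suc k) / c) ^ (Suc k)) * exp (- (c/2) * (norm z)\<^sup>2))"
  proof (rule AE_I2)
    fix z :: 'a
    have "norm z ^ k * exp (- c * (norm z)\<^sup>2) \<le>
        (1 + (2 * real (Suc k) / c) ^ (Suc k)) * exp (c * (norm z)\<^sup>2 / 2) * exp (- c * (norm z)\<^sup>2)"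
      by (intro mult_right_mono power_le_exp_square c) auto
    also have "\<dots> = (1 + (2 * real (Suc k) / c) ^ (Suc k)) * exp (- (c/2) * (norm z)\<^sup>2)"
      by (simp add: mult.assoc exp_add[symmetric] del: power_Suc)
    finally show "norm (norm z ^ k * exp (- c * (norm z)\<^sup>2))
      \<le> norm ((1 + (2 * real (Suc k) / c) ^ (Suc k)) * exp (- (c/2) * (norm z)\<^sup>2))"
      using c by (simp add: abs_mult del: power_Suc)
  qed
next
  have "(\<lambda>z::'a. norm z ^ k * exp (- c * (norm z)\<^sup>2)) \<in> borel_measurable borel"
    by (intro borel_measurable_continuous_onI continuous_intros)
  then show "(\<lambda>z::'a. norm z ^ k * exp (- c * (norm z)\<^sup>2)) \<in> borel_measurable lborel" by simp
qed

lemma lborel_scale: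
  fixes F :: "'a::euclidean_space \<Rightarrow> real"
  assumes c: "c > 0" and F: "F \<in> borel_measurable borel"
  shows "(\<integral>x. F x \<partial>lborel) = c ^ DIM('a) * (\<integral>x. F (c *\<^sub>R x) \<partial>lborel)"
    and "integrable lborel F \<longleftrightarrow> integrable lborel (\<lambda>x. F (c *\<^sub>R x))"
proof -
  have l: "(lborel :: 'a measure) = density (distr lborel borel (\<lambda>x. 0 + c *\<^sub>R x)) (\<lambda>_. ennreal (\<bar>c\<bar> ^ DIM('a)))"
    using c by (intro lborel_affine) auto
  have "(\<integral>x. F x \<partial>lborel) = (\<integral>x. c ^ DIM('a) * F (c *\<^sub>R x) \<partial>lborel)"
    by (subst l, subst integral_density) (use c F in \<open>auto simp: integral_distr\<close>)
  then show "(\<integral>x. F x \<partial>lborel) = c ^ DIM('a) * (\<integral>x. F (c *\<^sub>R x) \<partial>lborel)" by simp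
  have "integrable lborel F \<longleftrightarrow> integrable lborel (\<lambda>x. c ^ DIM('a) * F (c *\<^sub>R x))"
    by (subst l, subst integrable_density) (use c F in \<open>auto simp: integrable_distr_eq\<close>)
  then show "integrable lborel F \<longleftrightarrow> integrable lborel (\<lambda>x. F (c *\<^sub>R x))" using c by simp
qed

text \<open>Equals (2 pi)^(N/2); kept as an integral, so that the kernel has unit mass by
  construction.\<close>

definition gauss_mass :: "'n::finite itself \<Rightarrow> real" where
  "gauss_mass _ = (\<integral>z. exp (- (1/2) * (norm z)\<^sup>2) \<partial>(lborel :: (real^'n) measure))"

lemma gauss_mass_pos: "gauss_mass TYPE('n::finite) > 0"
proof -
  have "gauss_mass TYPE('n) \<noteq> 0"
  proof
    assume "gauss_mass TYPE('n) = 0"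
    then have "AE z in (lborel :: (real^'n) measure). exp (- (1/2) * (norm z)\<^sup>2) = 0"
      unfolding gauss_mass_def
      using integrable_exp_norm_square[of "1/2", where 'a="real^'n"]
      by (subst (asm) integral_nonneg_eq_0_iff_AE) simp_all
    then have "AE z in (lborel :: (real^'n) measure). False" by simp
    then show False by (simp add: AE_iff_null null_sets_def emeasure_lborel_UNIV)
  qed
  moreover have "gauss_mass TYPE('n) \<ge> 0" unfolding gauss_mass_def by (rule Bochner_Integration.integral_nonneg) simp
  ultimately show ?thesis by simp
qed

lemma gauss_mass_nz [simp]: "gauss_mass TYPE('n::finite) \<noteq> 0"
  using gauss_mass_pos[where 'n='n] by simp

text \<open>The Gaussian density with covariance t times the identity. It solves the heat equation
  with the factor 1/2, hence the halves in all time derivatives below.\<close>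

definition heat :: "real \<Rightarrow> real^'n \<Rightarrow> real" where
  "heat t d = t powr (- real CARD('n) / 2) * exp (- (norm d)\<^sup>2 / (2 * t)) / gauss_mass TYPE('n)"

definition heat1 :: "'n \<Rightarrow> real \<Rightarrow> real^'n \<Rightarrow> real" where
  "heat1 j t d = - (d $ j / t) * heat t d"

definition heat2 :: "'n \<Rightarrow> 'n \<Rightarrow> real \<Rightarrow> real^'n \<Rightarrow> real" where
  "heat2 j k t d = (d $ j * d $ k / t\<^sup>2 - (if j = k then 1 / t else 0)) * heat t d"

lemma heat2_commute: "heat2 j k t d = heat2 k j t d"
  by (auto simp: heat2_def)

lemma heat_pos: "t > 0 \<Longrightarrow> heat t d > 0"
  by (simp add: heat_def gauss_mass_pos)

lemma norm_square_add_axis: "(norm (d + s *\<^sub>R axis j (1::real)))\<^sup>2 = (norm d)\<^sup>2 + 2 * s * d $ j + s\<^sup>2"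
proof -
  have "d \<bullet> axis j 1 = d $ j" "axis j 1 \<bullet> d = d $ j" by (simp_all add: inner_axis inner_axis')
  moreover have "(axis j 1 :: real^'a) \<bullet> axis j 1 = 1" by (simp add: inner_axis')
  ultimately show ?thesis
    unfolding power2_norm_eq_inner by (simp add: inner_add_left inner_add_right power2_eq_square algebra_simps)
qed

lemma has_derivative_heat_axis:
  assumes t: "t > 0"
  shows "((\<lambda>s. heat t (d + s *\<^sub>R axis j 1)) has_real_derivative heat1 j t (d + s *\<^sub>R axis j 1)) (at s)"
  unfolding heat_def heat1_def norm_square_add_axis
  using t by (auto intro!: derivative_eq_intros simp: field_simps)

lemma has_derivative_heat1_axis:
  assumes t: "t > 0"
  shows "((\<lambda>s. heat1 k t (d + s *\<^sub>R axis j 1)) has_real_derivative heat2 j k t (d + s *\<^sub>R axis j 1)) (at s)"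
proof -
  have D: "((\<lambda>s. - ((d $ k + s * (if k = j then 1 else 0)) / t) * heat t (d + s *\<^sub>R axis j 1)) has_real_derivative
     - ((if k = j then 1 else 0) / t) * heat t (d + s *\<^sub>R axis j 1) +
     heat1 j t (d + s *\<^sub>R axis j 1) * - ((d $ k + s * (if k = j then 1 else 0)) / t)) (at s)"
    by (rule DERIV_mult[OF _ has_derivative_heat_axis[OF t]]) (use t in \<open>auto intro!: derivative_eq_intros\<close>)
  have c: "(d + s *\<^sub>R axis j 1) $ k = d $ k + s * (if k = j then 1 else 0)" for s
    by (simp add: axis_def)
  have "- ((if k = j then 1 else 0) / t) * heat t (d + s *\<^sub>R axis j 1) +
     heat1 j t (d + s *\<^sub>R axis j 1) * - ((d $ k + s * (if k = j then 1 else 0)) / t) = heat2 j k t (d + s *\<^sub>R axis j 1)"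
  proof -
    have "- ((if k = j then 1 else 0) / t) * H + (- (z / t) * H) * - (y / t) = (z * y / t\<^sup>2 - (if j = k then 1 / t else 0)) * H"
      for y z H :: real by (auto simp: power2_eq_square algebra_simps)
    then show ?thesis unfolding heat2_def heat1_def c[symmetric] .
  qed
  from DERIV_cong[OF D this] show ?thesis unfolding heat1_def c .
qed

lemma has_derivative_heat_time:
  fixes d :: "real^'n"
  assumes t: "t > 0"
  shows "((\<lambda>t. heat t d) has_real_derivative (\<Sum>k\<in>UNIV. heat2 k k t d) / 2) (at t)"
proof -
  have "(\<Sum>k\<in>UNIV. heat2 k k t d) = ((norm d)\<^sup>2 / t\<^sup>2 - real CARD('n) / t) * heat t d"
  proof -
    have "(norm d)\<^sup>2 = (\<Sum>k\<in>UNIV. d $ k * d $ k)" by (simp add: power2_norm_eq_inner inner_vec_def)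
    then show ?thesis by (simp add: heat2_def sum_distrib_right[symmetric] sum_subtractf sum_divide_distrib[symmetric])
  qed
  note S = this
  have D: "((\<lambda>t. heat t d) has_real_derivative
     (- real CARD('n) / 2 * t powr (- real CARD('n) / 2 - 1) * exp (- (norm d)\<^sup>2 / (2 * t)) +
      t powr (- real CARD('n) / 2) * (exp (- (norm d)\<^sup>2 / (2 * t)) * ((norm d)\<^sup>2 / (2 * t\<^sup>2)))) / gauss_mass TYPE('n)) (at t)"
    unfolding heat_def
    using t by (auto intro!: derivative_eq_intros has_real_derivative_powr simp: field_simps power2_eq_square)
  have p: "t powr (- real CARD('n) / 2 - 1) = t powr (- real CARD('n) / 2) / t"
    using t by (simp add: powr_diff)
  show ?thesis
    by (rule DERIV_cong[OF D]) (unfold S p, use t in \<open>simp add: heat_def field_simps power2_eq_square\<close>)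
qed

lemma continuous_heat:
  assumes t: "t > 0"
  shows "isCont (\<lambda>p. heat (fst p) (snd p)) (t, d)" "isCont (\<lambda>p. heat1 j (fst p) (snd p)) (t, d)"
    "isCont (\<lambda>p. heat2 j k (fst p) (snd p)) (t, d)"
proof -
  show 0: "isCont (\<lambda>p. heat (fst p) (snd p)) (t, d)"
    unfolding heat_def using t by (auto intro!: continuous_intros)
  show "isCont (\<lambda>p. heat1 j (fst p) (snd p)) (t, d)"
    unfolding heat1_def using t by (auto intro!: continuous_intros 0)
  show "isCont (\<lambda>p. heat2 j k (fst p) (snd p)) (t, d)"
    unfolding heat2_def using t by (cases "j = k") (auto intro!: continuous_intros 0)
qed

text \<open>For t in [a, b] the Gaussian factor is at most the one at time b and the negative powers
  of t are largest at a. The exponential from \<open>power_le_exp_square\<close> with c = 1/b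
  cancels the Gaussian factor exactly.\<close>

lemma heat_bounds:
  assumes a: "0 < a" "a \<le> b"
  obtains K where "\<And>t d. a \<le> t \<Longrightarrow> t \<le> b \<Longrightarrow> heat t (d::real^'n) \<le> K"
    "\<And>t d j. a \<le> t \<Longrightarrow> t \<le> b \<Longrightarrow> \<bar>heat1 j t (d::real^'n)\<bar> \<le> K"
    "\<And>t d j k. a \<le> t \<Longrightarrow> t \<le> b \<Longrightarrow> \<bar>heat2 j k t (d::real^'n)\<bar> \<le> K"
proof -
  define A where "A = a powr (- real CARD('n) / 2) / gauss_mass TYPE('n)"
  define P where "P k = (1 + (2 * real (Suc k) / (1/b)) ^ (Suc k))" for k
  have A: "A > 0" using a gauss_mass_pos[where 'n='n] by (auto simp: A_def)
  have P0: "P k \<ge> 0" for k using a by (auto simp: P_def intro!: add_nonneg_nonneg zero_le_power divide_nonneg_nonneg)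
  have key: "norm d ^ k * heat t d \<le> P k * A" if t: "a \<le> t" "t \<le> b" for t k and d :: "real^'n"
  proof -
    have "norm d ^ k \<le> P k * exp (1/b * (norm d)\<^sup>2 / 2)" unfolding P_def by (rule power_le_exp_square) (use a in auto)
    moreover have "heat t d \<le> A * exp (- (1/b * (norm d)\<^sup>2 / 2))"
    proof -
      have "t powr (- real CARD('n) / 2) \<le> a powr (- real CARD('n) / 2)" using t a by (intro powr_mono2') auto
      moreover have "exp (- (norm d)\<^sup>2 / (2 * t)) \<le> exp (- (1/b * (norm d)\<^sup>2 / 2))"
        using t a by (simp add: field_simps mult_right_mono)
      ultimately show ?thesis unfolding heat_def A_def
        using gauss_mass_pos[where 'n='n] by (simp add: divide_right_mono mult_mono)
    qed
    ultimately have "norm d ^ k * heat t d \<le> (P k * exp (1/b * (norm d)\<^sup>2 / 2)) * (A * exp (- (1/b * (norm d)\<^sup>2 / 2)))"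
      using heat_pos[of t d] t a by (intro mult_mono) (auto intro: mult_nonneg_nonneg P0)
    also have "\<dots> = P k * A" by (simp add: exp_minus field_simps)
    finally show ?thesis .
  qed
  define K where "K = P 0 * A + P 1 * A / a + (P 2 * A / a\<^sup>2 + P 0 * A / a)"
  have n: "P k * A \<ge> 0" "P k * A / a \<ge> 0" "P k * A / a\<^sup>2 \<ge> 0" for k using P0 A a by auto
  have c: "\<bar>d $ j\<bar> \<le> norm d" for d :: "real^'n" and j by (rule component_le_norm_cart)
  show ?thesis
  proof (rule that)
    fix t j k and d :: "real^'n" assume t: "a \<le> t" "t \<le> b"
    have h: "heat t d > 0" using t a by (simp add: heat_pos)
    have "heat t d \<le> P 0 * A" using key[OF t, of d 0] by simp
    then show "heat t d \<le> K" using n[of 0] n[of 1] n[of 2] unfolding K_def by linarith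
    have "\<bar>heat1 j t d\<bar> \<le> P 1 * A / a"
    proof -
      have "\<bar>heat1 j t d\<bar> = \<bar>d $ j\<bar> * heat t d / t" using h t a by (simp add: heat1_def abs_mult)
      also have "\<dots> \<le> (norm d ^ 1 * heat t d) / t" using c h t a by (intro divide_right_mono mult_right_mono) auto
      also have "\<dots> \<le> (P 1 * A) / a" using key[OF t, of d 1] t a n by (intro frac_le) auto
      finally show ?thesis .
    qed
    then show "\<bar>heat1 j t d\<bar> \<le> K" using n[of 0] n[of 1] n[of 2] unfolding K_def by linarith
    have "\<bar>heat2 j k t d\<bar> \<le> (\<bar>d $ j\<bar> * \<bar>d $ k\<bar> / t\<^sup>2 + 1 / t) * heat t d"
      using h t a unfolding heat2_def abs_mult
      by (intro mult_mono order_trans[OF abs_triangle_ineq4] add_mono) (auto simp: abs_mult)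
    also have "\<dots> \<le> (norm d * norm d / t\<^sup>2 + 1 / t) * heat t d"
      using c h t a by (intro mult_right_mono add_right_mono divide_right_mono mult_mono) auto
    also have "\<dots> = (norm d ^ 2 * heat t d) / t\<^sup>2 + (norm d ^ 0 * heat t d) / t"
      by (simp add: field_simps power2_eq_square)
    also have "\<dots> \<le> P 2 * A / a\<^sup>2 + P 0 * A / a"
      using key[OF t, of d 2] key[OF t, of d 0] t a n by (intro add_mono frac_le power_mono) auto
    finally show "\<bar>heat2 j k t d\<bar> \<le> K" using n[of 0] n[of 1] n[of 2] unfolding K_def by linarith
  qed
qed

text \<open>Parabolic scaling: substituting d = sqrt t times a new variable removes t.\<close>

lemma heat_moment:
  fixes k :: nat
  assumes t: "t > 0"
  shows "integrable lborel (\<lambda>d::real^'n. (norm d / sqrt t) ^ k * heat t d)"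
    and "(\<integral>d. (norm d / sqrt t) ^ k * heat t d \<partial>(lborel :: (real^'n) measure)) =
      (\<integral>d. norm d ^ k * heat 1 d \<partial>(lborel :: (real^'n) measure))"
proof -
  let ?F = "\<lambda>d::real^'n. (norm d / sqrt t) ^ k * heat t d"
  have m: "?F \<in> borel_measurable borel"
    unfolding heat_def using t by (intro borel_measurable_continuous_onI continuous_intros) auto
  have p: "sqrt t ^ CARD('n) * t powr (- real CARD('n) / 2) = 1"
    using t by (simp add: powr_half_sqrt[symmetric] powr_realpow[symmetric] powr_powr powr_add[symmetric])
  have eq: "sqrt t ^ CARD('n) * ?F (sqrt t *\<^sub>R d) = norm d ^ k * heat 1 d" for d
  proof -
    have "sqrt t ^ CARD('n) * ?F (sqrt t *\<^sub>R d) = norm d ^ k * ((sqrt t ^ CARD('n) * t powr (- real CARD('n) / 2)) *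
       exp (- (norm d)\<^sup>2 / 2) / gauss_mass TYPE('n))"
      using t by (simp add: heat_def power_mult_distrib)
    then show ?thesis unfolding p by (simp add: heat_def)
  qed
  have s: "sqrt t > 0" using t by simp
  have i1: "integrable lborel (\<lambda>d::real^'n. norm d ^ k * heat 1 d)"
  proof -
    have "(\<lambda>d::real^'n. norm d ^ k * heat 1 d) = (\<lambda>d. 1 / gauss_mass TYPE('n) * (norm d ^ k * exp (- (1/2) * (norm d)\<^sup>2)))"
      by (auto simp: heat_def field_simps)
    then show ?thesis using integrable_norm_power_exp[of "1/2" k, where 'a="real^'n"] by (simp only:) (rule integrable_mult_right, simp)
  qed
  have "(\<lambda>d. ?F (sqrt t *\<^sub>R d)) = (\<lambda>d. (1 / sqrt t ^ CARD('n)) * (norm d ^ k * heat 1 d))"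
    unfolding eq[symmetric] using s by (auto simp: field_simps)
  then have "integrable lborel (\<lambda>d. ?F (sqrt t *\<^sub>R d))" using i1 by (simp only:) (rule integrable_mult_right, simp)
  then show "integrable lborel ?F" using lborel_scale(2)[OF s m] by simp
  have "(\<integral>d. ?F d \<partial>lborel) = sqrt t ^ CARD('n) * (\<integral>d. ?F (sqrt t *\<^sub>R d) \<partial>lborel)"
    using lborel_scale(1)[OF s m] by simp
  also have "\<dots> = (\<integral>d. norm d ^ k * heat 1 d \<partial>(lborel :: (real^'n) measure))" by (simp only: eq flip: Bochner_Integration.integral_mult_right_zero)
  finally show "(\<integral>d. ?F d \<partial>lborel) = (\<integral>d. norm d ^ k * heat 1 d \<partial>(lborel :: (real^'n) measure))" .
qed

lemma heat_integral: "t > 0 \<Longrightarrow> (\<integral>d. heat t d \<partial>(lborel :: (real^'n) measure)) = 1"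
  using heat_moment(2)[of t 0, where 'n='n] gauss_mass_nz[where 'n='n]
  by (simp add: heat_def) (simp add: gauss_mass_def)

section \<open>Gaussian mollification\<close>

lemma heat_measurable:
  assumes t: "t > 0"
  shows "(heat t :: real^'n \<Rightarrow> real) \<in> borel_measurable borel" "heat1 (j::'n) t \<in> borel_measurable borel"
    "heat2 j (k::'n) t \<in> borel_measurable borel"
proof -
  have "isCont (heat t) d" "isCont (heat1 j t) d" "isCont (heat2 j k t) d" for d :: "real^'n"
    using continuous_heat[OF t, of d] isCont_o2[where f="\<lambda>d. (t, d)" and a=d]
    by fastforce+
  then show "(heat t :: real^'n \<Rightarrow> real) \<in> borel_measurable borel" "heat1 j t \<in> borel_measurable borel" "heat2 j k t \<in> borel_measurable borel"
    by (auto intro!: borel_measurable_continuous_onI continuous_at_imp_continuous_on)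
qed

text \<open>The measure lives on an abstract space with a position map \<open>X\<close>. Thus the
  weight of a varifold and every entry of its tensor are mollified by the same operator:
  \<open>mol\<close> of the constant 1 and \<open>mol\<close> of the entry.\<close>

locale mollification = finite_measure V for V :: "'w measure" +
  fixes X :: "'w \<Rightarrow> real^'n"
  assumes X_measurable [measurable]: "X \<in> borel_measurable V"
    and V_pos: "measure V (space V) > 0"
begin

definition mol :: "('w \<Rightarrow> real) \<Rightarrow> real \<Rightarrow> real^'n \<Rightarrow> real" where
  "mol f t x = (\<integral>w. f w * heat t (x - X w) \<partial>V)"

definition mol1 :: "('w \<Rightarrow> real) \<Rightarrow> 'n \<Rightarrow> real \<Rightarrow> real^'n \<Rightarrow> real" where
  "mol1 f j t x = (\<integral>w. f w * heat1 j t (x - X w) \<partial>V)"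

definition mol2 :: "('w \<Rightarrow> real) \<Rightarrow> 'n \<Rightarrow> 'n \<Rightarrow> real \<Rightarrow> real^'n \<Rightarrow> real" where
  "mol2 f j k t x = (\<integral>w. f w * heat2 j k t (x - X w) \<partial>V)"

text \<open>Displacements are measured in units of sqrt t; the integral over x then does not depend
  on t, see \<open>moment_lborel\<close>.\<close>

definition moment :: "nat \<Rightarrow> real \<Rightarrow> real^'n \<Rightarrow> real" where
  "moment k t x = (\<integral>w. (norm (x - X w) / sqrt t) ^ k * heat t (x - X w) \<partial>V)"

lemma mol2_commute: "mol2 f j k t x = mol2 f k j t x"
  by (simp add: mol2_def heat2_commute)

lemma integrable_kernel:
  fixes \<beta> C :: real and K :: "real^'n \<Rightarrow> real"
  assumes f: "f \<in> borel_measurable V" "\<And>w. \<bar>f w\<bar> \<le> \<beta>"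
    and K: "K \<in> borel_measurable borel" "\<And>d. \<bar>K d\<bar> \<le> C"
  shows "integrable V (\<lambda>w. f w * K (x - X w))"
proof (rule integrable_const_bound[where B="\<beta> * C"])
  show "AE w in V. norm (f w * K (x - X w)) \<le> \<beta> * C"
    using f(2) K(2) by (auto simp: abs_mult intro!: mult_mono order_trans[OF abs_ge_zero f(2)])
  have "(\<lambda>w. K (x - X w)) \<in> borel_measurable V"
    by (rule measurable_compose[OF _ K(1)]) simp
  then show "(\<lambda>w. f w * K (x - X w)) \<in> borel_measurable V" using f by simp
qed

lemma DERIV_kernel:
  fixes \<beta> C :: real and K K' :: "real^'n \<Rightarrow> real"
  assumes f: "f \<in> borel_measurable V" "\<And>w. \<bar>f w\<bar> \<le> \<beta>"
    and K: "K \<in> borel_measurable borel" "\<And>d. \<bar>K d\<bar> \<le> C"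
    and K': "K' \<in> borel_measurable borel" "\<And>d. \<bar>K' d\<bar> \<le> C"
    and D: "\<And>d s. ((\<lambda>s. K (d + s *\<^sub>R v)) has_real_derivative K' (d + s *\<^sub>R v)) (at s)"
  shows "((\<lambda>s. \<integral>w. f w * K (x + s *\<^sub>R v - X w) \<partial>V) has_real_derivative (\<integral>w. f w * K' (x - X w) \<partial>V)) (at 0)"
proof -
  have "((\<lambda>s. \<integral>w. f w * K (x + s *\<^sub>R v - X w) \<partial>V) has_real_derivative (\<integral>w. f w * K' (x + 0 *\<^sub>R v - X w) \<partial>V)) (at 0)"
  proof (rule has_real_derivative_integral[where S=UNIV and K="\<beta> * C"])
    show "((\<lambda>s. f w * K (x + s *\<^sub>R v - X w)) has_real_derivative f w * K' (x + r *\<^sub>R v - X w)) (at r)" for w r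
      using DERIV_cmult[OF D[of "x - X w" r], of "f w"] by (simp add: algebra_simps)
    show "\<bar>f w * K' (x + r *\<^sub>R v - X w)\<bar> \<le> \<beta> * C" for w r
      using f(2) K'(2) by (auto simp: abs_mult intro!: mult_mono order_trans[OF abs_ge_zero f(2)])
    show "integrable V (\<lambda>w. f w * K (x + r *\<^sub>R v - X w))" for r
      by (rule integrable_kernel[OF f K])
    show "(\<lambda>w. f w * K' (x + 0 *\<^sub>R v - X w)) \<in> borel_measurable V"
      using integrable_kernel[OF f K'] by auto
  qed (use finite_measure_axioms in auto)
  then show ?thesis by simp
qed

lemma heat_bounds_at:
  assumes t: "t > 0"
  obtains K where "\<And>d::real^'n. \<bar>heat t d\<bar> \<le> K" "\<And>j d::real^'n. \<bar>heat1 j t d\<bar> \<le> K"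
    "\<And>j k d::real^'n. \<bar>heat2 j k t d\<bar> \<le> K"
proof -
  obtain K where "\<And>d::real^'n. heat t d \<le> K" "\<And>j d::real^'n. \<bar>heat1 j t d\<bar> \<le> K"
    "\<And>j k d::real^'n. \<bar>heat2 j k t d\<bar> \<le> K"
    using heat_bounds[OF t order_refl, where 'n='n] t by (metis order_refl)
  then show ?thesis using heat_pos[OF t, where 'a='n] by (intro that[of K]) (auto simp: abs_of_pos)
qed

context
  fixes f :: "'w \<Rightarrow> real" and \<beta> :: real
  assumes f: "f \<in> borel_measurable V" "\<And>w. \<bar>f w\<bar> \<le> \<beta>"
begin

lemma integrable_mol:
  assumes t: "t > 0"
  shows "integrable V (\<lambda>w. f w * heat t (x - X w))" "integrable V (\<lambda>w. f w * heat1 j t (x - X w))"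
    "integrable V (\<lambda>w. f w * heat2 j k t (x - X w))"
proof -
  from heat_bounds_at[OF t] obtain K where K: "\<And>d::real^'n. \<bar>heat t d\<bar> \<le> K" "\<And>j d::real^'n. \<bar>heat1 j t d\<bar> \<le> K"
    "\<And>j k d::real^'n. \<bar>heat2 j k t d\<bar> \<le> K" by blast
  show "integrable V (\<lambda>w. f w * heat t (x - X w))" "integrable V (\<lambda>w. f w * heat1 j t (x - X w))"
    "integrable V (\<lambda>w. f w * heat2 j k t (x - X w))"
    by (rule integrable_kernel[OF f], use heat_measurable[OF t] K in blast, use K in blast)+
qed

lemma DERIV_mol:
  assumes t: "t > 0"
  shows "((\<lambda>s. mol f t (x + s *\<^sub>R axis j 1)) has_real_derivative mol1 f j t x) (at 0)"
    and "((\<lambda>s. mol1 f k t (x + s *\<^sub>R axis j 1)) has_real_derivative mol2 f j k t x) (at 0)"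
proof -
  from heat_bounds_at[OF t] obtain K where K: "\<And>d::real^'n. \<bar>heat t d\<bar> \<le> K" "\<And>j d::real^'n. \<bar>heat1 j t d\<bar> \<le> K"
    "\<And>j k d::real^'n. \<bar>heat2 j k t d\<bar> \<le> K" by blast
  show "((\<lambda>s. mol f t (x + s *\<^sub>R axis j 1)) has_real_derivative mol1 f j t x) (at 0)"
    unfolding mol_def mol1_def
    by (rule DERIV_kernel[OF f heat_measurable(1)[OF t] K(1) heat_measurable(2)[OF t] K(2) has_derivative_heat_axis[OF t]])
  show "((\<lambda>s. mol1 f k t (x + s *\<^sub>R axis j 1)) has_real_derivative mol2 f j k t x) (at 0)"
    unfolding mol2_def mol1_def
    by (rule DERIV_kernel[OF f heat_measurable(2)[OF t] K(2) heat_measurable(3)[OF t] K(3) has_derivative_heat1_axis[OF t]])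
qed

lemma DERIV_mol_time:
  assumes t: "t > 0"
  shows "((\<lambda>t. mol f t x) has_real_derivative (\<Sum>k\<in>UNIV. mol2 f k k t x) / 2) (at t)"
proof -
  \<comment> \<open>A window around t on which the derivatives of the kernel are bounded uniformly,
    to dominate the difference quotients in time.\<close>
  obtain K where K: "\<And>r d. t/2 \<le> r \<Longrightarrow> r \<le> 2*t \<Longrightarrow> heat r (d::real^'n) \<le> K"
    "\<And>r d j. t/2 \<le> r \<Longrightarrow> r \<le> 2*t \<Longrightarrow> \<bar>heat1 j r (d::real^'n)\<bar> \<le> K"
    "\<And>r d j k. t/2 \<le> r \<Longrightarrow> r \<le> 2*t \<Longrightarrow> \<bar>heat2 j k r (d::real^'n)\<bar> \<le> K"
    using heat_bounds[of "t/2" "2*t", where 'n='n] t by auto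
  have "((\<lambda>t. mol f t x) has_real_derivative (\<integral>w. f w * ((\<Sum>k\<in>UNIV. heat2 k k t (x - X w)) / 2) \<partial>V)) (at t)"
    unfolding mol_def
  proof (rule has_real_derivative_integral[where S="{t/2<..<2*t}" and K="\<beta> * ((\<Sum>k\<in>(UNIV::'n set). K) / 2)"])
    show "((\<lambda>t. f w * heat t (x - X w)) has_real_derivative f w * ((\<Sum>k\<in>UNIV. heat2 k k r (x - X w)) / 2)) (at r)"
      if "r \<in> {t/2<..<2*t}" for w r
      using that t by (intro DERIV_cmult has_derivative_heat_time) auto
    show "\<bar>f w * ((\<Sum>k\<in>UNIV. heat2 k k r (x - X w)) / 2)\<bar> \<le> \<beta> * ((\<Sum>k\<in>(UNIV::'n set). K) / 2)"
      if "r \<in> {t/2<..<2*t}" for w r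
      using f(2)[of w] K(3)[of r] that unfolding abs_mult abs_divide
      by (intro mult_mono divide_mono order_trans[OF sum_abs] sum_mono) auto
    show "integrable V (\<lambda>w. f w * heat r (x - X w))" if "r \<in> {t/2<..<2*t}" for r
      using that t by (intro integrable_mol) auto
    show "(\<lambda>w. f w * ((\<Sum>k\<in>UNIV. heat2 k k t (x - X w)) / 2)) \<in> borel_measurable V"
      using integrable_mol(3)[OF t] f heat_measurable(3)[OF t]
      by (auto intro!: borel_measurable_times borel_measurable_divide borel_measurable_sum measurable_compose[OF _ heat_measurable(3)[OF t]])
  qed (use t finite_measure_axioms in auto)
  moreover have "(\<integral>w. f w * ((\<Sum>k\<in>UNIV. heat2 k k t (x - X w)) / 2) \<partial>V) = (\<Sum>k\<in>UNIV. mol2 f k k t x) / 2"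
    unfolding mol2_def using integrable_mol(3)[OF t]
    by (simp add: sum_distrib_left)
  ultimately show ?thesis by simp
qed

lemma isCont_mol:
  assumes t: "t > 0"
  shows "isCont (\<lambda>p. mol f (fst p) (snd p)) (t, x)" "isCont (\<lambda>p. mol1 f j (fst p) (snd p)) (t, x)"
    "isCont (\<lambda>p. mol2 f j k (fst p) (snd p)) (t, x)"
proof -
  obtain K where K: "\<And>r d. t/2 \<le> r \<Longrightarrow> r \<le> 2*t \<Longrightarrow> heat r (d::real^'n) \<le> K"
    "\<And>r d j. t/2 \<le> r \<Longrightarrow> r \<le> 2*t \<Longrightarrow> \<bar>heat1 j r (d::real^'n)\<bar> \<le> K"
    "\<And>r d j k. t/2 \<le> r \<Longrightarrow> r \<le> 2*t \<Longrightarrow> \<bar>heat2 j k r (d::real^'n)\<bar> \<le> K"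
    using heat_bounds[of "t/2" "2*t", where 'n='n] t by auto
  let ?S = "{t/2<..<2*t} \<times> (UNIV :: (real^'n) set)"
  have S: "open ?S" "(t, x) \<in> ?S" using t by (auto intro: open_Times)
  have c: "isCont (\<lambda>p. f w * Q (fst p) (snd p - X w)) (t, x)" if "\<And>d. isCont (\<lambda>p. Q (fst p) (snd p)) (t, d)"
    for Q :: "real \<Rightarrow> real^'n \<Rightarrow> real" and w
  proof -
    have "isCont (\<lambda>p. (fst p, snd p - X w)) (t, x)" by (intro continuous_intros)
    then have "isCont (\<lambda>p. Q (fst (fst p, snd p - X w)) (snd (fst p, snd p - X w))) (t, x)"
      by (rule isCont_o2) (use that in simp)
    then show ?thesis by (intro continuous_intros) simp
  qed
  have b: "\<bar>f w * k\<bar> \<le> \<beta> * K" if "\<bar>k\<bar> \<le> K" for w k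
    using f(2) that by (auto simp: abs_mult intro!: mult_mono order_trans[OF abs_ge_zero f(2)])
  have K0: "\<bar>heat r (d::real^'n)\<bar> \<le> K" if "t/2 \<le> r" "r \<le> 2*t" for r d
    using K(1)[OF that, of d] heat_pos[of r d] that t by (simp add: abs_of_pos)
  show "isCont (\<lambda>p. mol f (fst p) (snd p)) (t, x)"
    unfolding mol_def using integrable_mol(1) K0 t
    by (intro continuous_at_integral[where K="\<beta> * K", OF finite_measure_axioms S] c continuous_heat b) (auto intro!: borel_measurable_integrable)
  show "isCont (\<lambda>p. mol1 f j (fst p) (snd p)) (t, x)"
    unfolding mol1_def using integrable_mol(2) K(2) t
    by (intro continuous_at_integral[where K="\<beta> * K", OF finite_measure_axioms S] c continuous_heat b) (auto intro!: borel_measurable_integrable)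
  show "isCont (\<lambda>p. mol2 f j k (fst p) (snd p)) (t, x)"
    unfolding mol2_def using integrable_mol(3) K(3) t
    by (intro continuous_at_integral[where K="\<beta> * K", OF finite_measure_axioms S] c continuous_heat b) (auto intro!: borel_measurable_integrable)
qed

end

section \<open>Moments of the mollified weight\<close>

lemma integrable_moment:
  assumes t: "t > 0"
  shows "integrable V (\<lambda>w. (norm (x - X w) / sqrt t) ^ k * heat t (x - X w))"
proof -
  define K where "K d = (norm d / sqrt t) ^ k * heat t d" for d :: "real^'n"
  define P where "P = (1 + (2 * real (Suc k) / (1/t)) ^ (Suc k))"
  have P: "P \<ge> 0" using t by (auto simp: P_def intro!: add_nonneg_nonneg zero_le_power divide_nonneg_nonneg)
  have "\<bar>K d\<bar> \<le> P * (1 / sqrt t ^ k * (t powr (- real CARD('n) / 2) / gauss_mass TYPE('n)))" for d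
  proof -
    have "norm d ^ k \<le> P * exp (1/t * (norm d)\<^sup>2 / 2)" unfolding P_def by (rule power_le_exp_square) (use t in auto)
    then have "norm d ^ k * exp (- (norm d)\<^sup>2 / (2 * t)) \<le> P * exp (1/t * (norm d)\<^sup>2 / 2) * exp (- (norm d)\<^sup>2 / (2 * t))"
      by (rule mult_right_mono) simp
    also have "\<dots> = P" by (simp add: exp_minus field_simps)
    finally have "norm d ^ k * exp (- (norm d)\<^sup>2 / (2 * t)) * (1 / sqrt t ^ k * (t powr (- real CARD('n) / 2) / gauss_mass TYPE('n)))
       \<le> P * (1 / sqrt t ^ k * (t powr (- real CARD('n) / 2) / gauss_mass TYPE('n)))"
      by (rule mult_right_mono) (use t gauss_mass_pos[where 'n='n] in auto)
    moreover have "K d \<ge> 0" using heat_pos[OF t, of d] t by (simp add: K_def)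
    moreover have "K d = norm d ^ k * exp (- (norm d)\<^sup>2 / (2 * t)) * (1 / sqrt t ^ k * (t powr (- real CARD('n) / 2) / gauss_mass TYPE('n)))"
      by (simp add: K_def heat_def power_divide)
    ultimately show ?thesis by simp
  qed
  moreover have "K \<in> borel_measurable borel" unfolding K_def using heat_measurable(1)[OF t] by measurable
  ultimately have "integrable V (\<lambda>w. 1 * K (x - X w))"
    by (intro integrable_kernel[where \<beta>=1]) auto
  then show ?thesis by (simp add: K_def)
qed

lemma moment_nonneg: "t > 0 \<Longrightarrow> moment k t x \<ge> 0"
  unfolding moment_def by (intro Bochner_Integration.integral_nonneg) (auto intro!: mult_nonneg_nonneg simp: heat_pos less_imp_le)

lemma moment_0: "moment 0 t x = mol (\<lambda>_. 1) t x"
  by (simp add: moment_def mol_def)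

lemma mol_pos:
  assumes t: "t > 0"
  shows "mol (\<lambda>_. 1) t x > 0"
proof -
  have i: "integrable V (\<lambda>w. heat t (x - X w))" using integrable_mol(1)[of "\<lambda>_. 1" 1, OF _ _ t] by simp
  have "mol (\<lambda>_. 1) t x \<noteq> 0"
  proof
    assume "mol (\<lambda>_. 1) t x = 0"
    then have "AE w in V. heat t (x - X w) = 0"
      unfolding mol_def using i heat_pos[OF t, where 'a='n] by (subst (asm) integral_nonneg_eq_0_iff_AE) (auto simp: less_imp_le)
    then have "AE w in V. False" using heat_pos[OF t, where 'a='n] by (auto elim!: eventually_mono simp: less_le)
    then have "measure V (space V) = 0" by (simp add: AE_iff_null null_sets_def measure_def)
    then show False using V_pos by simp
  qed
  moreover have "mol (\<lambda>_. 1) t x \<ge> 0" unfolding mol_def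
    using heat_pos[OF t, where 'a='n] by (intro Bochner_Integration.integral_nonneg) (auto simp: less_imp_le)
  ultimately show ?thesis by simp
qed

lemma moment_lborel:
  assumes t: "t > 0"
  shows "integrable lborel (moment k t)"
    and "(\<integral>x. moment k t x \<partial>lborel) = measure V (space V) * (\<integral>d. norm d ^ k * heat 1 d \<partial>(lborel :: (real^'n) measure))"
proof -
  interpret pair_sigma_finite V "lborel :: (real^'n) measure"
    by (intro pair_sigma_finite.intro sigma_finite_measure_axioms sigma_finite_lborel)
  define K where "K d = (norm d / sqrt t) ^ k * heat t d" for d :: "real^'n"
  have K[measurable]: "K \<in> borel_measurable borel" unfolding K_def using heat_measurable(1)[OF t] by measurable
  have K0: "K d \<ge> 0" for d using heat_pos[OF t, of d] t by (simp add: K_def)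
  have tr: "(\<integral>x. K (x - c) \<partial>lborel) = (\<integral>d. norm d ^ k * heat 1 d \<partial>(lborel :: (real^'n) measure))" "integrable lborel (\<lambda>x. K (x - c))" for c
    using lborel_translation_integral[of K "-c"] heat_moment[OF t, of k, where 'n='n, folded K_def] by simp_all
  let ?F = "\<lambda>(w, x). K (x - X w)"
  have m: "?F \<in> borel_measurable (V \<Otimes>\<^sub>M lborel)" by measurable
  have i: "integrable (V \<Otimes>\<^sub>M lborel) ?F"
    by (rule Fubini_integrable[OF m]) (use K0 tr in auto)
  show "integrable lborel (moment k t)"
    using integrable_snd[OF i] unfolding moment_def[abs_def] K_def by simp
  have "(\<integral>x. moment k t x \<partial>lborel) = (\<integral>w. (\<integral>x. K (x - X w) \<partial>lborel) \<partial>V)"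
    unfolding moment_def using Fubini_integral[OF i] by (simp add: K_def)
  then show "(\<integral>x. moment k t x \<partial>lborel) = measure V (space V) * (\<integral>d. norm d ^ k * heat 1 d \<partial>(lborel :: (real^'n) measure))"
    by (simp add: tr)
qed

text \<open>Jensen's inequality for squares and cubes under the weights \<open>H w / m\<close>. It
  follows from the tangent lines at the mean y: (W - y)^2 \<ge> 0, and W^3 - 3 y^2 W + 2 y^3 = (W -
  y)^2 (W + 2 y) \<ge> 0.\<close>

lemma moment_power_mean:
  assumes t: "t > 0"
  shows "moment 1 t x ^ 2 \<le> moment 2 t x * mol (\<lambda>_. 1) t x"
    and "moment 1 t x ^ 3 \<le> moment 3 t x * (mol (\<lambda>_. 1) t x)\<^sup>2"
proof -
  define m where "m = mol (\<lambda>_. 1) t x"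
  define y where "y = moment 1 t x / m"
  have m: "m > 0" using mol_pos[OF t] by (simp add: m_def)
  have y: "y \<ge> 0" using m moment_nonneg[OF t] by (simp add: y_def)
  define W where "W w = norm (x - X w) / sqrt t" for w
  define H where "H w = heat t (x - X w)" for w
  have H: "H w > 0" and W: "W w \<ge> 0" for w using heat_pos[OF t] t by (auto simp: H_def W_def)
  have i: "integrable V (\<lambda>w. W w ^ k * H w)" for k using integrable_moment[OF t, of x k] by (simp add: W_def H_def)
  have mk: "moment k t x = (\<integral>w. W w ^ k * H w \<partial>V)" for k by (simp add: moment_def W_def H_def)
  have i1: "integrable V H" "integrable V (\<lambda>w. W w * H w)" using i[of 0] i[of 1] by simp_all
  have m0: "m = (\<integral>w. H w \<partial>V)" using mk[of 0] by (simp add: m_def moment_0)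
  have m1: "(\<integral>w. W w * H w \<partial>V) = y * m" using mk[of 1] m by (simp add: y_def)
  have "(\<integral>w. (2 * y) * (W w * H w) - y\<^sup>2 * H w \<partial>V) \<le> (\<integral>w. W w ^ 2 * H w \<partial>V)"
  proof (rule integral_mono)
    fix w
    have "0 \<le> (W w - y)\<^sup>2 * H w" using H[of w] by simp
    then show "(2 * y) * (W w * H w) - y\<^sup>2 * H w \<le> W w ^ 2 * H w" by (simp add: power2_eq_square algebra_simps)
  qed (use i i1 in auto)
  then have "y\<^sup>2 * m \<le> moment 2 t x" using i1 m0 m1 by (simp add: mk power2_eq_square)
  then have "y\<^sup>2 * m * m \<le> moment 2 t x * m" using m by (intro mult_right_mono) auto
  then show "moment 1 t x ^ 2 \<le> moment 2 t x * mol (\<lambda>_. 1) t x"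
    using m by (simp add: y_def power2_eq_square flip: m_def)
  have "(\<integral>w. (3 * y\<^sup>2) * (W w * H w) - 2 * y^3 * H w \<partial>V) \<le> (\<integral>w. W w ^ 3 * H w \<partial>V)"
  proof (rule integral_mono)
    fix w
    have "0 \<le> ((W w - y)\<^sup>2 * (W w + 2 * y)) * H w" using H[of w] W[of w] y by simp
    then show "(3 * y\<^sup>2) * (W w * H w) - 2 * y^3 * H w \<le> W w ^ 3 * H w"
      by (simp add: power2_eq_square power3_eq_cube algebra_simps)
  qed (use i i1 in auto)
  then have "y^3 * m \<le> moment 3 t x" using i1 m0 m1 by (simp add: mk power2_eq_square power3_eq_cube)
  then have "y^3 * m * m\<^sup>2 \<le> moment 3 t x * m\<^sup>2" using m by (intro mult_right_mono) auto
  then show "moment 1 t x ^ 3 \<le> moment 3 t x * (mol (\<lambda>_. 1) t x)\<^sup>2"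
    using m by (simp add: y_def power2_eq_square power3_eq_cube flip: m_def)
qed

lemma mol_bounds:
  assumes f: "f \<in> borel_measurable V" "\<And>w. \<bar>f w\<bar> \<le> \<beta>" and t: "t > 0"
  shows "\<bar>mol f t x\<bar> \<le> \<beta> * mol (\<lambda>_. 1) t x"
    and "\<bar>mol1 f j t x\<bar> \<le> \<beta> / sqrt t * moment 1 t x"
    and "\<bar>mol2 f j k t x\<bar> \<le> \<beta> / t * (moment 2 t x + mol (\<lambda>_. 1) t x)"
proof -
  have h: "heat t d > 0" for d :: "real^'n" using heat_pos[OF t] .
  have c: "\<bar>d $ j\<bar> \<le> norm d" for d :: "real^'n" and j by (rule component_le_norm_cart)
  have b: "\<beta> \<ge> 0" using f(2) abs_ge_zero order_trans by blast
  have im: "integrable V (\<lambda>w. heat t (x - X w))" using integrable_mol(1)[of "\<lambda>_. 1" 1, OF _ _ t] by simp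
  have "\<bar>mol f t x\<bar> \<le> (\<integral>w. \<beta> * heat t (x - X w) \<partial>V)"
    unfolding mol_def using integrable_mol(1)[OF f t] im f(2) h
    by (intro order_trans[OF integral_abs_bound] integral_mono integrable_abs integrable_mult_right)
      (auto simp: abs_mult less_imp_le intro!: mult_right_mono)
  then show "\<bar>mol f t x\<bar> \<le> \<beta> * mol (\<lambda>_. 1) t x" by (simp add: mol_def)
  have "\<bar>mol1 f j t x\<bar> \<le> (\<integral>w. \<beta> / sqrt t * ((norm (x - X w) / sqrt t) ^ 1 * heat t (x - X w)) \<partial>V)"
    unfolding mol1_def
  proof (intro order_trans[OF integral_abs_bound] integral_mono)
    fix w
    have "\<bar>heat1 j t (x - X w)\<bar> \<le> norm (x - X w) / t * heat t (x - X w)"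
      using c[of "x - X w" j] h[of "x - X w"] t unfolding heat1_def
      by (auto simp: abs_mult intro!: mult_right_mono divide_right_mono)
    then have "\<bar>f w * heat1 j t (x - X w)\<bar> \<le> \<beta> * (norm (x - X w) / t * heat t (x - X w))"
      using f(2)[of w] b unfolding abs_mult by (intro mult_mono) auto
    also have "\<dots> = \<beta> / sqrt t * ((norm (x - X w) / sqrt t) ^ 1 * heat t (x - X w))"
    proof -
      have "1 / t = 1 / sqrt t * (1 / sqrt t)" using t by (simp add: real_div_sqrt)
      then have "norm (x - X w) / t = norm (x - X w) / sqrt t / sqrt t" by (simp add: divide_inverse)
      then show ?thesis by (simp only: power_one_right times_divide_eq_left times_divide_eq_right)
    qed
    finally show "\<bar>f w * heat1 j t (x - X w)\<bar> \<le> \<beta> / sqrt t * ((norm (x - X w) / sqrt t) ^ 1 * heat t (x - X w))" .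
  qed (intro integrable_abs integrable_mol(2)[OF f t] integrable_mult_right integrable_moment[OF t, of x 1])+
  then show "\<bar>mol1 f j t x\<bar> \<le> \<beta> / sqrt t * moment 1 t x"
    by (simp only: moment_def Bochner_Integration.integral_mult_right_zero)
  have "\<bar>mol2 f j k t x\<bar> \<le> (\<integral>w. \<beta> / t * ((norm (x - X w) / sqrt t) ^ 2 * heat t (x - X w) + heat t (x - X w)) \<partial>V)"
    unfolding mol2_def
  proof (intro order_trans[OF integral_abs_bound] integral_mono)
    fix w
    let ?d = "x - X w"
    have "\<bar>heat2 j k t ?d\<bar> \<le> (\<bar>?d $ j\<bar> * \<bar>?d $ k\<bar> / t\<^sup>2 + 1 / t) * heat t ?d"
      using h[of ?d] t unfolding heat2_def abs_mult
      by (intro mult_mono order_trans[OF abs_triangle_ineq4] add_mono) (auto simp: abs_mult)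
    also have "\<dots> \<le> (norm ?d * norm ?d / t\<^sup>2 + 1 / t) * heat t ?d"
      using h[of ?d] t by (intro mult_right_mono add_right_mono divide_right_mono mult_mono c) auto
    also have "\<dots> = 1 / t * ((norm ?d / sqrt t) ^ 2 * heat t ?d + heat t ?d)"
      using t by (simp add: power_divide power2_eq_square field_simps)
    finally have "\<bar>f w * heat2 j k t ?d\<bar> \<le> \<beta> * (1 / t * ((norm ?d / sqrt t) ^ 2 * heat t ?d + heat t ?d))"
      using f(2)[of w] b unfolding abs_mult by (intro mult_mono) auto
    then show "\<bar>f w * heat2 j k t ?d\<bar> \<le> \<beta> / t * ((norm ?d / sqrt t) ^ 2 * heat t ?d + heat t ?d)" by simp
  qed (use integrable_mol(3)[OF f t] integrable_moment[OF t, of x 2] im in \<open>auto intro!: integrable_mult_right\<close>)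
  then show "\<bar>mol2 f j k t x\<bar> \<le> \<beta> / t * (moment 2 t x + mol (\<lambda>_. 1) t x)"
    using integrable_moment[OF t, of x 2] im by (simp add: moment_def mol_def)
qed

end

section \<open>Partial derivatives and the divergence identity\<close>

definition has_partial :: "'n::finite \<Rightarrow> (real^'n \<Rightarrow> real) \<Rightarrow> (real^'n \<Rightarrow> real) \<Rightarrow> bool" where
  "has_partial k F F' \<longleftrightarrow> (\<forall>x. ((\<lambda>s. F (x + s *\<^sub>R axis k 1)) has_real_derivative F' x) (at 0))"

lemma partial_cong: "has_partial k F F' \<Longrightarrow> (\<And>x. F' x = G' x) \<Longrightarrow> has_partial k F G'"
  by (simp add: has_partial_def)

lemma partial_const: "has_partial k (\<lambda>x. c) (\<lambda>x. 0)"
  by (simp add: has_partial_def)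

lemma partial_add: "has_partial k F F' \<Longrightarrow> has_partial k G G' \<Longrightarrow> has_partial k (\<lambda>x. F x + G x) (\<lambda>x. F' x + G' x)"
  unfolding has_partial_def by (auto intro!: derivative_eq_intros)

lemma partial_diff: "has_partial k F F' \<Longrightarrow> has_partial k G G' \<Longrightarrow> has_partial k (\<lambda>x. F x - G x) (\<lambda>x. F' x - G' x)"
  unfolding has_partial_def by (auto intro!: derivative_eq_intros)

lemma partial_sum: "(\<And>i. i \<in> I \<Longrightarrow> has_partial k (F i) (F' i)) \<Longrightarrow> has_partial k (\<lambda>x. \<Sum>i\<in>I. F i x) (\<lambda>x. \<Sum>i\<in>I. F' i x)"
  unfolding has_partial_def by (auto intro!: DERIV_sum)

lemma partial_mult: "has_partial k F F' \<Longrightarrow> has_partial k G G' \<Longrightarrow> has_partial k (\<lambda>x. F x * G x) (\<lambda>x. F' x * G x + F x * G' x)"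
  unfolding has_partial_def
proof safe
  fix x assume "\<forall>x. ((\<lambda>s. F (x + s *\<^sub>R axis k 1)) has_real_derivative F' x) (at 0)"
    "\<forall>x. ((\<lambda>s. G (x + s *\<^sub>R axis k 1)) has_real_derivative G' x) (at 0)"
  then have "((\<lambda>s. F (x + s *\<^sub>R axis k 1)) has_real_derivative F' x) (at 0)"
    "((\<lambda>s. G (x + s *\<^sub>R axis k 1)) has_real_derivative G' x) (at 0)" by auto
  from DERIV_mult[OF this] show "((\<lambda>s. F (x + s *\<^sub>R axis k 1) * G (x + s *\<^sub>R axis k 1)) has_real_derivative F' x * G x + F x * G' x) (at 0)"
    by (simp add: algebra_simps)
qed

lemma partial_cmult: "has_partial k F F' \<Longrightarrow> has_partial k (\<lambda>x. c * F x) (\<lambda>x. c * F' x)"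
  unfolding has_partial_def by (auto intro!: derivative_eq_intros)

text \<open>This shape of the quotient rule reuses the quotient itself instead of a squared
  denominator; \<open>E1\<close>, \<open>xi1\<close> and \<open>E2\<close> are later defined in this
  shape.\<close>

lemma partial_divide:
  assumes "has_partial k F F'" "has_partial k G G'" "\<And>x. G x \<noteq> 0"
  shows "has_partial k (\<lambda>x. F x / G x) (\<lambda>x. (F' x - F x / G x * G' x) / G x)"
  unfolding has_partial_def
proof
  fix x
  have "((\<lambda>s. F (x + s *\<^sub>R axis k 1)) has_real_derivative F' x) (at 0)"
    "((\<lambda>s. G (x + s *\<^sub>R axis k 1)) has_real_derivative G' x) (at 0)" using assms by (auto simp: has_partial_def)
  from DERIV_divide[OF this] assms(3)[of x]
  show "((\<lambda>s. F (x + s *\<^sub>R axis k 1) / G (x + s *\<^sub>R axis k 1)) has_real_derivative (F' x - F x / G x * G' x) / G x) (at 0)"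
    by (simp add: field_simps)
qed

lemma partial_chain:
  assumes "has_partial k F F'" "\<And>x. (g has_real_derivative g' (F x)) (at (F x))"
  shows "has_partial k (\<lambda>x. g (F x)) (\<lambda>x. g' (F x) * F' x)"
  unfolding has_partial_def
proof
  fix x
  show "((\<lambda>s. g (F (x + s *\<^sub>R axis k 1))) has_real_derivative g' (F x) * F' x) (at 0)"
    by (rule DERIV_chain2[where f=g]) (use assms in \<open>auto simp: has_partial_def\<close>)
qed

lemma matrix_axis_expansion:
  "(\<chi> a b. f a b) = (\<Sum>a\<in>UNIV. \<Sum>b\<in>UNIV. f a b *\<^sub>R (axis a (axis b (1::real)) :: real^'n^'m))"
proof -
  have "(\<Sum>a\<in>UNIV. \<Sum>b\<in>UNIV. f a b *\<^sub>R (axis a (axis b (1::real)) :: real^'n^'m)) $ i $ j = f i j" for i j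
  proof -
    have "(\<Sum>a\<in>UNIV. \<Sum>b\<in>UNIV. f a b *\<^sub>R (axis a (axis b (1::real)) :: real^'n^'m)) $ i $ j
      = (\<Sum>a\<in>UNIV. \<Sum>b\<in>UNIV. if a = i then if b = j then f a b else 0 else 0)"
      by (auto simp: axis_def intro!: sum.cong)
    also have "\<dots> = (\<Sum>a\<in>UNIV. if a = i then f a j else 0)"
      by (intro sum.cong) auto
    also have "\<dots> = f i j" by simp
    finally show ?thesis .
  qed
  then show ?thesis by (simp add: vec_eq_iff)
qed

lemma partial_chain_matrix:
  fixes F F1 :: "'n::finite \<Rightarrow> 'n \<Rightarrow> real^'n \<Rightarrow> real" and g :: "real^'n^'n \<Rightarrow> real"
  assumes F: "\<And>a b. has_partial k (F a b) (F1 a b)"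
    and g: "\<And>x. (g has_derivative D x) (at (\<chi> a b. F a b x))"
  shows "has_partial k (\<lambda>x. g (\<chi> a b. F a b x)) (\<lambda>x. \<Sum>a\<in>UNIV. \<Sum>b\<in>UNIV. D x (axis a (axis b 1)) * F1 a b x)"
  unfolding has_partial_def
proof
  fix x
  let ?P = "\<lambda>s. (\<chi> a b. F a b (x + s *\<^sub>R axis k 1)) :: real^'n^'n"
  have "(?P has_derivative (\<lambda>s. \<Sum>a\<in>UNIV. \<Sum>b\<in>UNIV. (F1 a b x * s) *\<^sub>R axis a (axis b 1))) (at 0)"
    unfolding matrix_axis_expansion
    using F unfolding has_partial_def has_field_derivative_def
    by (intro has_derivative_sum has_derivative_scaleR_left) auto
  moreover have "(g has_derivative D x) (at (?P 0))" using g[of x] by simp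
  ultimately have "((\<lambda>s. g (?P s)) has_derivative (\<lambda>s. D x (\<Sum>a\<in>UNIV. \<Sum>b\<in>UNIV. (F1 a b x * s) *\<^sub>R axis a (axis b 1)))) (at 0)"
    using has_derivative_compose by blast
  moreover have "D x (\<Sum>a\<in>UNIV. \<Sum>b\<in>UNIV. (F1 a b x * s) *\<^sub>R axis a (axis b 1)) = (\<Sum>a\<in>UNIV. \<Sum>b\<in>UNIV. D x (axis a (axis b 1)) * F1 a b x) * s" for s
  proof -
    interpret linear "D x" using g has_derivative_linear by blast
    show ?thesis by (simp add: sum scale sum_distrib_left sum_distrib_right mult_ac)
  qed
  ultimately show "((\<lambda>s. g (\<chi> a b. F a b (x + s *\<^sub>R axis k 1))) has_real_derivative
      (\<Sum>a\<in>UNIV. \<Sum>b\<in>UNIV. D x (axis a (axis b 1)) * F1 a b x)) (at 0)"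
    unfolding has_field_derivative_def by (simp add: fun_eq_iff)
qed

text \<open>Algebra at one point: \<open>\<xi>\<close> stands for grad log m, and the suffixes 1 and
  2 mark derivatives. The Hessian term is m \<theta> N : (Dv - DE \<xi>). Its first half is the
  divergence of \<theta> m E M v up to derivatives falling on the other factors. In the second half
  \<theta> m \<xi> is the gradient of \<Theta>, so it is the divergence of \<Theta> (N d - N DE) up
  to lower terms. The second derivatives of E cancel in that flux, hence the remainder contains
  first derivatives only.\<close>

lemma flux_identity:
  fixes m \<theta> \<theta>' \<Theta> :: real and \<xi> v d :: "'n::finite \<Rightarrow> real" and E M \<xi>1 v1 d1 N :: "'n \<Rightarrow> 'n \<Rightarrow> real"
    and E1 M1 N1 :: "'n \<Rightarrow> 'n \<Rightarrow> 'n \<Rightarrow> real" and E2 :: "'n \<Rightarrow> 'n \<Rightarrow> 'n \<Rightarrow> 'n \<Rightarrow> real"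
  assumes v: "\<And>i. v i = (\<Sum>k\<in>UNIV. E i k * \<xi> k)"
    and v1: "\<And>i j. v1 i j = (\<Sum>k\<in>UNIV. E1 i k j * \<xi> k + E i k * \<xi>1 k j)"
    and d: "\<And>i. d i = (\<Sum>j\<in>UNIV. E1 i j j)"
    and d1: "\<And>i k. d1 i k = (\<Sum>j\<in>UNIV. E2 i j j k)"
    and N: "\<And>l j. N l j = (\<Sum>i\<in>UNIV. M i l * E i j)"
    and sym: "\<And>i j k l. E2 i j k l = E2 i j l k"
  shows "m * \<theta> * (\<Sum>j\<in>UNIV. \<Sum>k\<in>UNIV. \<Sum>l\<in>UNIV. N l j * E l k * \<xi>1 k j) =
      (\<Sum>j\<in>UNIV. \<Sum>i\<in>UNIV. \<Sum>l\<in>UNIV. (\<theta>' * (m * \<xi> j) * (m * E i j) + \<theta> * (m * (E1 i j j + E i j * \<xi> j))) * (M i l * v l)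
          + \<theta> * (m * E i j) * (M1 i l j * v l + M i l * v1 l j))
    + (\<Sum>k\<in>UNIV. \<Sum>l\<in>UNIV. \<theta> * (m * \<xi> k) * (N l k * d l - (\<Sum>j\<in>UNIV. N l j * E1 l k j))
          + \<Theta> * (N1 l k k * d l + N l k * d1 l k - (\<Sum>j\<in>UNIV. N1 l j k * E1 l k j + N l j * E2 l k j k)))
    - \<theta>' * m\<^sup>2 * (\<Sum>i\<in>UNIV. \<Sum>l\<in>UNIV. v i * M i l * v l)
    - \<theta> * (\<Sum>i\<in>UNIV. \<Sum>l\<in>UNIV. m * (v i + d i) * M i l * v l)
    - \<theta> * m * (\<Sum>j\<in>UNIV. \<Sum>i\<in>UNIV. \<Sum>l\<in>UNIV. E i j * M1 i l j * v l)
    - \<theta> * m * (\<Sum>l\<in>UNIV. \<Sum>i\<in>UNIV. M i l * v i * d l)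
    - \<Theta> * (\<Sum>k\<in>UNIV. \<Sum>l\<in>UNIV. N1 l k k * d l - (\<Sum>j\<in>UNIV. N1 l j k * E1 l k j))"
proof -
  let ?P = "\<Sum>j\<in>UNIV. \<Sum>l\<in>UNIV. \<Sum>k\<in>UNIV. N l j * (E1 l k j * \<xi> k)"
  let ?Q = "\<Sum>j\<in>UNIV. \<Sum>k\<in>UNIV. \<Sum>l\<in>UNIV. N l j * E l k * \<xi>1 k j"
  let ?R1 = "\<Sum>j\<in>UNIV. \<Sum>i\<in>UNIV. \<Sum>l\<in>UNIV. E i j * M1 i l j * v l"
  let ?R2 = "\<Sum>k\<in>UNIV. \<Sum>l\<in>UNIV. N1 l k k * d l - (\<Sum>j\<in>UNIV. N1 l j k * E1 l k j)"
  let ?V = "\<Sum>i\<in>UNIV. \<Sum>l\<in>UNIV. v i * M i l * v l"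
  let ?W = "\<Sum>i\<in>UNIV. \<Sum>l\<in>UNIV. m * (v i + d i) * M i l * v l"
  let ?X = "\<Sum>l\<in>UNIV. \<Sum>i\<in>UNIV. M i l * v i * d l"
  have a1: "(\<Sum>j\<in>UNIV. \<Sum>i\<in>UNIV. \<Sum>l\<in>UNIV. \<theta>' * (m * \<xi> j) * (m * E i j) * (M i l * v l)) = \<theta>' * m\<^sup>2 * ?V"
  proof -
    have "(\<Sum>j\<in>UNIV. \<Sum>i\<in>UNIV. \<Sum>l\<in>UNIV. \<theta>' * (m * \<xi> j) * (m * E i j) * (M i l * v l))
      = (\<Sum>i\<in>UNIV. \<Sum>l\<in>UNIV. \<Sum>j\<in>UNIV. \<theta>' * (m * \<xi> j) * (m * E i j) * (M i l * v l))"
      by (subst sum.swap) (intro sum.cong refl sum.swap)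
    also have "\<dots> = \<theta>' * m\<^sup>2 * ?V"
      by (simp add: v sum_distrib_left sum_distrib_right power2_eq_square mult_ac)
    finally show ?thesis .
  qed
  have a2: "(\<Sum>j\<in>UNIV. \<Sum>i\<in>UNIV. \<Sum>l\<in>UNIV. \<theta> * (m * (E1 i j j + E i j * \<xi> j)) * (M i l * v l)) = \<theta> * ?W"
  proof -
    have "(\<Sum>j\<in>UNIV. \<Sum>i\<in>UNIV. \<Sum>l\<in>UNIV. \<theta> * (m * (E1 i j j + E i j * \<xi> j)) * (M i l * v l))
      = (\<Sum>i\<in>UNIV. \<Sum>l\<in>UNIV. \<Sum>j\<in>UNIV. \<theta> * (m * (E1 i j j + E i j * \<xi> j)) * (M i l * v l))"
      by (subst sum.swap) (intro sum.cong refl sum.swap)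
    also have "\<dots> = (\<Sum>i\<in>UNIV. \<Sum>l\<in>UNIV. \<theta> * (m * (v i + d i) * M i l * v l))"
    proof (intro sum.cong refl)
      fix i l
      have "(\<Sum>j\<in>UNIV. \<theta> * (m * (E1 i j j + E i j * \<xi> j)) * (M i l * v l)) = (\<theta> * m * M i l * v l) * (\<Sum>j\<in>UNIV. E1 i j j + E i j * \<xi> j)"
        unfolding sum_distrib_left by (intro sum.cong) (auto simp: mult_ac)
      also have "(\<Sum>j\<in>UNIV. E1 i j j + E i j * \<xi> j) = d i + v i" by (simp add: v d sum.distrib)
      finally show "(\<Sum>j\<in>UNIV. \<theta> * (m * (E1 i j j + E i j * \<xi> j)) * (M i l * v l)) = \<theta> * (m * (v i + d i) * M i l * v l)"
        by (simp add: algebra_simps)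
    qed
    finally show ?thesis by (simp add: sum_distrib_left)
  qed
  have a3: "(\<Sum>j\<in>UNIV. \<Sum>i\<in>UNIV. \<Sum>l\<in>UNIV. \<theta> * (m * E i j) * (M1 i l j * v l)) = \<theta> * m * ?R1"
    by (simp add: sum_distrib_left mult_ac)
  \<comment> \<open>The Hessian times E is completed to the derivative \<open>v1\<close> of
    \<open>v\<close>; the product-rule term this adds is \<open>?P\<close>.\<close>
  have a4: "(\<Sum>j\<in>UNIV. \<Sum>i\<in>UNIV. \<Sum>l\<in>UNIV. \<theta> * (m * E i j) * (M i l * v1 l j)) = \<theta> * m * (?P + ?Q)"
  proof -
    have "(\<Sum>j\<in>UNIV. \<Sum>i\<in>UNIV. \<Sum>l\<in>UNIV. \<theta> * (m * E i j) * (M i l * v1 l j))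
        = (\<Sum>j\<in>UNIV. \<Sum>l\<in>UNIV. \<Sum>i\<in>UNIV. \<theta> * (m * E i j) * (M i l * v1 l j))"
      by (intro sum.cong refl sum.swap)
    also have "\<dots> = (\<Sum>j\<in>UNIV. \<Sum>l\<in>UNIV. \<theta> * m * (N l j * v1 l j))"
      by (intro sum.cong refl) (simp add: N sum_distrib_left sum_distrib_right mult_ac)
    also have "\<dots> = \<theta> * m * (\<Sum>j\<in>UNIV. \<Sum>l\<in>UNIV. N l j * v1 l j)" by (simp add: sum_distrib_left)
    also have "(\<Sum>j\<in>UNIV. \<Sum>l\<in>UNIV. N l j * v1 l j) = (\<Sum>j\<in>UNIV. \<Sum>l\<in>UNIV. (\<Sum>k\<in>UNIV. N l j * (E1 l k j * \<xi> k)) + (\<Sum>k\<in>UNIV. N l j * E l k * \<xi>1 k j))"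
      by (intro sum.cong refl) (simp add: v1 sum_distrib_left sum.distrib distrib_left mult.assoc)
    also have "\<dots> = ?P + (\<Sum>j\<in>UNIV. \<Sum>l\<in>UNIV. \<Sum>k\<in>UNIV. N l j * E l k * \<xi>1 k j)"
      by (simp add: sum.distrib)
    also have "(\<Sum>j\<in>UNIV. \<Sum>l\<in>UNIV. \<Sum>k\<in>UNIV. N l j * E l k * \<xi>1 k j) = ?Q"
      by (intro sum.cong refl sum.swap)
    finally show ?thesis .
  qed
  have A: "(\<Sum>j\<in>UNIV. \<Sum>i\<in>UNIV. \<Sum>l\<in>UNIV. (\<theta>' * (m * \<xi> j) * (m * E i j) + \<theta> * (m * (E1 i j j + E i j * \<xi> j))) * (M i l * v l)
          + \<theta> * (m * E i j) * (M1 i l j * v l + M i l * v1 l j)) = \<theta>' * m\<^sup>2 * ?V + \<theta> * ?W + \<theta> * m * ?R1 + \<theta> * m * (?P + ?Q)"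
    unfolding a1[symmetric] a2[symmetric] a3[symmetric] a4[symmetric]
    by (simp only: sum.distrib[symmetric]) (intro sum.cong refl, simp add: algebra_simps)
  have b1: "(\<Sum>k\<in>UNIV. \<Sum>l\<in>UNIV. \<theta> * (m * \<xi> k) * (N l k * d l)) = \<theta> * m * ?X"
  proof -
    have "(\<Sum>k\<in>UNIV. \<Sum>l\<in>UNIV. \<theta> * (m * \<xi> k) * (N l k * d l)) = (\<Sum>l\<in>UNIV. \<Sum>k\<in>UNIV. \<Sum>i\<in>UNIV. \<theta> * m * (M i l * E i k * \<xi> k * d l))"
      by (subst sum.swap) (simp add: N sum_distrib_left sum_distrib_right mult_ac)
    also have "\<dots> = (\<Sum>l\<in>UNIV. \<Sum>i\<in>UNIV. \<Sum>k\<in>UNIV. \<theta> * m * (M i l * E i k * \<xi> k * d l))"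
      by (intro sum.cong refl sum.swap)
    also have "\<dots> = \<theta> * m * ?X"
      by (simp add: v sum_distrib_left sum_distrib_right mult_ac)
    finally show ?thesis .
  qed
  have b2: "(\<Sum>k\<in>UNIV. \<Sum>l\<in>UNIV. \<theta> * (m * \<xi> k) * (\<Sum>j\<in>UNIV. N l j * E1 l k j)) = \<theta> * m * ?P"
  proof -
    have "(\<Sum>k\<in>UNIV. \<Sum>l\<in>UNIV. \<theta> * (m * \<xi> k) * (\<Sum>j\<in>UNIV. N l j * E1 l k j)) = (\<Sum>k\<in>UNIV. \<Sum>l\<in>UNIV. \<Sum>j\<in>UNIV. \<theta> * m * (N l j * (E1 l k j * \<xi> k)))"
      by (simp add: sum_distrib_left mult_ac)
    also have "\<dots> = (\<Sum>k\<in>UNIV. \<Sum>j\<in>UNIV. \<Sum>l\<in>UNIV. \<theta> * m * (N l j * (E1 l k j * \<xi> k)))"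
      by (intro sum.cong refl sum.swap)
    also have "\<dots> = (\<Sum>j\<in>UNIV. \<Sum>k\<in>UNIV. \<Sum>l\<in>UNIV. \<theta> * m * (N l j * (E1 l k j * \<xi> k)))"
      by (rule sum.swap)
    also have "\<dots> = (\<Sum>j\<in>UNIV. \<Sum>l\<in>UNIV. \<Sum>k\<in>UNIV. \<theta> * m * (N l j * (E1 l k j * \<xi> k)))"
      by (intro sum.cong refl sum.swap)
    finally show ?thesis by (simp add: sum_distrib_left)
  qed
  \<comment> \<open>Renaming j and k and using the symmetry of the last two indices identifies both
    second-order terms. This cancellation is the reason for pairing \<open>d\<close> with
    \<open>E1\<close> in the second flux.\<close>
  have b3: "(\<Sum>k\<in>UNIV. \<Sum>l\<in>UNIV. N l k * d1 l k) = (\<Sum>k\<in>UNIV. \<Sum>l\<in>UNIV. \<Sum>j\<in>UNIV. N l j * E2 l k j k)"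
  proof -
    have "(\<Sum>k\<in>UNIV. \<Sum>l\<in>UNIV. N l k * d1 l k) = (\<Sum>k\<in>UNIV. \<Sum>l\<in>UNIV. \<Sum>j\<in>UNIV. N l k * E2 l j k j)"
      by (simp add: d1 sum_distrib_left sym[of _ _ _ _])
    also have "\<dots> = (\<Sum>k\<in>UNIV. \<Sum>j\<in>UNIV. \<Sum>l\<in>UNIV. N l k * E2 l j k j)"
      by (intro sum.cong refl sum.swap)
    also have "\<dots> = (\<Sum>j\<in>UNIV. \<Sum>k\<in>UNIV. \<Sum>l\<in>UNIV. N l k * E2 l j k j)"
      by (rule sum.swap)
    also have "\<dots> = (\<Sum>j\<in>UNIV. \<Sum>l\<in>UNIV. \<Sum>k\<in>UNIV. N l k * E2 l j k j)"
      by (intro sum.cong refl sum.swap)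
    finally show ?thesis .
  qed
  have B: "(\<Sum>k\<in>UNIV. \<Sum>l\<in>UNIV. \<theta> * (m * \<xi> k) * (N l k * d l - (\<Sum>j\<in>UNIV. N l j * E1 l k j))
          + \<Theta> * (N1 l k k * d l + N l k * d1 l k - (\<Sum>j\<in>UNIV. N1 l j k * E1 l k j + N l j * E2 l k j k)))
     = \<theta> * m * ?X - \<theta> * m * ?P + \<Theta> * ?R2"
  proof -
    have "(\<Sum>k\<in>UNIV. \<Sum>l\<in>UNIV. \<theta> * (m * \<xi> k) * (N l k * d l - (\<Sum>j\<in>UNIV. N l j * E1 l k j))
          + \<Theta> * (N1 l k k * d l + N l k * d1 l k - (\<Sum>j\<in>UNIV. N1 l j k * E1 l k j + N l j * E2 l k j k)))
      = (\<Sum>k\<in>UNIV. \<Sum>l\<in>UNIV. \<theta> * (m * \<xi> k) * (N l k * d l)) - (\<Sum>k\<in>UNIV. \<Sum>l\<in>UNIV. \<theta> * (m * \<xi> k) * (\<Sum>j\<in>UNIV. N l j * E1 l k j))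
       + \<Theta> * (?R2 + ((\<Sum>k\<in>UNIV. \<Sum>l\<in>UNIV. N l k * d1 l k) - (\<Sum>k\<in>UNIV. \<Sum>l\<in>UNIV. \<Sum>j\<in>UNIV. N l j * E2 l k j k)))"
      unfolding sum_subtractf[symmetric] sum.distrib[symmetric] sum_distrib_left[of \<Theta>]
      by (intro sum.cong refl) (simp add: sum.distrib algebra_simps)
    then show ?thesis unfolding b1 b2 b3 by simp
  qed
  \<comment> \<open>\<open>?P\<close> occurs in \<open>A\<close> and \<open>B\<close> with opposite
    signs, so only the Hessian term \<open>?Q\<close> survives.\<close>
  show ?thesis unfolding A B by (simp add: algebra_simps)
qed

lemma abs_sum_le_card:
  fixes f :: "'n::finite \<Rightarrow> real"
  assumes "\<And>i. \<bar>f i\<bar> \<le> b"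
  shows "\<bar>\<Sum>i\<in>UNIV. f i\<bar> \<le> real CARD('n) * b"
  using order_trans[OF sum_abs sum_bounded_above[of UNIV "\<lambda>i. \<bar>f i\<bar>" b]] assms by auto

lemma abs_mult_le: "\<bar>a\<bar> \<le> (A::real) \<Longrightarrow> \<bar>b\<bar> \<le> B \<Longrightarrow> \<bar>a * b\<bar> \<le> A * B"
  unfolding abs_mult by (intro mult_mono) auto

text \<open>Here p controls grad log m and q controls DE. Each error is a product of two such
  first-order factors, and a factor v can be replaced by (v + d) - d, that is, by \<sigma> / m plus
  a multiple of q. What is left is \<sigma> (p + q) and m q^2.\<close>

lemma flux_error_bound:
  fixes m \<theta> \<theta>' \<Theta> K p q \<sigma> :: real and v d :: "'n::finite \<Rightarrow> real" and E M N :: "'n \<Rightarrow> 'n \<Rightarrow> real"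
    and E1 M1 N1 :: "'n \<Rightarrow> 'n \<Rightarrow> 'n \<Rightarrow> real"
  defines "n \<equiv> real CARD('n)"
  assumes K: "K \<ge> 1" and m: "m > 0" and p: "p \<ge> 0" and q: "q \<ge> 0"
    and th: "0 \<le> \<theta>" "\<theta> \<le> 1" "0 \<le> \<theta>'" "\<theta>' * m\<^sup>2 \<le> m" "0 \<le> \<Theta>" "\<Theta> \<le> m"
    and E: "\<And>i j. \<bar>E i j\<bar> \<le> K" and M: "\<And>i j. \<bar>M i j\<bar> \<le> K" and E1: "\<And>i j k. \<bar>E1 i j k\<bar> \<le> q"
    and M1: "\<And>i j k. \<bar>M1 i j k\<bar> \<le> n\<^sup>2 * K * q" and v: "\<And>i. \<bar>v i\<bar> \<le> n * K * p" and d: "\<And>i. \<bar>d i\<bar> \<le> n * q"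
    and N1: "\<And>l j k. N1 l j k = (\<Sum>i\<in>UNIV. M1 i l k * E i j + M i l * E1 i j k)"
    and \<sigma>: "\<sigma> = (\<Sum>i\<in>UNIV. \<bar>m * (v i + d i)\<bar>)"
  shows "\<bar>- \<theta>' * m\<^sup>2 * (\<Sum>i\<in>UNIV. \<Sum>l\<in>UNIV. v i * M i l * v l)
    - \<theta> * (\<Sum>i\<in>UNIV. \<Sum>l\<in>UNIV. m * (v i + d i) * M i l * v l)
    - \<theta> * m * (\<Sum>j\<in>UNIV. \<Sum>i\<in>UNIV. \<Sum>l\<in>UNIV. E i j * M1 i l j * v l)
    - \<theta> * m * (\<Sum>l\<in>UNIV. \<Sum>i\<in>UNIV. M i l * v i * d l)
    - \<Theta> * (\<Sum>k\<in>UNIV. \<Sum>l\<in>UNIV. N1 l k k * d l - (\<Sum>j\<in>UNIV. N1 l j k * E1 l k j))\<bar>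
    \<le> 9 * n ^ 6 * K\<^sup>2 * (\<sigma> * (p + q) + m * q\<^sup>2)"
proof -
  have n: "n \<ge> 1" by (simp add: n_def Suc_leI)
  \<comment> \<open>Bounds v through v = (v + d) - d: the first term is at most \<sigma> / m, the
    second at most n q.\<close>
  define U where "U = \<sigma> / m + n * q"
  have \<sigma>0: "\<sigma> \<ge> 0" by (simp add: \<sigma> sum_nonneg)
  have vU: "\<bar>v i\<bar> \<le> U" for i
  proof -
    have "\<bar>m * (v i + d i)\<bar> \<le> \<sigma>" unfolding \<sigma> by (rule member_le_sum) auto
    then have "\<bar>v i + d i\<bar> \<le> \<sigma> / m" using m unfolding abs_mult by (simp add: pos_le_divide_eq mult.commute[of _ m])
    then show ?thesis using d[of i] by (simp add: U_def)
  qed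
  have U0: "U \<ge> 0" using \<sigma>0 m n q by (simp add: U_def)
  have nb: "1 \<le> n ^ k" for k using n by simp
  have np: "n ^ j \<le> n ^ k" if "j \<le> k" for j k using n that by (rule power_increasing[rotated])
  have KK: "K \<le> K\<^sup>2" "1 \<le> K\<^sup>2" using K one_le_power[OF K, of 2] self_le_power[OF K, of 2] by auto
  define S where "S = \<sigma> * (p + q) + m * q\<^sup>2"
  have S0: "\<sigma> * p \<ge> 0" "\<sigma> * q \<ge> 0" "m * q\<^sup>2 \<ge> 0" using \<sigma>0 p q m by auto
  have mUq: "m * U * q \<le> n * S"
  proof -
    have "m * U * q = \<sigma> * q + n * (m * q\<^sup>2)" using m by (simp add: U_def power2_eq_square field_simps)
    also have "\<dots> \<le> n * (\<sigma> * q) + n * (m * q\<^sup>2)" using S0 n by (simp add: mult_le_cancel_right1)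
    also have "\<dots> \<le> n * S" using mult_nonneg_nonneg[of n "\<sigma> * p"] S0 n by (simp add: S_def algebra_simps)
    finally show ?thesis .
  qed
  have mq: "m * q\<^sup>2 \<le> S" "\<sigma> * p \<le> S" "0 \<le> S" using S0 by (auto simp: S_def algebra_simps)
  have c1: "c * S \<le> n ^ 6 * K\<^sup>2 * S" if "c \<le> n ^ 6 * K\<^sup>2" for c using that mq by (intro mult_right_mono) auto
  have T1: "\<bar>\<theta>' * m\<^sup>2 * (\<Sum>i\<in>UNIV. \<Sum>l\<in>UNIV. v i * M i l * v l)\<bar> \<le> 2 * (n ^ 6 * K\<^sup>2 * S)"
  proof -
    have "\<bar>\<Sum>i\<in>UNIV. \<Sum>l\<in>UNIV. v i * M i l * v l\<bar> \<le> n * (n * ((n * K * p) * K * U))"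
      unfolding n_def using v M vU by (intro abs_sum_le_card abs_mult_le) (auto simp: n_def)
    then have "\<bar>\<theta>' * m\<^sup>2 * (\<Sum>i\<in>UNIV. \<Sum>l\<in>UNIV. v i * M i l * v l)\<bar> \<le> m * (n * (n * ((n * K * p) * K * U)))"
      using th by (intro abs_mult_le) auto
    moreover have "\<bar>\<Sum>i\<in>UNIV. \<Sum>l\<in>UNIV. v i * M i l * v l\<bar> \<le> n * (n * (U * K * U))"
      unfolding n_def using v M vU by (intro abs_sum_le_card abs_mult_le) (auto simp: n_def)
    then have "\<bar>\<theta>' * m\<^sup>2 * (\<Sum>i\<in>UNIV. \<Sum>l\<in>UNIV. v i * M i l * v l)\<bar> \<le> m * (n * (n * (U * K * U)))"
      using th by (intro abs_mult_le) auto
    \<comment> \<open>Both bounds for one factor v are kept: against \<sigma> / m the bound by p is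
      used, against n q the bound \<open>U\<close>.\<close>
    ultimately have b: "\<bar>\<theta>' * m\<^sup>2 * (\<Sum>i\<in>UNIV. \<Sum>l\<in>UNIV. v i * M i l * v l)\<bar> \<le> m * n\<^sup>2 * K * U * min (n * K * p) U"
      by (auto simp: min_def power2_eq_square algebra_simps)
    let ?w = "min (n * K * p) U"
    have w: "0 \<le> ?w" "?w \<le> n * K * p" "?w \<le> U" using U0 p n K by auto
    have "m * U * ?w = \<sigma> * ?w + m * n * q * ?w" using m by (simp add: U_def algebra_simps)
    also have "\<dots> \<le> \<sigma> * (n * K * p) + m * n * q * U"
      using w \<sigma>0 m n q by (intro add_mono mult_left_mono) auto
    also have "\<dots> = n * K * (\<sigma> * p) + n * (m * U * q)" by (simp add: algebra_simps)
    also have "\<dots> \<le> n * K * S + n * (n * S)"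
      using mq mUq n K by (intro add_mono mult_left_mono) auto
    finally have "n\<^sup>2 * K * (m * U * ?w) \<le> n\<^sup>2 * K * (n * K * S + n * (n * S))" using n K by (intro mult_left_mono) auto
    also have "\<dots> = (n ^ 3 * K\<^sup>2) * S + (n ^ 4 * K) * S" by (simp add: algebra_simps power2_eq_square power3_eq_cube power4_eq_xxxx)
    also have "\<dots> \<le> n ^ 6 * K\<^sup>2 * S + n ^ 6 * K\<^sup>2 * S"
      using np[of 3 6] np[of 4 6] n K KK by (intro add_mono c1 mult_mono) auto
    finally have "m * n\<^sup>2 * K * U * ?w \<le> 2 * (n ^ 6 * K\<^sup>2 * S)" by (simp add: mult_ac)
    with b show ?thesis by linarith
  qed
  have T2: "\<bar>\<theta> * (\<Sum>i\<in>UNIV. \<Sum>l\<in>UNIV. m * (v i + d i) * M i l * v l)\<bar> \<le> n ^ 6 * K\<^sup>2 * S"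
  proof -
    have "\<bar>\<Sum>i\<in>UNIV. \<Sum>l\<in>UNIV. m * (v i + d i) * M i l * v l\<bar> \<le> (\<Sum>i\<in>UNIV. n * (\<bar>m * (v i + d i)\<bar> * K * (n * K * p)))"
      by (rule order_trans[OF sum_abs], rule sum_mono, unfold n_def)
        (intro abs_sum_le_card abs_mult_le M v[unfolded n_def] order_refl)
    also have "\<dots> = \<sigma> * (n * K * (n * K * p))" by (simp add: \<sigma> sum_distrib_left sum_distrib_right mult_ac)
    finally have "\<bar>\<theta> * (\<Sum>i\<in>UNIV. \<Sum>l\<in>UNIV. m * (v i + d i) * M i l * v l)\<bar> \<le> 1 * (\<sigma> * (n * K * (n * K * p)))"
      using th by (intro abs_mult_le) auto
    also have "\<dots> = n\<^sup>2 * K\<^sup>2 * (\<sigma> * p)" by (simp add: power2_eq_square algebra_simps)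
    also have "\<dots> \<le> n\<^sup>2 * K\<^sup>2 * S" using mq by (intro mult_left_mono) auto
    also have "\<dots> \<le> n ^ 6 * K\<^sup>2 * S" using np[of 2 6] by (intro c1 mult_right_mono) auto
    finally show ?thesis .
  qed
  have T3: "\<bar>\<theta> * m * (\<Sum>j\<in>UNIV. \<Sum>i\<in>UNIV. \<Sum>l\<in>UNIV. E i j * M1 i l j * v l)\<bar> \<le> n ^ 6 * K\<^sup>2 * S"
  proof -
    have "\<bar>\<theta> * m * (\<Sum>j\<in>UNIV. \<Sum>i\<in>UNIV. \<Sum>l\<in>UNIV. E i j * M1 i l j * v l)\<bar> \<le> 1 * m * (n * (n * (n * (K * (n\<^sup>2 * K * q) * U))))"
      using th m E M1 vU unfolding n_def by (intro abs_mult_le abs_sum_le_card) auto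
    also have "\<dots> = n ^ 5 * K\<^sup>2 * (m * U * q)" by (simp add: power2_eq_square eval_nat_numeral algebra_simps)
    also have "\<dots> \<le> n ^ 5 * K\<^sup>2 * (n * S)" using n mUq by (intro mult_left_mono) auto
    also have "\<dots> = n ^ 6 * K\<^sup>2 * S" by (simp add: eval_nat_numeral algebra_simps)
    finally show ?thesis .
  qed
  have T4: "\<bar>\<theta> * m * (\<Sum>l\<in>UNIV. \<Sum>i\<in>UNIV. M i l * v i * d l)\<bar> \<le> n ^ 6 * K\<^sup>2 * S"
  proof -
    have "\<bar>\<theta> * m * (\<Sum>l\<in>UNIV. \<Sum>i\<in>UNIV. M i l * v i * d l)\<bar> \<le> 1 * m * (n * (n * (K * U * (n * q))))"
      using th m M vU d unfolding n_def by (intro abs_mult_le abs_sum_le_card) auto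
    also have "\<dots> = n ^ 3 * K * (m * U * q)" by (simp add: power2_eq_square eval_nat_numeral algebra_simps)
    also have "\<dots> \<le> n ^ 3 * K * (n * S)" using n mUq K by (intro mult_left_mono) auto
    also have "\<dots> = (n ^ 4 * K) * S" by (simp add: eval_nat_numeral algebra_simps)
    also have "\<dots> \<le> n ^ 6 * K\<^sup>2 * S"
      using np[of 4 6] n K KK by (intro c1 mult_mono) auto
    finally show ?thesis .
  qed
  have T5: "\<bar>\<Theta> * (\<Sum>k\<in>UNIV. \<Sum>l\<in>UNIV. N1 l k k * d l - (\<Sum>j\<in>UNIV. N1 l j k * E1 l k j))\<bar> \<le> 4 * (n ^ 6 * K\<^sup>2 * S)"
  proof -
    have N1b: "\<bar>N1 l j k\<bar> \<le> n * (n\<^sup>2 * K * q * K + K * q)" for l j k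
      unfolding N1 n_def by (intro abs_sum_le_card order_trans[OF abs_triangle_ineq] add_mono abs_mult_le M1[unfolded n_def] E M E1)
    also have "n * (n\<^sup>2 * K * q * K + K * q) \<le> n * (n\<^sup>2 * K\<^sup>2 * q + n\<^sup>2 * K\<^sup>2 * q)"
    proof -
      have "1 * K \<le> n\<^sup>2 * K\<^sup>2" using nb[of 2] KK K by (intro mult_mono) auto
      then have "K * q \<le> n\<^sup>2 * K\<^sup>2 * q" using q by (intro mult_right_mono) auto
      then show ?thesis using n by (intro mult_left_mono) (auto simp: power2_eq_square mult_ac)
    qed
    also have "\<dots> = 2 * n ^ 3 * K\<^sup>2 * q" by (simp add: eval_nat_numeral algebra_simps)
    finally have N1b: "\<bar>N1 l j k\<bar> \<le> 2 * n ^ 3 * K\<^sup>2 * q" for l j k .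
    have "\<bar>\<Theta> * (\<Sum>k\<in>UNIV. \<Sum>l\<in>UNIV. N1 l k k * d l - (\<Sum>j\<in>UNIV. N1 l j k * E1 l k j))\<bar>
        \<le> m * (n * (n * ((2 * n ^ 3 * K\<^sup>2 * q) * (n * q) + n * ((2 * n ^ 3 * K\<^sup>2 * q) * q))))"
      using th N1b d E1 unfolding n_def
      by (intro abs_mult_le abs_sum_le_card order_trans[OF abs_triangle_ineq4] add_mono) auto
    also have "\<dots> = 4 * (n ^ 6 * K\<^sup>2 * (m * q\<^sup>2))" by (simp add: power2_eq_square eval_nat_numeral algebra_simps)
    also have "\<dots> \<le> 4 * (n ^ 6 * K\<^sup>2 * S)" using mq n by (intro mult_left_mono) auto
    finally show ?thesis by linarith
  qed
  \<comment> \<open>The nine units are 2 + 1 + 1 + 1 + 4 from \<open>T1\<close> to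
    \<open>T5\<close>.\<close>
  have "9 * n ^ 6 * K\<^sup>2 * S = 9 * (n ^ 6 * K\<^sup>2 * S)" by simp
  moreover have "n ^ 6 * K\<^sup>2 * S \<ge> 0" using n mq by simp
  ultimately show ?thesis using T1 T2 T3 T4 T5 unfolding S_def[symmetric] by linarith
qed

section \<open>The dissipation inequality at a fixed time\<close>

text \<open>
  The assumption \<open>trace_bound\<close> encodes $-tD^2\log m\le I$ tested against $I-\Pi$, where $\Pi = E^tM(E)E$
  and $E = A/m$. The functions \<open>y\<close> and \<open>y2\<close> dominate first and second logarithmic derivatives.
\<close>

locale flux =
  fixes t c \<kappa> K \<Lambda> r :: real and m :: "real^'n \<Rightarrow> real" and m1 :: "'n \<Rightarrow> real^'n \<Rightarrow> real"
    and m2 :: "'n \<Rightarrow> 'n \<Rightarrow> real^'n \<Rightarrow> real" and A :: "'n \<Rightarrow> 'n \<Rightarrow> real^'n \<Rightarrow> real"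
    and A1 :: "'n \<Rightarrow> 'n \<Rightarrow> 'n \<Rightarrow> real^'n \<Rightarrow> real" and A2 :: "'n \<Rightarrow> 'n \<Rightarrow> 'n \<Rightarrow> 'n \<Rightarrow> real^'n \<Rightarrow> real"
    and Mf :: "'n \<Rightarrow> 'n \<Rightarrow> real^'n^'n \<Rightarrow> real" and D :: "'n \<Rightarrow> 'n \<Rightarrow> real^'n^'n \<Rightarrow> real^'n^'n \<Rightarrow> real"
    and y y2 :: "real^'n \<Rightarrow> real"
  assumes t: "t > 0" and c: "c > 0" and K: "K \<ge> 1"
    and m: "\<And>x. m x > 0"
    and partial_m: "\<And>k. has_partial k m (m1 k)" and partial_m1: "\<And>k l. has_partial l (m1 k) (m2 k l)"
    and partial_A: "\<And>i j k. has_partial k (A i j) (A1 i j k)" and partial_A1: "\<And>i j k l. has_partial l (A1 i j k) (A2 i j k l)"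
    and m2_sym: "\<And>k l x. m2 k l x = m2 l k x" and A2_sym: "\<And>i j k l x. A2 i j k l x = A2 i j l k x"
    and Mf_deriv: "\<And>i l x. (Mf i l has_derivative D i l (\<chi> a b. A a b x / m x)) (at (\<chi> a b. A a b x / m x))"
    and A_bound: "\<And>i j x. \<bar>A i j x\<bar> \<le> K * m x"
    and m1_bound: "\<And>k x. \<bar>m1 k x\<bar> \<le> K * m x * y x" and A1_bound: "\<And>i j k x. \<bar>A1 i j k x\<bar> \<le> K * m x * y x"
    and m2_bound: "\<And>k l x. \<bar>m2 k l x\<bar> \<le> K * m x * y2 x" and A2_bound: "\<And>i j k l x. \<bar>A2 i j k l x\<bar> \<le> K * m x * y2 x"
    and y: "\<And>x. 0 \<le> y x" "\<And>x. (y x)\<^sup>2 \<le> y2 x"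
    and Mf_bound: "\<And>i l x. \<bar>Mf i l (\<chi> a b. A a b x / m x)\<bar> \<le> K"
    and D_bound: "\<And>i l x a b. \<bar>D i l (\<chi> a b. A a b x / m x) (axis a (axis b 1))\<bar> \<le> K"
    and L_bound: "\<And>x. \<bar>ln (m x + c) + \<kappa>\<bar> \<le> \<Lambda>"
    and cont_m: "continuous_on UNIV m" and cont_m1: "\<And>k. continuous_on UNIV (m1 k)"
    and cont_m2: "\<And>k l. continuous_on UNIV (m2 k l)"
    and cont_A: "\<And>i j. continuous_on UNIV (A i j)" and cont_A1: "\<And>i j k. continuous_on UNIV (A1 i j k)"
    and cont_A2: "\<And>i j k l. continuous_on UNIV (A2 i j k l)"
    and cont_Mf: "\<And>i l. continuous_on UNIV (\<lambda>x. Mf i l (\<chi> a b. A a b x / m x))"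
    and cont_D: "\<And>i l a b. continuous_on UNIV (\<lambda>x. D i l (\<chi> a b. A a b x / m x) (axis a (axis b 1)))"
    and int_y: "integrable lborel (\<lambda>x. m x * y x)" and int_y2: "integrable lborel (\<lambda>x. m x * y2 x)"
    and trace_bound: "\<And>x. t * (\<Sum>j\<in>UNIV. \<Sum>k\<in>UNIV. \<Sum>l\<in>UNIV. (\<Sum>i\<in>UNIV. Mf i l (\<chi> a b. A a b x / m x) * (A i j x / m x)) * (A l k x / m x) *
        ((m2 k j x - m1 k x / m x * m1 j x) / m x)) \<le> r + t * (\<Sum>k\<in>UNIV. (m2 k k x - m1 k x / m x * m1 k x) / m x)"
begin

section \<open>Logarithmic derivatives of the density and derivatives of the averaged tensor\<close>

definition E where "E i j x = A i j x / m x"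
text \<open>\<open>xi\<close> is the gradient and \<open>xi1\<close> the Hessian of log m.\<close>

definition xi where "xi k x = m1 k x / m x"
definition xi1 where "xi1 k j x = (m2 k j x - xi k x * m1 j x) / m x"
definition E1 where "E1 i j k x = (A1 i j k x - E i j x * m1 k x) / m x"
definition E2 where "E2 i j k l x = (A2 i j k l x - (E1 i j l x * m1 k x + E i j x * m2 k l x) - E1 i j k x * m1 l x) / m x"
definition M where "M i l x = Mf i l (\<chi> a b. E a b x)"
definition M1 where "M1 i l k x = (\<Sum>a\<in>UNIV. \<Sum>b\<in>UNIV. D i l (\<chi> a b. E a b x) (axis a (axis b 1)) * E1 a b k x)"
text \<open>With \<open>d\<close> the row divergence of \<open>E\<close>, the sum m (v + d) is the
  row divergence of \<open>A\<close>. This is how the first variation enters.\<close>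

definition v where "v i x = (\<Sum>k\<in>UNIV. E i k x * xi k x)"
definition v1 where "v1 i j x = (\<Sum>k\<in>UNIV. E1 i k j x * xi k x + E i k x * xi1 k j x)"
definition d where "d i x = (\<Sum>j\<in>UNIV. E1 i j j x)"
definition d1 where "d1 i k x = (\<Sum>j\<in>UNIV. E2 i j j k x)"
text \<open>The averaged projection \<Pi> is the transpose of \<open>N\<close> times
  \<open>E\<close>.\<close>

definition N where "N l j x = (\<Sum>i\<in>UNIV. M i l x * E i j x)"
definition N1 where "N1 l j k x = (\<Sum>i\<in>UNIV. M1 i l k x * E i j x + M i l x * E1 i j k x)"
text \<open>As functions of the density, \<open>\<theta>'\<close> is the derivative of
  \<open>\<theta>\<close> and \<open>\<Theta>\<close> its antiderivative vanishing at 0, so that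
  \<theta> grad m = grad \<Theta>. The factor \<theta> arises from differentiating the logarithm
  shifted by c.\<close>

definition \<theta> where "\<theta> x = m x / (m x + c)"
definition \<theta>' where "\<theta>' x = c / (m x + c)\<^sup>2"
definition \<Theta> where "\<Theta> x = m x - c * ln (1 + m x / c)"
definition L where "L x = ln (m x + c) + \<kappa>"

lemma m_nz: "m x \<noteq> 0" "m x + c \<noteq> 0" "m x + c > 0" using m[of x] c by auto

lemma partial_E: "has_partial k (E i j) (E1 i j k)"
  unfolding E_def[abs_def] E1_def[abs_def] by (rule partial_divide[OF partial_A partial_m]) (use m_nz in auto)

lemma partial_xi: "has_partial j (xi k) (xi1 k j)"
  unfolding xi_def[abs_def] xi1_def[abs_def] by (rule partial_divide[OF partial_m1 partial_m]) (use m_nz in auto)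

lemma partial_E1: "has_partial l (E1 i j k) (E2 i j k l)"
proof -
  have "has_partial l (\<lambda>x. (A1 i j k x - E i j x * m1 k x) / m x) (E2 i j k l)"
    by (rule partial_cong, rule partial_divide[OF partial_diff[OF partial_A1 partial_mult[OF partial_E partial_m1]] partial_m])
      (use m_nz in \<open>auto simp: E2_def E1_def\<close>)
  then show ?thesis unfolding E1_def[abs_def] .
qed

lemma E2_sym: "E2 i j k l x = E2 i j l k x"
  by (simp add: E2_def m2_sym[of k] A2_sym[of i j k])

lemma partial_M: "has_partial k (M i l) (M1 i l k)"
  unfolding M_def[abs_def] M1_def[abs_def] using Mf_deriv by (intro partial_chain_matrix partial_E) (simp add: E_def)

lemma partial_v: "has_partial j (v i) (v1 i j)"
  unfolding v_def[abs_def] v1_def[abs_def] by (intro partial_sum partial_mult partial_E partial_xi)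

lemma partial_d: "has_partial k (d i) (d1 i k)"
  unfolding d_def[abs_def] d1_def[abs_def] by (intro partial_sum partial_E1)

lemma partial_N: "has_partial k (N l j) (N1 l j k)"
  unfolding N_def[abs_def] N1_def[abs_def] by (intro partial_sum partial_mult partial_E partial_M)

lemma partial_\<theta>: "has_partial k \<theta> (\<lambda>x. \<theta>' x * m1 k x)"
  unfolding \<theta>_def[abs_def] \<theta>'_def
  by (rule partial_chain[OF partial_m, of "\<lambda>u. u / (u + c)" "\<lambda>u. c / (u + c)\<^sup>2"])
    (use m_nz in \<open>auto intro!: derivative_eq_intros simp: power2_eq_square field_simps\<close>)

lemma partial_\<Theta>: "has_partial k \<Theta> (\<lambda>x. \<theta> x * m1 k x)"
  unfolding \<Theta>_def[abs_def] \<theta>_def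
proof (rule partial_chain[OF partial_m, of "\<lambda>u. u - c * ln (1 + u / c)" "\<lambda>u. u / (u + c)"])
  fix x
  have "1 + m x / c > 0" using m[of x] c by (auto intro: add_pos_pos)
  then show "((\<lambda>u. u - c * ln (1 + u / c)) has_real_derivative m x / (m x + c)) (at (m x))"
    using m_nz[of x] c by (auto intro!: derivative_eq_intros simp: field_simps)
qed

lemma partial_L: "has_partial k L (\<lambda>x. m1 k x / (m x + c))"
proof -
  have "has_partial k (\<lambda>x. ln (m x + c) + \<kappa>) (\<lambda>x. inverse (m x + c) * m1 k x)"
    by (rule partial_chain[OF partial_m, of "\<lambda>u. ln (u + c) + \<kappa>" "\<lambda>u. inverse (u + c)"])
     (use m_nz in \<open>auto intro!: derivative_eq_intros simp: field_simps\<close>)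
  then show ?thesis unfolding L_def[abs_def] by (rule partial_cong) (simp add: field_simps)
qed

lemma partial_mE: "has_partial k (\<lambda>x. m x * E i j x) (\<lambda>x. m x * (E1 i j k x + E i j x * xi k x))"
  by (rule partial_cong[OF partial_mult[OF partial_m partial_E]]) (use m_nz in \<open>simp add: xi_def field_simps\<close>)

text \<open>\<open>Z1\<close>, \<open>Z2\<close>, \<open>Z3\<close> are the fluxes of the entropy,
  and \<open>Z4\<close> is the gradient of |A|^2 / m. A primed function is the derivative of the
  k-th component in the k-th direction, so the sum over k is a divergence.\<close>

definition Z1 where "Z1 k x = L x * m1 k x"
definition Z1' where "Z1' k x = m1 k x / (m x + c) * m1 k x + L x * m2 k k x"
definition Z2 where "Z2 j x = (\<Sum>i\<in>UNIV. \<Sum>l\<in>UNIV. \<theta> x * (m x * E i j x) * (M i l x * v l x))"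
definition Z2' where "Z2' j x = (\<Sum>i\<in>UNIV. \<Sum>l\<in>UNIV. (\<theta>' x * (m x * xi j x) * (m x * E i j x) + \<theta> x * (m x * (E1 i j j x + E i j x * xi j x))) * (M i l x * v l x)
          + \<theta> x * (m x * E i j x) * (M1 i l j x * v l x + M i l x * v1 l j x))"
definition Z3 where "Z3 k x = (\<Sum>l\<in>UNIV. \<Theta> x * (N l k x * d l x - (\<Sum>j\<in>UNIV. N l j x * E1 l k j x)))"
definition Z3' where "Z3' k x = (\<Sum>l\<in>UNIV. \<theta> x * (m x * xi k x) * (N l k x * d l x - (\<Sum>j\<in>UNIV. N l j x * E1 l k j x))
          + \<Theta> x * (N1 l k k x * d l x + N l k x * d1 l k x - (\<Sum>j\<in>UNIV. N1 l j k x * E1 l k j x + N l j x * E2 l k j k x)))"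
definition Z4 where "Z4 k x = (\<Sum>i\<in>UNIV. \<Sum>j\<in>UNIV. 2 * (E i j x * A1 i j k x) - E i j x * E i j x * m1 k x)"
definition Z4' where "Z4' k x = (\<Sum>i\<in>UNIV. \<Sum>j\<in>UNIV. 2 * (E1 i j k x * A1 i j k x + E i j x * A2 i j k k x)
     - ((E1 i j k x * E i j x + E i j x * E1 i j k x) * m1 k x + E i j x * E i j x * m2 k k x))"

lemma m_xi: "m x * xi k x = m1 k x" using m_nz by (simp add: xi_def)

lemma partial_Z1: "has_partial k (Z1 k) (Z1' k)"
  unfolding Z1_def[abs_def] Z1'_def[abs_def] by (intro partial_mult partial_L partial_m1)

lemma partial_Z2: "has_partial j (Z2 j) (Z2' j)"
  unfolding Z2_def[abs_def] Z2'_def[abs_def] m_xi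
  by (intro partial_sum partial_mult partial_\<theta> partial_mE partial_M partial_v)

lemma partial_Z3: "has_partial k (Z3 k) (Z3' k)"
  unfolding Z3_def[abs_def] Z3'_def[abs_def] m_xi
  by (intro partial_sum partial_mult partial_diff partial_\<Theta> partial_N partial_d partial_E1)

lemma partial_Z4: "has_partial k (Z4 k) (Z4' k)"
  unfolding Z4_def[abs_def] Z4'_def[abs_def]
  by (intro partial_sum partial_diff partial_cmult partial_mult partial_E partial_A1 partial_m1)

definition \<sigma> where "\<sigma> x = (\<Sum>i\<in>UNIV. \<bar>\<Sum>k\<in>UNIV. A1 i k k x\<bar>)"

text \<open>Half of the constant in \<open>flux_error_bound\<close>, because the heat equation
  carries a factor 1/2.\<close>

definition Cst :: real where "Cst = 9 * real CARD('n) ^ 6 * K\<^sup>2 / 2"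

definition Lap where "Lap x = (\<Sum>k\<in>UNIV. m2 k k x)"

text \<open>
  This is the time derivative of $m\log(t^{r/2}m+\eta) - C|A|^2/m$. The choice of \<open>Cst\<close> makes the dissipation
  $m|DE|^2$ of the second term absorb the errors bounded in \<open>flux_error_bound\<close>.
\<close>

definition G where "G x = (L x + \<theta> x) * Lap x / 2 + m x * \<theta> x * r / (2 * t)
   - Cst * ((\<Sum>i\<in>UNIV. \<Sum>j\<in>UNIV. 2 * (E i j x * (\<Sum>k\<in>UNIV. A2 i j k k x)) - E i j x * E i j x * Lap x) / 2)"

definition Z where "Z k x = (Z1 k x + Z2 k x + Z3 k x) / 2 - Cst * (Z4 k x / 2)"
definition Z' where "Z' k x = (Z1' k x + Z2' k x + Z3' k x) / 2 - Cst * (Z4' k x / 2)"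

lemma partial_Z: "has_partial k (Z k) (Z' k)"
proof -
  have "has_partial k (\<lambda>x. (Z1 k x + Z2 k x + Z3 k x) * (1/2) - (Cst/2) * Z4 k x) (Z' k)"
    by (rule partial_cong[OF partial_diff[OF partial_mult[OF partial_add[OF partial_add[OF partial_Z1 partial_Z2] partial_Z3] partial_const] partial_mult[OF partial_const partial_Z4]]])
      (simp add: Z'_def)
  then show ?thesis by (simp add: Z_def[abs_def])
qed

lemma y2: "0 \<le> y2 x" using y(2)[of x] zero_le_power2[of "y x"] by linarith

lemma basic_bounds:
  shows "\<bar>E i j x\<bar> \<le> K" and "\<bar>xi k x\<bar> \<le> K * y x" and "\<bar>M i l x\<bar> \<le> K" and "\<bar>E1 i j k x\<bar> \<le> 2 * K\<^sup>2 * y x"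
proof -
  have m0: "m x > 0" by (rule m)
  show E: "\<bar>E i j x\<bar> \<le> K" using A_bound[of i j x] m0 by (simp add: E_def divide_le_eq)
  show "\<bar>xi k x\<bar> \<le> K * y x" using m1_bound[of k x] m0 by (simp add: xi_def divide_le_eq mult_ac)
  show "\<bar>M i l x\<bar> \<le> K" using Mf_bound[of i l x] by (simp add: M_def E_def)
  have "\<bar>A1 i j k x - E i j x * m1 k x\<bar> \<le> K * m x * y x + K * (K * m x * y x)"
    by (intro order_trans[OF abs_triangle_ineq4] add_mono abs_mult_le A1_bound E m1_bound)
  also have "\<dots> \<le> K\<^sup>2 * m x * y x + K * (K * m x * y x)"
    using K m0 y(1)[of x] self_le_power[OF K, of 2] by (intro add_mono mult_right_mono) auto
  finally show "\<bar>E1 i j k x\<bar> \<le> 2 * K\<^sup>2 * y x"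
    using m0 by (simp add: E1_def divide_le_eq power2_eq_square algebra_simps)
qed

lemma \<theta>_bounds: "0 \<le> \<theta> x" "\<theta> x \<le> 1" "0 \<le> \<theta>' x" "\<theta>' x * m x \<le> 1" "\<theta>' x * (m x)\<^sup>2 \<le> m x" "0 \<le> \<Theta> x" "\<Theta> x \<le> m x"
proof -
  have m0: "m x > 0" by (rule m)
  show "0 \<le> \<theta> x" "\<theta> x \<le> 1" "0 \<le> \<theta>' x" using m0 c by (auto simp: \<theta>_def \<theta>'_def)
  have "c * m x \<le> (m x + c)\<^sup>2" using m0 c by (simp add: power2_eq_square algebra_simps)
  then show 1: "\<theta>' x * m x \<le> 1" using m0 c by (simp add: \<theta>'_def)
  show "\<theta>' x * (m x)\<^sup>2 \<le> m x" using mult_right_mono[OF 1, of "m x"] m0 by (simp add: power2_eq_square)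
  have "ln (1 + m x / c) \<le> m x / c" using m0 c by (intro ln_add_one_self_le_self) auto
  then have "c * ln (1 + m x / c) \<le> c * (m x / c)" using c by (intro mult_left_mono) auto
  then show "0 \<le> \<Theta> x" using c by (simp add: \<Theta>_def)
  have "ln (1 + m x / c) \<ge> 0" using m0 c by simp
  then show "\<Theta> x \<le> m x" using c by (simp add: \<Theta>_def)
qed

text \<open>The entropy part produces divergences, the term controlled by \<open>trace_bound\<close>
  and the errors of \<open>flux_identity\<close>; the penalty part produces a divergence and the
  exact dissipation that removes the quadratic errors in DE.\<close>

lemma flux_pointwise: "G x \<ge> (\<Sum>k\<in>UNIV. Z' k x) - Cst * (3 * real CARD('n) ^ 3 * K\<^sup>2) * (\<sigma> x * y x)"
proof -
  define n where "n = real CARD('n)"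
  have n: "n \<ge> 1" by (simp add: n_def Suc_leI)
  have m0: "m x > 0" by (rule m)
  define q where "q = sqrt (\<Sum>i\<in>UNIV. \<Sum>j\<in>UNIV. \<Sum>k\<in>UNIV. (E1 i j k x)\<^sup>2)"
  have q2: "q\<^sup>2 = (\<Sum>i\<in>UNIV. \<Sum>j\<in>UNIV. \<Sum>k\<in>UNIV. (E1 i j k x)\<^sup>2)" unfolding q_def
    by (intro real_sqrt_pow2 sum_nonneg) auto
  have q0: "q \<ge> 0" unfolding q_def by (intro real_sqrt_ge_zero sum_nonneg) auto
  have E1q: "\<bar>E1 i j k x\<bar> \<le> q" for i j k
  proof -
    have "(E1 i j k x)\<^sup>2 \<le> (\<Sum>k\<in>UNIV. (E1 i j k x)\<^sup>2)" by (rule member_le_sum) auto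
    also have "\<dots> \<le> (\<Sum>j\<in>UNIV. \<Sum>k\<in>UNIV. (E1 i j k x)\<^sup>2)"
      by (rule member_le_sum[of j _ "\<lambda>j. \<Sum>k\<in>UNIV. (E1 i j k x)\<^sup>2"]) (auto intro!: sum_nonneg)
    also have "\<dots> \<le> q\<^sup>2" unfolding q2
      by (rule member_le_sum[of i _ "\<lambda>i. \<Sum>j\<in>UNIV. \<Sum>k\<in>UNIV. (E1 i j k x)\<^sup>2"]) (auto intro!: sum_nonneg)
    finally show ?thesis using q0 by (metis abs_of_nonneg abs_le_square_iff)
  qed
  have qy: "q \<le> 2 * n ^ 3 * K\<^sup>2 * y x"
  proof -
    have "(E1 i j k x)\<^sup>2 \<le> (2 * K\<^sup>2 * y x)\<^sup>2" for i j k
      using basic_bounds(4)[of i j k x] abs_le_square_iff[of "E1 i j k x" "2 * K\<^sup>2 * y x"] y(1)[of x] by (simp add: abs_mult)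
    then have "\<bar>\<Sum>i\<in>UNIV. \<Sum>j\<in>UNIV. \<Sum>k\<in>UNIV. (E1 i j k x)\<^sup>2\<bar> \<le> n * (n * (n * (2 * K\<^sup>2 * y x)\<^sup>2))"
      unfolding n_def by (intro abs_sum_le_card) auto
    then have "q\<^sup>2 \<le> n ^ 3 * (2 * K\<^sup>2 * y x)\<^sup>2" by (simp add: q2[symmetric] power3_eq_cube mult_ac)
    also have "\<dots> \<le> (n ^ 3)\<^sup>2 * (2 * K\<^sup>2 * y x)\<^sup>2"
      using n one_le_power[OF n, of 3] self_le_power[of "n^3" 2] by (intro mult_right_mono) auto
    also have "\<dots> = (2 * n ^ 3 * K\<^sup>2 * y x)\<^sup>2" by (simp add: power_mult_distrib)
    finally have "q\<^sup>2 \<le> (2 * n ^ 3 * K\<^sup>2 * y x)\<^sup>2" .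
    then show ?thesis by (rule power2_le_imp_le) (intro mult_nonneg_nonneg zero_le_power, use n y(1)[of x] K in auto)
  qed
  define p where "p = K * y x"
  have p0: "p \<ge> 0" using K y by (simp add: p_def)
  have vb: "\<bar>v i x\<bar> \<le> n * K * p" for i
    using basic_bounds unfolding v_def n_def p_def mult.assoc by (intro abs_sum_le_card abs_mult_le) (auto simp: mult.assoc)
  have db: "\<bar>d i x\<bar> \<le> n * q" for i
    unfolding d_def n_def by (intro abs_sum_le_card E1q)
  have M1b: "\<bar>M1 i l k x\<bar> \<le> n\<^sup>2 * K * q" for i l k
  proof -
    have "\<bar>M1 i l k x\<bar> \<le> n * (n * (K * q))"
      unfolding M1_def n_def using D_bound by (intro abs_sum_le_card abs_mult_le E1q) (simp add: E_def)
    then show ?thesis by (simp add: power2_eq_square mult_ac)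
  qed
  have \<sigma>e: "\<sigma> x = (\<Sum>i\<in>UNIV. \<bar>m x * (v i x + d i x)\<bar>)"
  proof -
    have "(\<Sum>k\<in>UNIV. A1 i k k x) = m x * (v i x + d i x)" for i
    proof -
      have "A1 i k k x = m x * (E i k x * xi k x + E1 i k k x)" for k
        using m_nz by (simp add: E1_def xi_def field_simps)
      then show ?thesis by (simp add: v_def d_def sum.distrib sum_distrib_left distrib_left)
    qed
    then show ?thesis by (simp add: \<sigma>_def)
  qed
  let ?Q = "\<Sum>j\<in>UNIV. \<Sum>k\<in>UNIV. \<Sum>l\<in>UNIV. N l j x * E l k x * xi1 k j x"
  let ?err = "- \<theta>' x * (m x)\<^sup>2 * (\<Sum>i\<in>UNIV. \<Sum>l\<in>UNIV. v i x * M i l x * v l x)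
    - \<theta> x * (\<Sum>i\<in>UNIV. \<Sum>l\<in>UNIV. m x * (v i x + d i x) * M i l x * v l x)
    - \<theta> x * m x * (\<Sum>j\<in>UNIV. \<Sum>i\<in>UNIV. \<Sum>l\<in>UNIV. E i j x * M1 i l j x * v l x)
    - \<theta> x * m x * (\<Sum>l\<in>UNIV. \<Sum>i\<in>UNIV. M i l x * v i x * d l x)
    - \<Theta> x * (\<Sum>k\<in>UNIV. \<Sum>l\<in>UNIV. N1 l k k x * d l x - (\<Sum>j\<in>UNIV. N1 l j k x * E1 l k j x))"
  have err: "\<bar>?err\<bar> \<le> 9 * n ^ 6 * K\<^sup>2 * (\<sigma> x * (p + q) + m x * q\<^sup>2)"
    unfolding n_def
    by (rule flux_error_bound[OF K m0 p0 q0 \<theta>_bounds(1,2,3,5,6,7) basic_bounds(1,3) E1q M1b[unfolded n_def] vb[unfolded n_def] db[unfolded n_def] N1_def \<sigma>e])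
  have id: "m x * \<theta> x * ?Q = (\<Sum>k\<in>UNIV. Z2' k x) + (\<Sum>k\<in>UNIV. Z3' k x) + ?err"
    using flux_identity[of "\<lambda>i. v i x" "\<lambda>i j. E i j x" "\<lambda>k. xi k x" "\<lambda>i j. v1 i j x" "\<lambda>i j k. E1 i j k x" "\<lambda>k j. xi1 k j x"
        "\<lambda>i. d i x" "\<lambda>i j. d1 i j x" "\<lambda>i j k l. E2 i j k l x" "\<lambda>l j. N l j x" "\<lambda>i l. M i l x" "m x" "\<theta> x" "\<theta>' x" "\<lambda>i l k. M1 i l k x"
        "\<Theta> x" "\<lambda>l j k. N1 l j k x", OF v_def v1_def d_def d1_def N_def E2_sym]
    unfolding Z2'_def Z3'_def by linarith
  have tr: "t * ?Q \<le> r + t * (\<Sum>k\<in>UNIV. xi1 k k x)"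
    using trace_bound[of x] unfolding N_def M_def E_def xi1_def xi_def .
  \<comment> \<open>Since grad L = grad m / (m + c), completing L times the Laplacian to a
    divergence leaves m \<theta> times the Laplacian of log m.\<close>
  have id1: "(L x + \<theta> x) * Lap x + m x * \<theta> x * r / t = (\<Sum>k\<in>UNIV. Z1' k x) + m x * \<theta> x * ((\<Sum>k\<in>UNIV. xi1 k k x) + r / t)"
  proof -
    have "Z1' k x + m x * \<theta> x * xi1 k k x = (L x + \<theta> x) * m2 k k x" for k
    proof -
      have "m x * \<theta> x * xi1 k k x = \<theta> x * m2 k k x - \<theta> x / m x * (m1 k x * m1 k x)"
        using m_nz by (simp add: xi1_def xi_def field_simps)
      also have "\<theta> x / m x = 1 / (m x + c)" using m_nz by (simp add: \<theta>_def)
      finally show ?thesis by (simp add: Z1'_def algebra_simps)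
    qed
    then have "(L x + \<theta> x) * Lap x = (\<Sum>k\<in>UNIV. Z1' k x) + m x * \<theta> x * (\<Sum>k\<in>UNIV. xi1 k k x)"
      by (simp add: Lap_def sum_distrib_left flip: sum.distrib)
    then show ?thesis by (simp add: algebra_simps)
  qed
  \<comment> \<open>Along the heat flow |A|^2 / m changes by a divergence minus the dissipation m
    |DE|^2; completing the square with A1 = m E1 + E m1 shows this.\<close>
  have id2: "(\<Sum>i\<in>UNIV. \<Sum>j\<in>UNIV. 2 * (E i j x * (\<Sum>k\<in>UNIV. A2 i j k k x)) - E i j x * E i j x * Lap x) = (\<Sum>k\<in>UNIV. Z4' k x) - 2 * (m x * q\<^sup>2)"
  proof -
    have "(\<Sum>k\<in>UNIV. Z4' k x) = (\<Sum>i\<in>UNIV. \<Sum>k\<in>UNIV. \<Sum>j\<in>UNIV. 2 * (E1 i j k x * A1 i j k x + E i j x * A2 i j k k x)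
     - ((E1 i j k x * E i j x + E i j x * E1 i j k x) * m1 k x + E i j x * E i j x * m2 k k x))"
      unfolding Z4'_def by (rule sum.swap)
    also have "\<dots> = (\<Sum>i\<in>UNIV. \<Sum>j\<in>UNIV. \<Sum>k\<in>UNIV. 2 * (E1 i j k x * A1 i j k x + E i j x * A2 i j k k x)
     - ((E1 i j k x * E i j x + E i j x * E1 i j k x) * m1 k x + E i j x * E i j x * m2 k k x))"
      by (intro sum.cong refl sum.swap)
    finally have "(\<Sum>k\<in>UNIV. Z4' k x) - 2 * (m x * q\<^sup>2) = (\<Sum>i\<in>UNIV. \<Sum>j\<in>UNIV. \<Sum>k\<in>UNIV. 2 * (E1 i j k x * A1 i j k x + E i j x * A2 i j k k x)
     - ((E1 i j k x * E i j x + E i j x * E1 i j k x) * m1 k x + E i j x * E i j x * m2 k k x)) - 2 * (m x * q\<^sup>2)" by simp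
    also have "\<dots> = (\<Sum>i\<in>UNIV. \<Sum>j\<in>UNIV. \<Sum>k\<in>UNIV. 2 * (E i j x * A2 i j k k x) - E i j x * E i j x * m2 k k x)"
      unfolding q2 sum_distrib_left sum_subtractf[symmetric]
    proof (intro sum.cong refl)
      fix i j k
      have "A1 i j k x = m x * E1 i j k x + E i j x * m1 k x" using m_nz by (simp add: E1_def)
      then show "2 * (E1 i j k x * A1 i j k x + E i j x * A2 i j k k x)
     - ((E1 i j k x * E i j x + E i j x * E1 i j k x) * m1 k x + E i j x * E i j x * m2 k k x) - 2 * (m x * (E1 i j k x)\<^sup>2)
       = 2 * (E i j x * A2 i j k k x) - E i j x * E i j x * m2 k k x"
        by (simp add: power2_eq_square algebra_simps)
    qed
    also have "\<dots> = (\<Sum>i\<in>UNIV. \<Sum>j\<in>UNIV. 2 * (E i j x * (\<Sum>k\<in>UNIV. A2 i j k k x)) - E i j x * E i j x * Lap x)"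
      by (simp add: Lap_def sum_distrib_left sum_subtractf mult.assoc)
    finally show ?thesis by simp
  qed
  \<comment> \<open>The Hessian bound trades the Laplacian of log m for its \<Pi>-part. The loss r /
    t is what the factor t^(r/2) inside the logarithm compensates.\<close>
  have "?Q \<le> (\<Sum>k\<in>UNIV. xi1 k k x) + r / t" using tr t by (simp add: field_simps)
  then have "m x * \<theta> x * ?Q \<le> m x * \<theta> x * ((\<Sum>k\<in>UNIV. xi1 k k x) + r / t)"
    using m0 \<theta>_bounds(1)[of x] by (intro mult_left_mono) auto
  then have *: "(L x + \<theta> x) * Lap x + m x * \<theta> x * r / t \<ge> (\<Sum>k\<in>UNIV. Z1' k x) + (\<Sum>k\<in>UNIV. Z2' k x) + (\<Sum>k\<in>UNIV. Z3' k x)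
     - 9 * n ^ 6 * K\<^sup>2 * (\<sigma> x * (p + q) + m x * q\<^sup>2)"
    using err id id1 by linarith
  define S1 S2 S3 S4 where S: "S1 = (\<Sum>k\<in>UNIV. Z1' k x)" "S2 = (\<Sum>k\<in>UNIV. Z2' k x)" "S3 = (\<Sum>k\<in>UNIV. Z3' k x)" "S4 = (\<Sum>k\<in>UNIV. Z4' k x)"
  have G: "G x = ((L x + \<theta> x) * Lap x + m x * \<theta> x * r / t) / 2 - Cst * ((S4 - 2 * (m x * q\<^sup>2)) / 2)"
    unfolding G_def id2 S by (simp add: add_divide_distrib)
  have sZ: "(\<Sum>k\<in>UNIV. Z' k x) = (S1 + S2 + S3) / 2 - Cst * (S4 / 2)"
    by (simp add: Z'_def S sum.distrib sum_subtractf sum_distrib_left sum_divide_distrib add_divide_distrib)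
  have e: "9 * n ^ 6 * K\<^sup>2 * (\<sigma> x * (p + q) + m x * q\<^sup>2) = 2 * (Cst * (\<sigma> x * (p + q))) + 2 * (Cst * (m x * q\<^sup>2))"
    by (simp add: Cst_def n_def distrib_left)
  have e2: "Cst * ((S4 - 2 * (m x * q\<^sup>2)) / 2) = Cst * (S4 / 2) - Cst * (m x * q\<^sup>2)"
    by (simp add: field_simps)
  \<comment> \<open>The dissipation \<open>Cst\<close> m q^2 cancels the q^2 part of the error
    exactly; only the part with \<sigma> remains.\<close>
  have 1: "G x \<ge> (\<Sum>k\<in>UNIV. Z' k x) - Cst * (\<sigma> x * (p + q))"
  proof -
    have "a / 2 - (w - z) \<ge> (s1 + s2 + s3) / 2 - w - u" if "s1 + s2 + s3 - (2 * u + 2 * z) \<le> a" for a s1 s2 s3 u w z :: real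
      using that by (simp add: field_simps)
    then show ?thesis using * unfolding G sZ e e2 S[symmetric] by blast
  qed
  have "K * y x \<le> n ^ 3 * K\<^sup>2 * y x"
  proof -
    have "1 * K \<le> n ^ 3 * K\<^sup>2" using n one_le_power[OF n, of 3] self_le_power[OF K, of 2] K by (intro mult_mono) auto
    then show ?thesis using y(1)[of x] by (intro mult_right_mono) auto
  qed
  then have "p + q \<le> 3 * n ^ 3 * K\<^sup>2 * y x" using qy by (simp add: p_def)
  then have "Cst * (\<sigma> x * (p + q)) \<le> Cst * (\<sigma> x * (3 * n ^ 3 * K\<^sup>2 * y x))"
    by (intro mult_left_mono) (auto simp: \<sigma>_def Cst_def intro: sum_nonneg)
  with 1 show ?thesis unfolding n_def by (simp add: mult_ac)
qed

section \<open>Growth orders and integrability of the fluxes\<close>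

definition wt :: "nat \<Rightarrow> real^'n \<Rightarrow> real" where
  "wt k x = (if k = 0 then 1 else if k = 1 then y x else y2 x)"

text \<open>A growth class: b counts factors of the density and k the order of differentiation.
  Orders add under products, because y^2 \<le> y2, and a function of order (1, 1) or (1, 2) is
  integrable. Continuity is included to supply measurability.\<close>

definition ord :: "nat \<Rightarrow> nat \<Rightarrow> (real^'n \<Rightarrow> real) \<Rightarrow> bool" where
  "ord b k F \<longleftrightarrow> continuous_on UNIV F \<and> (\<exists>C. \<forall>x. \<bar>F x\<bar> \<le> C * (m x ^ b * wt k x))"

lemma wt_nonneg: "wt k x \<ge> 0" using y y2 by (simp add: wt_def)

lemma ord_mult:
  assumes "ord a i F" "ord b j H" "i + j \<le> 2"
  shows "ord (a + b) (i + j) (\<lambda>x. F x * H x)"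
proof -
  obtain C1 C2 where 1: "\<And>x. \<bar>F x\<bar> \<le> C1 * (m x ^ a * wt i x)" "\<And>x. \<bar>H x\<bar> \<le> C2 * (m x ^ b * wt j x)"
    and c: "continuous_on UNIV F" "continuous_on UNIV H"
    using assms by (auto simp: ord_def)
  have "\<bar>F x * H x\<bar> \<le> \<bar>C1 * C2\<bar> * (m x ^ (a + b) * wt (i + j) x)" for x
  proof -
    have "\<bar>F x * H x\<bar> \<le> C1 * (m x ^ a * wt i x) * (C2 * (m x ^ b * wt j x))" by (intro abs_mult_le 1)
    also have "\<dots> = C1 * C2 * (m x ^ (a + b) * (wt i x * wt j x))" by (simp add: power_add algebra_simps)
    also have "\<dots> \<le> \<bar>C1 * C2\<bar> * (m x ^ (a + b) * (wt i x * wt j x))"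
      using m[of x] wt_nonneg by (intro mult_right_mono) (auto simp: less_imp_le)
    also have "\<dots> \<le> \<bar>C1 * C2\<bar> * (m x ^ (a + b) * wt (i + j) x)"
    proof -
      have "wt i x * wt j x \<le> wt (i + j) x" using assms(3) y(2)[of x] by (auto simp: wt_def power2_eq_square)
      then show ?thesis using m[of x] by (intro mult_left_mono) (auto simp: less_imp_le)
    qed
    finally show ?thesis .
  qed
  then show ?thesis using c by (auto simp: ord_def intro!: continuous_intros)
qed

lemma ord_add:
  assumes "ord a i F" "ord a i H"
  shows "ord a i (\<lambda>x. F x + H x)" "ord a i (\<lambda>x. F x - H x)"
proof -
  obtain C1 C2 where 1: "\<And>x. \<bar>F x\<bar> \<le> C1 * (m x ^ a * wt i x)" "\<And>x. \<bar>H x\<bar> \<le> C2 * (m x ^ a * wt i x)"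
    and c: "continuous_on UNIV F" "continuous_on UNIV H"
    using assms by (auto simp: ord_def)
  have "\<bar>F x + H x\<bar> \<le> (C1 + C2) * (m x ^ a * wt i x) \<and> \<bar>F x - H x\<bar> \<le> (C1 + C2) * (m x ^ a * wt i x)" for x
    using 1(1)[of x] 1(2)[of x] unfolding distrib_right by linarith
  then show "ord a i (\<lambda>x. F x + H x)" "ord a i (\<lambda>x. F x - H x)"
    using c unfolding ord_def by (auto intro!: continuous_intros)
qed

lemma ord_sum: "(\<And>k::'n. ord a i (F k)) \<Longrightarrow> ord a i (\<lambda>x. \<Sum>k\<in>UNIV. F k x)"
proof -
  assume F: "\<And>k::'n. ord a i (F k)"
  have "ord a i (\<lambda>x. \<Sum>k\<in>S. F k x)" if "finite S" for S
    using that
  proof induction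
    case empty then show ?case by (auto simp: ord_def intro: exI[of _ 0])
  next
    case (insert k S)
    then show ?case using ord_add(1)[OF F[of k] insert(3)] by simp
  qed
  then show ?thesis by simp
qed

lemma ord_cmult: "ord a i F \<Longrightarrow> ord a i (\<lambda>x. b * F x)"
proof -
  assume "ord a i F"
  then obtain C where C: "\<And>x. \<bar>F x\<bar> \<le> C * (m x ^ a * wt i x)" and c: "continuous_on UNIV F"
    by (auto simp: ord_def)
  have "\<bar>b * F x\<bar> \<le> (\<bar>b\<bar> * C) * (m x ^ a * wt i x)" for x
    using mult_left_mono[OF C[of x], of "\<bar>b\<bar>"] by (simp add: abs_mult mult.assoc)
  then show ?thesis using c unfolding ord_def by (auto intro!: continuous_intros)
qed

text \<open>Instances of \<open>ord_mult\<close> with the sums of indices evaluated, since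
  unification cannot split a numeral into i + j.\<close>

lemma ord_mults:
  shows
  "ord 0 0 F \<Longrightarrow> ord 0 0 H \<Longrightarrow> ord 0 0 (\<lambda>x. F x * H x)"
  "ord 0 0 F \<Longrightarrow> ord 0 1 H \<Longrightarrow> ord 0 1 (\<lambda>x. F x * H x)"
  "ord 0 1 F \<Longrightarrow> ord 0 0 H \<Longrightarrow> ord 0 1 (\<lambda>x. F x * H x)"
  "ord 0 1 F \<Longrightarrow> ord 0 1 H \<Longrightarrow> ord 0 2 (\<lambda>x. F x * H x)"
  "ord 0 0 F \<Longrightarrow> ord 0 2 H \<Longrightarrow> ord 0 2 (\<lambda>x. F x * H x)"
  "ord 0 2 F \<Longrightarrow> ord 0 0 H \<Longrightarrow> ord 0 2 (\<lambda>x. F x * H x)"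
  "ord 0 0 F \<Longrightarrow> ord 1 0 H \<Longrightarrow> ord 1 0 (\<lambda>x. F x * H x)"
  "ord 1 0 F \<Longrightarrow> ord 0 0 H \<Longrightarrow> ord 1 0 (\<lambda>x. F x * H x)"
  "ord 0 0 F \<Longrightarrow> ord 1 1 H \<Longrightarrow> ord 1 1 (\<lambda>x. F x * H x)"
  "ord 0 1 F \<Longrightarrow> ord 1 1 H \<Longrightarrow> ord 1 2 (\<lambda>x. F x * H x)"
  "ord 0 0 F \<Longrightarrow> ord 1 2 H \<Longrightarrow> ord 1 2 (\<lambda>x. F x * H x)"
  "ord 1 0 F \<Longrightarrow> ord 0 1 H \<Longrightarrow> ord 1 1 (\<lambda>x. F x * H x)"
  "ord 1 1 F \<Longrightarrow> ord 0 0 H \<Longrightarrow> ord 1 1 (\<lambda>x. F x * H x)"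
  "ord 1 0 F \<Longrightarrow> ord 0 2 H \<Longrightarrow> ord 1 2 (\<lambda>x. F x * H x)"
  "ord 1 1 F \<Longrightarrow> ord 0 1 H \<Longrightarrow> ord 1 2 (\<lambda>x. F x * H x)"
  using ord_mult[of 0 0 F 0 0 H]
    ord_mult[of 0 0 F 0 1 H]
    ord_mult[of 0 1 F 0 0 H]
    ord_mult[of 0 1 F 0 1 H]
    ord_mult[of 0 0 F 0 2 H]
    ord_mult[of 0 2 F 0 0 H]
    ord_mult[of 0 0 F 1 0 H]
    ord_mult[of 1 0 F 0 0 H]
    ord_mult[of 0 0 F 1 1 H]
    ord_mult[of 0 1 F 1 1 H]
    ord_mult[of 0 0 F 1 2 H]
    ord_mult[of 1 0 F 0 1 H]
    ord_mult[of 1 1 F 0 0 H]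
    ord_mult[of 1 0 F 0 2 H]
    ord_mult[of 1 1 F 0 1 H]
  by (simp_all add: numeral_2_eq_2)

lemma ord_divide_m:
  assumes "ord 1 i F" shows "ord 0 i (\<lambda>x. F x / m x)"
proof -
  obtain C where C: "\<And>x. \<bar>F x\<bar> \<le> C * (m x ^ 1 * wt i x)" and c: "continuous_on UNIV F"
    using assms by (auto simp: ord_def)
  have "\<bar>F x / m x\<bar> \<le> C * (m x ^ 0 * wt i x)" for x
    using C[of x] m[of x] by (simp add: field_simps)
  then show ?thesis using c m_nz cont_m by (auto simp: ord_def intro!: continuous_intros)
qed

lemma cont_E: "continuous_on UNIV (E i j)"
  unfolding E_def[abs_def] by (intro continuous_intros cont_A cont_m) (use m_nz in auto)

lemma ord_prim:
  shows "ord 1 0 m" "ord 1 1 (m1 k)" "ord 1 2 (m2 k l)" "ord 1 0 (A i j)" "ord 1 1 (A1 i j k)" "ord 1 2 (A2 i j k l)"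
    "ord 0 0 L" "ord 0 0 \<theta>" "ord 1 0 \<Theta>" "ord 0 0 (\<lambda>x. \<theta>' x * m x)" "ord 0 0 (M i l)" "ord 0 0 (E i j)"
    "ord 0 1 (\<lambda>x. m1 k x / (m x + c))"
proof -
  have "ord 1 0 m" unfolding ord_def using m cont_m by (auto simp: wt_def abs_of_pos intro!: exI[of _ 1])
  then show "ord 1 0 m" .
  show "ord 1 1 (m1 k)" "ord 1 2 (m2 k l)" "ord 1 0 (A i j)" "ord 1 1 (A1 i j k)" "ord 1 2 (A2 i j k l)"
    unfolding ord_def using A_bound m1_bound A1_bound m2_bound A2_bound cont_m1 cont_m2 cont_A cont_A1 cont_A2
    by (auto simp: wt_def mult.assoc intro!: exI[of _ K])
  have mc: "continuous_on UNIV (\<lambda>x. m x + c)" by (intro continuous_intros cont_m)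
  show "ord 0 0 L" unfolding ord_def L_def[abs_def] using L_bound m_nz mc
    by (auto simp: wt_def intro!: exI[of _ \<Lambda>] continuous_intros)
  show "ord 0 0 \<theta>" unfolding ord_def using m c m_nz mc cont_m
    by (auto simp: wt_def \<theta>_def[abs_def] abs_of_pos intro!: exI[of _ 1] continuous_intros)
  have "1 + m x / c \<noteq> 0" for x using m[of x] c by (auto simp: add_pos_pos less_imp_neq[symmetric])
  then show "ord 1 0 \<Theta>" unfolding ord_def using \<theta>_bounds m_nz c cont_m
    by (auto simp: wt_def \<Theta>_def[abs_def] intro!: exI[of _ 1] continuous_intros) 
  have "\<bar>\<theta>' x * m x\<bar> \<le> 1" for x using \<theta>_bounds(3,4)[of x] m[of x] by simp
  then show "ord 0 0 (\<lambda>x. \<theta>' x * m x)" unfolding ord_def using m_nz mc cont_m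
    by (auto simp: wt_def \<theta>'_def[abs_def] intro!: exI[of _ 1] continuous_intros)
  show "ord 0 0 (M i l)" unfolding ord_def using basic_bounds(3) cont_Mf
    by (auto simp: wt_def M_def[abs_def] E_def intro!: exI[of _ K])
  show "ord 0 0 (E i j)" unfolding ord_def using basic_bounds(1) cont_E
    by (auto simp: wt_def intro!: exI[of _ K])
  have "\<bar>m1 k x / (m x + c)\<bar> \<le> K * y x" for x
  proof -
    have "\<bar>m1 k x / (m x + c)\<bar> \<le> \<bar>m1 k x / m x\<bar>" using m[of x] c by (auto simp: abs_divide intro!: divide_left_mono)
    also have "\<dots> \<le> K * y x" using basic_bounds(2)[of k x] by (simp add: xi_def)
    finally show ?thesis .
  qed
  then show "ord 0 1 (\<lambda>x. m1 k x / (m x + c))" unfolding ord_def using m_nz mc cont_m1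
    by (auto simp: wt_def intro!: exI[of _ K] continuous_intros)
qed

lemma ord_xi: "ord 0 1 (xi k)"
  unfolding xi_def[abs_def] by (intro ord_divide_m ord_prim)

lemma ord_E1: "ord 0 1 (E1 i j k)"
  unfolding E1_def[abs_def]
  by (intro ord_divide_m ord_add ord_prim ord_mults(9))

lemma ord_xi1: "ord 0 2 (xi1 k l)"
  unfolding xi1_def[abs_def]
  using ord_mults(10)[OF ord_xi ord_prim(2)]
  by (intro ord_divide_m ord_add ord_prim) (simp add: numeral_2_eq_2)

lemma ord_E2: "ord 0 2 (E2 i j k l)"
  unfolding E2_def[abs_def]
  using ord_mults(10)[OF ord_E1 ord_prim(2)] ord_mults(11)[OF ord_prim(12,3)]
  by (intro ord_divide_m ord_add ord_prim) (simp_all add: numeral_2_eq_2)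

lemma ord_v: "ord 0 1 (v i)"
  unfolding v_def[abs_def] by (intro ord_sum ord_mults(2) ord_prim ord_xi)

lemma ord_v1: "ord 0 2 (v1 i j)"
  unfolding v1_def[abs_def]
  using ord_mults(4)[OF ord_E1 ord_xi] ord_mults(5)[OF ord_prim(12) ord_xi1]
  by (intro ord_sum ord_add) (simp_all add: numeral_2_eq_2)

lemma ord_d: "ord 0 1 (d i)"
  unfolding d_def[abs_def] by (intro ord_sum ord_E1)

lemma ord_d1: "ord 0 2 (d1 i k)"
  unfolding d1_def[abs_def] by (intro ord_sum ord_E2)

lemma ord_N: "ord 0 0 (N l j)"
  unfolding N_def[abs_def] by (intro ord_sum ord_mults(1) ord_prim)

lemma ord_M1: "ord 0 1 (M1 i l k)"
proof -
  have "ord 0 0 (\<lambda>x. D i l (\<chi> a b. E a b x) (axis a (axis b 1)))" for a b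
    unfolding ord_def using D_bound cont_D by (auto simp: E_def wt_def intro!: exI[of _ K])
  then show ?thesis unfolding M1_def[abs_def] by (intro ord_sum ord_mults(2) ord_E1)
qed

lemma ord_N1: "ord 0 1 (N1 l j k)"
  unfolding N1_def[abs_def] by (intro ord_sum ord_add ord_mults(2)[OF ord_prim(11) ord_E1] ord_mults(3)[OF ord_M1 ord_prim(12)])

lemma ord_Z1: "ord 1 1 (Z1 k)" "ord 1 2 (Z1' k)"
  unfolding Z1_def[abs_def] Z1'_def[abs_def]
  using ord_mults(9)[OF ord_prim(7,2)] ord_mults(11)[OF ord_prim(7,3)]
    ord_mults(10)[OF ord_prim(13,2)]
  by (auto intro!: ord_add simp: numeral_2_eq_2)

lemma ord_Mv: "ord 0 1 (\<lambda>x. M i l x * v l x)" "ord 0 2 (\<lambda>x. M1 i l j x * v l x + M i l x * v1 l j x)"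
  using ord_mults(2)[OF ord_prim(11) ord_v] ord_mults(4)[OF ord_M1 ord_v] ord_mults(5)[OF ord_prim(11) ord_v1]
  by (auto intro!: ord_add simp: numeral_2_eq_2)

lemma ord_\<theta>E: "ord 1 0 (\<lambda>x. \<theta> x * (m x * E i j x))"
  using ord_mults(7)[OF ord_prim(8) ord_mults(8)[OF ord_prim(1,12)]] .

lemma ord_Z2: "ord 1 1 (Z2 j)" "ord 1 2 (Z2' j)"
proof -
  show "ord 1 1 (Z2 j)" unfolding Z2_def[abs_def]
    by (intro ord_sum ord_mults(12)[OF ord_\<theta>E ord_Mv(1)])
  have "ord 0 0 (\<lambda>x. \<theta>' x * m x * (E i j x))" for i
    by (rule ord_mults(1)[OF ord_prim(10,12)])
  from ord_mults(13)[OF ord_prim(2) this]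
  have a: "ord 1 1 (\<lambda>x. \<theta>' x * (m x * xi j x) * (m x * E i j x))" for i
    by (simp add: m_xi mult_ac)
  have "ord 0 1 (\<lambda>x. E1 i j j x + E i j x * xi j x)" for i
    by (intro ord_add ord_E1 ord_mults(2) ord_prim ord_xi)
  from ord_mults(9)[OF ord_prim(8) ord_mults(12)[OF ord_prim(1) this]]
  have b: "ord 1 1 (\<lambda>x. \<theta> x * (m x * (E1 i j j x + E i j x * xi j x)))" for i .
  show "ord 1 2 (Z2' j)" unfolding Z2'_def[abs_def]
    by (intro ord_sum ord_add ord_mults(14)[OF ord_\<theta>E ord_Mv(2)]
      ord_mults(15)[OF ord_add(1)[OF a b] ord_Mv(1)])
qed

lemma ord_Z3: "ord 1 1 (Z3 k)" "ord 1 2 (Z3' k)"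
proof -
  have w: "ord 0 1 (\<lambda>x. N l k x * d l x - (\<Sum>j\<in>UNIV. N l j x * E1 l k j x))" for l
    by (intro ord_add ord_sum ord_mults(2) ord_N ord_d ord_E1)
  show "ord 1 1 (Z3 k)" unfolding Z3_def[abs_def]
    by (intro ord_sum ord_mults(12)[OF ord_prim(9) w])
  have w': "ord 0 2 (\<lambda>x. N1 l k k x * d l x + N l k x * d1 l k x - (\<Sum>j\<in>UNIV. N1 l j k x * E1 l k j x + N l j x * E2 l k j k x))" for l
    by (intro ord_add ord_sum ord_mults(5)[OF ord_N ord_d1] ord_mults(5)[OF ord_N ord_E2]
      ord_mults(4)[OF ord_N1 ord_d] ord_mults(4)[OF ord_N1 ord_E1])
  have "ord 1 1 (\<lambda>x. \<theta> x * (m x * xi k x))"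
    unfolding m_xi by (rule ord_mults(9)[OF ord_prim(8,2)])
  from ord_mults(15)[OF this w]
  show "ord 1 2 (Z3' k)" unfolding Z3'_def[abs_def]
    by (intro ord_sum ord_add ord_mults(14)[OF ord_prim(9) w'])
qed

lemma ord_Z4: "ord 1 1 (Z4 k)" "ord 1 2 (Z4' k)"
proof -
  have e: "ord 0 0 (\<lambda>x. E i j x * E i j x)" for i j by (rule ord_mults(1)[OF ord_prim(12,12)])
  have e1: "ord 0 1 (\<lambda>x. E1 i j k x * E i j x + E i j x * E1 i j k x)" for i j
    by (rule ord_add(1)[OF ord_mults(3)[OF ord_E1 ord_prim(12)] ord_mults(2)[OF ord_prim(12) ord_E1]])
  show "ord 1 1 (Z4 k)" unfolding Z4_def[abs_def]
    by (intro ord_sum ord_add ord_cmult ord_mults(9)[OF ord_prim(12,5)] ord_mults(9)[OF e ord_prim(2)])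
  show "ord 1 2 (Z4' k)" unfolding Z4'_def[abs_def]
    by (intro ord_sum ord_add ord_cmult ord_mults(11)[OF ord_prim(12,6)] ord_mults(11)[OF e ord_prim(3)]
       ord_mults(10)[OF ord_E1 ord_prim(5)] ord_mults(10)[OF e1 ord_prim(2)])
qed

lemma ord_Z: "ord 1 1 (Z k)" "ord 1 2 (Z' k)"
proof -
  have "ord 1 1 (\<lambda>x. (1/2) * (Z1 k x + Z2 k x + Z3 k x) - (Cst / 2) * Z4 k x)"
    by (intro ord_add ord_cmult ord_Z1 ord_Z2 ord_Z3 ord_Z4)
  then show "ord 1 1 (Z k)" unfolding Z_def[abs_def] by simp
  have "ord 1 2 (\<lambda>x. (1/2) * (Z1' k x + Z2' k x + Z3' k x) - (Cst / 2) * Z4' k x)"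
    by (intro ord_add ord_cmult ord_Z1 ord_Z2 ord_Z3 ord_Z4)
  then show "ord 1 2 (Z' k)" unfolding Z'_def[abs_def] by simp
qed

lemma ord_integrable:
  assumes "ord 1 i F" "i = 1 \<or> i = 2"
  shows "integrable lborel F"
proof -
  obtain C where C: "\<And>x. \<bar>F x\<bar> \<le> C * (m x ^ 1 * wt i x)" and c: "continuous_on UNIV F"
    using assms by (auto simp: ord_def)
  have "integrable lborel (\<lambda>x. C * (m x ^ 1 * wt i x))"
    using assms(2) int_y int_y2 by (auto simp: wt_def intro!: integrable_mult_right)
  then show ?thesis
    by (rule Bochner_Integration.integrable_bound)
      (use C c in \<open>auto intro: borel_measurable_continuous_onI intro!: order_trans[OF _ abs_ge_self]\<close>)
qed

lemma integral_Z': "(\<integral>x. Z' k x \<partial>lborel) = 0" "integrable lborel (Z' k)"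
proof -
  show i: "integrable lborel (Z' k)" using ord_integrable[OF ord_Z(2)] by simp
  have "integrable lborel (Z k)" using ord_integrable[OF ord_Z(1)] by simp
  then show "(\<integral>x. Z' k x \<partial>lborel) = 0"
    by (rule integral_directional_derivative_eq_0[rotated])
      (use i partial_Z[of k] ord_Z(2)[of k] in \<open>auto simp: has_partial_def ord_def\<close>)
qed

lemma integral_G_ge:
  assumes "integrable lborel G" and "integrable lborel (\<lambda>x. \<sigma> x * y x)"
  shows "(\<integral>x. G x \<partial>lborel) \<ge> - (Cst * (3 * real CARD('n) ^ 3 * K\<^sup>2)) * (\<integral>x. \<sigma> x * y x \<partial>lborel)"
proof -
  have "(\<integral>x. (\<Sum>k\<in>UNIV. Z' k x) - Cst * (3 * real CARD('n) ^ 3 * K\<^sup>2) * (\<sigma> x * y x) \<partial>lborel) \<le> (\<integral>x. G x \<partial>lborel)"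
    by (rule integral_mono) (use assms integral_Z' flux_pointwise in auto)
  then show ?thesis using assms integral_Z' by simp
qed

end

section \<open>The convex hull of the tensors of an integrand satisfying USAC\<close>

text \<open>The off-diagonal block is traceless: cycling the trace produces the factor
  \<open>T ** perp T\<close>, which is 0.\<close>

lemma trace_B_int:
  fixes T :: "real^'n^'n"
  assumes T: "T \<in> grassmannian m"
  shows "trace (B_int m \<Psi> T) = real m * \<Psi> T"
proof -
  have idem: "T ** T = T" and tr: "trace T = real m" using T by (auto simp: grassmannian_def)
  have "T ** perp T = 0" by (simp add: perp_def matrix_sub_ldistrib idem)
  then have "trace (perp T ** d_int m \<Psi> T ** T) = 0"
    by (simp add: trace_mul_sym[of _ T] matrix_mul_assoc) (simp add: trace_def)
  moreover have "trace (\<Psi> T *\<^sub>R T) = \<Psi> T * trace T"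
    by (simp add: trace_def sum_distrib_left)
  ultimately show ?thesis by (simp add: B_int_def trace_add tr)
qed

lemma transpose_d_int: "transpose (d_int m \<Psi> T) = d_int m \<Psi> T"
  by (simp add: d_int_def transpose_add add.commute)

text \<open>Transposition exchanges the two off-diagonal blocks, so up to sign and a multiple of the
  identity the dual tensor is the transpose of the original one. The USAC pairing thereby becomes a
  trace of a product, see \<open>inner_B_int_dual\<close>.\<close>

lemma B_int_dual_transpose:
  fixes S :: "real^'n^'n"
  assumes m: "m \<le> CARD('n)" and I: "C1_integrand m \<Psi>" and S: "S \<in> grassmannian m"
  shows "B_int (CARD('n) - m) (dual_integrand \<Psi>) (perp S) =
           \<Psi> S *\<^sub>R mat 1 - transpose (B_int m \<Psi> S)"
proof -
  have sym: "transpose S = S" using S by (auto simp: grassmannian_def)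
  have "transpose (perp S ** d_int m \<Psi> S ** S) = S ** d_int m \<Psi> S ** perp S"
    by (simp add: matrix_transpose_mul transpose_d_int sym perp_def transpose_diff transpose_mat
        matrix_mul_assoc)
  moreover have "transpose (\<Psi> S *\<^sub>R S) = \<Psi> S *\<^sub>R S"
    using sym by (simp add: transpose_def vec_eq_iff)
  ultimately show ?thesis
    unfolding B_int_dual[OF m I S] B_int_def[of m \<Psi> S] transpose_add
    by (simp add: perp_def scaleR_right_diff_distrib)
qed

lemma inner_B_int_dual:
  fixes S T :: "real^'n^'n"
  assumes m: "m \<le> CARD('n)" and I: "C1_integrand m \<Psi>"
    and S: "S \<in> grassmannian m" and T: "T \<in> grassmannian m"
  shows "B_int m \<Psi> T \<bullet> B_int (CARD('n) - m) (dual_integrand \<Psi>) (perp S) =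
           real m * \<Psi> S * \<Psi> T - trace (B_int m \<Psi> S ** B_int m \<Psi> T)"
proof -
  have 1: "A \<bullet> (mat 1 :: real^'n^'n) = trace A" for A
    by (metis inner_commute inner_eq_trace matrix_mul_lid transpose_mat)
  have 2: "A \<bullet> transpose C = trace (C ** A)" for A C :: "real^'n^'n"
    by (metis inner_commute inner_eq_trace transpose_transpose)
  show ?thesis
    by (simp add: B_int_dual_transpose[OF m I S] inner_diff_right 1 2 trace_B_int[OF T])
qed


section \<open>Rank of the matrices in the convex hull\<close>

lemma matrix_add_rdistrib: "((B :: real^'n^'m) + C) ** (A :: real^'k^'n) = B ** A + C ** A"
  by (simp add: matrix_matrix_mult_def vec_eq_iff sum.distrib algebra_simps)

lemma orthonormal_projection:
  fixes B :: "(real^'n) set"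
  assumes B: "finite B" "pairwise orthogonal B" "\<And>x. x \<in> B \<Longrightarrow> norm x = 1"
  defines "P \<equiv> \<Sum>b\<in>B. outer b b"
  shows "P \<in> grassmannian (card B)" and "P *v x = (\<Sum>b\<in>B. (b \<bullet> x) *\<^sub>R b)"
proof -
  show Pv: "P *v x = (\<Sum>b\<in>B. (b \<bullet> x) *\<^sub>R b)" for x
    unfolding P_def using B(1)
    by (induction B rule: finite_induct) (simp_all add: matrix_vector_mult_add_rdistrib outer_mult_vec)
  have fixb: "P *v b = b" if b: "b \<in> B" for b
  proof -
    have "(\<Sum>c\<in>B. (c \<bullet> b) *\<^sub>R c) = (\<Sum>c\<in>B. if c = b then b else 0)"
      using B b by (intro sum.cong) (auto simp: pairwise_def orthogonal_def dot_square_norm)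
    then show ?thesis using B b by (simp add: Pv)
  qed
  have "P *v (P *v x) = P *v x" for x
    by (simp only: Pv[of x] linear_sum[OF matrix_vector_mul_linear]) (auto simp: matrix_vector_mult_scaleR fixb intro: sum.cong)
  then have "P ** P = P" by (simp add: matrix_eq flip: matrix_vector_mul_assoc)
  moreover have "transpose P = P"
    unfolding P_def using B(1) by (induction B rule: finite_induct) (simp_all add: transpose_add transpose_outer, simp add: transpose_def vec_eq_iff)
  moreover have "trace P = (\<Sum>b\<in>B. b \<bullet> b)"
    unfolding P_def using B(1) by (induction B rule: finite_induct) (simp_all add: trace_add trace_outer, simp add: trace_def)
  then have "trace P = card B" using B by (simp add: dot_square_norm)
  ultimately show "P \<in> grassmannian (card B)" by (simp add: grassmannian_def)
qed

text \<open>Multiplication by T from the left kills the off-diagonal block and leaves \<Psi>(T)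
  T.\<close>

lemma B_int_ker:
  fixes T :: "real^'n^'n"
  assumes T: "T \<in> grassmannian m" and "\<Psi> T > 0" and x: "B_int m \<Psi> T *v x = 0"
  shows "T *v x = 0"
proof -
  have idem: "T ** T = T" using T by (auto simp: grassmannian_def)
  have "T ** perp T = 0" by (simp add: perp_def matrix_sub_ldistrib idem)
  then have "T ** B_int m \<Psi> T = \<Psi> T *\<^sub>R T"
    by (simp add: B_int_def matrix_add_ldistrib idem matrix_mul_assoc matrix_scalar_ac flip: scalar_matrix_assoc)
  then have "\<Psi> T *\<^sub>R (T *v x) = T *v (B_int m \<Psi> T *v x)"
    by (simp add: matrix_vector_mul_assoc scaleR_matrix_vector_assoc)
  then show ?thesis using x assms(2) by simp
qed

text \<open>The dual tensor has \<open>perp S\<close> as its right factor, and inside the trace this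
  factor can be moved onto A.\<close>

lemma inner_dual_ker:
  fixes A S :: "real^'n^'n"
  assumes m: "m \<le> CARD('n)" and I: "C1_integrand m \<Psi>" and S: "S \<in> grassmannian m" and A: "A ** perp S = 0"
  shows "A \<bullet> B_int (CARD('n) - m) (dual_integrand \<Psi>) (perp S) = 0"
proof -
  have sym: "transpose (perp S) = perp S" using S by (auto simp: grassmannian_def perp_def transpose_diff transpose_mat)
  have "B_int (CARD('n) - m) (dual_integrand \<Psi>) (perp S) = (\<Psi> S *\<^sub>R mat 1 - S ** d_int m \<Psi> S) ** perp S"
    by (simp add: B_int_dual[OF m I S] matrix_sub_rdistrib flip: scalar_matrix_assoc)
  then obtain K where K: "B_int (CARD('n) - m) (dual_integrand \<Psi>) (perp S) = K ** perp S" by blast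
  have "trace (transpose A ** (K ** perp S)) = trace (transpose (A ** perp S) ** K)"
    by (simp add: matrix_transpose_mul sym matrix_mul_assoc trace_mul_sym[of _ "perp S"])
  then show ?thesis by (simp add: K inner_eq_trace A) (simp add: transpose_def trace_def matrix_matrix_mult_def)
qed

text \<open>If the rank were below m, some S would have the range of \<open>perp S\<close> inside
  the kernel of A, and A would pair to 0 with the dual tensor of S. By USAC this pairing is positive
  on B(T) unless B(T) = B(S), so a point of the hull with pairing 0 must be B(S). But the kernel of
  B(S) lies in the kernel of S, which is too small.\<close>

lemma USAC_rank:
  fixes \<Psi> :: "real^'n^'n \<Rightarrow> real"
  assumes m: "m < CARD('n)" and U: "USAC m \<Psi>" and A: "A \<in> convex hull (B_int m \<Psi> ` grassmannian m)"
  shows "dim (rows A) \<ge> m"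
proof (rule ccontr)
  assume less: "\<not> m \<le> dim (rows A)"
  obtain c where I: "C1_integrand m \<Psi>" and c: "c > 0" "\<And>S T. S \<in> grassmannian m \<Longrightarrow> T \<in> grassmannian m \<Longrightarrow>
     B_int m \<Psi> T \<bullet> B_int (CARD('n) - m) (dual_integrand \<Psi>) (perp S) \<ge> c * (norm (T - S))\<^sup>2"
    using U by (auto simp: USAC_def)
  let ?U = "{y. \<forall>x\<in>span (rows A). orthogonal x y}"
  have "dim {y \<in> UNIV. \<forall>x\<in>span (rows A). orthogonal x y} + dim (span (rows A)) = dim (UNIV :: (real^'n) set)"
    by (rule dim_subspace_orthogonal_to_vectors) auto
  then have dU: "dim ?U > CARD('n) - m" using less m by simp
  have "subspace ?U" by (auto simp: subspace_def orthogonal_def inner_add_right)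
  then obtain B where B: "B \<subseteq> ?U" "pairwise orthogonal B" "\<And>x. x \<in> B \<Longrightarrow> norm x = 1"
    "independent B" "card B = dim ?U" by (rule orthonormal_basis_subspace) (rule that; blast)
  have ker: "A *v b = 0" if "b \<in> B" for b
  proof -
    have "A $ i \<bullet> b = 0" for i
    proof -
      have "A $ i \<in> span (rows A)" by (intro span_base) (auto simp: rows_def row_def)
      then show ?thesis using that B(1) by (auto simp: orthogonal_def)
    qed
    then show ?thesis by (simp add: vec_eq_iff matrix_vector_mul_component)
  qed
  obtain B' where B': "B' \<subseteq> B" "card B' = CARD('n) - m" "finite B'"
  proof -
    have "CARD('n) - m \<le> card B" using dU B(5) by simp
    from obtain_subset_with_card_n[OF this] show ?thesis using that by blast
  qed
  have "finite B" using B(4) independent_imp_finite by blast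
  then obtain b where b: "b \<in> B" "b \<notin> B'"
    using card_mono[OF B'(3), of B] B'(2) dU B(5) by force
  have B'o: "pairwise orthogonal B'" "\<And>x. x \<in> B' \<Longrightarrow> norm x = 1" using B' B by (auto intro: pairwise_subset)
  define P where "P = (\<Sum>b\<in>B'. outer b b)"
  note pr = orthonormal_projection[OF B'(3) B'o, folded P_def]
  define S where "S = perp P"
  have S: "S \<in> grassmannian m" using perp_in_grassmannian[of "CARD('n) - m" P] pr(1) B'(2) m by (simp add: S_def)
  have AP: "A ** perp S = 0"
  proof -
    have "(A ** P) *v x = 0" for x
      using ker B' by (auto simp: pr(2) linear_sum[OF matrix_vector_mul_linear] matrix_vector_mult_scaleR simp flip: matrix_vector_mul_assoc intro!: sum.neutral)
    then show ?thesis by (simp add: S_def matrix_eq)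
  qed
  let ?b = "B_int (CARD('n) - m) (dual_integrand \<Psi>) (perp S)"
  \<comment> \<open>An open half-space together with one point of its boundary hyperplane is
    convex.\<close>
  let ?Q = "{A. A \<bullet> ?b > 0} \<union> {B_int m \<Psi> S}"
  have BS: "B_int m \<Psi> S ** perp S = 0"
  proof -
    have "S ** perp S = 0" using S by (simp add: perp_def matrix_sub_ldistrib grassmannian_def)
    then show ?thesis by (simp add: B_int_def matrix_add_rdistrib matrix_mul_assoc[symmetric] flip: scalar_matrix_assoc)
  qed
  have BS0: "B_int m \<Psi> S \<bullet> ?b = 0" using inner_dual_ker[OF _ I S BS] m by simp
  have "convex hull (B_int m \<Psi> ` grassmannian m) \<subseteq> ?Q"
  proof (rule hull_minimal)
    show "B_int m \<Psi> ` grassmannian m \<subseteq> ?Q"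
    proof safe
      fix T :: "real^'n^'n" assume T: "T \<in> grassmannian m" and n: "B_int m \<Psi> T \<notin> {}" "B_int m \<Psi> T \<noteq> B_int m \<Psi> S"
      then have "T \<noteq> S" by auto
      then show "B_int m \<Psi> T \<bullet> ?b > 0" using c(1) c(2)[OF S T] by (smt (verit) mult_pos_pos norm_eq_zero right_minus_eq zero_less_power2)
    qed
    show "convex ?Q"
    proof (rule convexI)
      fix x y :: "real^'n^'n" and u v :: real
      assume x: "x \<in> ?Q" and y: "y \<in> ?Q" and u: "0 \<le> u" "0 \<le> v" "u + v = 1"
      show "u *\<^sub>R x + v *\<^sub>R y \<in> ?Q"
      proof (cases "x = B_int m \<Psi> S \<and> y = B_int m \<Psi> S \<or> u = 0 \<or> v = 0")
        case True then show ?thesis using x y u by (auto simp: scaleR_left_distrib[symmetric])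
      next
        case False
        have "x \<bullet> ?b \<ge> 0" "y \<bullet> ?b \<ge> 0" using x y BS0 by auto
        moreover have "x \<bullet> ?b > 0 \<or> y \<bullet> ?b > 0" using x y False by auto
        ultimately have "u * (x \<bullet> ?b) + v * (y \<bullet> ?b) > 0" using False u
          by (auto intro: add_pos_nonneg add_nonneg_pos)
        then show ?thesis by (simp add: inner_add_left)
      qed
    qed
  qed
  then have "A = B_int m \<Psi> S" using A inner_dual_ker[OF _ I S AP] m by auto
  then have "S *v b = 0" using B_int_ker[OF S, of \<Psi> b] I S ker[OF b(1)] by (auto simp: C1_integrand_def)
  moreover have "P *v b = 0"
  proof -
    have "c \<bullet> b = 0" if "c \<in> B'" for c
    proof -
      have "c \<in> B" "c \<noteq> b" using that b B'(1) by auto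
      from pairwiseD[OF B(2) this(1) b(1) this(2)] show ?thesis by (simp add: orthogonal_def)
    qed
    then show ?thesis by (simp add: pr(2))
  qed
  ultimately have "b = 0" by (simp add: S_def perp_def matrix_vector_mult_diff_rdistrib)
  then show False using B(3)[OF b(1)] by simp
qed

lemma compact_grassmannian: "compact (grassmannian m :: (real^'n^'n) set)"
proof -
  have "closed (grassmannian m :: (real^'n^'n) set)"
  proof -
    have c: "continuous_on UNIV (\<lambda>T::real^'n^'n. transpose T)" "continuous_on UNIV (\<lambda>T::real^'n^'n. T ** T)" "continuous_on UNIV (\<lambda>T::real^'n^'n. trace T)"
      unfolding transpose_def matrix_matrix_mult_def trace_def by (intro continuous_intros)+
    have "grassmannian m = {T::real^'n^'n. transpose T = T} \<inter> {T. T ** T = T} \<inter> {T. trace T = real m}"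
      by (auto simp: grassmannian_def)
    then show ?thesis by (simp only:) (intro closed_Int closed_Collect_eq c continuous_intros)
  qed
  moreover have "norm T \<le> sqrt (real m)" if "T \<in> grassmannian m" for T :: "real^'n^'n"
    using that by (simp add: norm_eq_sqrt_inner inner_eq_trace grassmannian_def)
  then have "bounded (grassmannian m :: (real^'n^'n) set)" by (auto simp: bounded_iff)
  ultimately show ?thesis by (simp add: compact_eq_bounded_closed)
qed

lemma continuous_on_matrix_mult:
  assumes "continuous_on S f" "continuous_on S g"
  shows "continuous_on S (\<lambda>x. (f x :: real^'n^'m) ** (g x :: real^'k^'n))"
  unfolding matrix_matrix_mult_def using assms by (intro continuous_intros)

lemma continuous_B_int:
  fixes \<Psi> :: "real^'n^'n \<Rightarrow> real"
  assumes I: "C1_integrand m \<Psi>"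
  shows "continuous_on (grassmannian m) (B_int m \<Psi>)" "continuous_on (grassmannian m) \<Psi>"
proof -
  obtain F where E: "C1_extension m \<Psi> F (D_int m \<Psi>)"
    using I someI_ex[of "\<lambda>DF. \<exists>F. C1_extension m \<Psi> F DF"]
    unfolding C1_integrand_def D_int_def by blast
  then obtain U where U: "open U" "grassmannian m \<subseteq> U" "\<And>X. X \<in> U \<Longrightarrow> GDERIV F X :> D_int m \<Psi> X"
    "continuous_on U (D_int m \<Psi>)" and F: "\<And>T. T \<in> grassmannian m \<Longrightarrow> F T = \<Psi> T"
    unfolding C1_extension_def by blast
  have "continuous_on (grassmannian m) F"
    using U by (intro continuous_at_imp_continuous_on ballI) (meson GDERIV_DERIV_compose gderiv_def has_derivative_continuous subsetD)
  then show P: "continuous_on (grassmannian m) \<Psi>" using F continuous_on_cong by metis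
  have "continuous_on (grassmannian m) (D_int m \<Psi>)" using U continuous_on_subset by blast
  then have "continuous_on (grassmannian m) (d_int m \<Psi>)"
    unfolding d_int_def transpose_def by (intro continuous_intros)
  then show "continuous_on (grassmannian m) (B_int m \<Psi>)"
    unfolding B_int_def[abs_def] perp_def using P by (intro continuous_intros continuous_on_matrix_mult)
qed

lemma compact_B_hull:
  assumes "C1_integrand m \<Psi>"
  shows "compact (convex hull (B_int m \<Psi> ` grassmannian m))"
  by (intro compact_convex_hull compact_continuous_image continuous_B_int assms compact_grassmannian)

section \<open>A smooth average of coordinate projections\<close>

text \<open>Derivatives are taken in the full space but only at points of S, which will be the
  compact hull; their continuity is demanded direction by direction, the form in which the partial
  derivatives use it.\<close>

definition C1_fun :: "'a::real_normed_vector set \<Rightarrow> ('a \<Rightarrow> real) \<Rightarrow> bool" where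
  "C1_fun S f \<longleftrightarrow> (\<exists>D. (\<forall>x\<in>S. (f has_derivative D x) (at x)) \<and> (\<forall>v. continuous_on S (\<lambda>x. D x v)))"

lemma C1_fun_continuous: "C1_fun S f \<Longrightarrow> continuous_on S f"
  unfolding C1_fun_def by (meson continuous_at_imp_continuous_on has_derivative_continuous)

lemma C1_fun_const: "C1_fun S (\<lambda>x. c)"
  unfolding C1_fun_def by (rule exI[of _ "\<lambda>_ _. 0"]) auto

lemma C1_fun_entry: "C1_fun S (\<lambda>A::real^'n^'m. A $ i $ j)"
  unfolding C1_fun_def
  by (rule exI[of _ "\<lambda>_ A. A $ i $ j"])
    (auto intro!: bounded_linear_imp_has_derivative bounded_linear_compose[OF bounded_linear_vec_nth bounded_linear_vec_nth])

lemma C1_fun_add: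
  assumes "C1_fun S f" "C1_fun S g" shows "C1_fun S (\<lambda>x. f x + g x)"
proof -
  obtain D D' where "\<And>x. x \<in> S \<Longrightarrow> (f has_derivative D x) (at x)" "\<And>x. x \<in> S \<Longrightarrow> (g has_derivative D' x) (at x)"
     "\<And>v. continuous_on S (\<lambda>x. D x v)" "\<And>v. continuous_on S (\<lambda>x. D' x v)"
    using assms unfolding C1_fun_def by metis
  then show ?thesis unfolding C1_fun_def
    by (intro exI[of _ "\<lambda>x v. D x v + D' x v"]) (auto intro!: has_derivative_add continuous_intros)
qed

lemma C1_fun_mult:
  assumes "C1_fun S f" "C1_fun S g" shows "C1_fun S (\<lambda>x. f x * g x)"
proof -
  obtain D D' where "\<And>x. x \<in> S \<Longrightarrow> (f has_derivative D x) (at x)" "\<And>x. x \<in> S \<Longrightarrow> (g has_derivative D' x) (at x)"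
     "\<And>v. continuous_on S (\<lambda>x. D x v)" "\<And>v. continuous_on S (\<lambda>x. D' x v)"
    using assms unfolding C1_fun_def by metis
  then show ?thesis unfolding C1_fun_def using assms[THEN C1_fun_continuous]
    by (intro exI[of _ "\<lambda>x v. f x * D' x v + D x v * g x"]) (auto intro!: has_derivative_mult continuous_intros)
qed

lemma C1_fun_inverse:
  assumes "C1_fun S f" "\<And>x. x \<in> S \<Longrightarrow> f x \<noteq> 0" shows "C1_fun S (\<lambda>x. inverse (f x))"
proof -
  obtain D where "\<And>x. x \<in> S \<Longrightarrow> (f has_derivative D x) (at x)"  "\<And>v. continuous_on S (\<lambda>x. D x v)"
    using assms unfolding C1_fun_def by metis
  then show ?thesis unfolding C1_fun_def using assms(1)[THEN C1_fun_continuous] assms(2)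
    by (intro exI[of _ "\<lambda>x v. - (inverse (f x) * D x v * inverse (f x))"]) (auto intro!: has_derivative_inverse continuous_intros)
qed

lemma C1_fun_sum: "(\<And>i. i \<in> I \<Longrightarrow> C1_fun S (f i)) \<Longrightarrow> C1_fun S (\<lambda>x. \<Sum>i\<in>I. f i x)"
  by (induction I rule: infinite_finite_induct) (auto intro: C1_fun_const C1_fun_add)

lemma C1_fun_prod: "(\<And>i. i \<in> I \<Longrightarrow> C1_fun S (f i)) \<Longrightarrow> C1_fun S (\<lambda>x. \<Prod>i\<in>I. f i x)"
  by (induction I rule: infinite_finite_induct) (auto intro: C1_fun_const C1_fun_mult)

lemma C1_fun_det: "(\<And>i j. C1_fun S (\<lambda>x. G x $ i $ j)) \<Longrightarrow> C1_fun S (\<lambda>x. det (G x :: real^'n^'n))"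
  unfolding det_def by (intro C1_fun_sum C1_fun_mult C1_fun_const C1_fun_prod)

section \<open>Gram matrices of selected rows\<close>

definition restrict_rows :: "'n set \<Rightarrow> real^'n^'n \<Rightarrow> real^'n^'n" where
  "restrict_rows J A = (\<chi> i j. if i \<in> J then A $ i $ j else 0)"

definition diag_on :: "'n set \<Rightarrow> real^'n^'n" where
  "diag_on J = (\<chi> i j. if i = j \<and> i \<in> J then 1 else 0)"

text \<open>The Gram matrix of the rows in J, padded by the identity on the complement of J. The
  padding keeps the size N for every J and makes the determinant that of the Gram block.\<close>

definition gram :: "'n set \<Rightarrow> real^'n^'n \<Rightarrow> real^'n^'n" where
  "gram J A = restrict_rows J A ** transpose (restrict_rows J A) + (mat 1 - diag_on J)"

text \<open>The numerator in Cramer's rule, with column k replaced by the l-th unit vector. It is a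
  polynomial in A, hence smooth also where the Gram matrix is singular.\<close>

definition adjoint_entry :: "'n set \<Rightarrow> real^'n^'n \<Rightarrow> 'n \<Rightarrow> 'n \<Rightarrow> real" where
  "adjoint_entry J A k l = det (\<chi> i j. if j = k then (if i = l then 1 else 0) else gram J A $ i $ j)"

lemma C1_fun_gram: "C1_fun S (\<lambda>A. gram J A $ i $ j)"
proof -
  have r: "C1_fun S (\<lambda>A. restrict_rows J A $ i $ j)" for i j
    unfolding restrict_rows_def by (cases "i \<in> J") (auto intro: C1_fun_const C1_fun_entry)
  show ?thesis unfolding gram_def matrix_matrix_mult_def transpose_def
    by (auto intro!: C1_fun_add C1_fun_sum C1_fun_mult r C1_fun_const)
qed

lemma C1_fun_adjoint_entry: "C1_fun S (\<lambda>A. adjoint_entry J A k l)"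
  unfolding adjoint_entry_def
proof (rule C1_fun_det)
  fix i j
  show "C1_fun S (\<lambda>A. (\<chi> i j. if j = k then if i = l then 1 else 0 else gram J A $ i $ j) $ i $ j)"
    by (cases "j = k"; cases "i = l") (auto intro: C1_fun_const C1_fun_gram)
qed

lemma diag_on_mult: "diag_on J ** A = restrict_rows J A"
proof -
  have "(diag_on J ** A) $ i $ j = (\<Sum>k\<in>UNIV. if k = i then (if i \<in> J then A $ i $ j else 0) else 0)" for i j
    unfolding matrix_matrix_mult_def diag_on_def vec_lambda_beta by (intro sum.cong refl) auto
  then show ?thesis by (simp add: vec_eq_iff restrict_rows_def)
qed

lemma transpose_diag_on: "transpose (diag_on J) = diag_on J"
  by (auto simp: transpose_def diag_on_def vec_eq_iff)

text \<open>With C the selected rows and G their padded Gram matrix, P = C^t G^(-1) C is the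
  orthogonal projection onto the span of these rows. Moreover trace R - trace (P R) is the trace of
  (I - P) R (I - P), which is nonnegative for positive R.\<close>

lemma gram_inverse_projection:
  fixes A :: "real^'n^'n"
  assumes d: "det (gram J A) \<noteq> 0"
  obtains H where "\<And>k l. adjoint_entry J A k l = det (gram J A) * H $ k $ l"
    and "trace (transpose A ** (diag_on J ** H ** diag_on J) ** A) = card J"
    and "\<And>R. (\<And>y. y \<bullet> (R *v y) \<ge> 0) \<Longrightarrow> trace ((transpose A ** (diag_on J ** H ** diag_on J) ** A) ** R) \<le> trace R"
proof -
  define G where "G = gram J A"
  define H where "H = matrix_inv G"
  define L where "L = (diag_on J :: real^'n^'n)"
  define C where "C = restrict_rows J A"
  have inv: "invertible G" using d by (simp add: invertible_det_nz G_def)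
  have GH: "G ** H = mat 1" "H ** G = mat 1"
  proof -
    have "\<exists>B. G ** B = mat 1 \<and> B ** G = mat 1" using inv by (auto simp: invertible_def)
    then have "G ** H = mat 1 \<and> H ** G = mat 1" unfolding H_def matrix_inv_def by (rule someI_ex)
    then show "G ** H = mat 1" "H ** G = mat 1" by auto
  qed
  have LL: "L ** L = L" unfolding L_def diag_on_mult by (auto simp: restrict_rows_def diag_on_def vec_eq_iff)
  have C: "L ** A = C" "L ** C = C" unfolding L_def C_def diag_on_mult by (auto simp: restrict_rows_def vec_eq_iff)
  have Lt: "transpose L = L" by (simp add: L_def transpose_diag_on)
  have Ct: "transpose C = transpose A ** L" using arg_cong[OF C(1), of transpose] by (simp add: matrix_transpose_mul Lt)
  have CtL: "transpose C ** L = transpose C" using arg_cong[OF C(2), of transpose] by (simp add: matrix_transpose_mul Lt)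
  have G: "G = C ** transpose C + (mat 1 - L)" by (simp add: G_def gram_def C_def L_def)
  have LG: "L ** G = C ** transpose C" "G ** L = C ** transpose C"
    unfolding G by (simp_all add: matrix_add_ldistrib matrix_add_rdistrib matrix_sub_ldistrib matrix_sub_rdistrib LL matrix_mul_assoc C)
      (simp add: CtL flip: matrix_mul_assoc)
  have Gt: "transpose G = G"
    unfolding G by (simp add: transpose_add transpose_diff matrix_transpose_mul Lt transpose_mat)
  have Ht: "transpose H = H"
  proof -
    have "G ** transpose H = mat 1" using arg_cong[OF GH(2), of transpose] by (simp add: matrix_transpose_mul Gt transpose_mat)
    then have "H ** (G ** transpose H) = H" by simp
    then show ?thesis by (simp add: matrix_mul_assoc GH)
  qed
  \<comment> \<open>\<open>L\<close> commutes with G and therefore with its inverse: the padding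
    never mixes with the rows in J.\<close>
  have HL: "H ** L = L ** H"
  proof -
    have "H ** (L ** G) ** H = H ** (G ** L) ** H" by (simp add: LG)
    moreover have "H ** (L ** G) ** H = (H ** L) ** (G ** H)" by (simp add: matrix_mul_assoc)
    moreover have "H ** (G ** L) ** H = (H ** G) ** (L ** H)" by (simp add: matrix_mul_assoc)
    ultimately show ?thesis by (simp add: GH)
  qed
  define P where "P = transpose C ** H ** C"
  have PP: "transpose A ** (L ** H ** L) ** A = P"
  proof -
    have "transpose A ** (L ** H ** L) ** A = (transpose A ** L) ** H ** (L ** A)" by (simp add: matrix_mul_assoc)
    then show ?thesis by (simp add: P_def Ct C)
  qed
  have Pt: "transpose P = P" by (simp add: P_def matrix_transpose_mul Ht matrix_mul_assoc)
  have P2: "P ** P = P"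
  proof -
    have "P ** P = transpose C ** H ** (C ** transpose C) ** H ** C" by (simp add: P_def matrix_mul_assoc)
    also have "\<dots> = transpose C ** (H ** G) ** (L ** H) ** C" unfolding LG(2)[symmetric] by (simp add: matrix_mul_assoc)
    also have "\<dots> = transpose C ** (H ** L) ** C" by (simp add: GH HL)
    also have "\<dots> = transpose C ** H ** (L ** C)" by (simp add: matrix_mul_assoc)
    finally show ?thesis by (simp add: C P_def)
  qed
  have "trace P = trace (H ** (C ** transpose C))"
    by (simp add: P_def matrix_mul_assoc[symmetric] trace_mul_sym[of "transpose C"])
  also have "\<dots> = trace ((H ** G) ** L)" unfolding LG(2)[symmetric] by (simp add: matrix_mul_assoc)
  also have "\<dots> = card J" by (simp add: GH L_def trace_def diag_on_def sum.If_cases)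
  finally have trP: "trace P = card J" .
  have R: "trace (P ** R) \<le> trace R" if R: "\<And>y. y \<bullet> (R *v y) \<ge> 0" for R
  proof -
    define Q where "Q = mat 1 - P"
    have Qt: "transpose Q = Q" by (simp add: Q_def transpose_diff transpose_mat Pt)
    have Q2: "Q ** Q = Q" by (simp add: Q_def matrix_sub_ldistrib matrix_sub_rdistrib P2)
    have "trace R - trace (P ** R) = trace (Q ** R)" by (simp add: Q_def matrix_sub_rdistrib trace_sub)
    also have "\<dots> = trace (Q ** (Q ** R))" by (simp add: Q2 matrix_mul_assoc)
    also have "\<dots> = trace (transpose Q ** (R ** Q))" by (simp add: Qt matrix_mul_assoc trace_mul_sym[of Q "Q ** R"] trace_mul_sym[of _ Q])
    also have "\<dots> = (\<Sum>i\<in>UNIV. (Q *v axis i 1) \<bullet> (R *v (Q *v axis i 1)))"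
    proof -
      have "(transpose Q ** (R ** Q)) $ i $ i = axis i 1 \<bullet> ((transpose Q ** (R ** Q)) *v axis i 1)" for i
        by (simp add: matrix_vector_mult_basis column_def inner_axis')
      also have "axis i 1 \<bullet> ((transpose Q ** (R ** Q)) *v axis i 1) = (Q *v axis i 1) \<bullet> (R *v (Q *v axis i 1))" for i
        using sym_inner[OF Qt, of "axis i 1" "R *v (Q *v axis i 1)"] by (simp add: Qt matrix_vector_mul_assoc matrix_mul_assoc)
      finally show ?thesis by (simp add: trace_def)
    qed
    also have "\<dots> \<ge> 0" by (intro sum_nonneg R)
    finally show ?thesis by simp
  qed
  have adj: "adjoint_entry J A k l = det (gram J A) * H $ k $ l" for k l
  proof -
    have Hb: "G *v (H *v axis l 1) = axis l 1" by (simp add: matrix_vector_mul_assoc GH)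
    have "(\<chi> i j. if j = k then (if i = l then 1 else 0) else gram J A $ i $ j) =
        (\<chi> i j. if j = k then (G *v (H *v axis l 1)) $ i else G $ i $ j)"
      unfolding Hb by (auto simp: vec_eq_iff axis_def G_def)
    then show ?thesis unfolding adjoint_entry_def
      by (simp only: cramer_lemma) (simp add: matrix_vector_mult_basis column_def G_def)
  qed
  show thesis
    by (rule that[of H]) (use adj trP R PP in \<open>simp_all add: L_def\<close>)
qed

text \<open>Select m independent rows. A null vector z of their Gram matrix satisfies 0 = z . G z =
  |C^t z|^2 + |z outside J|^2, so it vanishes outside J and is a linear relation between the
  selected rows.\<close>

lemma gram_det_nonzero:
  fixes A :: "real^'n^'n"
  assumes "dim (rows A) \<ge> m"
  obtains J where "card J = m" "det (gram J A) \<noteq> 0"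
proof -
  obtain B where B: "B \<subseteq> rows A" "independent B" "rows A \<subseteq> span B" "card B = dim (rows A)"
    using basis_exists[of "rows A"] by metis
  obtain B' where B': "B' \<subseteq> B" "card B' = m" "finite B'"
    using obtain_subset_with_card_n[of m B] assms B(4) by metis
  have ind: "independent B'" using B(2) B'(1) independent_mono by blast
  have "\<forall>b\<in>B'. \<exists>i. A $ i = b" using B' B by (auto simp: rows_def row_def)
  then obtain f where f: "\<And>b. b \<in> B' \<Longrightarrow> A $ f b = b" by metis
  define J where "J = f ` B'"
  have inj: "inj_on f B'" by (rule inj_on_inverseI[of _ "\<lambda>i. A $ i"]) (use f in auto)
  have "card J = m" using inj B'(2) by (simp add: J_def card_image)
  moreover have "det (gram J A) \<noteq> 0"
  proof -
    have "z = 0" if z: "gram J A *v z = 0" for z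
    proof -
      let ?C = "restrict_rows J A"
      have "0 = z \<bullet> (gram J A *v z)" using z by simp
      also have "\<dots> = z \<bullet> (?C *v (transpose ?C *v z)) + z \<bullet> ((mat 1 - diag_on J) *v z)"
        by (simp add: gram_def matrix_vector_mult_add_rdistrib inner_add_right flip: matrix_vector_mul_assoc)
      also have "z \<bullet> (?C *v (transpose ?C *v z)) = (transpose ?C *v z) \<bullet> (transpose ?C *v z)"
        by (metis dot_lmul_matrix transpose_matrix_vector)
      also have "z \<bullet> ((mat 1 - diag_on J) *v z) = (\<Sum>i\<in>UNIV. if i \<in> J then 0 else (z $ i)\<^sup>2)"
      proof -
        have "((mat 1 - diag_on J) *v z) $ i = (if i \<in> J then 0 else z $ i)" for i
        proof -
          have "((mat 1 - diag_on J) *v z) $ i = (\<Sum>j\<in>UNIV. if j = i then (if i \<in> J then 0 else z $ i) else 0)"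
            unfolding matrix_vector_mult_def vec_lambda_beta by (intro sum.cong refl) (auto simp: mat_def diag_on_def)
          then show ?thesis by simp
        qed
        then show ?thesis by (auto simp: inner_vec_def power2_eq_square intro!: sum.cong)
      qed
      finally have s: "(transpose ?C *v z) \<bullet> (transpose ?C *v z) + (\<Sum>i\<in>UNIV. if i \<in> J then 0 else (z $ i)\<^sup>2) = 0" by simp
      have s2: "(\<Sum>i\<in>UNIV. if i \<in> J then 0 else (z $ i)\<^sup>2) \<ge> 0" by (intro sum_nonneg) auto
      have s3: "(transpose ?C *v z) \<bullet> (transpose ?C *v z) \<ge> 0" by (rule inner_ge_zero)
      from s s2 s3 have "(transpose ?C *v z) \<bullet> (transpose ?C *v z) = 0" and z0: "(\<Sum>i\<in>UNIV. if i \<in> J then 0 else (z $ i)\<^sup>2) = 0"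
        by linarith+
      then have Cz: "transpose ?C *v z = 0" by (simp only: inner_eq_zero_iff)
      have out: "z $ i = 0" if "i \<notin> J" for i
        using z0 that by (subst (asm) sum_nonneg_eq_0_iff) (auto split: if_splits)
      have "(\<Sum>b\<in>B'. z $ f b *\<^sub>R b) = 0"
      proof -
        have "(\<Sum>b\<in>B'. z $ f b *\<^sub>R b) = (\<Sum>i\<in>J. z $ i *\<^sub>R A $ i)"
          unfolding J_def by (subst sum.reindex[OF inj]) (simp add: f)
        also have "\<dots> = transpose ?C *v z"
        proof -
          have "(\<Sum>i\<in>J. z $ i *\<^sub>R A $ i) $ j = (transpose ?C *v z) $ j" for j
          proof -
            have "(transpose ?C *v z) $ j = (\<Sum>i\<in>UNIV. if i \<in> J then z $ i * A $ i $ j else 0)"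
              unfolding matrix_vector_mult_def by (auto intro!: sum.cong simp: transpose_def restrict_rows_def)
            then show ?thesis by (simp add: sum.If_cases)
          qed
          then show ?thesis by (simp add: vec_eq_iff)
        qed
        finally show ?thesis using Cz by simp
      qed
      then have "z $ f b = 0" if "b \<in> B'" for b
        using independentD[OF ind B'(3), of "\<lambda>b. z $ f b"] that by auto
      then have "z $ i = 0" if "i \<in> J" for i using that by (auto simp: J_def)
      then show ?thesis using out by (auto simp: vec_eq_iff)
    qed
    then show ?thesis using matrix_left_invertible_ker[of "gram J A"] invertible_left_inverse[of "gram J A"] invertible_det_nz by blast
  qed
  ultimately show thesis by (rule that)
qed

text \<open>
  By Cramer's rule \<open>adjoint_entry\<close> divided by the determinant is an entry of the inverse Gram matrix. The weights
  $\det^2$ remove the row sets with singular Gram matrix, so that the average is a rational function.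
\<close>

definition row_projector :: "nat \<Rightarrow> 'n \<Rightarrow> 'n \<Rightarrow> real^'n^'n \<Rightarrow> real" where
  "row_projector m k l A = (\<Sum>J | card J = m. if k \<in> J \<and> l \<in> J then det (gram J A) * adjoint_entry J A k l else 0) *
     inverse (\<Sum>J | card J = m. (det (gram J A))\<^sup>2)"

lemma sum_det_gram_pos:
  fixes A :: "real^'n^'n"
  assumes "dim (rows A) \<ge> m"
  shows "(\<Sum>J | card J = m. (det (gram J A))\<^sup>2) > 0"
proof -
  obtain J where "card J = m" "det (gram J A) \<noteq> 0" using gram_det_nonzero[OF assms] .
  then show ?thesis by (intro sum_pos2[of _ J]) auto
qed

lemma C1_fun_row_projector:
  assumes "\<And>A. A \<in> S \<Longrightarrow> dim (rows A) \<ge> m"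
  shows "C1_fun S (row_projector m k l)"
  unfolding row_projector_def
proof (intro C1_fun_mult C1_fun_sum C1_fun_inverse)
  show "C1_fun S (\<lambda>A. if k \<in> J \<and> l \<in> J then det (gram J A) * adjoint_entry J A k l else 0)" for J
  proof (cases "k \<in> J \<and> l \<in> J")
    case True
    have "C1_fun S (\<lambda>A. det (gram J A) * adjoint_entry J A k l)"
      by (intro C1_fun_mult C1_fun_adjoint_entry C1_fun_det C1_fun_gram)
    then show ?thesis using True by simp
  qed (auto intro: C1_fun_const)
  show "C1_fun S (\<lambda>A. (det (gram J A))\<^sup>2)" for J
    unfolding power2_eq_square by (intro C1_fun_mult C1_fun_det C1_fun_gram)
  show "A \<in> S \<Longrightarrow> (\<Sum>J | card J = m. (det (gram J A))\<^sup>2) \<noteq> 0" for A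
    using sum_det_gram_pos[OF assms] by fastforce
qed

text \<open>The matrix is a convex combination of the projections from
  \<open>gram_inverse_projection\<close>, with weights det^2 divided by their sum; both claims are
  linear in the projection.\<close>

lemma row_projector_trace:
  fixes A :: "real^'n^'n"
  assumes r: "dim (rows A) \<ge> m"
  defines "P \<equiv> transpose A ** (\<chi> k l. row_projector m k l A) ** A"
  shows "trace P = m" and "(\<And>y. y \<bullet> (R *v y) \<ge> 0) \<Longrightarrow> trace (P ** R) \<le> trace R"
proof -
  define s where "s = (\<Sum>J | card J = m. (det (gram J A))\<^sup>2)"
  have s: "s > 0" using sum_det_gram_pos[OF r] by (simp add: s_def)
  define w where "w J = (det (gram J A))\<^sup>2 / s" for J
  have w: "w J \<ge> 0" for J using s by (simp add: w_def)
  have w1: "(\<Sum>J | card J = m. w J) = 1" using s by (simp add: w_def sum_divide_distrib[symmetric] flip: s_def)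
  \<comment> \<open>For a singular Gram matrix the choice of H is arbitrary, because the weight
    \<open>w J\<close> is 0 there.\<close>
  have "\<exists>H. det (gram J A) \<noteq> 0 \<longrightarrow> (\<forall>k l. adjoint_entry J A k l = det (gram J A) * H $ k $ l) \<and>
     trace (transpose A ** (diag_on J ** H ** diag_on J) ** A) = card J \<and>
     (\<forall>R. (\<forall>y. y \<bullet> (R *v y) \<ge> 0) \<longrightarrow> trace ((transpose A ** (diag_on J ** H ** diag_on J) ** A) ** R) \<le> trace R)" for J
    by (cases "det (gram J A) = 0") (auto elim!: gram_inverse_projection[of J A])
  then obtain H where H: "\<And>J k l. det (gram J A) \<noteq> 0 \<Longrightarrow> adjoint_entry J A k l = det (gram J A) * H J $ k $ l"
    "\<And>J. det (gram J A) \<noteq> 0 \<Longrightarrow> trace (transpose A ** (diag_on J ** H J ** diag_on J) ** A) = card J"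
    "\<And>J R. det (gram J A) \<noteq> 0 \<Longrightarrow> (\<And>y. y \<bullet> (R *v y) \<ge> 0) \<Longrightarrow> trace ((transpose A ** (diag_on J ** H J ** diag_on J) ** A) ** R) \<le> trace R"
    by metis
  define Q where "Q J = transpose A ** (diag_on J ** H J ** diag_on J) ** A" for J
  have LHL: "(diag_on J ** X ** diag_on J) $ k $ l = (if k \<in> J \<and> l \<in> J then X $ k $ l else 0)" for J and X :: "real^'n^'n" and k l
  proof -
    have "diag_on J ** X ** diag_on J = transpose (diag_on J ** transpose (diag_on J ** X))"
      by (simp add: matrix_transpose_mul transpose_diag_on)
    then show ?thesis by (simp add: diag_on_mult restrict_rows_def transpose_def)
  qed
  have M: "(\<chi> k l. row_projector m k l A) = (\<Sum>J | card J = m. w J *\<^sub>R (diag_on J ** H J ** diag_on J))"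
  proof -
    have "row_projector m k l A = (\<Sum>J | card J = m. w J *\<^sub>R (diag_on J ** H J ** diag_on J)) $ k $ l" for k l
      unfolding row_projector_def sum_component vector_scaleR_component LHL sum_distrib_right
      by (rule sum.cong) (auto simp: w_def H(1) s_def power2_eq_square field_simps, metis H(1))
    then show ?thesis by (simp add: vec_eq_iff)
  qed
  have lin: "transpose A ** (\<Sum>J | card J = m. w J *\<^sub>R Y J) ** A = (\<Sum>J | card J = m. w J *\<^sub>R (transpose A ** Y J ** A))" for Y :: "_ \<Rightarrow> real^'n^'n"
  proof -
    have "linear (\<lambda>Y. transpose A ** Y ** A)"
      by (rule linearI) (simp_all add: matrix_add_ldistrib matrix_add_rdistrib matrix_scalar_ac flip: scalar_matrix_assoc)
    note l = this
    show ?thesis by (simp add: linear_sum[OF l] linear_scale[OF l])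
  qed
  have P: "P = (\<Sum>J | card J = m. w J *\<^sub>R Q J)" unfolding P_def M lin Q_def ..
  have trlin: "trace (\<Sum>J | card J = m. w J *\<^sub>R Y J) = (\<Sum>J | card J = m. w J * trace (Y J))" for Y :: "_ \<Rightarrow> real^'n^'n"
  proof -
    have "linear (trace :: real^'n^'n \<Rightarrow> real)"
      by (rule linearI) (simp_all add: trace_def sum.distrib sum_distrib_left)
    note l = this
    show ?thesis by (simp add: linear_sum[OF l] linear_scale[OF l])
  qed
  have "trace P = (\<Sum>J | card J = m. w J * real m)"
    unfolding P trlin
  proof (rule sum.cong)
    fix J :: "'n set" assume "J \<in> {J. card J = m}"
    then show "w J * trace (Q J) = w J * real m" by (cases "det (gram J A) = 0") (auto simp: w_def Q_def H(2))
  qed simp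
  then show "trace P = m" using w1 by (simp flip: sum_distrib_right)
  show "trace (P ** R) \<le> trace R" if R: "\<And>y. y \<bullet> (R *v y) \<ge> 0"
  proof -
    have "P ** R = (\<Sum>J | card J = m. w J *\<^sub>R (Q J ** R))"
    proof -
      have "linear (\<lambda>Y. Y ** R)"
        by (rule linearI) (simp_all add: matrix_add_rdistrib flip: scalar_matrix_assoc)
      note l = this
      show ?thesis by (simp add: P linear_sum[OF l] linear_scale[OF l])
    qed
    then have "trace (P ** R) = (\<Sum>J | card J = m. w J * trace (Q J ** R))" by (simp add: trlin)
    also have "\<dots> \<le> (\<Sum>J | card J = m. w J * trace R)"
    proof (rule sum_mono)
      fix J :: "'n set"
      show "w J * trace (Q J ** R) \<le> w J * trace R"
      proof (cases "det (gram J A) = 0")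
        case False
        show ?thesis unfolding Q_def by (rule mult_left_mono[OF H(3)[OF False R] w])
      qed (simp add: w_def)
    qed
    also have "\<dots> = trace R" using w1 by (simp flip: sum_distrib_right)
    finally show ?thesis .
  qed
qed

section \<open>Mollified tensor fields\<close>

text \<open>\<open>KK\<close> stands for the convex hull of the tensors and \<open>Mf\<close> for M.
  Of \<Pi> only two properties are kept: trace \<open>dm\<close>, and \<Pi> \<le> I in the weak form
  \<open>Mf_psd\<close>. One number \<open>K\<close> bounds the tensors, M and DM.\<close>

locale tensor_flow = mollification V X for V :: "'w measure" and X :: "'w \<Rightarrow> real^'n" +
  fixes Bf :: "'w \<Rightarrow> real^'n^'n" and KK :: "(real^'n^'n) set"
    and Mf :: "'n \<Rightarrow> 'n \<Rightarrow> real^'n^'n \<Rightarrow> real" and D :: "'n \<Rightarrow> 'n \<Rightarrow> real^'n^'n \<Rightarrow> real^'n^'n \<Rightarrow> real"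
    and K :: real and dm :: nat
  assumes Bf_measurable [measurable]: "Bf \<in> borel_measurable V" and Bf_in: "\<And>w. Bf w \<in> KK"
    and KK: "compact KK" "convex KK" and K: "K \<ge> 1"
    and KK_bound: "\<And>A i j. A \<in> KK \<Longrightarrow> \<bar>A $ i $ j\<bar> \<le> K"
    and Mf_deriv: "\<And>i l A. A \<in> KK \<Longrightarrow> (Mf i l has_derivative D i l A) (at A)"
    and cont_Mf: "\<And>i l. continuous_on KK (Mf i l)" and cont_D: "\<And>i l v. continuous_on KK (\<lambda>A. D i l A v)"
    and Mf_bound: "\<And>i l A. A \<in> KK \<Longrightarrow> \<bar>Mf i l A\<bar> \<le> K"
    and D_bound: "\<And>i l A a b. A \<in> KK \<Longrightarrow> \<bar>D i l A (axis a (axis b 1))\<bar> \<le> K"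
    and Mf_trace: "\<And>A. A \<in> KK \<Longrightarrow> trace (transpose A ** (\<chi> k l. Mf k l A) ** A) = dm"
    and Mf_psd: "\<And>A R. A \<in> KK \<Longrightarrow> (\<And>y. y \<bullet> (R *v y) \<ge> 0) \<Longrightarrow> trace ((transpose A ** (\<chi> k l. Mf k l A) ** A) ** R) \<le> trace R"
    and dm: "dm \<le> CARD('n)"
begin

definition mu :: "real \<Rightarrow> real^'n \<Rightarrow> real" where "mu = mol (\<lambda>_. 1)"
definition mu1 where "mu1 k = mol1 (\<lambda>_. 1) k"
text \<open>The index order is reversed: \<open>mol2 f l k\<close> is the derivative of
  \<open>mol1 f k\<close> in direction l, whereas \<open>flux\<close> lists directions in the order
  of differentiation.\<close>

definition mu2 where "mu2 k l = mol2 (\<lambda>_. 1) l k"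
definition BB where "BB i j w = Bf w $ i $ j"
definition A where "A i j = mol (BB i j)"
definition A1 where "A1 i j k = mol1 (BB i j) k"
definition A2 where "A2 i j k l = mol2 (BB i j) l k"
text \<open>The mean normalised displacement under the kernel weights; bb / sqrt t dominates the
  logarithmic gradient and serves as \<open>y\<close> in \<open>flux\<close>.\<close>

definition bb where "bb t x = moment 1 t x / mu t x"
definition mass where "mass = measure V (space V)"

lemma one_ok: "(\<lambda>_. 1) \<in> borel_measurable V" "\<And>w. \<bar>1::real\<bar> \<le> K" using K by auto

lemma BB_ok: "BB i j \<in> borel_measurable V" "\<And>w. \<bar>BB i j w\<bar> \<le> K"
proof -
  have "(\<lambda>A::real^'n^'n. A $ i $ j) \<in> borel_measurable borel"
    by (intro borel_measurable_continuous_onI continuous_intros)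
  then show "BB i j \<in> borel_measurable V" unfolding BB_def[abs_def] by (rule measurable_compose[OF Bf_measurable])
  show "\<bar>BB i j w\<bar> \<le> K" for w unfolding BB_def by (rule KK_bound[OF Bf_in])
qed

lemma mu_pos: "t > 0 \<Longrightarrow> mu t x > 0" unfolding mu_def by (rule mol_pos)

text \<open>A weighted average of points of a closed convex set: a hyperplane separating it from the
  set would also separate all values of \<open>Bf\<close> from their average.\<close>

lemma mean_in_KK:
  assumes t: "t > 0"
  shows "(\<chi> i j. A i j t x / mu t x) \<in> KK"
proof (rule ccontr)
  let ?E = "(\<chi> i j. A i j t x / mu t x) :: real^'n^'n"
  assume "?E \<notin> KK"
  then obtain a b where ab: "a \<bullet> ?E < b" "\<And>z. z \<in> KK \<Longrightarrow> b < a \<bullet> z"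
    using separating_hyperplane_closed_point[of KK ?E] KK compact_imp_closed by blast
  have i1: "integrable V (\<lambda>w. heat t (x - X w))" using integrable_mol(1)[OF one_ok t] by simp
  have i2: "integrable V (\<lambda>w. BB i j w * heat t (x - X w))" for i j by (rule integrable_mol(1)[OF BB_ok t])
  have "mu t x * (a \<bullet> ?E) = (\<Sum>i\<in>UNIV. \<Sum>j\<in>UNIV. a $ i $ j * A i j t x)"
    using mu_pos[OF t, of x] by (simp add: inner_vec_def sum_distrib_left)
  also have "\<dots> = (\<integral>w. (\<Sum>i\<in>UNIV. \<Sum>j\<in>UNIV. a $ i $ j * (BB i j w * heat t (x - X w))) \<partial>V)"
    using i2 by (simp add: A_def mol_def)
  also have "\<dots> = (\<integral>w. (a \<bullet> Bf w) * heat t (x - X w) \<partial>V)"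
    by (simp add: inner_vec_def BB_def sum_distrib_right mult.assoc)
  also have "\<dots> \<ge> (\<integral>w. b * heat t (x - X w) \<partial>V)"
  proof (rule integral_mono)
    show "integrable V (\<lambda>w. b * heat t (x - X w))" using i1 by simp
    have "integrable V (\<lambda>w. (\<Sum>i\<in>UNIV. \<Sum>j\<in>UNIV. a $ i $ j * (BB i j w * heat t (x - X w))))" using i2 by auto
    then show "integrable V (\<lambda>w. a \<bullet> Bf w * heat t (x - X w))" by (simp add: inner_vec_def BB_def sum_distrib_right mult.assoc)
    show "b * heat t (x - X w) \<le> a \<bullet> Bf w * heat t (x - X w)" for w
      using ab(2)[OF Bf_in[of w]] heat_pos[OF t, of "x - X w"] by (intro mult_right_mono) auto
  qed
  finally have "mu t x * (a \<bullet> ?E) \<ge> b * mu t x" by (simp add: mu_def mol_def)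
  then show False using ab(1) mu_pos[OF t, of x] by (simp add: mult.commute)
qed

text \<open>The expression is t times the variance of \<open>q\<close> = z . (x - X) / t under the
  weights \<open>H / mu\<close>. For the Gaussian kernel, q and q^2 become first and second
  derivatives of \<open>mu\<close>, up to the shift |z|^2 / t.\<close>

lemma hessian_psd:
  assumes t: "t > 0"
  shows "z \<bullet> z + t * (\<Sum>k\<in>UNIV. \<Sum>j\<in>UNIV. z $ k * ((mu2 k j t x - mu1 k t x / mu t x * mu1 j t x) / mu t x) * z $ j) \<ge> 0"
proof -
  have m0: "mu t x > 0" by (rule mu_pos[OF t])
  define H where "H w = heat t (x - X w)" for w
  define q where "q w = (z \<bullet> (x - X w)) / t" for w
  have i1: "integrable V H" using integrable_mol(1)[OF one_ok t] by (simp add: H_def[abs_def])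
  have ik: "integrable V (\<lambda>w. heat1 k t (x - X w))" for k using integrable_mol(2)[OF one_ok t] by simp
  have ikj: "integrable V (\<lambda>w. heat2 k j t (x - X w))" for k j using integrable_mol(3)[OF one_ok t] by simp
  have q1: "q w * H w = - (\<Sum>k\<in>UNIV. z $ k * heat1 k t (x - X w))" for w
    by (simp add: q_def H_def heat1_def inner_vec_def sum_divide_distrib sum_distrib_right sum_negf mult.assoc)
  have q2: "(q w)\<^sup>2 * H w = (\<Sum>k\<in>UNIV. \<Sum>j\<in>UNIV. z $ k * z $ j * heat2 j k t (x - X w)) + (z \<bullet> z) / t * H w" for w
  proof -
    have "(\<Sum>k\<in>UNIV. \<Sum>j\<in>UNIV. z $ k * z $ j * heat2 j k t (x - X w)) =
       (\<Sum>k\<in>UNIV. \<Sum>j\<in>UNIV. (z $ k * (x - X w) $ k / t) * (z $ j * (x - X w) $ j / t) * H w - (if j = k then z $ k * z $ k / t * H w else 0))"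
      by (intro sum.cong refl) (auto simp: heat2_def H_def power2_eq_square field_simps)
    also have "\<dots> = (q w)\<^sup>2 * H w - (z \<bullet> z) / t * H w"
    proof -
      have "q w = (\<Sum>k\<in>UNIV. z $ k * (x - X w) $ k / t)" by (simp add: q_def inner_vec_def sum_divide_distrib)
      then have "(q w)\<^sup>2 = (\<Sum>k\<in>UNIV. \<Sum>j\<in>UNIV. (z $ k * (x - X w) $ k / t) * (z $ j * (x - X w) $ j / t))"
        by (simp only: power2_eq_square sum_product)
      then have "(q w)\<^sup>2 * H w = (\<Sum>k\<in>UNIV. \<Sum>j\<in>UNIV. (z $ k * (x - X w) $ k / t) * (z $ j * (x - X w) $ j / t) * H w)"
        by (simp only: sum_distrib_right)
      then show ?thesis by (simp add: sum_subtractf inner_vec_def sum_divide_distrib sum_distrib_right)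
    qed
    finally show ?thesis by simp
  qed
  have iq: "integrable V (\<lambda>w. q w * H w)" unfolding q1 using ik by auto
  have iq2: "integrable V (\<lambda>w. (q w)\<^sup>2 * H w)" unfolding q2 using ikj i1 by auto
  define S1 where "S1 = (\<Sum>k\<in>UNIV. z $ k * mu1 k t x)"
  define S2 where "S2 = (\<Sum>k\<in>UNIV. \<Sum>j\<in>UNIV. z $ k * z $ j * mu2 k j t x)"
  have e0: "(\<integral>w. H w \<partial>V) = mu t x" by (simp add: H_def mu_def mol_def)
  have e1: "(\<integral>w. q w * H w \<partial>V) = - S1" unfolding q1 S1_def mu1_def mol1_def using ik by simp
  have e2: "(\<integral>w. (q w)\<^sup>2 * H w \<partial>V) = S2 + (z \<bullet> z) / t * mu t x"
    unfolding q2 S2_def mu2_def mol2_def using ikj i1 by (simp add: e0)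
  \<comment> \<open>The mean of \<open>q\<close>, so that the integral of (q - s)^2 H is the
    variance times \<open>mu\<close>.\<close>
  define s where "s = - S1 / mu t x"
  have "0 \<le> (\<integral>w. (q w - s)\<^sup>2 * H w \<partial>V)"
    using heat_pos[OF t, where 'a='n] by (intro Bochner_Integration.integral_nonneg mult_nonneg_nonneg) (auto simp: H_def less_imp_le)
  also have "(\<lambda>w. (q w - s)\<^sup>2 * H w) = (\<lambda>w. (q w)\<^sup>2 * H w - 2 * s * (q w * H w) + s\<^sup>2 * H w)"
    by (simp add: fun_eq_iff power2_eq_square algebra_simps)
  also have "(\<integral>w. (q w)\<^sup>2 * H w - 2 * s * (q w * H w) + s\<^sup>2 * H w \<partial>V) = S2 + (z \<bullet> z) / t * mu t x - 2 * s * (- S1) + s\<^sup>2 * mu t x"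
    using iq iq2 i1 by (simp add: e0 e1 e2)
  also have "\<dots> = S2 + (z \<bullet> z) / t * mu t x - S1\<^sup>2 / mu t x"
    using m0 by (simp add: s_def power2_eq_square field_simps)
  finally have 1: "0 \<le> S2 + (z \<bullet> z) / t * mu t x - S1\<^sup>2 / mu t x" .
  have "(\<Sum>k\<in>UNIV. \<Sum>j\<in>UNIV. z $ k * ((mu2 k j t x - mu1 k t x / mu t x * mu1 j t x) / mu t x) * z $ j) =
     (\<Sum>k\<in>UNIV. \<Sum>j\<in>UNIV. (1 / mu t x) * (z $ k * z $ j * mu2 k j t x) - (1 / (mu t x * mu t x)) * ((z $ k * mu1 k t x) * (z $ j * mu1 j t x)))"
    using m0 by (intro sum.cong refl) (simp add: field_simps)
  also have "\<dots> = S2 / mu t x - S1\<^sup>2 / (mu t x * mu t x)"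
    unfolding sum_subtractf sum_distrib_left[symmetric] sum_product[symmetric] S2_def S1_def power2_eq_square by (simp add: sum_distrib_right[symmetric])
  finally have e: "(\<Sum>k\<in>UNIV. \<Sum>j\<in>UNIV. z $ k * ((mu2 k j t x - mu1 k t x / mu t x * mu1 j t x) / mu t x) * z $ j) = S2 / mu t x - S1\<^sup>2 / (mu t x * mu t x)" .
  have "z \<bullet> z + t * (S2 / mu t x - S1\<^sup>2 / (mu t x * mu t x)) = (t / mu t x) * (S2 + (z \<bullet> z) / t * mu t x - S1\<^sup>2 / mu t x)"
    using m0 t by (simp add: field_simps)
  moreover have "\<dots> \<ge> 0" using 1 m0 t by (intro mult_nonneg_nonneg) auto
  ultimately show ?thesis unfolding e by simp
qed

text \<open>\<open>Mf_psd\<close> is applied to R = I + t Hess log mu. The trace of \<Pi> R is dm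
  plus t times the \<Pi>-part of the Hessian, and the trace of R is N plus t times the
  Laplacian.\<close>

lemma trace_inequality:
  assumes t: "t > 0"
  shows "t * (\<Sum>j\<in>UNIV. \<Sum>k\<in>UNIV. \<Sum>l\<in>UNIV. (\<Sum>i\<in>UNIV. Mf i l (\<chi> a b. A a b t x / mu t x) * (A i j t x / mu t x)) * (A l k t x / mu t x) *
        ((mu2 k j t x - mu1 k t x / mu t x * mu1 j t x) / mu t x)) \<le> (real CARD('n) - real dm) + t * (\<Sum>k\<in>UNIV. (mu2 k k t x - mu1 k t x / mu t x * mu1 k t x) / mu t x)"
proof -
  define E where "E = (\<chi> a b. A a b t x / mu t x)"
  define M where "M = (\<chi> k l. Mf k l E)"
  define P where "P = transpose E ** M ** E"
  define Xi where "Xi k j = (mu2 k j t x - mu1 k t x / mu t x * mu1 j t x) / mu t x" for k j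
  define R where "R = (\<chi> k j. (if k = j then 1 else 0) + t * Xi k j)"
  have E: "E \<in> KK" unfolding E_def by (rule mean_in_KK[OF t])
  have Rv: "z \<bullet> (R *v z) \<ge> 0" for z
  proof -
    have "z \<bullet> (R *v z) = (\<Sum>k\<in>UNIV. \<Sum>j\<in>UNIV. (if j = k then z $ k * z $ k else 0) + t * (z $ k * Xi k j * z $ j))"
      unfolding inner_vec_def R_def matrix_vector_mult_def
      by (simp add: sum_distrib_left) (intro sum.cong refl, auto simp: algebra_simps)
    also have "\<dots> = z \<bullet> z + t * (\<Sum>k\<in>UNIV. \<Sum>j\<in>UNIV. z $ k * Xi k j * z $ j)"
      by (simp add: sum.distrib inner_vec_def sum_distrib_left)
    also have "\<dots> \<ge> 0" unfolding Xi_def by (rule hessian_psd[OF t])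
    finally show ?thesis .
  qed
  have "trace (P ** R) \<le> trace R" using Mf_psd[OF E Rv] by (simp add: P_def M_def)
  moreover have "trace R = real CARD('n) + t * (\<Sum>k\<in>UNIV. Xi k k)"
    by (simp add: trace_def R_def sum.distrib sum_distrib_left)
  moreover have "trace (P ** R) = trace P + t * (\<Sum>j\<in>UNIV. \<Sum>k\<in>UNIV. P $ j $ k * Xi k j)"
  proof -
    have "trace (P ** R) = (\<Sum>j\<in>UNIV. \<Sum>k\<in>UNIV. (if k = j then P $ j $ j else 0) + t * (P $ j $ k * Xi k j))"
      unfolding trace_def matrix_matrix_mult_def R_def by simp (intro sum.cong refl, auto simp: algebra_simps)
    then show ?thesis by (simp add: sum.distrib trace_def sum_distrib_left)
  qed
  moreover have "trace P = real dm" using Mf_trace[OF E] by (simp add: P_def M_def)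
  moreover have "P $ j $ k = (\<Sum>l\<in>UNIV. (\<Sum>i\<in>UNIV. Mf i l E * (A i j t x / mu t x)) * (A l k t x / mu t x))" for j k
    unfolding P_def M_def matrix_matrix_mult_def transpose_def by (simp add: E_def mult.commute)
  ultimately show ?thesis unfolding Xi_def[symmetric] E_def[symmetric] by (simp add: sum_distrib_right)
qed

lemma partial_mol:
  assumes "f \<in> borel_measurable V" "\<And>w. \<bar>f w\<bar> \<le> K" "t > 0"
  shows "has_partial k (mol f t) (mol1 f k t)" "has_partial l (mol1 f k t) (mol2 f l k t)"
  unfolding has_partial_def using DERIV_mol[OF assms] by auto

lemma cont_mol:
  assumes "f \<in> borel_measurable V" "\<And>w. \<bar>f w\<bar> \<le> K" "t > 0"
  shows "continuous_on UNIV (mol f t)" "continuous_on UNIV (mol1 f k t)" "continuous_on UNIV (mol2 f l k t)"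
proof -
  have "isCont (mol f t) x" "isCont (mol1 f k t) x" "isCont (mol2 f l k t) x" for x
    using isCont_mol[OF assms, of x] isCont_o2[where f="\<lambda>x. (t, x)" and a=x] by fastforce+
  then show "continuous_on UNIV (mol f t)" "continuous_on UNIV (mol1 f k t)" "continuous_on UNIV (mol2 f l k t)"
    by (auto intro: continuous_at_imp_continuous_on)
qed

lemma cont_mean:
  assumes t: "t > 0" and g: "continuous_on KK g"
  shows "continuous_on UNIV (\<lambda>x. g (\<chi> i j. A i j t x / mu t x))"
proof (rule continuous_on_compose2[OF g])
  show "continuous_on UNIV (\<lambda>x. \<chi> i j. A i j t x / mu t x)"
    unfolding A_def mu_def using mol_pos[OF t]
    by (intro continuous_intros cont_mol BB_ok t one_ok) (auto simp: less_imp_neq[symmetric])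
qed (use mean_in_KK[OF t] in auto)

text \<open>The additive constant a ln t turns ln (mu + c) into ln (t^a mu + \<eta>), the logarithm
  of the entropy. The bound \<Lambda> provides integrability at one fixed time, so it may depend on
  t.\<close>

lemma flux_at:
  assumes t: "t > 0" and \<eta>: "\<eta> > 0"
  defines "a \<equiv> (real CARD('n) - real dm) / 2"
  obtains \<Lambda> where "flux t (\<eta> * t powr (- a)) (a * ln t) K \<Lambda> (real CARD('n) - real dm) (mu t) (\<lambda>k. mu1 k t) (\<lambda>k l. mu2 k l t)
     (\<lambda>i j. A i j t) (\<lambda>i j k. A1 i j k t) (\<lambda>i j k l. A2 i j k l t) Mf D (\<lambda>x. bb t x / sqrt t) (\<lambda>x. (moment 2 t x + mu t x) / (mu t x * t))"
proof -
  obtain Q where Q: "\<And>d::real^'n. \<bar>heat t d\<bar> \<le> Q" using heat_bounds_at[OF t] by metis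
  have muQ: "mu t x \<le> Q * mass" for x
  proof -
    have "mu t x \<le> (\<integral>w. Q \<partial>V)"
      unfolding mu_def mol_def using integrable_mol(1)[OF one_ok t] Q by (intro integral_mono) (auto intro: order_trans[OF abs_ge_self])
    then show ?thesis by (simp add: mass_def mult.commute)
  qed
  define c where "c = \<eta> * t powr (- a)"
  have c: "c > 0" using \<eta> t by (simp add: c_def)
  define \<Lambda> where "\<Lambda> = \<bar>ln c\<bar> + \<bar>ln (Q * mass + c)\<bar> + \<bar>a * ln t\<bar>"
  have sq: "sqrt t > 0" "sqrt t * sqrt t = t" using t by auto
  have L: "\<bar>ln (mu t x + c) + a * ln t\<bar> \<le> \<Lambda>" for x
  proof -
    have "ln c \<le> ln (mu t x + c)" "ln (mu t x + c) \<le> ln (Q * mass + c)"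
      using c mu_pos[OF t, of x] muQ[of x] by (intro ln_mono; simp)+
    then show ?thesis by (simp add: \<Lambda>_def)
  qed
  have my: "mu t x * (bb t x / sqrt t) = moment 1 t x / sqrt t" for x using mu_pos[OF t, of x] by (simp add: bb_def)
  have my2: "mu t x * ((moment 2 t x + mu t x) / (mu t x * t)) = (moment 2 t x + mu t x) / t" for x using mu_pos[OF t, of x] t by simp
  have im: "integrable lborel (moment k t)" for k by (rule moment_lborel(1)[OF t])
  have imu: "integrable lborel (mu t)" using im[of 0] by (simp add: moment_0[abs_def] mu_def)
  have "flux t c (a * ln t) K \<Lambda> (real CARD('n) - real dm) (mu t) (\<lambda>k. mu1 k t) (\<lambda>k l. mu2 k l t)
     (\<lambda>i j. A i j t) (\<lambda>i j k. A1 i j k t) (\<lambda>i j k l. A2 i j k l t) Mf D (\<lambda>x. bb t x / sqrt t) (\<lambda>x. (moment 2 t x + mu t x) / (mu t x * t))"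
  proof
    fix i j k l :: 'n and x :: "real^'n"
    show "t > 0" "c > 0" "K \<ge> 1" "mu t x > 0" using t c K mu_pos[OF t] by auto
    show "has_partial k (mu t) (mu1 k t)" unfolding mu_def mu1_def by (rule partial_mol(1)[OF one_ok t])
    show "has_partial l (mu1 k t) (mu2 k l t)" unfolding mu1_def mu2_def by (rule partial_mol(2)[OF one_ok t])
    show "has_partial k (A i j t) (A1 i j k t)" unfolding A_def A1_def by (rule partial_mol(1)[OF BB_ok t])
    show "has_partial l (A1 i j k t) (A2 i j k l t)" unfolding A1_def A2_def by (rule partial_mol(2)[OF BB_ok t])
    show "mu2 k l t x = mu2 l k t x" unfolding mu2_def by (rule mol2_commute)
    show "A2 i j k l t x = A2 i j l k t x" unfolding A2_def by (rule mol2_commute)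
    show "(Mf i l has_derivative D i l (\<chi> a b. A a b t x / mu t x)) (at (\<chi> a b. A a b t x / mu t x))"
      by (rule Mf_deriv[OF mean_in_KK[OF t]])
    show "\<bar>A i j t x\<bar> \<le> K * mu t x" unfolding A_def mu_def by (rule mol_bounds(1)[OF BB_ok t])
    show "\<bar>mu1 k t x\<bar> \<le> K * mu t x * (bb t x / sqrt t)" using mol_bounds(2)[OF one_ok t, of k x] unfolding mult.assoc my by (simp add: mu1_def)
    show "\<bar>A1 i j k t x\<bar> \<le> K * mu t x * (bb t x / sqrt t)" using mol_bounds(2)[OF BB_ok t, of i j k x] unfolding mult.assoc my by (simp add: A1_def)
    show "\<bar>mu2 k l t x\<bar> \<le> K * mu t x * ((moment 2 t x + mu t x) / (mu t x * t))"
      using mol_bounds(3)[OF one_ok t, of l k x] unfolding mult.assoc my2 by (simp add: mu2_def mu_def)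
    show "\<bar>A2 i j k l t x\<bar> \<le> K * mu t x * ((moment 2 t x + mu t x) / (mu t x * t))"
      using mol_bounds(3)[OF BB_ok t, of i j l k x] unfolding mult.assoc my2 by (simp add: A2_def mu_def)
    show "0 \<le> bb t x / sqrt t" using moment_nonneg[OF t, of 1 x] mu_pos[OF t, of x] sq by (simp add: bb_def)
    show "(bb t x / sqrt t)\<^sup>2 \<le> (moment 2 t x + mu t x) / (mu t x * t)"
    proof -
      have "(moment 1 t x)\<^sup>2 \<le> (moment 2 t x + mu t x) * mu t x"
        using moment_power_mean(1)[OF t, of x] zero_le_square[of "mu t x"] unfolding distrib_right mu_def by linarith
      then have "(moment 1 t x)\<^sup>2 / (mu t x)\<^sup>2 \<le> (moment 2 t x + mu t x) / mu t x"
        using mu_pos[OF t, of x] by (simp add: power2_eq_square field_simps)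
      then have "(moment 1 t x)\<^sup>2 / (mu t x)\<^sup>2 / t \<le> (moment 2 t x + mu t x) / mu t x / t"
        using t by (intro divide_right_mono) auto
      then show ?thesis using t by (simp add: bb_def power_divide power_mult_distrib)
    qed
    show "\<bar>Mf i l (\<chi> a b. A a b t x / mu t x)\<bar> \<le> K" by (rule Mf_bound[OF mean_in_KK[OF t]])
    show "\<bar>D i l (\<chi> a b. A a b t x / mu t x) (axis j (axis k 1))\<bar> \<le> K" by (rule D_bound[OF mean_in_KK[OF t]])
    show "\<bar>ln (mu t x + c) + a * ln t\<bar> \<le> \<Lambda>" by (rule L)
    show "continuous_on UNIV (mu t)" "continuous_on UNIV (mu1 k t)" "continuous_on UNIV (mu2 k l t)"
      unfolding mu_def mu1_def mu2_def by (intro cont_mol one_ok t)+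
    show "continuous_on UNIV (A i j t)" "continuous_on UNIV (A1 i j k t)" "continuous_on UNIV (A2 i j k l t)"
      unfolding A_def A1_def A2_def by (intro cont_mol BB_ok t)+
    show "continuous_on UNIV (\<lambda>x. Mf i l (\<chi> a b. A a b t x / mu t x))" by (rule cont_mean[OF t cont_Mf])
    show "continuous_on UNIV (\<lambda>x. D i l (\<chi> a b. A a b t x / mu t x) (axis j (axis k 1)))" by (rule cont_mean[OF t cont_D])
    show "integrable lborel (\<lambda>x. mu t x * (bb t x / sqrt t))" unfolding my using im[of 1] by simp
    show "integrable lborel (\<lambda>x. mu t x * ((moment 2 t x + mu t x) / (mu t x * t)))" unfolding my2 using im[of 2] imu by simp
    show "t * (\<Sum>j\<in>UNIV. \<Sum>k\<in>UNIV. \<Sum>l\<in>UNIV. (\<Sum>i\<in>UNIV. Mf i l (\<chi> a b. A a b t x / mu t x) * (A i j t x / mu t x)) * (A l k t x / mu t x) *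
        ((mu2 k j t x - mu1 k t x / mu t x * mu1 j t x) / mu t x)) \<le> (real CARD('n) - real dm) + t * (\<Sum>k\<in>UNIV. (mu2 k k t x - mu1 k t x / mu t x * mu1 k t x) / mu t x)"
      by (rule trace_inequality[OF t])
  qed
  then show thesis using that unfolding c_def by blast
qed

end

section \<open>Entropy growth\<close>

context tensor_flow
begin

definition codim where "codim = (real CARD('n) - real dm) / 2"

text \<open>The value of \<open>Cst\<close> from \<open>flux\<close>, restated here so that it
  visibly does not depend on time.\<close>

definition Cpen :: real where "Cpen = 9 * real CARD('n) ^ 6 * K\<^sup>2 / 2"

text \<open>The power of t compensates the decay of the heat kernel across a plane of dimension dm.
  The shift \<eta> keeps the logarithm bounded where \<open>mu\<close> is small.\<close>

definition ent where "ent \<eta> t x = mu t x * ln (t powr codim * mu t x + \<eta>)"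

definition pen where "pen t x = (\<Sum>i\<in>UNIV. \<Sum>j\<in>UNIV. (A i j t x)\<^sup>2 / mu t x)"

definition lap where "lap t x = (\<Sum>k\<in>UNIV. mu2 k k t x)"

text \<open>The time derivative is written term by term in the shape of \<open>G\<close> from
  \<open>flux\<close>, so that the two agree by unfolding.\<close>

definition dent where "dent \<eta> t x = (ln (t powr codim * mu t x + \<eta>) + mu t x / (mu t x + \<eta> * t powr (- codim))) * lap t x / 2
   + mu t x * (mu t x / (mu t x + \<eta> * t powr (- codim))) * (2 * codim) / (2 * t)
   - Cpen * ((\<Sum>i\<in>UNIV. \<Sum>j\<in>UNIV. 2 * (A i j t x / mu t x * (\<Sum>k\<in>UNIV. A2 i j k k t x)) - A i j t x / mu t x * (A i j t x / mu t x) * lap t x) / 2)"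

lemma codim_nonneg: "codim \<ge> 0" using dm by (simp add: codim_def)

lemma log_shift:
  assumes t: "t > 0" and \<eta>: "\<eta> > 0"
  shows "ln (mu t x + \<eta> * t powr (- codim)) + codim * ln t = ln (t powr codim * mu t x + \<eta>)"
proof -
  have "t powr codim * (mu t x + \<eta> * t powr (- codim)) = t powr codim * mu t x + \<eta>"
    using t by (simp add: distrib_left powr_minus)
  moreover have "mu t x + \<eta> * t powr (- codim) > 0" using mu_pos[OF t, of x] \<eta> t by (simp add: add_pos_pos)
  ultimately show ?thesis using t ln_mult[of "t powr codim" "mu t x + \<eta> * t powr (- codim)"] by (simp add: ln_powr)
qed

lemma DERIV_ent:
  assumes t: "t > 0" and \<eta>: "\<eta> > 0"
  shows "((\<lambda>t. ent \<eta> t x - Cpen * pen t x) has_real_derivative dent \<eta> t x) (at t)"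
proof -
  define u where "u = t powr codim * mu t x + \<eta>"
  have m0: "mu t x > 0" by (rule mu_pos[OF t])
  have u0: "u > 0" using m0 \<eta> t by (simp add: u_def add_pos_pos)
  have dmu: "((\<lambda>t. mu t x) has_real_derivative lap t x / 2) (at t)"
    using DERIV_mol_time[OF one_ok t, of x] by (simp add: mu_def lap_def mu2_def)
  have dA: "((\<lambda>t. A i j t x) has_real_derivative (\<Sum>k\<in>UNIV. A2 i j k k t x) / 2) (at t)" for i j
    using DERIV_mol_time[OF BB_ok t, of i j x] by (simp add: A_def A2_def)
  have dl: "((\<lambda>t. ln (t powr codim * mu t x + \<eta>)) has_real_derivative (codim * t powr (codim - 1) * mu t x + t powr codim * (lap t x / 2)) / u) (at t)"
    using t u0 by (auto intro!: derivative_eq_intros dmu simp: u_def field_simps)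
  have d1: "((\<lambda>t. ent \<eta> t x) has_real_derivative lap t x / 2 * ln u + (codim * t powr (codim - 1) * mu t x + t powr codim * (lap t x / 2)) / u * mu t x) (at t)"
    unfolding ent_def using DERIV_mult[OF dmu dl] by (simp add: u_def)
  have pos: "mu t x + \<eta> * t powr (- codim) > 0" using m0 \<eta> t by (simp add: add_pos_pos)
  define p where "p = mu t x + \<eta> * t powr (- codim)"
  have p0: "p > 0" using pos by (simp add: p_def)
  have uu: "u = t powr codim * (mu t x + \<eta> * t powr (- codim))"
    using t by (simp add: u_def distrib_left powr_minus)
  have f1: "t powr codim / u = 1 / (mu t x + \<eta> * t powr (- codim))" unfolding uu using t by simp
  have f2: "t powr (codim - 1) = t powr codim / t" using t by (simp add: powr_diff)
  have d1': "((\<lambda>t. ent \<eta> t x) has_real_derivative (ln u + mu t x / (mu t x + \<eta> * t powr (- codim))) * lap t x / 2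
      + mu t x * (mu t x / (mu t x + \<eta> * t powr (- codim))) * (2 * codim) / (2 * t)) (at t)"
  proof (rule DERIV_cong[OF d1])
    have "(codim * t powr (codim - 1) * mu t x + t powr codim * (lap t x / 2)) / u * mu t x =
       (t powr codim / u) * (codim / t * mu t x + lap t x / 2) * mu t x"
      unfolding f2 by (simp add: field_simps)
    then have e: "(codim * t powr (codim - 1) * mu t x + t powr codim * (lap t x / 2)) / u * mu t x = 1 / p * (codim / t * mu t x + lap t x / 2) * mu t x"
      unfolding f1 p_def .
    show "lap t x / 2 * ln u + (codim * t powr (codim - 1) * mu t x + t powr codim * (lap t x / 2)) / u * mu t x =
      (ln u + mu t x / (mu t x + \<eta> * t powr (- codim))) * lap t x / 2
      + mu t x * (mu t x / (mu t x + \<eta> * t powr (- codim))) * (2 * codim) / (2 * t)"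
      unfolding e p_def[symmetric] using p0 t by (simp add: field_simps)
  qed
  have d2: "((\<lambda>t. pen t x) has_real_derivative (\<Sum>i\<in>UNIV. \<Sum>j\<in>UNIV. 2 * (A i j t x / mu t x * (\<Sum>k\<in>UNIV. A2 i j k k t x)) - A i j t x / mu t x * (A i j t x / mu t x) * lap t x) / 2) (at t)"
    unfolding pen_def sum_divide_distrib
  proof (intro DERIV_sum)
    fix i j
    show "((\<lambda>t. (A i j t x)\<^sup>2 / mu t x) has_real_derivative
       (2 * (A i j t x / mu t x * (\<Sum>k\<in>UNIV. A2 i j k k t x)) - A i j t x / mu t x * (A i j t x / mu t x) * lap t x) / 2) (at t)"
      by (rule DERIV_cong, rule DERIV_divide[OF DERIV_power[OF dA] dmu])
        (use m0 in \<open>auto simp: field_simps power2_eq_square\<close>)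
  qed
  show ?thesis unfolding dent_def u_def[symmetric]
    by (rule DERIV_diff[OF d1' DERIV_cmult[OF d2]])
qed

lemma dent_flux:
  assumes t: "t > 0" and \<eta>: "\<eta> > 0" and i: "integrable lborel (dent \<eta> t)"
    and s: "integrable lborel (\<lambda>x. (\<Sum>i\<in>UNIV. \<bar>\<Sum>k\<in>UNIV. A1 i k k t x\<bar>) * (bb t x / sqrt t))"
  shows "(\<integral>x. dent \<eta> t x \<partial>lborel) \<ge> - (Cpen * (3 * real CARD('n) ^ 3 * K\<^sup>2)) *
     (\<integral>x. (\<Sum>i\<in>UNIV. \<bar>\<Sum>k\<in>UNIV. A1 i k k t x\<bar>) * (bb t x / sqrt t) \<partial>lborel)"
proof -
  obtain \<Lambda> where F: "flux t (\<eta> * t powr (- codim)) (codim * ln t) K \<Lambda> (real CARD('n) - real dm) (mu t) (\<lambda>k. mu1 k t) (\<lambda>k l. mu2 k l t)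
     (\<lambda>i j. A i j t) (\<lambda>i j k. A1 i j k t) (\<lambda>i j k l. A2 i j k l t) Mf D (\<lambda>x. bb t x / sqrt t) (\<lambda>x. (moment 2 t x + mu t x) / (mu t x * t))"
    using flux_at[OF t \<eta>, folded codim_def] .
  interpret F: flux t "\<eta> * t powr (- codim)" "codim * ln t" K \<Lambda> "real CARD('n) - real dm" "mu t" "\<lambda>k. mu1 k t" "\<lambda>k l. mu2 k l t"
     "\<lambda>i j. A i j t" "\<lambda>i j k. A1 i j k t" "\<lambda>i j k l. A2 i j k l t" Mf D "\<lambda>x. bb t x / sqrt t" "\<lambda>x. (moment 2 t x + mu t x) / (mu t x * t)"
    by (rule F)
  have C: "F.Cst = Cpen" by (simp add: F.Cst_def Cpen_def)
  have r: "real CARD('n) - real dm = 2 * codim" by (simp add: codim_def)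
  have G: "F.G = dent \<eta> t"
    unfolding F.G_def[abs_def] F.L_def F.\<theta>_def F.Lap_def F.E_def dent_def[abs_def] C log_shift[OF t \<eta>] lap_def unfolding r ..
  have \<sigma>: "F.\<sigma> = (\<lambda>x. (\<Sum>i\<in>UNIV. \<bar>\<Sum>k\<in>UNIV. A1 i k k t x\<bar>))" by (simp add: F.\<sigma>_def fun_eq_iff)
  show ?thesis using F.integral_G_ge i s unfolding G \<sigma> C by blast
qed

section \<open>A time-integrable bound for the divergence term\<close>

definition sig where "sig t x = (\<Sum>i\<in>UNIV. \<bar>\<Sum>k\<in>UNIV. A1 i k k t x\<bar>)"

lemma sig_bounds:
  assumes t: "t > 0"
  shows "0 \<le> sig t x" "sig t x \<le> (real CARD('n))\<^sup>2 * K / sqrt t * moment 1 t x"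
proof -
  show "0 \<le> sig t x" by (simp add: sig_def sum_nonneg)
  have "\<bar>A1 i j k t x\<bar> \<le> K / sqrt t * moment 1 t x" for i j k
    unfolding A1_def by (rule mol_bounds(2)[OF BB_ok t])
  then have "\<bar>\<bar>\<Sum>k\<in>UNIV. A1 i k k t x\<bar>\<bar> \<le> real CARD('n) * (K / sqrt t * moment 1 t x)" for i
    unfolding abs_abs by (rule abs_sum_le_card)
  then have "\<bar>sig t x\<bar> \<le> real CARD('n) * (real CARD('n) * (K / sqrt t * moment 1 t x))"
    unfolding sig_def by (rule abs_sum_le_card)
  then show "sig t x \<le> (real CARD('n))\<^sup>2 * K / sqrt t * moment 1 t x" by (simp add: power2_eq_square)
qed

lemma bb_facts:
  assumes t: "t > 0"
  shows "0 \<le> bb t x" "moment 1 t x * (bb t x)\<^sup>2 \<le> moment 3 t x" "continuous_on UNIV (sig t)" "bb t \<in> borel_measurable borel"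
    "moment 1 t x * bb t x \<le> moment 2 t x"
proof -
  have m0: "mu t x > 0" by (rule mu_pos[OF t])
  show "0 \<le> bb t x" using m0 moment_nonneg[OF t] by (simp add: bb_def)
  have "moment 1 t x * (bb t x)\<^sup>2 = moment 1 t x ^ 3 / (mu t x)\<^sup>2" by (simp add: bb_def power_divide power3_eq_cube power2_eq_square)
  also have "\<dots> \<le> moment 3 t x" using moment_power_mean(2)[OF t, of x] m0 by (simp add: mu_def divide_le_eq)
  finally show "moment 1 t x * (bb t x)\<^sup>2 \<le> moment 3 t x" .
  have "moment 1 t x * bb t x = (moment 1 t x)\<^sup>2 / mu t x" by (simp add: bb_def power2_eq_square)
  also have "\<dots> \<le> moment 2 t x" using moment_power_mean(1)[OF t, of x] m0 by (simp add: mu_def divide_le_eq)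
  finally show "moment 1 t x * bb t x \<le> moment 2 t x" .
  show "continuous_on UNIV (sig t)" unfolding sig_def A1_def by (intro continuous_intros cont_mol BB_ok t)
  have "moment k t \<in> borel_measurable borel" for k using moment_lborel(1)[OF t, of k] by (auto dest: borel_measurable_integrable)
  moreover have "mu t \<in> borel_measurable borel"
    unfolding mu_def by (intro borel_measurable_continuous_onI cont_mol one_ok t)
  ultimately show "bb t \<in> borel_measurable borel" unfolding bb_def[abs_def] by measurable
qed

definition M3 where "M3 = (\<integral>d. norm d ^ 3 * heat 1 d \<partial>(lborel :: (real^'n) measure))"

lemma integrable_sig:
  assumes t: "t > 0"
  shows "integrable lborel (sig t)" "integrable lborel (\<lambda>x. sig t x * bb t x)"
proof -
  have m: "sig t \<in> borel_measurable borel" by (intro borel_measurable_continuous_onI bb_facts(3)[OF t])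
  have im: "integrable lborel (moment k t)" for k by (rule moment_lborel(1)[OF t])
  show "integrable lborel (sig t)"
  proof (rule Bochner_Integration.integrable_bound)
    show "integrable lborel (\<lambda>x. (real CARD('n))\<^sup>2 * K / sqrt t * moment 1 t x)" using im[of 1] by (intro integrable_mult_right)
    show "AE x in lborel. norm (sig t x) \<le> norm ((real CARD('n))\<^sup>2 * K / sqrt t * moment 1 t x)"
    proof (rule AE_I2)
      fix x show "norm (sig t x) \<le> norm ((real CARD('n))\<^sup>2 * K / sqrt t * moment 1 t x)"
        using sig_bounds[OF t, of x] unfolding real_norm_def by linarith
    qed
  qed (use m in simp)
  show "integrable lborel (\<lambda>x. sig t x * bb t x)"
  proof (rule Bochner_Integration.integrable_bound)
    show "integrable lborel (\<lambda>x. (real CARD('n))\<^sup>2 * K / sqrt t * moment 2 t x)" using im[of 2] by (intro integrable_mult_right)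
    show "AE x in lborel. norm (sig t x * bb t x) \<le> norm ((real CARD('n))\<^sup>2 * K / sqrt t * moment 2 t x)"
    proof (rule AE_I2)
      fix x
      have "sig t x * bb t x \<le> ((real CARD('n))\<^sup>2 * K / sqrt t * moment 1 t x) * bb t x"
        by (intro mult_right_mono sig_bounds t bb_facts)
      also have "\<dots> = (real CARD('n))\<^sup>2 * K / sqrt t * (moment 1 t x * bb t x)" by simp
      also have "\<dots> \<le> (real CARD('n))\<^sup>2 * K / sqrt t * moment 2 t x"
        using K t by (intro mult_left_mono bb_facts) auto
      finally have "sig t x * bb t x \<le> (real CARD('n))\<^sup>2 * K / sqrt t * moment 2 t x" .
      moreover have "sig t x * bb t x \<ge> 0" by (intro mult_nonneg_nonneg sig_bounds t bb_facts)
      ultimately show "norm (sig t x * bb t x) \<le> norm ((real CARD('n))\<^sup>2 * K / sqrt t * moment 2 t x)"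
        unfolding real_norm_def by linarith
    qed
  qed (use m bb_facts(4)[OF t] in simp)
qed

text \<open>The pointwise bound of \<open>sig\<close> gives only the rate 1/t, while the bound
  \<open>Dv\<close> on its integral does not see the unbounded factor \<open>bb\<close>. Young's
  inequality with weight la t^(-1/4) splits sig bb between \<open>Dv\<close> and the third moment,
  whose integral is constant in time, and yields t^(-3/4).\<close>

lemma integral_sig_bb:
  assumes t: "t > 0" and Dv: "(\<integral>x. sig t x \<partial>lborel) \<le> Dv" and la: "la > 0"
  shows "(\<integral>x. sig t x * (bb t x / sqrt t) \<partial>lborel) \<le> t powr (- 3/4) * (la * Dv / 2 + (real CARD('n))\<^sup>2 * K * M3 * mass / (2 * la))"
proof -
  define s where "s = t powr (1/4)"
  have s: "s > 0" "s * s = sqrt t" using t by (simp_all add: s_def powr_half_sqrt[symmetric] flip: powr_add)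
  have s3: "t powr (- 3/4) = 1 / (s * sqrt t)"
    using t by (simp add: s_def powr_half_sqrt[symmetric] powr_minus_divide flip: powr_add)
  have im: "integrable lborel (moment 3 t)" by (rule moment_lborel(1)[OF t])
  define c where "c = (real CARD('n))\<^sup>2 * K"
  have c: "c \<ge> 0" using K by (simp add: c_def)
  have "(\<integral>x. sig t x * bb t x \<partial>lborel) \<le> (\<integral>x. la / (2 * s) * sig t x + c / (2 * la * s) * moment 3 t x \<partial>lborel)"
  proof (rule integral_mono)
    show "integrable lborel (\<lambda>x. sig t x * bb t x)" by (rule integrable_sig[OF t])
    show "integrable lborel (\<lambda>x. la / (2 * s) * sig t x + c / (2 * la * s) * moment 3 t x)"
      using integrable_sig[OF t] im by auto
    fix x
    define w where "w = la / s"
    have w: "w > 0" using la s by (simp add: w_def)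
    have "0 \<le> (bb t x - w)\<^sup>2" by simp
    then have "bb t x \<le> w / 2 + (bb t x)\<^sup>2 / (2 * w)" using w by (simp add: power2_eq_square field_simps)
    then have "sig t x * bb t x \<le> sig t x * (w / 2 + (bb t x)\<^sup>2 / (2 * w))" using sig_bounds[OF t] by (intro mult_left_mono)
    also have "\<dots> = la / (2 * s) * sig t x + sig t x * (bb t x)\<^sup>2 * s / (2 * la)"
      using la s by (simp add: w_def field_simps)
    also have "\<dots> \<le> la / (2 * s) * sig t x + (c / sqrt t * moment 3 t x) * s / (2 * la)"
    proof -
      have "sig t x * (bb t x)\<^sup>2 \<le> (c / sqrt t * moment 1 t x) * (bb t x)\<^sup>2"
        unfolding c_def by (intro mult_right_mono sig_bounds t) auto
      also have "\<dots> \<le> c / sqrt t * moment 3 t x"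
        using bb_facts(2)[OF t, of x] c t by (simp add: mult.assoc divide_right_mono mult_left_mono)
      finally show ?thesis using s la by (intro add_left_mono divide_right_mono mult_right_mono) auto
    qed
    also have "\<dots> = la / (2 * s) * sig t x + c / (2 * la * s) * moment 3 t x"
      unfolding s(2)[symmetric] using s(1) by (simp add: field_simps)
    finally show "sig t x * bb t x \<le> la / (2 * s) * sig t x + c / (2 * la * s) * moment 3 t x" .
  qed
  also have "\<dots> = la / (2 * s) * (\<integral>x. sig t x \<partial>lborel) + c / (2 * la * s) * (mass * M3)"
    using integrable_sig[OF t] im moment_lborel(2)[OF t, of 3] by (simp add: mass_def M3_def)
  also have "\<dots> \<le> la / (2 * s) * Dv + c / (2 * la * s) * (mass * M3)"
    using Dv la s by (intro add_right_mono mult_left_mono) auto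
  finally have "(\<integral>x. sig t x * bb t x \<partial>lborel) / sqrt t \<le> (la / (2 * s) * Dv + c / (2 * la * s) * (mass * M3)) / sqrt t"
    using t by (intro divide_right_mono) auto
  also have "\<dots> = t powr (- 3/4) * (la * Dv / 2 + c * M3 * mass / (2 * la))"
    unfolding s3 using s la t by (simp add: field_simps)
  finally show ?thesis by (simp add: c_def)
qed

end

context tensor_flow
begin

section \<open>Continuity and integrability in space and time\<close>

lemma isCont_joint:
  assumes t: "t > 0"
  shows "isCont (\<lambda>p. mu (fst p) (snd p)) (t, x)" "isCont (\<lambda>p. lap (fst p) (snd p)) (t, x)"
    "isCont (\<lambda>p. A i j (fst p) (snd p)) (t, x)" "isCont (\<lambda>p. A2 i j k l (fst p) (snd p)) (t, x)"
  unfolding mu_def lap_def mu2_def A_def A2_def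
  by (intro continuous_intros isCont_mol[OF one_ok t] isCont_mol[OF BB_ok t])+

lemma isCont_dent:
  assumes t: "t > 0" and \<eta>: "\<eta> > 0"
  shows "isCont (\<lambda>p. dent \<eta> (fst p) (snd p)) (t, x)"
proof -
  have m0: "mu t x > 0" by (rule mu_pos[OF t])
  have 1: "t powr codim * mu t x + \<eta> > 0" "mu t x + \<eta> * t powr (- codim) > 0" using m0 \<eta> t by (auto intro: add_pos_pos)
  show ?thesis unfolding dent_def
    using 1 m0 t by (intro continuous_intros isCont_joint[OF t]) auto
qed

lemma mu_upper:
  assumes "0 < a" "a \<le> b"
  obtains Q where "\<And>t x. a \<le> t \<Longrightarrow> t \<le> b \<Longrightarrow> mu t x \<le> Q"
proof -
  obtain Q where Q: "\<And>t d. a \<le> t \<Longrightarrow> t \<le> b \<Longrightarrow> heat t (d::real^'n) \<le> Q" using heat_bounds[OF assms, where 'n='n] by metis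
  have "mu t x \<le> Q * mass" if t: "a \<le> t" "t \<le> b" for t x
  proof -
    have t0: "t > 0" using t assms by simp
    have "mu t x \<le> (\<integral>w. Q \<partial>V)"
      unfolding mu_def mol_def using integrable_mol(1)[OF one_ok t0] Q[OF t] by (intro integral_mono) auto
    then show ?thesis by (simp add: mass_def mult.commute)
  qed
  then show thesis using that by blast
qed

lemma log_bounded:
  assumes "0 < a" "a \<le> b" and \<eta>: "\<eta> > 0"
  obtains \<Lambda> where "\<And>t x. a \<le> t \<Longrightarrow> t \<le> b \<Longrightarrow> \<bar>ln (t powr codim * mu t x + \<eta>)\<bar> \<le> \<Lambda>" "\<Lambda> \<ge> 0"
proof -
  obtain Q where Q: "\<And>t x. a \<le> t \<Longrightarrow> t \<le> b \<Longrightarrow> mu t x \<le> Q" using mu_upper[OF assms(1,2)] by metis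
  have "\<bar>ln (t powr codim * mu t x + \<eta>)\<bar> \<le> \<bar>ln \<eta>\<bar> + \<bar>ln (b powr codim * Q + \<eta>)\<bar>" if t: "a \<le> t" "t \<le> b" for t x
  proof -
    have t0: "t > 0" using t assms by simp
    have "t powr codim * mu t x \<le> b powr codim * Q"
      using t t0 Q[OF t, of x] mu_pos[OF t0, of x] codim_nonneg by (intro mult_mono powr_mono2) auto
    moreover have "t powr codim * mu t x \<ge> 0" using mu_pos[OF t0, of x] by simp
    ultimately have "ln \<eta> \<le> ln (t powr codim * mu t x + \<eta>)" "ln (t powr codim * mu t x + \<eta>) \<le> ln (b powr codim * Q + \<eta>)"
      using \<eta> by (intro ln_mono; simp)+
    then show ?thesis by linarith
  qed
  then show thesis using that by force
qed

lemma ratio_bounds: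
  assumes t: "t > 0" and \<eta>: "\<eta> > 0"
  shows "\<bar>mu t x / (mu t x + \<eta> * t powr (- codim))\<bar> \<le> 1" "\<bar>A i j t x / mu t x\<bar> \<le> K"
proof -
  have m0: "mu t x > 0" by (rule mu_pos[OF t])
  have "\<eta> * t powr (- codim) \<ge> 0" "mu t x + \<eta> * t powr (- codim) > 0" using \<eta> t m0 by (auto intro: add_pos_pos)
  then show "\<bar>mu t x / (mu t x + \<eta> * t powr (- codim))\<bar> \<le> 1" using m0 by simp
  show "\<bar>A i j t x / mu t x\<bar> \<le> K" using KK_bound[OF mean_in_KK[OF t, of x], of i j] by simp
qed

lemma dent_bound:
  assumes ab: "0 < a" "a \<le> b" and \<eta>: "\<eta> > 0"
  obtains C where "\<And>t x. a \<le> t \<Longrightarrow> t \<le> b \<Longrightarrow> \<bar>dent \<eta> t x\<bar> \<le> C * (moment 2 t x + mu t x)" "C \<ge> 0"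
proof -
  obtain \<Lambda> where \<Lambda>: "\<And>t x. a \<le> t \<Longrightarrow> t \<le> b \<Longrightarrow> \<bar>ln (t powr codim * mu t x + \<eta>)\<bar> \<le> \<Lambda>" "\<Lambda> \<ge> 0"
    using log_bounded[OF ab \<eta>] by metis
  define n where "n = real CARD('n)"
  have n0: "n \<ge> 0" by (simp add: n_def)
  define C where "C = (\<Lambda> + 1) * (n * (K / a)) / 2 + 1 * (2 * codim) / (2 * a) + Cpen * (n * (n * (2 * (K * (n * (K / a))) + K * K * (n * (K / a)))) / 2)"
  have Cp: "Cpen \<ge> 0" by (simp add: Cpen_def)
  have "\<bar>dent \<eta> t x\<bar> \<le> C * (moment 2 t x + mu t x)" if t: "a \<le> t" "t \<le> b" for t x
  proof -
    have t0: "t > 0" using t ab by simp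
    define h where "h = moment 2 t x + mu t x"
    have m0: "mu t x > 0" by (rule mu_pos[OF t0])
    have h0: "h \<ge> mu t x" "h \<ge> 0" using moment_nonneg[OF t0, of 2 x] m0 by (auto simp: h_def)
    have Kt: "K / t * h \<le> K / a * h" using K t ab h0 by (intro mult_right_mono divide_left_mono) auto
    have b1: "\<bar>mu2 k l t x\<bar> \<le> K / a * h" for k l
      using mol_bounds(3)[OF one_ok t0, of l k x] Kt by (simp add: mu2_def h_def mu_def)
    have b2: "\<bar>A2 i j k l t x\<bar> \<le> K / a * h" for i j k l
      using mol_bounds(3)[OF BB_ok t0, of i j l k x] Kt by (simp add: A2_def h_def mu_def)
    have bl: "\<bar>lap t x\<bar> \<le> n * (K / a * h)" unfolding lap_def n_def by (intro abs_sum_le_card b1)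
    have 1: "\<bar>(ln (t powr codim * mu t x + \<eta>) + mu t x / (mu t x + \<eta> * t powr (- codim))) * lap t x / 2\<bar> \<le> (\<Lambda> + 1) * (n * (K / a * h)) / 2"
      unfolding abs_divide using \<Lambda>(1)[OF t, of x] ratio_bounds(1)[OF t0 \<eta>, of x]
      by (intro divide_mono abs_mult_le order_trans[OF abs_triangle_ineq] add_mono bl) auto
    have 2: "\<bar>mu t x * (mu t x / (mu t x + \<eta> * t powr (- codim))) * (2 * codim) / (2 * t)\<bar> \<le> h * 1 * (2 * codim) / (2 * a)"
      unfolding abs_divide using ratio_bounds(1)[OF t0 \<eta>, of x] codim_nonneg h0 m0 ab t
      by (intro divide_mono abs_mult_le) auto
    have 3: "\<bar>\<Sum>i\<in>UNIV. \<Sum>j\<in>UNIV. 2 * (A i j t x / mu t x * (\<Sum>k\<in>UNIV. A2 i j k k t x)) - A i j t x / mu t x * (A i j t x / mu t x) * lap t x\<bar>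
       \<le> n * (n * (2 * (K * (n * (K / a * h))) + K * K * (n * (K / a * h))))"
      unfolding n_def
      by (intro abs_sum_le_card order_trans[OF abs_triangle_ineq4] add_mono abs_mult_le ratio_bounds(2)[OF t0 \<eta>] b2 bl[unfolded n_def]) auto
    have "\<bar>dent \<eta> t x\<bar> \<le> (\<Lambda> + 1) * (n * (K / a * h)) / 2 + h * 1 * (2 * codim) / (2 * a) + Cpen * (n * (n * (2 * (K * (n * (K / a * h))) + K * K * (n * (K / a * h)))) / 2)"
      unfolding dent_def
      by (intro order_trans[OF abs_triangle_ineq4] order_trans[OF abs_triangle_ineq] add_mono 1 2 abs_mult_le)
        (use 3 Cp in \<open>auto simp: abs_divide intro!: divide_right_mono\<close>)
    also have "\<dots> = C * h" by (simp add: C_def algebra_simps add_divide_distrib)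
    finally show ?thesis by (simp add: h_def)
  qed
  moreover have "C \<ge> 0" using \<Lambda>(2) n0 K ab codim_nonneg Cp by (auto simp: C_def intro!: add_nonneg_nonneg mult_nonneg_nonneg divide_nonneg_nonneg)
  ultimately show thesis using that by blast
qed

lemma integrable_fixed:
  assumes t: "t > 0" and \<eta>: "\<eta> > 0"
  shows "integrable lborel (mu t)" "integrable lborel (ent \<eta> t)" "integrable lborel (pen t)" "integrable lborel (dent \<eta> t)"
    and "\<And>x. 0 \<le> pen t x" "\<And>x. pen t x \<le> (real CARD('n))\<^sup>2 * K\<^sup>2 * mu t x" "(\<integral>x. mu t x \<partial>lborel) = mass"
proof -
  have c: "isCont (\<lambda>x. Q (fst (t, x)) (snd (t, x))) x" if "isCont (\<lambda>p. Q (fst p) (snd p)) (t, x)" for Q :: "real \<Rightarrow> real^'n \<Rightarrow> real" and x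
    using isCont_o2[where f="\<lambda>x. (t, x)" and a=x and g="\<lambda>p. Q (fst p) (snd p)"] that by simp
  have m0: "mu t x > 0" for x by (rule mu_pos[OF t])
  have cont: "continuous_on UNIV (mu t)" "\<And>i j. continuous_on UNIV (A i j t)" "continuous_on UNIV (dent \<eta> t)"
    using c[OF isCont_joint(1)[OF t]] c[OF isCont_joint(3)[OF t]] c[OF isCont_dent[OF t \<eta>]]
    by (auto intro: continuous_at_imp_continuous_on)
  have p1: "t powr codim * mu t x + \<eta> > 0" for x using m0[of x] \<eta> t by (auto intro: add_pos_pos)
  have m: "mu t \<in> borel_measurable lborel" "ent \<eta> t \<in> borel_measurable lborel" "pen t \<in> borel_measurable lborel" "dent \<eta> t \<in> borel_measurable lborel"
    unfolding ent_def[abs_def] pen_def[abs_def] measurable_lborel1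
    using cont p1 m0 by (auto intro!: borel_measurable_continuous_onI continuous_intros simp: less_imp_neq[symmetric])
  show imu: "integrable lborel (mu t)" using moment_lborel(1)[OF t, of 0] by (simp add: moment_0[abs_def] mu_def)
  obtain \<Lambda> where \<Lambda>: "\<And>x. \<bar>ln (t powr codim * mu t x + \<eta>)\<bar> \<le> \<Lambda>" "\<Lambda> \<ge> 0"
    using log_bounded[OF t order_refl \<eta>] by (metis order_refl)
  show "integrable lborel (ent \<eta> t)"
  proof (rule Bochner_Integration.integrable_bound)
    show "integrable lborel (\<lambda>x. \<Lambda> * mu t x)" using imu by simp
    show "AE x in lborel. norm (ent \<eta> t x) \<le> norm (\<Lambda> * mu t x)"
    proof (rule AE_I2)
      fix x
      have "norm (ent \<eta> t x) = \<bar>ln (t powr codim * mu t x + \<eta>)\<bar> * mu t x" using m0[of x] by (simp add: ent_def abs_mult)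
      also have "\<dots> \<le> \<Lambda> * mu t x" using m0[of x] \<Lambda>(1)[of x] by (intro mult_right_mono) auto
      finally show "norm (ent \<eta> t x) \<le> norm (\<Lambda> * mu t x)" by simp
    qed
  qed (rule m)
  show p0: "0 \<le> pen t x" for x unfolding pen_def using m0[of x] by (auto intro!: sum_nonneg)
  show p: "pen t x \<le> (real CARD('n))\<^sup>2 * K\<^sup>2 * mu t x" for x
  proof -
    have "(A i j t x)\<^sup>2 / mu t x = (A i j t x / mu t x)\<^sup>2 * mu t x" for i j using m0[of x] by (simp add: power_divide power2_eq_square)
    moreover have "(A i j t x / mu t x)\<^sup>2 \<le> K\<^sup>2" for i j using ratio_bounds(2)[OF t \<eta>, of i j x] K by (metis abs_le_square_iff abs_of_nonneg order_trans zero_le_one)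
    ultimately have "\<bar>(A i j t x)\<^sup>2 / mu t x\<bar> \<le> K\<^sup>2 * mu t x" for i j using m0[of x] by (auto intro!: mult_right_mono)
    then have "\<bar>pen t x\<bar> \<le> real CARD('n) * (real CARD('n) * (K\<^sup>2 * mu t x))"
      unfolding pen_def by (intro abs_sum_le_card)
    then show ?thesis by (simp add: power2_eq_square mult.assoc)
  qed
  show "integrable lborel (pen t)"
  proof (rule Bochner_Integration.integrable_bound)
    show "integrable lborel (\<lambda>x. (real CARD('n))\<^sup>2 * K\<^sup>2 * mu t x)" using imu by simp
    show "AE x in lborel. norm (pen t x) \<le> norm ((real CARD('n))\<^sup>2 * K\<^sup>2 * mu t x)"
    proof (rule AE_I2)
      fix x show "norm (pen t x) \<le> norm ((real CARD('n))\<^sup>2 * K\<^sup>2 * mu t x)" using p[of x] p0[of x] unfolding real_norm_def by linarith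
    qed
  qed (rule m)
  obtain C where C: "\<And>x. \<bar>dent \<eta> t x\<bar> \<le> C * (moment 2 t x + mu t x)" using dent_bound[OF t order_refl \<eta>] by (metis order_refl)
  show "integrable lborel (dent \<eta> t)"
  proof (rule Bochner_Integration.integrable_bound)
    show "integrable lborel (\<lambda>x. C * (moment 2 t x + mu t x))" using imu moment_lborel(1)[OF t, of 2] by auto
    show "AE x in lborel. norm (dent \<eta> t x) \<le> norm (C * (moment 2 t x + mu t x))"
      using C by (intro AE_I2) (auto intro: order_trans[OF _ abs_ge_self])
  qed (rule m)
  show "(\<integral>x. mu t x \<partial>lborel) = mass"
    using moment_lborel(2)[OF t, of 0] heat_integral[of 1, where 'n='n] by (simp add: moment_0[abs_def] mu_def mass_def)
qed

text \<open>The time derivative is integrated over [t0, T] and Fubini exchanges the integrals; t0 >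
  0 supplies the uniform bounds for this. The rate t^(-3/4) integrates to at most 4 T^(1/4),
  uniformly in t0.\<close>

lemma entropy_inequality:
  assumes t0: "0 < t0" "t0 \<le> T" and \<eta>: "\<eta> > 0" and la: "la > 0" and Dv: "\<And>t. t > 0 \<Longrightarrow> (\<integral>x. sig t x \<partial>lborel) \<le> Dv" and Dv0: "Dv \<ge> 0"
  shows "(\<integral>x. ent \<eta> T x \<partial>lborel) \<ge> (\<integral>x. ent \<eta> t0 x \<partial>lborel) - Cpen * (real CARD('n))\<^sup>2 * K\<^sup>2 * mass
     - 4 * (Cpen * (3 * real CARD('n) ^ 3 * K\<^sup>2)) * T powr (1/4) * (la * Dv / 2 + (real CARD('n))\<^sup>2 * K * M3 * mass / (2 * la))"
proof -
  have T: "T > 0" using t0 by simp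
  define F where "F t x = ent \<eta> t x - Cpen * pen t x" for t x
  define f where "f = (\<lambda>(t, x). indicator {t0..T} t * dent \<eta> t x)"
  obtain C where C: "\<And>t x. t0 \<le> t \<Longrightarrow> t \<le> T \<Longrightarrow> \<bar>dent \<eta> t x\<bar> \<le> C * (moment 2 t x + mu t x)" "C \<ge> 0"
    using dent_bound[OF t0 \<eta>] by metis
  define M2 where "M2 = (\<integral>d. norm d ^ 2 * heat 1 d \<partial>(lborel :: (real^'n) measure))"
  have fm: "f \<in> borel_measurable (lborel \<Otimes>\<^sub>M lborel)"
  proof -
    have "continuous_on ({t0..T} \<times> UNIV) (\<lambda>p. dent \<eta> (fst p) (snd p))"
      using isCont_dent[OF _ \<eta>] t0 by (intro continuous_at_imp_continuous_on) auto
    then have "(\<lambda>p. if p \<in> {t0..T} \<times> UNIV then dent \<eta> (fst p) (snd p) else 0) \<in> borel_measurable borel"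
      by (intro borel_measurable_continuous_on_if) (auto intro!: borel_closed closed_Times continuous_intros)
    also have "(\<lambda>p. if p \<in> {t0..T} \<times> UNIV then dent \<eta> (fst p) (snd p) else 0) = f"
      by (auto simp: f_def fun_eq_iff indicator_def)
    finally show ?thesis by (subst lborel_prod) simp
  qed
  have fi: "integrable (lborel \<Otimes>\<^sub>M lborel) f"
  proof (rule lborel_pair.Fubini_integrable[OF fm])
    show "AE t in lborel. integrable lborel (\<lambda>x. f (t, x))"
    proof (rule AE_I2)
      fix t show "integrable lborel (\<lambda>x. f (t, x))"
        using integrable_fixed(4)[OF _ \<eta>, of t] t0 by (cases "t \<in> {t0..T}") (auto simp: f_def)
    qed
    show "integrable lborel (\<lambda>t. \<integral>x. norm (f (t, x)) \<partial>lborel)"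
    proof (rule Bochner_Integration.integrable_bound)
      show "integrable lborel (\<lambda>t. indicator {t0..T} t * (C * (mass * (M2 + 1))))"
        by (intro integrable_mult_left integrable_real_indicator) (auto simp: emeasure_lborel_Icc_eq)
      show "(\<lambda>t. \<integral>x. norm (f (t, x)) \<partial>lborel) \<in> borel_measurable lborel" using fm by measurable
      show "AE t in lborel. norm (\<integral>x. norm (f (t, x)) \<partial>lborel) \<le> norm (indicator {t0..T} t * (C * (mass * (M2 + 1))))"
      proof (rule AE_I2)
        fix t
        show "norm (\<integral>x. norm (f (t, x)) \<partial>lborel) \<le> norm (indicator {t0..T} t * (C * (mass * (M2 + 1))))"
        proof (cases "t \<in> {t0..T}")
          case True
          then have t: "t > 0" using t0 by auto
          have i: "integrable lborel (\<lambda>x. moment 2 t x + mu t x)" using moment_lborel(1)[OF t, of 2] integrable_fixed(1)[OF t \<eta>] by auto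
          have "(\<integral>x. norm (f (t, x)) \<partial>lborel) \<le> (\<integral>x. C * (moment 2 t x + mu t x) \<partial>lborel)"
            using integrable_fixed(4)[OF t \<eta>] i C(1)[of t] True by (intro integral_mono) (auto simp: f_def)
          also have "\<dots> = C * (mass * (M2 + 1))"
            using moment_lborel[OF t, of 2] integrable_fixed(1,7)[OF t \<eta>] by (simp add: M2_def mass_def distrib_left)
          finally have "(\<integral>x. norm (f (t, x)) \<partial>lborel) \<le> C * (mass * (M2 + 1))" .
          moreover have "(\<integral>x. norm (f (t, x)) \<partial>lborel) \<ge> 0" by (rule Bochner_Integration.integral_nonneg) auto
          ultimately show ?thesis using True by simp
        qed (simp add: f_def)
      qed
    qed
  qed
  have ftc: "(\<integral>t. f (t, x) \<partial>lborel) = F T x - F t0 x" for x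
  proof -
    have "(\<integral>t. dent \<eta> t x * indicator {t0..T} t \<partial>lborel) = F T x - F t0 x"
    proof (rule integral_FTC_Icc_real[OF t0(2)])
      fix t assume "t0 \<le> t" "t \<le> T"
      then have t: "t > 0" using t0 by simp
      show "((\<lambda>t. F t x) has_real_derivative dent \<eta> t x) (at t)" unfolding F_def by (rule DERIV_ent[OF t \<eta>])
      show "isCont (\<lambda>t. dent \<eta> t x) t"
        using isCont_o2[where f="\<lambda>t. (t, x)" and a=t and g="\<lambda>p. dent \<eta> (fst p) (snd p)"] isCont_dent[OF t \<eta>, of x] by simp
    qed
    then show ?thesis by (simp add: f_def mult.commute)
  qed
  define W where "W = (Cpen * (3 * real CARD('n) ^ 3 * K\<^sup>2)) * (la * Dv / 2 + (real CARD('n))\<^sup>2 * K * M3 * mass / (2 * la))"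
  have M30: "M3 \<ge> 0" unfolding M3_def using heat_pos[of 1, where 'a='n] by (intro Bochner_Integration.integral_nonneg) (simp add: less_imp_le)
  have W0: "W \<ge> 0" unfolding W_def Cpen_def using la Dv0 K M30 by (auto simp: mass_def intro!: mult_nonneg_nonneg add_nonneg_nonneg divide_nonneg_nonneg)
  have iF: "integrable lborel (F t)" if "t > 0" for t
    unfolding F_def[abs_def] using integrable_fixed(2,3)[OF that \<eta>] by auto
  have powr_int: "(\<integral>t. t powr (- 3/4) * indicator {t0..T} t \<partial>lborel) = 4 * T powr (1/4) - 4 * t0 powr (1/4)"
      "integrable lborel (\<lambda>t. t powr (- 3/4) * indicator {t0..T} t)"
  proof -
    have D: "((\<lambda>t. 4 * t powr (1/4)) has_real_derivative t powr (- 3/4)) (at t)" if "t0 \<le> t" for t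
      using that t0 by (auto intro!: derivative_eq_intros simp: field_simps)
    have ic: "isCont (\<lambda>t::real. t powr (- 3/4)) t" if "t0 \<le> t" for t using that t0 by (auto intro!: continuous_intros)
    show "(\<integral>t. t powr (- 3/4) * indicator {t0..T} t \<partial>lborel) = 4 * T powr (1/4) - 4 * t0 powr (1/4)"
      by (rule integral_FTC_Icc_real[OF t0(2) D ic])
    show "integrable lborel (\<lambda>t. t powr (- 3/4) * indicator {t0..T} t)"
      using borel_integrable_atLeastAtMost[OF ic, of t0 T] by (simp add: set_integrable_def mult.commute indicator_scaleR_eq_if)
  qed
  have "(\<integral>x. F T x \<partial>lborel) - (\<integral>x. F t0 x \<partial>lborel) = (\<integral>x. F T x - F t0 x \<partial>lborel)"
    using iF T t0 by simp
  also have "\<dots> = (\<integral>x. (\<integral>t. f (t, x) \<partial>lborel) \<partial>lborel)" by (simp add: ftc)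
  also have "\<dots> = (\<integral>t. (\<integral>x. f (t, x) \<partial>lborel) \<partial>lborel)"
    using lborel_pair.Fubini_integral[of "\<lambda>t x. f (t, x)"] fi by simp
  also have "\<dots> \<ge> (\<integral>t. - W * (t powr (- 3/4) * indicator {t0..T} t) \<partial>lborel)"
  proof (rule integral_mono)
    show "integrable lborel (\<lambda>t. \<integral>x. f (t, x) \<partial>lborel)" using lborel_pair.integrable_fst[of "\<lambda>t x. f (t, x)"] fi by simp
    show "integrable lborel (\<lambda>t. - W * (t powr (- 3/4) * indicator {t0..T} t))" using powr_int(2) by simp
    fix t
    show "- W * (t powr (- 3/4) * indicator {t0..T} t) \<le> (\<integral>x. f (t, x) \<partial>lborel)"
    proof (cases "t \<in> {t0..T}")
      case True
      then have t: "t > 0" using t0 by auto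
      have s: "integrable lborel (\<lambda>x. (\<Sum>i\<in>UNIV. \<bar>\<Sum>k\<in>UNIV. A1 i k k t x\<bar>) * (bb t x / sqrt t))"
        using integrable_sig(2)[OF t] by (simp add: sig_def)
      have "(\<integral>x. f (t, x) \<partial>lborel) = (\<integral>x. dent \<eta> t x \<partial>lborel)" using True by (simp add: f_def)
      also have "\<dots> \<ge> - (Cpen * (3 * real CARD('n) ^ 3 * K\<^sup>2)) * (\<integral>x. sig t x * (bb t x / sqrt t) \<partial>lborel)"
        unfolding sig_def by (rule dent_flux[OF t \<eta> integrable_fixed(4)[OF t \<eta>] s])
      moreover have "(Cpen * (3 * real CARD('n) ^ 3 * K\<^sup>2)) * (\<integral>x. sig t x * (bb t x / sqrt t) \<partial>lborel)
          \<le> (Cpen * (3 * real CARD('n) ^ 3 * K\<^sup>2)) * (t powr (- 3/4) * (la * Dv / 2 + (real CARD('n))\<^sup>2 * K * M3 * mass / (2 * la)))"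
        by (intro mult_left_mono integral_sig_bb[OF t Dv[OF t] la]) (simp add: Cpen_def)
      ultimately show ?thesis using True by (simp add: W_def mult_ac)
    qed (simp add: f_def)
  qed
  finally have main: "(\<integral>x. F T x \<partial>lborel) - (\<integral>x. F t0 x \<partial>lborel) \<ge> - W * (4 * T powr (1/4) - 4 * t0 powr (1/4))"
    using powr_int by simp
  \<comment> \<open>The penalty is nonnegative, so dropping it at the final time is free; at the
    initial time it costs a fixed multiple of the mass.\<close>
  have "(\<integral>x. F T x \<partial>lborel) \<le> (\<integral>x. ent \<eta> T x \<partial>lborel)"
    using iF[OF T] integrable_fixed[OF T \<eta>] by (intro integral_mono) (auto simp: F_def Cpen_def)
  moreover have "(\<integral>x. F t0 x \<partial>lborel) \<ge> (\<integral>x. ent \<eta> t0 x - Cpen * ((real CARD('n))\<^sup>2 * K\<^sup>2 * mu t0 x) \<partial>lborel)"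
  proof (rule integral_mono)
    show "integrable lborel (F t0)" by (rule iF[OF t0(1)])
    show "integrable lborel (\<lambda>x. ent \<eta> t0 x - Cpen * ((real CARD('n))\<^sup>2 * K\<^sup>2 * mu t0 x))"
      using integrable_fixed(1,2)[OF t0(1) \<eta>] by auto
    have Cp: "Cpen \<ge> 0" by (simp add: Cpen_def)
    fix x
    show "ent \<eta> t0 x - Cpen * ((real CARD('n))\<^sup>2 * K\<^sup>2 * mu t0 x) \<le> F t0 x"
      using mult_left_mono[OF integrable_fixed(6)[OF t0(1) \<eta>, of x] Cp] by (simp add: F_def)
  qed
  moreover have "(\<integral>x. ent \<eta> t0 x - Cpen * ((real CARD('n))\<^sup>2 * K\<^sup>2 * mu t0 x) \<partial>lborel) = (\<integral>x. ent \<eta> t0 x \<partial>lborel) - Cpen * (real CARD('n))\<^sup>2 * K\<^sup>2 * mass"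
    using integrable_fixed[OF t0(1) \<eta>] by simp
  moreover have "W * (4 * T powr (1/4) - 4 * t0 powr (1/4)) \<le> W * (4 * T powr (1/4))" using W0 by (intro mult_left_mono) auto
  ultimately have "(\<integral>x. ent \<eta> T x \<partial>lborel) \<ge> (\<integral>x. ent \<eta> t0 x \<partial>lborel) - Cpen * (real CARD('n))\<^sup>2 * K\<^sup>2 * mass - W * (4 * T powr (1/4))"
    using main by linarith
  then show ?thesis by (simp add: W_def mult_ac)
qed

end

section \<open>The divergence of the mollified tensor\<close>

lemma has_derivative_heat:
  assumes t: "t > 0"
  shows "(heat t has_derivative (\<lambda>h. - (heat t d / t) * (d \<bullet> h))) (at (d :: real^'n))"
proof -
  have "((\<lambda>d::real^'n. t powr (- real CARD('n) / 2) * exp (- (d \<bullet> d) / (2 * t)) / gauss_mass TYPE('n)) has_derivative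
     (\<lambda>h. - (t powr (- real CARD('n) / 2) * exp (- (d \<bullet> d) / (2 * t)) / gauss_mass TYPE('n) / t) * (d \<bullet> h))) (at d)"
    using t by (auto intro!: derivative_eq_intros simp: inner_commute field_simps)
  then show ?thesis by (simp add: heat_def[abs_def] power2_norm_eq_inner)
qed

lemma continuous_on_heat: "t > 0 \<Longrightarrow> continuous_on S (heat t)"
  by (meson continuous_at_imp_continuous_on has_derivative_continuous has_derivative_heat)

text \<open>G is the heat smoothing of \<phi> restricted to a box and Q is its gradient. It is the
  dual test function: integrating the mollified divergence against \<phi> amounts to integrating the
  tensor against Q. The box keeps the domain compact, as the Leibniz rule requires.\<close>

lemma box_smoothing:
  fixes \<phi> :: "real^'n \<Rightarrow> real" and a b :: "real^'n"
  assumes t: "t > 0" and \<phi>: "continuous_on UNIV \<phi>" "\<And>x. \<bar>\<phi> x\<bar> \<le> 1"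
  defines "G \<equiv> \<lambda>z. integral (cbox a b) (\<lambda>x. \<phi> x * heat t (x - z))"
    and "Q \<equiv> \<lambda>z. integral (cbox a b) (\<lambda>x. (\<phi> x * heat t (x - z) / t) *\<^sub>R (x - z))"
  shows "(G has_derivative (\<lambda>h. Q z \<bullet> h)) (at z)" and "continuous_on UNIV Q" and "\<bar>G z\<bar> \<le> 1"
    and "Q z $ k = - (\<integral>x. indicator (cbox a b) x * (\<phi> x * heat1 k t (x - z)) \<partial>lborel)"
    and "integrable lborel (\<lambda>x. indicator (cbox a b) x * (\<phi> x * heat1 k t (x - z)))"
proof -
  have ch: "continuous_on S (\<lambda>p. heat t (f p))" if "continuous_on S f" for f :: "'b::topological_space \<Rightarrow> real^'n" and S
    using continuous_on_compose2[OF continuous_on_heat[OF t] that] by auto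
  have c\<phi>: "continuous_on S (\<lambda>p. \<phi> (f p))" if "continuous_on S f" for f :: "'b::topological_space \<Rightarrow> real^'n" and S
    using continuous_on_compose2[OF \<phi>(1) that] by auto
  let ?k = "\<lambda>z x. (\<phi> x * heat t (x - z) / t) *\<^sub>R (x - z)"
  have ck: "continuous_on (UNIV \<times> cbox a b) (\<lambda>(z, x). ?k z x)"
    unfolding case_prod_unfold using t by (intro continuous_intros ch c\<phi>) auto
  have ik: "?k z integrable_on cbox a b" for z
    using t by (intro integrable_continuous continuous_intros ch c\<phi>) auto
  have "(G has_derivative blinfun_apply (integral (cbox a b) (\<lambda>x. blinfun_inner_right (?k z x)))) (at z within UNIV)"
    unfolding G_def
  proof (rule leibniz_rule)
    show "((\<lambda>z. \<phi> x * heat t (x - z)) has_derivative blinfun_apply (blinfun_inner_right (?k z x))) (at z within UNIV)" for z x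
    proof -
      have "((\<lambda>z. heat t (x - z)) has_derivative (\<lambda>h. - (heat t (x - z) / t) * ((x - z) \<bullet> (- h)))) (at z)"
        by (rule has_derivative_compose[OF _ has_derivative_heat[OF t]]) (auto intro!: derivative_eq_intros)
      from has_derivative_mult_right[OF this, of "\<phi> x"] have
        "((\<lambda>z. \<phi> x * heat t (x - z)) has_derivative blinfun_apply (blinfun_inner_right (?k z x))) (at z)"
        by (rule has_derivative_eq_rhs) (simp add: fun_eq_iff)
      then show ?thesis by simp
    qed
    show "(\<lambda>x. \<phi> x * heat t (x - z)) integrable_on cbox a b" for z
      by (intro integrable_continuous continuous_intros ch c\<phi>)
    show "continuous_on (UNIV \<times> cbox a b) (\<lambda>(z, x). blinfun_inner_right (?k z x))"
      using bounded_linear.continuous_on[OF bounded_linear_blinfun_inner_right ck] by (simp add: case_prod_unfold)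
  qed auto
  moreover have "integral (cbox a b) (\<lambda>x. blinfun_inner_right (?k z x)) = blinfun_inner_right (Q z)"
    unfolding Q_def using integral_linear[OF ik bounded_linear_blinfun_inner_right] by (simp add: o_def)
  ultimately show "(G has_derivative (\<lambda>h. Q z \<bullet> h)) (at z)" by simp
  show "continuous_on UNIV Q" unfolding Q_def by (rule integral_continuous_on_param[OF ck])
  have sh: "integrable lborel (\<lambda>x. heat t (x - z))"
    using lborel_translation_integral(2)[of "heat t" "-z"] heat_moment(1)[OF t, of 0, where 'n='n] by simp
  have lb: "set_integrable lborel (cbox a b) f" if "continuous_on UNIV f" for f :: "real^'n \<Rightarrow> real"
    unfolding set_integrable_def by (rule borel_integrable_compact[OF compact_cbox continuous_on_subset[OF that subset_UNIV]])
  show "\<bar>G z\<bar> \<le> 1"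
  proof -
    have c: "continuous_on UNIV (\<lambda>x. \<phi> x * heat t (x - z))" by (intro continuous_intros ch c\<phi>)
    have "G z = (\<integral>x. indicator (cbox a b) x * (\<phi> x * heat t (x - z)) \<partial>lborel)"
      unfolding G_def using set_borel_integral_eq_integral(2)[OF lb[OF c]] by (simp add: set_lebesgue_integral_def)
    also have "\<bar>\<dots>\<bar> \<le> (\<integral>x. heat t (x - z) \<partial>lborel)"
    proof (rule order_trans[OF integral_abs_bound], rule integral_mono)
      show "integrable lborel (\<lambda>x. \<bar>indicator (cbox a b) x * (\<phi> x * heat t (x - z))\<bar>)"
        using lb[OF c] by (simp add: set_integrable_def)
      show "integrable lborel (\<lambda>x. heat t (x - z))" by (rule sh)
      fix x
      have "\<bar>\<phi> x * heat t (x - z)\<bar> \<le> 1 * heat t (x - z)"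
        using \<phi>(2)[of x] heat_pos[OF t, of "x - z"] unfolding abs_mult by (intro mult_mono) auto
      then show "\<bar>indicator (cbox a b) x * (\<phi> x * heat t (x - z))\<bar> \<le> heat t (x - z)"
        using heat_pos[OF t, of "x - z"] by (auto simp: indicator_def)
    qed
    also have "\<dots> = 1" using lborel_translation_integral(1)[of "heat t" "-z"] heat_integral[OF t, where 'n='n] by simp
    finally show ?thesis .
  qed
  have c: "continuous_on UNIV (\<lambda>x. \<phi> x * heat1 k t (x - z))"
    unfolding heat1_def using t by (intro continuous_intros ch c\<phi>) auto
  show "integrable lborel (\<lambda>x. indicator (cbox a b) x * (\<phi> x * heat1 k t (x - z)))"
    using lb[OF c] by (simp add: set_integrable_def)
  have "Q z $ k = integral (cbox a b) (\<lambda>x. ?k z x $ k)"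
    unfolding Q_def using integral_linear[OF ik[of z] bounded_linear_vec_nth[of k]] by (simp add: o_def)
  also have "\<dots> = integral (cbox a b) (\<lambda>x. - (\<phi> x * heat1 k t (x - z)))"
    by (intro integral_cong) (simp add: heat1_def)
  also have "\<dots> = - integral (cbox a b) (\<lambda>x. \<phi> x * heat1 k t (x - z))" by simp
  finally show "Q z $ k = - (\<integral>x. indicator (cbox a b) x * (\<phi> x * heat1 k t (x - z)) \<partial>lborel)"
    using set_borel_integral_eq_integral(2)[OF lb[OF c]] by (simp add: set_lebesgue_integral_def)
qed

section \<open>Compactly supported cutoffs\<close>

lemma DERIV_max_square: "((\<lambda>s::real. (max 0 s)\<^sup>2) has_real_derivative 2 * max 0 s) (at s)"
proof (cases "s = 0")
  case False
  show ?thesis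
  proof (cases "s > 0")
    case True
    have "((\<lambda>s::real. s\<^sup>2) has_real_derivative 2 * s) (at s)" by (auto intro!: derivative_eq_intros)
    then show ?thesis
      by (rule has_field_derivative_transform_within_open[where S="{0<..}", THEN DERIV_cong]) (use True in auto)
  next
    case F: False
    have "((\<lambda>s::real. 0) has_real_derivative 0) (at s)" by simp
    then show ?thesis
      by (rule has_field_derivative_transform_within_open[where S="{..<0}", THEN DERIV_cong]) (use False F in auto)
  qed
next
  case True
  have "((\<lambda>h::real. (max 0 h)\<^sup>2 / h) \<longlongrightarrow> 0) (at 0)"
  proof (rule Lim_null_comparison[where g="\<lambda>h. \<bar>h\<bar>"])
    have "norm ((max 0 h)\<^sup>2 / h) \<le> \<bar>h\<bar>" for h :: real
      by (cases "h > 0") (auto simp: power2_eq_square max_def)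
    then show "\<forall>\<^sub>F h in at 0. norm ((max 0 h)\<^sup>2 / h) \<le> \<bar>h\<bar>" for h :: real by simp
    show "((\<lambda>h::real. \<bar>h\<bar>) \<longlongrightarrow> 0) (at 0)" by (auto intro!: tendsto_eq_intros)
  qed
  then show ?thesis using True by (simp add: DERIV_def)
qed

text \<open>The square makes the truncated paraboloid continuously differentiable. Its gradient is
  of order 1/R, so the error of cutting off vanishes as R grows.\<close>

definition cutoff :: "real \<Rightarrow> 'a::euclidean_space \<Rightarrow> real" where
  "cutoff R z = (max 0 (1 - (z \<bullet> z) / R\<^sup>2))\<^sup>2"

definition cutoff_grad :: "real \<Rightarrow> 'a::euclidean_space \<Rightarrow> 'a" where
  "cutoff_grad R z = (- 4 * max 0 (1 - (z \<bullet> z) / R\<^sup>2) / R\<^sup>2) *\<^sub>R z"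

lemma cutoff:
  assumes R: "R > 0"
  shows "(cutoff R has_derivative (\<lambda>h. cutoff_grad R z \<bullet> h)) (at z)" "continuous_on UNIV (cutoff_grad R)"
    "0 \<le> cutoff R z" "cutoff R z \<le> 1" "norm (cutoff_grad R z) \<le> 4 / R" "norm z > R \<Longrightarrow> cutoff R z = 0"
proof -
  have "((\<lambda>z. 1 - c * (z \<bullet> z)) has_derivative (\<lambda>h. - (2 * (z \<bullet> h) * c))) (at z)" for c
    by (auto intro!: derivative_eq_intros simp: inner_commute)
  from this[of "1 / R\<^sup>2"] have "((\<lambda>z. 1 - (z \<bullet> z) / R\<^sup>2) has_derivative (\<lambda>h. - (2 * (z \<bullet> h) / R\<^sup>2))) (at z)" by simp
  from has_derivative_compose[OF this DERIV_max_square[unfolded has_field_derivative_def]]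
  show "(cutoff R has_derivative (\<lambda>h. cutoff_grad R z \<bullet> h)) (at z)"
    by (simp add: cutoff_def[abs_def] cutoff_grad_def mult_ac)
  show "continuous_on UNIV (cutoff_grad R)" unfolding cutoff_grad_def[abs_def] using R by (intro continuous_intros) auto
  let ?m = "max 0 (1 - (z \<bullet> z) / R\<^sup>2)"
  have m: "0 \<le> ?m" "?m \<le> 1" by auto
  show "0 \<le> cutoff R z" by (simp add: cutoff_def)
  show "cutoff R z \<le> 1" unfolding cutoff_def by (rule power_le_one[OF m])
  show "norm (cutoff_grad R z) \<le> 4 / R"
  proof (cases "norm z \<le> R")
    case True
    have "norm (cutoff_grad R z) = 4 * ?m / R\<^sup>2 * norm z" using m by (simp add: cutoff_grad_def)
    also have "\<dots> \<le> 4 * 1 / R\<^sup>2 * R" using m True R by (intro mult_mono divide_right_mono mult_left_mono) auto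
    also have "\<dots> = 4 / R" using R by (simp add: power2_eq_square)
    finally show ?thesis .
  next
    case False
    then have "(z \<bullet> z) / R\<^sup>2 \<ge> 1" using R by (simp add: dot_square_norm power_mono)
    then have "?m = 0" by simp
    then show ?thesis using R by (simp add: cutoff_grad_def)
  qed
  show "cutoff R z = 0" if "norm z > R"
  proof -
    have "(z \<bullet> z) / R\<^sup>2 \<ge> 1" using R that by (simp add: dot_square_norm power_mono)
    then show ?thesis by (simp add: cutoff_def)
  qed
qed

lemma cutoff_tendsto:
  shows "(\<lambda>k. cutoff (real (Suc k)) z) \<longlonglongrightarrow> 1" "(\<lambda>k. cutoff_grad (real (Suc k)) z) \<longlonglongrightarrow> 0"
proof -
  have 0: "(\<lambda>k. inverse (real (Suc k))) \<longlonglongrightarrow> 0" by (rule LIMSEQ_inverse_real_of_nat)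
  have "(\<lambda>k. (max 0 (1 - (z \<bullet> z) * (inverse (real (Suc k)))\<^sup>2))\<^sup>2) \<longlonglongrightarrow> (max 0 (1 - (z \<bullet> z) * 0\<^sup>2))\<^sup>2"
    by (intro tendsto_intros 0)
  then show "(\<lambda>k. cutoff (real (Suc k)) z) \<longlonglongrightarrow> 1"
    by (simp add: cutoff_def divide_inverse power_inverse)
  have "(\<lambda>k. 4 * inverse (real (Suc k))) \<longlonglongrightarrow> 0" using tendsto_mult[OF tendsto_const 0, of 4] by simp
  then show "(\<lambda>k. cutoff_grad (real (Suc k)) z) \<longlonglongrightarrow> 0"
    by (rule Lim_null_comparison[rotated]) (use cutoff(5)[of "real (Suc _)" z] in \<open>auto simp: divide_inverse\<close>)
qed

context tensor_flow
begin

definition divA where "divA i t x = (\<Sum>k\<in>UNIV. A1 i k k t x)"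

text \<open>The hypothesis \<open>FV\<close> is the first variation bound for fields along the i-th
  axis. It admits only compactly supported tests, and G is not one; cutoffs at growing radii and
  dominated convergence remove the restriction, and Fubini then moves the kernel from the test to
  the tensor.\<close>

lemma divA_test:
  assumes t: "t > 0" and \<phi>: "continuous_on UNIV \<phi>" "\<And>x. \<bar>\<phi> x\<bar> \<le> 1"
    and FV: "\<And>q Q. (\<And>z. (q has_derivative (\<lambda>h. Q z \<bullet> h)) (at z)) \<Longrightarrow> continuous_on UNIV Q \<Longrightarrow> (\<And>z. \<bar>q z\<bar> \<le> 1) \<Longrightarrow>
       (\<exists>R. \<forall>z. norm z > R \<longrightarrow> q z = 0) \<Longrightarrow> (\<integral>w. (Bf w $ i) \<bullet> Q (X w) \<partial>V) \<le> Dv"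
  shows "(\<integral>x. indicator (cbox a b) x * (\<phi> x * divA i t x) \<partial>lborel) \<le> Dv"
proof -
  define G where "G z = integral (cbox a b) (\<lambda>x. \<phi> x * heat t (x - z))" for z
  define Q where "Q z = integral (cbox a b) (\<lambda>x. (\<phi> x * heat t (x - z) / t) *\<^sub>R (x - z))" for z
  note sm = box_smoothing[OF t \<phi>, of a b, folded G_def Q_def]
  interpret pair_sigma_finite V "lborel :: (real^'n) measure"
    by (intro pair_sigma_finite.intro sigma_finite_measure_axioms sigma_finite_lborel)
  obtain Kb where Kb: "\<And>j d::real^'n. \<bar>heat1 j t d\<bar> \<le> Kb" using heat_bounds_at[OF t] by metis
  define vol where "vol = measure lborel (cbox a b)"
  have ibox: "integrable lborel (indicator (cbox a b) :: real^'n \<Rightarrow> real)"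
    by (rule integrable_real_indicator) (auto intro: emeasure_bounded_finite[unfolded infinity_ennreal_def])
  have Qb: "\<bar>Q z $ k\<bar> \<le> vol * Kb" for z k
  proof -
    have "\<bar>Q z $ k\<bar> \<le> (\<integral>x. indicator (cbox a b) x * Kb \<partial>lborel)"
      unfolding sm(4) abs_minus_cancel
    proof (rule order_trans[OF integral_abs_bound], rule integral_mono)
      show "integrable lborel (\<lambda>x. \<bar>indicator (cbox a b) x * (\<phi> x * heat1 k t (x - z))\<bar>)" using sm(5) by (rule integrable_abs)
      show "integrable lborel (\<lambda>x. indicator (cbox a b) x * Kb)" using ibox by (rule integrable_mult_left)
      fix x
      have "\<bar>\<phi> x * heat1 k t (x - z)\<bar> \<le> 1 * Kb" by (intro abs_mult_le \<phi> Kb)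
      then show "\<bar>indicator (cbox a b) x * (\<phi> x * heat1 k t (x - z))\<bar> \<le> indicator (cbox a b) x * Kb"
        by (auto simp: indicator_def)
    qed
    also have "\<dots> = vol * Kb" by (simp add: vol_def)
    finally show ?thesis .
  qed
  have Bb: "\<bar>(Bf w $ i) \<bullet> u\<bar> \<le> real CARD('n) * (K * c)" if "\<And>k. \<bar>u $ k\<bar> \<le> c" for w u c
    unfolding inner_vec_def inner_real_def by (intro abs_sum_le_card abs_mult_le KK_bound[OF Bf_in] that)
  \<comment> \<open>The minus sign compensates the one from differentiating the kernel
    \<open>heat t (x - z)\<close> in z.\<close>
  let ?Q = "\<lambda>k z. - (cutoff (real (Suc k)) z *\<^sub>R Q z + G z *\<^sub>R cutoff_grad (real (Suc k)) z)"
  have le: "(\<integral>w. (Bf w $ i) \<bullet> ?Q k (X w) \<partial>V) \<le> Dv" for k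
  proof (rule FV[where q="\<lambda>z. - (cutoff (real (Suc k)) z * G z)"])
    have R: "real (Suc k) > 0" by simp
    show "((\<lambda>z. - (cutoff (real (Suc k)) z * G z)) has_derivative (\<lambda>h. ?Q k z \<bullet> h)) (at z)" for z
      by (rule has_derivative_eq_rhs, rule has_derivative_minus, rule has_derivative_mult[OF cutoff(1)[OF R] sm(1)])
        (simp add: fun_eq_iff inner_add_left algebra_simps)
    have "continuous_on UNIV G" using sm(1) by (meson continuous_at_imp_continuous_on has_derivative_continuous)
    moreover have "continuous_on UNIV (cutoff (real (Suc k)) :: real^'n \<Rightarrow> real)"
      using cutoff(1)[OF R] by (meson continuous_at_imp_continuous_on has_derivative_continuous)
    ultimately show "continuous_on UNIV (?Q k)" by (intro continuous_intros sm(2) cutoff(2)[OF R])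
    show "\<bar>- (cutoff (real (Suc k)) z * G z)\<bar> \<le> 1" for z
      using abs_mult_le[of "cutoff (real (Suc k)) z" 1 "G z" 1] cutoff(3,4)[OF R, of z] sm(3)[of z] by simp
    show "\<exists>R. \<forall>z. norm z > R \<longrightarrow> - (cutoff (real (Suc k)) z * G z) = 0"
      using cutoff(6)[OF R] by (intro exI[of _ "real (Suc k)"]) auto
  qed
  have Qm: "(\<lambda>w. (Bf w $ i) \<bullet> U (X w)) \<in> borel_measurable V" if "continuous_on UNIV U" for U :: "real^'n \<Rightarrow> real^'n"
  proof -
    have "(\<lambda>w. U (X w)) \<in> borel_measurable V" by (rule measurable_compose[OF X_measurable borel_measurable_continuous_onI[OF that]])
    moreover have "(\<lambda>A::real^'n^'n. A $ i) \<in> borel_measurable borel" by (intro borel_measurable_continuous_onI continuous_intros)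
    then have "(\<lambda>w. Bf w $ i) \<in> borel_measurable V" by (rule measurable_compose[OF Bf_measurable])
    ultimately show ?thesis by measurable
  qed
  have lim: "(\<lambda>k. \<integral>w. (Bf w $ i) \<bullet> ?Q k (X w) \<partial>V) \<longlonglongrightarrow> (\<integral>w. (Bf w $ i) \<bullet> (- Q (X w)) \<partial>V)"
  proof (rule integral_dominated_convergence[where w="\<lambda>_. real CARD('n) * (K * (vol * Kb + 4))"])
    show "(\<lambda>w. Bf w $ i \<bullet> - Q (X w)) \<in> borel_measurable V" by (rule Qm) (intro continuous_intros sm(2))
    show "(\<lambda>w. Bf w $ i \<bullet> ?Q k (X w)) \<in> borel_measurable V" for k
    proof (rule Qm)
      have R: "real (Suc k) > 0" by simp
      have "continuous_on UNIV G" using sm(1) by (meson continuous_at_imp_continuous_on has_derivative_continuous)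
      moreover have "continuous_on UNIV (cutoff (real (Suc k)) :: real^'n \<Rightarrow> real)"
        using cutoff(1)[OF R] by (meson continuous_at_imp_continuous_on has_derivative_continuous)
      ultimately show "continuous_on UNIV (?Q k)" by (intro continuous_intros sm(2) cutoff(2)[OF R])
    qed
    show "AE w in V. (\<lambda>k. Bf w $ i \<bullet> ?Q k (X w)) \<longlonglongrightarrow> Bf w $ i \<bullet> - Q (X w)"
    proof (rule AE_I2)
      fix w
      have "(\<lambda>k. Bf w $ i \<bullet> ?Q k (X w)) \<longlonglongrightarrow> Bf w $ i \<bullet> (- (1 *\<^sub>R Q (X w) + G (X w) *\<^sub>R 0))"
        by (intro tendsto_intros cutoff_tendsto)
      then show "(\<lambda>k. Bf w $ i \<bullet> ?Q k (X w)) \<longlonglongrightarrow> Bf w $ i \<bullet> - Q (X w)" by simp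
    qed
    show "AE w in V. norm (Bf w $ i \<bullet> ?Q k (X w)) \<le> real CARD('n) * (K * (vol * Kb + 4))" for k
    proof (rule AE_I2)
      fix w
      have R: "real (Suc k) > 0" by simp
      have "\<bar>?Q k z $ j\<bar> \<le> vol * Kb + 4" for z j
      proof -
        have "\<bar>?Q k z $ j\<bar> \<le> \<bar>cutoff (real (Suc k)) z * Q z $ j\<bar> + \<bar>G z * cutoff_grad (real (Suc k)) z $ j\<bar>" by simp
        also have "\<dots> \<le> 1 * (vol * Kb) + 1 * 4"
        proof (intro add_mono abs_mult_le Qb sm(3))
          show "\<bar>cutoff (real (Suc k)) z\<bar> \<le> 1" using cutoff(3,4)[OF R, of z] by simp
          have "\<bar>cutoff_grad (real (Suc k)) z $ j\<bar> \<le> 4 / real (Suc k)"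
            using component_le_norm_cart[of "cutoff_grad (real (Suc k)) z" j] cutoff(5)[OF R, of z] by simp
          also have "\<dots> \<le> 4" by (simp add: field_simps)
          finally show "\<bar>cutoff_grad (real (Suc k)) z $ j\<bar> \<le> 4" .
        qed
        finally show ?thesis by simp
      qed
      then show "norm (Bf w $ i \<bullet> ?Q k (X w)) \<le> real CARD('n) * (K * (vol * Kb + 4))" unfolding real_norm_def by (rule Bb)
    qed
  qed auto
  have "(\<integral>w. (Bf w $ i) \<bullet> (- Q (X w)) \<partial>V) \<le> Dv"
    by (rule LIMSEQ_le_const2[OF lim]) (use le in auto)
  also have "(\<integral>w. (Bf w $ i) \<bullet> (- Q (X w)) \<partial>V) = (\<integral>w. (\<Sum>k\<in>UNIV. (\<integral>x. indicator (cbox a b) x * (\<phi> x * (BB i k w * heat1 k t (x - X w))) \<partial>lborel)) \<partial>V)"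
  proof (rule Bochner_Integration.integral_cong[OF refl])
    fix w
    have "(Bf w $ i) \<bullet> (- Q (X w)) = (\<Sum>k\<in>UNIV. BB i k w * (\<integral>x. indicator (cbox a b) x * (\<phi> x * heat1 k t (x - X w)) \<partial>lborel))"
      by (simp add: inner_vec_def sm(4) BB_def)
    also have "\<dots> = (\<Sum>k\<in>UNIV. (\<integral>x. indicator (cbox a b) x * (\<phi> x * (BB i k w * heat1 k t (x - X w))) \<partial>lborel))"
      by (intro sum.cong refl) (simp add: mult_ac flip: integral_mult_right_zero)
    finally show "(Bf w $ i) \<bullet> (- Q (X w)) = (\<Sum>k\<in>UNIV. (\<integral>x. indicator (cbox a b) x * (\<phi> x * (BB i k w * heat1 k t (x - X w))) \<partial>lborel))" .
  qed
  also have "\<dots> = (\<integral>x. indicator (cbox a b) x * (\<phi> x * divA i t x) \<partial>lborel)"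
  proof -
    let ?H = "\<lambda>k. (\<lambda>(w, x). indicator (cbox a b) x * (\<phi> x * (BB i k w * heat1 k t (x - X w))))"
    have Hm: "?H k \<in> borel_measurable (V \<Otimes>\<^sub>M lborel)" for k
    proof -
      note [measurable] = BB_ok(1) heat_measurable(2)[OF t] borel_measurable_continuous_onI[OF \<phi>(1)]
      show ?thesis by measurable
    qed
    have Hb: "\<bar>?H k (w, x)\<bar> \<le> indicator (cbox a b) x * (K * Kb)" for k w x
    proof -
      have "\<bar>\<phi> x * (BB i k w * heat1 k t (x - X w))\<bar> \<le> 1 * (K * Kb)" by (intro abs_mult_le \<phi> BB_ok Kb)
      then show ?thesis by (auto simp: indicator_def)
    qed
    have Hx: "integrable lborel (\<lambda>x. ?H k (w, x))" for k w
      using integrable_mult_right[OF sm(5)[of k "X w"], of "BB i k w"] by (simp add: mult_ac)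
    have Hi: "integrable (V \<Otimes>\<^sub>M lborel) (?H k)" for k
    proof (rule Fubini_integrable[OF Hm])
      show "AE w in V. integrable lborel (\<lambda>x. ?H k (w, x))" using Hx by auto
      show "integrable V (\<lambda>w. \<integral>x. norm (?H k (w, x)) \<partial>lborel)"
      proof (rule integrable_const_bound[where B="vol * (K * Kb)"])
        show "AE w in V. norm (\<integral>x. norm (?H k (w, x)) \<partial>lborel) \<le> vol * (K * Kb)"
        proof (rule AE_I2)
          fix w
          have "(\<integral>x. norm (?H k (w, x)) \<partial>lborel) \<le> (\<integral>x. indicator (cbox a b) x * (K * Kb) \<partial>lborel)"
            using integrable_norm[OF Hx] ibox Hb by (intro integral_mono integrable_mult_left) auto
          moreover have "(\<integral>x. norm (?H k (w, x)) \<partial>lborel) \<ge> 0" by (rule Bochner_Integration.integral_nonneg) auto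
          ultimately show "norm (\<integral>x. norm (?H k (w, x)) \<partial>lborel) \<le> vol * (K * Kb)" by (simp add: vol_def)
        qed
        show "(\<lambda>w. \<integral>x. norm (?H k (w, x)) \<partial>lborel) \<in> borel_measurable V" using Hm by measurable
      qed
    qed
    have "(\<integral>w. (\<Sum>k\<in>UNIV. (\<integral>x. ?H k (w, x) \<partial>lborel)) \<partial>V) = (\<Sum>k\<in>UNIV. (\<integral>w. (\<integral>x. ?H k (w, x) \<partial>lborel) \<partial>V))"
      using integrable_fst'[OF Hi] by simp
    also have "\<dots> = (\<Sum>k\<in>UNIV. (\<integral>x. (\<integral>w. ?H k (w, x) \<partial>V) \<partial>lborel))"
      using Fubini_integral[of "\<lambda>w x. ?H _ (w, x)"] Hi by (intro sum.cong refl) simp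
    also have "\<dots> = (\<integral>x. (\<Sum>k\<in>UNIV. (\<integral>w. ?H k (w, x) \<partial>V)) \<partial>lborel)"
    proof (rule Bochner_Integration.integral_sum[symmetric])
      show "integrable lborel (\<lambda>x. \<integral>w. ?H k (w, x) \<partial>V)" for k
        using integrable_snd[of "\<lambda>w x. ?H k (w, x)"] Hi[of k] by simp
    qed
    also have "\<dots> = (\<integral>x. indicator (cbox a b) x * (\<phi> x * divA i t x) \<partial>lborel)"
      by (simp add: divA_def A1_def mol1_def sum_distrib_left)
    finally show ?thesis by simp
  qed
  finally show ?thesis .
qed

text \<open>Duality between L^1 and bounded continuous functions: test with an approximate sign of
  the divergence on a box, then exhaust the space by boxes.\<close>

lemma integral_divA:
  assumes t: "t > 0"
    and FV: "\<And>q Q. (\<And>z. (q has_derivative (\<lambda>h. Q z \<bullet> h)) (at z)) \<Longrightarrow> continuous_on UNIV Q \<Longrightarrow> (\<And>z. \<bar>q z\<bar> \<le> 1) \<Longrightarrow>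
       (\<exists>R. \<forall>z. norm z > R \<longrightarrow> q z = 0) \<Longrightarrow> (\<integral>w. (Bf w $ i) \<bullet> Q (X w) \<partial>V) \<le> Dv"
  shows "(\<integral>x. \<bar>divA i t x\<bar> \<partial>lborel) \<le> Dv"
proof -
  have c: "continuous_on UNIV (divA i t)" unfolding divA_def A1_def by (intro continuous_intros cont_mol BB_ok t)
  have i: "integrable lborel (divA i t)"
  proof (rule Bochner_Integration.integrable_bound)
    show "integrable lborel (sig t)" by (rule integrable_sig[OF t])
    show "divA i t \<in> borel_measurable lborel" using c by (simp add: borel_measurable_continuous_onI)
    have "\<bar>divA i t x\<bar> \<le> sig t x" for x
      unfolding sig_def divA_def[symmetric] by (rule member_le_sum) auto
    then show "AE x in lborel. norm (divA i t x) \<le> norm (sig t x)" by (auto intro: order_trans[OF _ abs_ge_self])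
  qed
  have box: "(\<integral>x. indicator (cbox a b) x * \<bar>divA i t x\<bar> \<partial>lborel) \<le> Dv" for a b
  proof (rule field_le_epsilon)
    fix e :: real assume e: "e > 0"
    define vol where "vol = measure lborel (cbox a b)"
    have vol: "vol \<ge> 0" by (simp add: vol_def)
    \<comment> \<open>Makes the total error \<epsilon> vol on the box at most e; the + 1 covers
      boxes of volume 0.\<close>
    define \<epsilon> where "\<epsilon> = e / (vol + 1)"
    have \<epsilon>: "\<epsilon> > 0" "\<epsilon> * vol \<le> e" using e vol by (simp_all add: \<epsilon>_def field_simps)
    \<comment> \<open>A continuous substitute for the sign of the divergence; testing with it loses
      at most \<epsilon> at each point.\<close>
    define \<phi> where "\<phi> x = divA i t x / (\<bar>divA i t x\<bar> + \<epsilon>)" for x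
    have c\<phi>: "continuous_on UNIV \<phi>" unfolding \<phi>_def[abs_def] using c \<epsilon> by (intro continuous_intros) (auto simp: add_nonneg_eq_0_iff)
    have \<phi>1: "\<bar>\<phi> x\<bar> \<le> 1" for x using \<epsilon> by (simp add: \<phi>_def abs_divide)
    have ibox: "integrable lborel (indicator (cbox a b) :: real^'n \<Rightarrow> real)"
      by (rule integrable_real_indicator) (auto intro: emeasure_bounded_finite[unfolded infinity_ennreal_def])
    have i1: "integrable lborel (\<lambda>x. indicator (cbox a b) x * \<bar>divA i t x\<bar>)"
      using integrable_mult_indicator[of "cbox a b" lborel "\<lambda>x. \<bar>divA i t x\<bar>"] integrable_abs[OF i] by simp
    have i2: "integrable lborel (\<lambda>x. indicator (cbox a b) x * (\<phi> x * divA i t x))"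
    proof -
      have "continuous_on (cbox a b) (\<lambda>x. \<phi> x * divA i t x)"
        by (intro continuous_intros continuous_on_subset[OF c] continuous_on_subset[OF c\<phi>]) auto
      from borel_integrable_compact[OF compact_cbox this] show ?thesis by (simp add: set_integrable_def)
    qed
    have "(\<integral>x. indicator (cbox a b) x * \<bar>divA i t x\<bar> - indicator (cbox a b) x * \<epsilon> \<partial>lborel) \<le> (\<integral>x. indicator (cbox a b) x * (\<phi> x * divA i t x) \<partial>lborel)"
    proof (rule integral_mono)
      fix x
      have "\<bar>divA i t x\<bar> - \<epsilon> \<le> \<phi> x * divA i t x"
      proof -
        let ?s = "\<bar>divA i t x\<bar>"
        have p: "?s + \<epsilon> > 0" using \<epsilon> by (simp add: add_nonneg_pos)
        have "(?s - \<epsilon>) * (?s + \<epsilon>) \<le> divA i t x * divA i t x" by (simp add: algebra_simps abs_mult_self_eq)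
        then show ?thesis using p by (simp add: \<phi>_def pos_le_divide_eq)
      qed
      then show "indicator (cbox a b) x * \<bar>divA i t x\<bar> - indicator (cbox a b) x * \<epsilon> \<le> indicator (cbox a b) x * (\<phi> x * divA i t x)"
        by (auto simp: indicator_def)
    qed (use i1 i2 ibox in auto)
    also have "\<dots> \<le> Dv" by (rule divA_test[OF t c\<phi> \<phi>1 FV])
    finally have "(\<integral>x. indicator (cbox a b) x * \<bar>divA i t x\<bar> \<partial>lborel) - vol * \<epsilon> \<le> Dv"
      using i1 ibox by (simp add: vol_def)
    then show "(\<integral>x. indicator (cbox a b) x * \<bar>divA i t x\<bar> \<partial>lborel) \<le> Dv + e" using \<epsilon>(2) by (simp add: mult.commute)
  qed
  have "(\<lambda>k. \<integral>x. indicator (cbox (- (\<chi> i. real k)) (\<chi> i. real k)) x * \<bar>divA i t x\<bar> \<partial>lborel) \<longlonglongrightarrow> (\<integral>x. \<bar>divA i t x\<bar> \<partial>lborel)"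
  proof (rule integral_dominated_convergence[where w="\<lambda>x. \<bar>divA i t x\<bar>"])
    show "AE x in lborel. (\<lambda>k. indicator (cbox (- (\<chi> i. real k)) (\<chi> i. real k)) x * \<bar>divA i t x\<bar>) \<longlonglongrightarrow> \<bar>divA i t x\<bar>"
    proof (rule AE_I2)
      fix x :: "real^'n"
      obtain k0 :: nat where k0: "norm x \<le> real k0" using real_arch_simple by blast
      have "indicator (cbox (- (\<chi> i. real k)) (\<chi> i. real k)) x * \<bar>divA i t x\<bar> = \<bar>divA i t x\<bar>" if "k \<ge> k0" for k
      proof -
        have "\<bar>x $ i\<bar> \<le> real k" for i using component_le_norm_cart[of x i] k0 that by linarith
        then have "x \<in> cbox (- (\<chi> i. real k)) (\<chi> i. real k)" by (auto simp: mem_box_cart abs_le_iff) (metis minus_le_iff)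
        then show ?thesis by simp
      qed
      then show "(\<lambda>k. indicator (cbox (- (\<chi> i. real k)) (\<chi> i. real k)) x * \<bar>divA i t x\<bar>) \<longlonglongrightarrow> \<bar>divA i t x\<bar>"
        by (intro tendsto_eventually) (auto simp: eventually_sequentially)
    qed
    show "AE x in lborel. norm (indicator (cbox (- (\<chi> i. real k)) (\<chi> i. real k)) x * \<bar>divA i t x\<bar>) \<le> \<bar>divA i t x\<bar>" for k
      by (auto simp: indicator_def)
  qed (use i in auto)
  then show ?thesis by (rule LIMSEQ_le_const2) (use box in auto)
qed

text \<open>Every row of the tensor is tested separately by fields along one axis, whence the factor
  N.\<close>

lemma integral_sig_le:
  assumes t: "t > 0"
    and FV: "\<And>i q Q. (\<And>z. (q has_derivative (\<lambda>h. Q z \<bullet> h)) (at z)) \<Longrightarrow> continuous_on UNIV Q \<Longrightarrow> (\<And>z. \<bar>q z\<bar> \<le> 1) \<Longrightarrow>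
       (\<exists>R. \<forall>z. norm z > R \<longrightarrow> q z = 0) \<Longrightarrow> (\<integral>w. (Bf w $ i) \<bullet> Q (X w) \<partial>V) \<le> Dv"
  shows "(\<integral>x. sig t x \<partial>lborel) \<le> real CARD('n) * Dv"
proof -
  have i: "integrable lborel (\<lambda>x. \<bar>divA i t x\<bar>)" for i
  proof (rule Bochner_Integration.integrable_bound)
    show "integrable lborel (sig t)" by (rule integrable_sig[OF t])
    have "continuous_on UNIV (divA i t)" unfolding divA_def A1_def by (intro continuous_intros cont_mol BB_ok t)
    then show "(\<lambda>x. \<bar>divA i t x\<bar>) \<in> borel_measurable lborel" by (auto intro!: borel_measurable_continuous_onI continuous_intros)
    have "\<bar>divA i t x\<bar> \<le> sig t x" for x
      unfolding sig_def divA_def[symmetric] by (rule member_le_sum) auto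
    then show "AE x in lborel. norm \<bar>divA i t x\<bar> \<le> norm (sig t x)" by (auto intro: order_trans[OF _ abs_ge_self])
  qed
  have "(\<integral>x. sig t x \<partial>lborel) = (\<Sum>i\<in>UNIV. \<integral>x. \<bar>divA i t x\<bar> \<partial>lborel)"
    using i by (simp add: sig_def divA_def)
  also have "\<dots> \<le> (\<Sum>i\<in>(UNIV::'n set). Dv)" by (intro sum_mono integral_divA[OF t FV])
  finally show ?thesis by simp
qed

end

section \<open>Entropy at small and large scales\<close>

definition heat_mom :: "'n::finite itself \<Rightarrow> nat \<Rightarrow> real" where
  "heat_mom _ k = (\<integral>d. norm d ^ k * heat 1 d \<partial>(lborel :: (real^'n) measure))"

lemma heat_mom_nonneg: "heat_mom TYPE('n::finite) k \<ge> 0"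
  unfolding heat_mom_def using heat_pos[of 1, where 'a='n] by (intro Bochner_Integration.integral_nonneg) (simp add: less_imp_le)

text \<open>A radius in units of sqrt t whose square exceeds twice the second moment of the kernel;
  the + 1 keeps it positive.\<close>

definition spread :: "'n::finite itself \<Rightarrow> real" where
  "spread n = sqrt (2 * heat_mom n 2 + 1)"

text \<open>Chebyshev's inequality with the second moment, which is at most half of the squared
  radius.\<close>

lemma heat_ball_half:
  assumes t: "t > 0"
  shows "(\<integral>d. indicator {d. norm d \<le> spread TYPE('n) * sqrt t} d * heat t d \<partial>(lborel :: (real^'n) measure)) \<ge> 1/2"
proof -
  let ?l = "spread TYPE('n)"
  have l: "?l\<^sup>2 = 2 * heat_mom TYPE('n) 2 + 1" "?l > 0" using heat_mom_nonneg[of 2, where 'n='n] by (auto simp: spread_def)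
  have i0: "integrable lborel (heat t :: real^'n \<Rightarrow> real)" using heat_moment(1)[OF t, of 0, where 'n='n] by simp
  have i2: "integrable lborel (\<lambda>d::real^'n. (norm d / sqrt t)\<^sup>2 * heat t d)" by (rule heat_moment(1)[OF t])
  have im: "integrable lborel (\<lambda>d::real^'n. indicator {d. norm d \<le> ?l * sqrt t} d * heat t d)"
    using integrable_mult_indicator[OF _ i0, of "{d. norm d \<le> ?l * sqrt t}"] by simp
  have "(\<integral>d. heat t d - (1 / ?l\<^sup>2) * ((norm d / sqrt t)\<^sup>2 * heat t d) \<partial>(lborel :: (real^'n) measure)) \<le> (\<integral>d. indicator {d. norm d \<le> ?l * sqrt t} d * heat t d \<partial>(lborel :: (real^'n) measure))"
  proof (rule integral_mono)
    fix d :: "real^'n"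
    have h: "heat t d > 0" by (rule heat_pos[OF t])
    show "heat t d - (1 / ?l\<^sup>2) * ((norm d / sqrt t)\<^sup>2 * heat t d) \<le> indicator {d. norm d \<le> ?l * sqrt t} d * heat t d"
    proof (cases "norm d \<le> ?l * sqrt t")
      case True then show ?thesis using h by simp
    next
      case False
      then have "?l \<le> norm d / sqrt t" using t by (simp add: pos_le_divide_eq)
      then have "?l\<^sup>2 \<le> (norm d / sqrt t)\<^sup>2" using l by (intro power_mono) auto
      then have "1 \<le> (1 / ?l\<^sup>2) * (norm d / sqrt t)\<^sup>2" using l(2) by (simp add: pos_le_divide_eq)
      then have "1 * heat t d \<le> (1 / ?l\<^sup>2) * (norm d / sqrt t)\<^sup>2 * heat t d" using h by (intro mult_right_mono) auto
      then show ?thesis using False by (simp add: mult.assoc)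
    qed
  qed (use i0 i2 im in auto)
  also have "(\<integral>d. heat t d - (1 / ?l\<^sup>2) * ((norm d / sqrt t)\<^sup>2 * heat t d) \<partial>(lborel :: (real^'n) measure)) = 1 - heat_mom TYPE('n) 2 / ?l\<^sup>2"
    using i0 i2 heat_moment(2)[OF t, of 2, where 'n='n] heat_integral[OF t, where 'n='n] by (simp add: heat_mom_def)
  finally have "1 - heat_mom TYPE('n) 2 / ?l\<^sup>2 \<le> (\<integral>d. indicator {d. norm d \<le> ?l * sqrt t} d * heat t d \<partial>(lborel :: (real^'n) measure))" .
  moreover have "heat_mom TYPE('n) 2 / ?l\<^sup>2 \<le> 1/2" unfolding l(1) using heat_mom_nonneg[of 2, where 'n='n] by (simp add: divide_le_eq)
  ultimately show ?thesis by linarith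
qed

text \<open>The balls are the sections of the closed set of pairs at distance at most r.\<close>

lemma measurable_measure_cball:
  fixes M :: "'a::euclidean_space measure"
  assumes M: "finite_measure M" "sets M = sets borel"
  shows "(\<lambda>x. measure M (cball x r)) \<in> borel_measurable borel"
proof -
  interpret finite_measure M by fact
  let ?Q = "{p :: 'a \<times> 'a. dist (fst p) (snd p) \<le> r}"
  have "closed ?Q" by (intro closed_Collect_le continuous_intros)
  then have "?Q \<in> sets (borel \<Otimes>\<^sub>M borel)" unfolding borel_prod by (rule borel_closed)
  also have "sets (borel \<Otimes>\<^sub>M borel) = sets (borel \<Otimes>\<^sub>M M)" by (intro sets_pair_measure_cong refl) (simp add: M)
  finally have "(\<lambda>x. emeasure M (Pair x -` ?Q)) \<in> borel_measurable borel" by (rule measurable_emeasure_Pair)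
  moreover have "Pair x -` ?Q = cball x r" for x by auto
  ultimately have "(\<lambda>x. emeasure M (cball x r)) \<in> borel_measurable borel" by simp
  then show ?thesis unfolding measure_def by measurable
qed

text \<open>The scale at which the density is nearly attained depends on the point. Along radii
  tending to 0 almost every point is eventually good, so by dominated convergence a single radius
  serves at least half of the mass.\<close>

lemma density_scale:
  fixes M :: "(real^'n) measure"
  assumes M: "finite_measure M" "sets M = sets borel" and R: "R > 0" and \<theta>: "\<theta>\<^sub>0 > 0" and mass: "measure M UNIV > 0"
    and dens: "AE x in M. \<exists>d\<ge>ennreal \<theta>\<^sub>0. has_density m M x d"
  obtains r where "0 < r" "r \<le> R" "measure M {x. measure M (cball x r) \<ge> \<theta>\<^sub>0 / 2 * (unit_ball_vol (real m) * r ^ m)} \<ge> measure M UNIV / 2"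
proof -
  interpret finite_measure M by fact
  define r where "r k = R / real (Suc k)" for k
  have r: "0 < r k" "r k \<le> R" for k using R by (auto simp: r_def field_simps)
  have "(\<lambda>k. R * inverse (real (Suc k))) \<longlonglongrightarrow> R * 0" by (intro tendsto_intros LIMSEQ_inverse_real_of_nat)
  then have rl: "r \<longlonglongrightarrow> 0" unfolding r_def by (simp add: divide_inverse)
  have rl': "filterlim r (at_right 0) sequentially"
  proof -
    have "r k \<noteq> 0" for k using r(1)[of k] by simp
    then show ?thesis unfolding filterlim_at using rl r by auto
  qed
  define S where "S k = {x. measure M (cball x (r k)) \<ge> \<theta>\<^sub>0 / 2 * (unit_ball_vol (real m) * r k ^ m)}" for k
  have Sm: "S k \<in> sets borel" for k
  proof -
    have "S k = (\<lambda>x. measure M (cball x (r k))) -` {\<theta>\<^sub>0 / 2 * (unit_ball_vol (real m) * r k ^ m)..} \<inter> space borel" by (auto simp: S_def)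
    then show ?thesis using measurable_measure_cball[OF M, of "r k"] by (simp only:) (rule measurable_sets, auto)
  qed
  have ev: "AE x in M. \<forall>\<^sub>F k in sequentially. x \<in> S k"
    using dens
  proof eventually_elim
    case (elim x)
    then obtain d where d: "ennreal \<theta>\<^sub>0 \<le> d"
      "((\<lambda>r. emeasure M (cball x r) / ennreal (unit_ball_vol (real m) * r ^ m)) \<longlongrightarrow> d) (at_right 0)"
      by (auto simp: has_density_def)
    \<comment> \<open>Halving makes the inequality strict, so that it passes from the limit to the
      small radii.\<close>
    have "ennreal (\<theta>\<^sub>0 / 2) < ennreal \<theta>\<^sub>0" using \<theta> by (intro ennreal_lessI) auto
    then have "ennreal (\<theta>\<^sub>0 / 2) < d" using d(1) by simp
    from order_tendstoD(1)[OF d(2) this]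
    have "\<forall>\<^sub>F k in sequentially. ennreal (\<theta>\<^sub>0 / 2) < emeasure M (cball x (r k)) / ennreal (unit_ball_vol (real m) * r k ^ m)"
      using rl' by (rule eventually_compose_filterlim)
    then show ?case
    proof eventually_elim
      case (elim k)
      have v: "unit_ball_vol (real m) * r k ^ m > 0" using r(1)[of k] by simp
      have "emeasure M (cball x (r k)) = ennreal (measure M (cball x (r k)))" by (rule emeasure_eq_measure)
      then have "ennreal (\<theta>\<^sub>0 / 2) < ennreal (measure M (cball x (r k)) / (unit_ball_vol (real m) * r k ^ m))"
        using elim v by (simp add: divide_ennreal)
      then have "\<theta>\<^sub>0 / 2 < measure M (cball x (r k)) / (unit_ball_vol (real m) * r k ^ m)"
        using \<theta> by (subst (asm) ennreal_less_iff) auto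
      then show ?case using v unfolding S_def by (simp add: pos_less_divide_eq)
    qed
  qed
  have "(\<lambda>k. \<integral>x. indicator (S k) x \<partial>M) \<longlonglongrightarrow> (\<integral>x. (1::real) \<partial>M)"
  proof (rule integral_dominated_convergence[where w="\<lambda>_. 1"])
    show "(\<lambda>x. indicator (S k) x :: real) \<in> borel_measurable M" for k
      using Sm M(2) by (intro borel_measurable_indicator) auto
    show "AE x in M. (\<lambda>k. indicator (S k) x :: real) \<longlonglongrightarrow> 1"
      using ev
    proof eventually_elim
      case (elim x)
      then show ?case by (intro tendsto_eventually) (auto elim: eventually_mono)
    qed
  qed auto
  moreover have "(\<integral>x. indicator (S k) x \<partial>M) = measure M (S k)" for k using Sm M(2) by (simp add: sets_eq_imp_space_eq[OF M(2)])
  moreover have "(\<integral>x. (1::real) \<partial>M) = measure M UNIV" by (simp add: sets_eq_imp_space_eq[OF M(2)])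
  ultimately have "(\<lambda>k. measure M (S k)) \<longlonglongrightarrow> measure M UNIV" by simp
  moreover have "measure M UNIV / 2 < measure M UNIV" using mass by simp
  ultimately have "\<forall>\<^sub>F k in sequentially. measure M UNIV / 2 < measure M (S k)" by (rule order_tendstoD(1))
  then obtain k where "measure M UNIV / 2 < measure M (S k)" by (auto simp: eventually_sequentially)
  then show thesis using that[of "r k"] r unfolding S_def by auto
qed

text \<open>The kernel at time r^2 and distance (spread + 1) r, times the volume of the unit ball
  and the factor 1/2 lost in \<open>density_scale\<close>; the powers of r cancel.\<close>

definition start_const :: "'n::finite itself \<Rightarrow> nat \<Rightarrow> real" where
  "start_const n m = exp (- (spread n + 1)\<^sup>2 / 2) / gauss_mass n * unit_ball_vol (real m) / 2"

lemma start_const_pos: "start_const TYPE('n::finite) m > 0"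
  using gauss_mass_pos[where 'n='n] by (simp add: start_const_def)

text \<open>This and the following constants are stated outside the locale, so that they depend on
  N, K and m but not on the varifold.\<close>

definition pen_const :: "'n::finite itself \<Rightarrow> real \<Rightarrow> real" where
  "pen_const n K = 9 * real CARD('n) ^ 6 * K\<^sup>2 / 2"

definition flux_const :: "'n::finite itself \<Rightarrow> real \<Rightarrow> real" where
  "flux_const n K = pen_const n K * (3 * real CARD('n) ^ 3 * K\<^sup>2)"

text \<open>Large enough that the third-moment part of Young's inequality costs at most one unit of
  mass; the + 1 keeps it positive.\<close>

definition balance_const :: "'n::finite itself \<Rightarrow> real \<Rightarrow> real" where
  "balance_const n K = 2 * flux_const n K * ((real CARD('n))\<^sup>2 * K * heat_mom n 3) + 1"

text \<open>What the entropy gain has to beat per unit of mass: the initial penalty, the logarithm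
  at the final time, and two spare units.\<close>

definition log_const :: "'n::finite itself \<Rightarrow> real \<Rightarrow> real" where
  "log_const n K = pen_const n K * (real CARD('n))\<^sup>2 * K\<^sup>2 + ln (1 + 1 / gauss_mass n) + 2"

text \<open>The power 1/m stems from the radius R, which is proportional to the m-th root of mass
  over \<open>\<theta>\<^sub>0\<close>.\<close>

definition ms_const :: "'n::finite itself \<Rightarrow> real \<Rightarrow> nat \<Rightarrow> real" where
  "ms_const n K m = 2 * flux_const n K * balance_const n K * (exp (4 * log_const n K) / start_const n m) powr (1 / real m)"

context tensor_flow
begin

text \<open>The kernel at time T is at most T^(-N/2) / gauss_mass. Hence T^codim mu is at most
  \<eta> / gauss_mass, and the logarithm exceeds ln \<eta> by at most a constant.\<close>

lemma entropy_end:
  assumes T: "T > 0" and \<eta>: "\<eta> = mass / sqrt T ^ dm"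
  shows "(\<integral>x. ent \<eta> T x \<partial>lborel) \<le> mass * (ln \<eta> + ln (1 + 1 / gauss_mass TYPE('n)))"
proof -
  let ?g = "gauss_mass TYPE('n)"
  have g: "?g > 0" by (rule gauss_mass_pos)
  have m0: "mass > 0" using V_pos by (simp add: mass_def)
  have \<eta>0: "\<eta> > 0" using m0 T by (simp add: \<eta>)
  have le: "ent \<eta> T x \<le> (ln \<eta> + ln (1 + 1 / ?g)) * mu T x" for x
  proof -
    have "mu T x \<le> (\<integral>w. T powr (- real CARD('n) / 2) / ?g \<partial>V)"
      unfolding mu_def mol_def
    proof (rule integral_mono)
      show "integrable V (\<lambda>w. 1 * heat T (x - X w))" by (rule integrable_mol(1)[OF one_ok T])
      show "1 * heat T (x - X w) \<le> T powr (- real CARD('n) / 2) / ?g" for w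
        using T g unfolding heat_def by (simp add: divide_right_mono mult_le_cancel_left1)
    qed auto
    then have "mu T x \<le> mass * (T powr (- real CARD('n) / 2) / ?g)" by (simp add: mass_def)
    then have "T powr codim * mu T x \<le> T powr codim * (mass * (T powr (- real CARD('n) / 2) / ?g))" by (intro mult_left_mono) auto
    also have "\<dots> = mass * (T powr codim * T powr (- real CARD('n) / 2)) / ?g" by simp
    also have "T powr codim * T powr (- real CARD('n) / 2) = 1 / sqrt T ^ dm"
    proof -
      have "T powr codim * T powr (- real CARD('n) / 2) = T powr (- (real dm / 2))"
        by (simp add: codim_def flip: powr_add) (simp add: field_simps)
      also have "\<dots> = 1 / sqrt T ^ dm" using T
        by (simp add: powr_minus_divide powr_half_sqrt[symmetric] powr_powr flip: powr_realpow)
      finally show ?thesis .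
    qed
    finally have "T powr codim * mu T x \<le> \<eta> / ?g" by (simp add: \<eta>)
    then have "T powr codim * mu T x + \<eta> \<le> \<eta> * (1 + 1 / ?g)" by (simp add: distrib_left)
    moreover have "T powr codim * mu T x + \<eta> > 0" using mu_pos[OF T, of x] \<eta>0 T by (intro add_nonneg_pos) auto
    ultimately have "ln (T powr codim * mu T x + \<eta>) \<le> ln (\<eta> * (1 + 1 / ?g))" by (intro ln_mono) auto
    also have "\<dots> = ln \<eta> + ln (1 + 1 / ?g)" using \<eta>0 add_pos_pos[of 1 "1 / ?g"] g by (simp add: ln_mult)
    finally show ?thesis using mu_pos[OF T, of x] by (simp add: ent_def mult.commute)
  qed
  have "(\<integral>x. ent \<eta> T x \<partial>lborel) \<le> (\<integral>x. (ln \<eta> + ln (1 + 1 / ?g)) * mu T x \<partial>lborel)"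
    using integrable_fixed[OF T \<eta>0] le by (intro integral_mono) auto
  also have "\<dots> = mass * (ln \<eta> + ln (1 + 1 / ?g))" using integrable_fixed[OF T \<eta>0] by simp
  finally show ?thesis .
qed

text \<open>At time r^2 the rescaled density exceeds a multiple of \<open>\<theta>\<^sub>0\<close>
  within distance spread r of every good point, and this region catches half of the kernel centred
  there. Good points carry half of the mass, so a quarter of the mass gains the logarithmic jump,
  while ln \<eta> is a lower bound elsewhere.\<close>

lemma entropy_start:
  assumes r: "r > 0" and \<eta>: "\<eta> > 0" and \<theta>: "\<theta>\<^sub>0 > 0"
    and half: "measure (distr V borel X) {x. measure (distr V borel X) (cball x r) \<ge> \<theta>\<^sub>0 / 2 * (unit_ball_vol (real dm) * r ^ dm)} \<ge> mass / 2"
  shows "(\<integral>x. ent \<eta> (r\<^sup>2) x \<partial>lborel) \<ge> mass * ln \<eta> + mass / 4 * ln (start_const TYPE('n) dm * \<theta>\<^sub>0 / \<eta>)"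
proof -
  define t where "t = r\<^sup>2"
  have t: "t > 0" "sqrt t = r" using r by (auto simp: t_def)
  let ?c = "start_const TYPE('n) dm" and ?l = "spread TYPE('n)"
  have c: "?c > 0" by (rule start_const_pos)
  have m0: "mass > 0" using V_pos by (simp add: mass_def)
  define S where "S = {x. measure (distr V borel X) (cball x r) \<ge> \<theta>\<^sub>0 / 2 * (unit_ball_vol (real dm) * r ^ dm)}"
  define U where "U = {x. ?c * \<theta>\<^sub>0 \<le> t powr codim * mu t x}"
  have fd: "finite_measure (distr V borel X)" by (rule finite_measure_distr) simp
  have Sm: "S \<in> sets borel"
  proof -
    have "S = (\<lambda>x. measure (distr V borel X) (cball x r)) -` {\<theta>\<^sub>0 / 2 * (unit_ball_vol (real dm) * r ^ dm)..} \<inter> space borel" by (auto simp: S_def)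
    then show ?thesis using measurable_measure_cball[OF fd, of r] by (simp only:) (rule measurable_sets, auto)
  qed
  have cmu: "continuous_on UNIV (mu t)" unfolding mu_def by (rule cont_mol(1)[OF one_ok t(1)])
  have Um[measurable]: "U \<in> sets borel"
    unfolding U_def by (intro borel_closed closed_Collect_le continuous_intros cmu)
  have hm[measurable]: "(heat t :: real^'n \<Rightarrow> real) \<in> borel_measurable borel" by (rule heat_measurable[OF t(1)])
  \<comment> \<open>The ball of radius r around \<open>X w\<close> lies within (spread + 1) r of x,
    where the kernel at time r^2 is at least the constant \<open>q\<close>.\<close>
  have SU: "x \<in> U" if w: "X w \<in> S" and x: "norm (x - X w) \<le> ?l * r" for w x
  proof -
    define q where "q = t powr (- real CARD('n) / 2) * exp (- (?l + 1)\<^sup>2 / 2) / gauss_mass TYPE('n)"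
    let ?B = "X -` cball (X w) r \<inter> space V"
    have Bm: "?B \<in> sets V" by measurable
    have "q * measure V ?B = (\<integral>w'. q * indicator ?B w' \<partial>V)" by simp
    also have "\<dots> \<le> mu t x" unfolding mu_def mol_def
    proof (rule integral_mono)
      show "integrable V (\<lambda>w'. q * indicator ?B w')" using Bm by (intro integrable_mult_right integrable_real_indicator) (auto simp: emeasure_eq_measure)
      show "integrable V (\<lambda>w. 1 * heat t (x - X w))" by (rule integrable_mol(1)[OF one_ok t(1)])
      fix w'
      show "q * indicator ?B w' \<le> 1 * heat t (x - X w')"
      proof (cases "w' \<in> ?B")
        case True
        then have "norm (X w - X w') \<le> r" by (simp add: dist_norm)
        moreover have "x - X w' = (x - X w) + (X w - X w')" by simp
        ultimately have "norm (x - X w') \<le> ?l * r + r" using x norm_triangle_ineq[of "x - X w" "X w - X w'"] by simp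
        then have "(norm (x - X w'))\<^sup>2 \<le> ((?l + 1) * r)\<^sup>2" by (intro power_mono) (auto simp: algebra_simps)
        then have "(norm (x - X w'))\<^sup>2 \<le> (?l + 1)\<^sup>2 * r\<^sup>2" by (simp only: power_mult_distrib)
        then have "(norm (x - X w'))\<^sup>2 / (2 * t) \<le> (?l + 1)\<^sup>2 / 2"
          using r unfolding t_def by (simp add: divide_le_eq)
        then have "exp (- (?l + 1)\<^sup>2 / 2) \<le> exp (- (norm (x - X w'))\<^sup>2 / (2 * t))" by simp
        then show ?thesis using True gauss_mass_pos[where 'n='n] unfolding q_def heat_def by (simp add: divide_right_mono mult_left_mono)
      next
        case False then show ?thesis using heat_pos[OF t(1), of "x - X w'"] by simp
      qed
    qed
    finally have 1: "q * measure V ?B \<le> mu t x" .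
    have "measure V ?B = measure (distr V borel X) (cball (X w) r)" by (simp add: measure_distr)
    also have "\<dots> \<ge> \<theta>\<^sub>0 / 2 * (unit_ball_vol (real dm) * r ^ dm)" using w by (simp add: S_def)
    finally have "q * (\<theta>\<^sub>0 / 2 * (unit_ball_vol (real dm) * r ^ dm)) \<le> q * measure V ?B"
      using gauss_mass_pos[where 'n='n] by (intro mult_left_mono) (auto simp: q_def)
    with 1 have "t powr codim * (q * (\<theta>\<^sub>0 / 2 * (unit_ball_vol (real dm) * r ^ dm))) \<le> t powr codim * mu t x" by (intro mult_left_mono) auto
    moreover have "t powr codim * (q * (\<theta>\<^sub>0 / 2 * (unit_ball_vol (real dm) * r ^ dm))) = ?c * \<theta>\<^sub>0"
    proof -
      have p: "t powr codim * t powr (- real CARD('n) / 2) * r ^ dm = 1"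
      proof -
        have "t powr codim * t powr (- real CARD('n) / 2) = t powr (- (real dm / 2))"
          by (simp add: codim_def flip: powr_add) (simp add: field_simps)
        also have "\<dots> = 1 / sqrt t ^ dm" using t(1)
          by (simp add: powr_minus_divide powr_half_sqrt[symmetric] powr_powr flip: powr_realpow)
        finally show ?thesis using r t by simp
      qed
      have "t powr codim * (q * (\<theta>\<^sub>0 / 2 * (unit_ball_vol (real dm) * r ^ dm))) =
        (t powr codim * t powr (- real CARD('n) / 2) * r ^ dm) * (exp (- (?l + 1)\<^sup>2 / 2) / gauss_mass TYPE('n) * unit_ball_vol (real dm) / 2 * \<theta>\<^sub>0)"
        by (simp add: q_def)
      then show ?thesis unfolding p by (simp add: start_const_def)
    qed
    ultimately show ?thesis by (simp only: U_def mem_Collect_eq)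
  qed
  \<comment> \<open>The gain of the logarithm over its lower bound ln \<eta> on the set
    \<open>U\<close>.\<close>
  define jump where "jump = ln (?c * \<theta>\<^sub>0 + \<eta>) - ln \<eta>"
  have jump0: "jump \<ge> 0" using ln_mono[of \<eta> "?c * \<theta>\<^sub>0 + \<eta>"] mult_pos_pos[OF c \<theta>] \<eta> by (simp add: jump_def)
  have imu: "integrable lborel (mu t)" using integrable_fixed(1)[OF t(1) \<eta>] .
  have iU: "integrable lborel (\<lambda>x. indicator U x * mu t x)" using integrable_mult_indicator[OF _ imu, of U] Um by simp
  have "mass * ln \<eta> + jump * (\<integral>x. indicator U x * mu t x \<partial>lborel) = (\<integral>x. ln \<eta> * mu t x + jump * (indicator U x * mu t x) \<partial>lborel)"
    using imu iU integrable_fixed(7)[OF t(1) \<eta>] by simp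
  also have "\<dots> \<le> (\<integral>x. ent \<eta> t x \<partial>lborel)"
  proof (rule integral_mono)
    fix x
    have mu0: "mu t x > 0" by (rule mu_pos[OF t(1)])
    have p: "t powr codim * mu t x \<ge> 0" using mu0 by simp
    have "ln \<eta> + jump * indicator U x \<le> ln (t powr codim * mu t x + \<eta>)"
    proof (cases "x \<in> U")
      case True
      then have "?c * \<theta>\<^sub>0 + \<eta> \<le> t powr codim * mu t x + \<eta>" by (simp add: U_def)
      then have "ln (?c * \<theta>\<^sub>0 + \<eta>) \<le> ln (t powr codim * mu t x + \<eta>)" using c \<theta> \<eta> by (intro ln_mono) (auto intro: add_pos_pos)
      then show ?thesis using True by (simp add: jump_def)
    next
      case False
      have "ln \<eta> \<le> ln (t powr codim * mu t x + \<eta>)" using p \<eta> by (intro ln_mono) auto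
      then show ?thesis using False by simp
    qed
    then have "(ln \<eta> + jump * indicator U x) * mu t x \<le> ln (t powr codim * mu t x + \<eta>) * mu t x" using mu0 by (intro mult_right_mono) auto
    then show "ln \<eta> * mu t x + jump * (indicator U x * mu t x) \<le> ent \<eta> t x" by (simp add: ent_def algebra_simps)
  qed (use imu iU integrable_fixed(2)[OF t(1) \<eta>] in auto)
  finally have 1: "mass * ln \<eta> + jump * (\<integral>x. indicator U x * mu t x \<partial>lborel) \<le> (\<integral>x. ent \<eta> t x \<partial>lborel)" .
  have 2: "(\<integral>x. indicator U x * mu t x \<partial>lborel) \<ge> mass / 4"
  proof -
    interpret pair_sigma_finite V "lborel :: (real^'n) measure"
      by (intro pair_sigma_finite.intro sigma_finite_measure_axioms sigma_finite_lborel)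
    let ?H = "\<lambda>(w, x). indicator U x * heat t (x - X w)"
    have tr: "(\<integral>x. heat t (x - z) \<partial>lborel) = 1" "integrable lborel (\<lambda>x. heat t (x - z))" for z :: "real^'n"
      using lborel_translation_integral[of "heat t" "-z"] heat_integral[OF t(1), where 'n='n] heat_moment(1)[OF t(1), of 0, where 'n='n] by simp_all
    have hp: "heat t d \<ge> 0" for d :: "real^'n" using heat_pos[OF t(1), of d] by simp
    have Hx: "integrable lborel (\<lambda>x. ?H (w, x))" for w using integrable_mult_indicator[OF _ tr(2)[of "X w"], of U] Um by simp
    have Hle: "(\<integral>x. norm (?H (w, x)) \<partial>lborel) \<le> 1" for w
    proof -
      have "(\<integral>x. norm (?H (w, x)) \<partial>lborel) \<le> (\<integral>x. heat t (x - X w) \<partial>lborel)"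
        using integrable_norm[OF Hx] tr(2) hp by (intro integral_mono) (auto simp: indicator_def)
      then show ?thesis by (simp add: tr)
    qed
    have Hm: "?H \<in> borel_measurable (V \<Otimes>\<^sub>M lborel)" by measurable
    have Hi: "integrable (V \<Otimes>\<^sub>M lborel) ?H"
    proof (rule Fubini_integrable[OF Hm])
      show "AE w in V. integrable lborel (\<lambda>x. ?H (w, x))" using Hx by auto
      show "integrable V (\<lambda>w. \<integral>x. norm (?H (w, x)) \<partial>lborel)"
      proof (rule integrable_const_bound[where B=1])
        have "0 \<le> (\<integral>x. norm (?H (w, x)) \<partial>lborel)" for w by (rule Bochner_Integration.integral_nonneg) auto
        then show "AE w in V. norm (\<integral>x. norm (?H (w, x)) \<partial>lborel) \<le> 1" using Hle by auto
        show "(\<lambda>w. \<integral>x. norm (?H (w, x)) \<partial>lborel) \<in> borel_measurable V" using Hm by measurable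
      qed
    qed
    have "(\<integral>x. indicator U x * mu t x \<partial>lborel) = (\<integral>x. (\<integral>w. ?H (w, x) \<partial>V) \<partial>lborel)"
      by (simp add: mu_def mol_def)
    also have "\<dots> = (\<integral>w. (\<integral>x. ?H (w, x) \<partial>lborel) \<partial>V)" using Fubini_integral[of "\<lambda>w x. ?H (w, x)"] Hi by simp
    also have "\<dots> \<ge> (\<integral>w. 1/2 * indicator (X -` S \<inter> space V) w \<partial>V)"
    proof (rule integral_mono)
      show "integrable V (\<lambda>w. 1/2 * indicator (X -` S \<inter> space V) w :: real)"
        using measurable_sets[OF X_measurable Sm] by (intro integrable_mult_right integrable_real_indicator) (auto simp: emeasure_eq_measure)
      show "integrable V (\<lambda>w. \<integral>x. ?H (w, x) \<partial>lborel)" using integrable_fst'[OF Hi] by simp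
      fix w assume "w \<in> space V"
      show "1/2 * indicator (X -` S \<inter> space V) w \<le> (\<integral>x. ?H (w, x) \<partial>lborel)"
      proof (cases "X w \<in> S")
        case True
        have "1/2 \<le> (\<integral>d. indicator {d. norm d \<le> ?l * r} d * heat t d \<partial>(lborel :: (real^'n) measure))"
          using heat_ball_half[OF t(1), where 'n='n] by (simp add: t)
        also have "\<dots> = (\<integral>x. indicator {d. norm d \<le> ?l * r} (x - X w) * heat t (x - X w) \<partial>lborel)"
          using lborel_translation_integral(1)[of "\<lambda>d. indicator {d. norm d \<le> ?l * r} d * heat t d" "- X w"] by simp
        also have "\<dots> \<le> (\<integral>x. ?H (w, x) \<partial>lborel)"
        proof (rule integral_mono)
          have "{x. norm (x - X w) \<le> ?l * r} \<in> sets lborel" by measurable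
          from integrable_mult_indicator[OF this tr(2)[of "X w"]]
          show "integrable lborel (\<lambda>x. indicator {d. norm d \<le> ?l * r} (x - X w) * heat t (x - X w))"
            by (simp add: indicator_def)
          show "integrable lborel (\<lambda>x. ?H (w, x))" by (rule Hx)
          fix x
          show "indicator {d. norm d \<le> ?l * r} (x - X w) * heat t (x - X w) \<le> ?H (w, x)"
            using SU[OF True, of x] hp[of "x - X w"] by (auto simp: indicator_def)
        qed
        finally show ?thesis using True by (simp add: indicator_def)
      next
        case False
        have "(\<integral>x. ?H (w, x) \<partial>lborel) \<ge> 0" using hp by (intro Bochner_Integration.integral_nonneg) auto
        then show ?thesis using False by simp
      qed
    qed
    also have "(\<integral>w. 1/2 * indicator (X -` S \<inter> space V) w \<partial>V) = 1/2 * measure (distr V borel X) S"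
      using Sm by (simp add: measure_distr)
    finally show ?thesis using half by (simp add: S_def)
  qed
  have "ln (?c * \<theta>\<^sub>0 / \<eta>) \<le> jump"
  proof -
    have "ln (?c * \<theta>\<^sub>0 / \<eta>) = ln (?c * \<theta>\<^sub>0) - ln \<eta>" using c \<theta> \<eta> by (simp add: ln_div)
    also have "\<dots> \<le> jump" unfolding jump_def using c \<theta> \<eta> by (intro diff_right_mono ln_mono) auto
    finally show ?thesis .
  qed
  then have "mass / 4 * ln (?c * \<theta>\<^sub>0 / \<eta>) \<le> mass / 4 * jump" using m0 by (intro mult_left_mono) auto
  also have "\<dots> \<le> jump * (\<integral>x. indicator U x * mu t x \<partial>lborel)" using mult_left_mono[OF 2 jump0] by (simp add: mult.commute)
  finally show ?thesis using 1 by (simp add: t_def)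
qed


text \<open>With \<eta> = mass / R^dm the initial entropy exceeds mass ln \<eta> by q mass, and the
  final one exceeds it by less. The growth inequality makes the first variation pay for the
  difference: mass \<le> const R Dv. Inserting R, a constant times (mass /
  \<open>\<theta>\<^sub>0\<close>)^(1/dm), gives the exponents.\<close>

lemma michael_simon:
  assumes dm1: "dm \<ge> 1" and \<theta>: "\<theta>\<^sub>0 > 0" and Dv0: "Dv \<ge> 0"
    and sig: "\<And>t. t > 0 \<Longrightarrow> (\<integral>x. sig t x \<partial>lborel) \<le> Dv"
    and dens: "AE x in distr V borel X. \<exists>d\<ge>ennreal \<theta>\<^sub>0. has_density dm (distr V borel X) x d"
  shows "mass powr ((real dm - 1) / real dm) \<le> ms_const TYPE('n) K dm * \<theta>\<^sub>0 powr (- 1 / real dm) * Dv"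
proof -
  let ?n = "TYPE('n)"
  define c where "c = start_const ?n dm"
  define q where "q = log_const ?n K"
  define C1 where "C1 = flux_const ?n K"
  define L0 where "L0 = balance_const ?n K"
  define Cb where "Cb = (real CARD('n))\<^sup>2 * K * heat_mom ?n 3"
  have c: "c > 0" unfolding c_def by (rule start_const_pos)
  have m0: "mass > 0" using V_pos by (simp add: mass_def)
  have P: "Cpen = pen_const ?n K" by (simp add: Cpen_def pen_const_def)
  have C1: "Cpen * (3 * real CARD('n) ^ 3 * K\<^sup>2) = C1" by (simp add: C1_def flux_const_def P)
  have C10: "C1 \<ge> 0" by (simp add: C1_def flux_const_def pen_const_def)
  have Cb0: "Cb \<ge> 0" using K heat_mom_nonneg[of 3, where 'n='n] by (simp add: Cb_def)
  have L0: "L0 = 2 * C1 * Cb + 1" "L0 > 0" using C10 Cb0 by (auto simp: L0_def balance_const_def C1_def Cb_def add_nonneg_pos)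
  \<comment> \<open>Makes the argument of the logarithm in \<open>entropy_start\<close> equal to exp
    (4 q); the 4 offsets the quarter of the mass there.\<close>
  define R where "R = (exp (4 * q) * mass / (c * \<theta>\<^sub>0)) powr (1 / real dm)"
  have R: "R > 0" using c \<theta> m0 by (simp add: R_def)
  have Rm: "R ^ dm = exp (4 * q) * mass / (c * \<theta>\<^sub>0)"
  proof -
    have "R ^ dm = R powr real dm" using R by (simp add: powr_realpow)
    also have "\<dots> = exp (4 * q) * mass / (c * \<theta>\<^sub>0)" unfolding R_def powr_powr using dm1 c \<theta> m0 by simp
    finally show ?thesis .
  qed
  define \<eta> where "\<eta> = mass / R ^ dm"
  have \<eta>0: "\<eta> > 0" using m0 R by (simp add: \<eta>_def)
  have ce: "c * \<theta>\<^sub>0 / \<eta> = exp (4 * q)" unfolding \<eta>_def Rm using c \<theta> m0 by simp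
  have fd: "finite_measure (distr V borel X)" by (rule finite_measure_distr) simp
  have md: "measure (distr V borel X) UNIV = mass" by (simp add: measure_distr mass_def)
  obtain r where r: "0 < r" "r \<le> R" "measure (distr V borel X) {x. measure (distr V borel X) (cball x r) \<ge> \<theta>\<^sub>0 / 2 * (unit_ball_vol (real dm) * r ^ dm)} \<ge> mass / 2"
    using density_scale[OF fd _ R \<theta> _ dens] m0 unfolding md by auto
  define T where "T = R\<^sup>2"
  have T: "T > 0" "sqrt T = R" using R by (auto simp: T_def)
  have T4: "T powr (1/4) = sqrt R"
  proof -
    have "T powr (1/4) = (T powr (1/2)) powr (1/2)" by (simp add: powr_powr)
    also have "\<dots> = sqrt R" using T R by (simp add: powr_half_sqrt)
    finally show ?thesis .
  qed
  have rT: "0 < r\<^sup>2" "r\<^sup>2 \<le> T" using r by (auto simp: T_def power_mono)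
  \<comment> \<open>Since T^(1/4) = sqrt R, this weight makes the first variation term linear in R
    and the remaining term at most \<open>mass\<close>.\<close>
  define la where "la = L0 * sqrt R"
  have la: "la > 0" using L0 R by (simp add: la_def)
  have e1: "(\<integral>x. ent \<eta> T x \<partial>lborel) \<le> mass * (ln \<eta> + ln (1 + 1 / gauss_mass ?n))"
    by (rule entropy_end[OF T(1)]) (simp add: \<eta>_def T)
  have e2: "(\<integral>x. ent \<eta> (r\<^sup>2) x \<partial>lborel) \<ge> mass * ln \<eta> + mass / 4 * (4 * q)"
    using entropy_start[OF r(1) \<eta>0 \<theta> r(3)] ce by (simp add: c_def)
  have M3: "(real CARD('n))\<^sup>2 * K * M3 = Cb" by (simp add: Cb_def M3_def heat_mom_def)
  have e3: "(\<integral>x. ent \<eta> T x \<partial>lborel) \<ge> (\<integral>x. ent \<eta> (r\<^sup>2) x \<partial>lborel) - Cpen * (real CARD('n))\<^sup>2 * K\<^sup>2 * mass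
     - 4 * C1 * sqrt R * (la * Dv / 2 + Cb * mass / (2 * la))"
    using entropy_inequality[OF rT \<eta>0 la sig Dv0] unfolding C1 M3 T4 .
  have e4: "4 * C1 * sqrt R * (la * Dv / 2 + Cb * mass / (2 * la)) \<le> 2 * C1 * L0 * R * Dv + mass"
  proof -
    have s: "sqrt R > 0" "sqrt R * sqrt R = R" using R by auto
    have "4 * C1 * sqrt R * (la * Dv / 2 + Cb * mass / (2 * la)) = 2 * C1 * L0 * (sqrt R * sqrt R) * Dv + (2 * C1 * Cb / L0) * mass"
      using s(1) L0(2) by (simp add: la_def field_simps)
    moreover have "2 * C1 * Cb / L0 \<le> 1" using L0 by (simp add: divide_le_eq)
    then have "(2 * C1 * Cb / L0) * mass \<le> 1 * mass" using m0 by (intro mult_right_mono) auto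
    ultimately show ?thesis using s(2) by simp
  qed
  have qe: "q * mass = Cpen * (real CARD('n))\<^sup>2 * K\<^sup>2 * mass + mass * ln (1 + 1 / gauss_mass ?n) + 2 * mass"
    by (simp add: q_def log_const_def P algebra_simps)
  have "mass * (ln \<eta> + ln (1 + 1 / gauss_mass ?n)) = mass * ln \<eta> + mass * ln (1 + 1 / gauss_mass ?n)" by (simp add: distrib_left)
  moreover have "mass / 4 * (4 * q) = q * mass" by simp
  \<comment> \<open>Of the two spare units in \<open>log_const\<close> one pays for the remainder of
    Young's inequality and the other survives as the left side.\<close>
  ultimately have main: "mass \<le> 2 * C1 * L0 * R * Dv" using e1 e2 e3 e4 qe by linarith
  have Re: "R = (exp (4 * q) / c) powr (1 / real dm) * mass powr (1 / real dm) * \<theta>\<^sub>0 powr (- 1 / real dm)"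
  proof -
    have "R = ((exp (4 * q) / c) * mass / \<theta>\<^sub>0) powr (1 / real dm)" by (simp add: R_def)
    also have "\<dots> = ((exp (4 * q) / c) * mass) powr (1 / real dm) / \<theta>\<^sub>0 powr (1 / real dm)"
      by (rule powr_divide)
    also have "((exp (4 * q) / c) * mass) powr (1 / real dm) = (exp (4 * q) / c) powr (1 / real dm) * mass powr (1 / real dm)"
      by (rule powr_mult)
    also have "\<dots> / \<theta>\<^sub>0 powr (1 / real dm) = \<dots> * \<theta>\<^sub>0 powr (- (1 / real dm))"
      by (simp add: powr_minus_divide)
    finally show ?thesis by simp
  qed
  have "mass powr ((real dm - 1) / real dm) = mass / mass powr (1 / real dm)"
    using m0 dm1 by (simp add: diff_divide_distrib powr_diff)
  also have "\<dots> \<le> 2 * C1 * L0 * R * Dv / mass powr (1 / real dm)"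
    using main m0 by (intro divide_right_mono) auto
  also have "\<dots> = ms_const ?n K dm * \<theta>\<^sub>0 powr (- 1 / real dm) * Dv"
    using m0 by (simp add: Re ms_const_def C1_def L0_def q_def c_def)
  finally show ?thesis .
qed

end

section \<open>The Michael-Simon inequality\<close>

text \<open>A scalar test function times a coordinate vector is an admissible field that sees a
  single row of the tensor.\<close>

lemma test_field_axis:
  fixes q :: "real^'n \<Rightarrow> real" and Q :: "real^'n \<Rightarrow> real^'n" and i :: 'n
  assumes q: "\<And>z. (q has_derivative (\<lambda>h. Q z \<bullet> h)) (at z)" and Q: "continuous_on UNIV Q"
    and supp: "\<And>z. norm z > R \<Longrightarrow> q z = 0"
  defines "g \<equiv> \<lambda>z. q z *\<^sub>R (axis i 1 :: real^'n)"
  shows "g \<in> test_fields UNIV" and "B \<bullet> matrix (frechet_derivative g (at x)) = (B $ i) \<bullet> Q x"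
proof -
  have D: "(g has_derivative (\<lambda>h. (Q z \<bullet> h) *\<^sub>R axis i 1)) (at z)" for z
    unfolding g_def by (rule has_derivative_scaleR_left[OF q])
  have bl: "bounded_linear (\<lambda>h. (Q z \<bullet> h) *\<^sub>R (axis i 1 :: real^'n))" for z
    using D has_derivative_bounded_linear by blast
  have "C1_on UNIV g" unfolding C1_on_def
  proof (intro exI[of _ "\<lambda>z. Blinfun (\<lambda>h. (Q z \<bullet> h) *\<^sub>R axis i 1)"] conjI ballI)
    show "(g has_derivative blinfun_apply (Blinfun (\<lambda>h. (Q z \<bullet> h) *\<^sub>R axis i 1))) (at z)" for z
      using D[of z] by (simp add: bounded_linear_Blinfun_apply[OF bl])
    show "continuous_on UNIV (\<lambda>z. Blinfun (\<lambda>h. (Q z \<bullet> h) *\<^sub>R (axis i 1 :: real^'n)))"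
      by (rule continuous_on_blinfun_componentwise)
        (simp add: bounded_linear_Blinfun_apply[OF bl], intro continuous_intros Q)
  qed
  moreover have "compact (closure {z. g z \<noteq> 0})"
  proof -
    have "{z. g z \<noteq> 0} \<subseteq> cball 0 R" using supp by (auto simp: g_def not_less[symmetric])
    then have "bounded {z. g z \<noteq> 0}" using bounded_cball bounded_subset by blast
    then show ?thesis by (simp add: compact_closure)
  qed
  ultimately show "g \<in> test_fields UNIV" by (simp add: test_fields_def)
  have f: "frechet_derivative g (at x) = (\<lambda>h. (Q x \<bullet> h) *\<^sub>R axis i 1)"
    using frechet_derivative_at[OF D[of x]] by simp
  have "B \<bullet> matrix (frechet_derivative g (at x)) = (\<Sum>a\<in>UNIV. \<Sum>b\<in>UNIV. if a = i then B $ i $ b * Q x $ b else 0)"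
    unfolding f matrix_def inner_vec_def
    by (intro sum.cong refl) (auto simp: axis_def inner_vec_def if_distrib cong: if_cong)
  also have "\<dots> = (\<Sum>a\<in>UNIV. if a = i then \<Sum>b\<in>UNIV. B $ i $ b * Q x $ b else 0)"
    by (intro sum.cong) auto
  also have "\<dots> = (B $ i) \<bullet> Q x" by (simp add: inner_vec_def)
  finally show "B \<bullet> matrix (frechet_derivative g (at x)) = (B $ i) \<bullet> Q x" .
qed

lemma compact_bound:
  assumes "compact S" "continuous_on S (f :: _ \<Rightarrow> real)"
  shows "\<exists>b. 0 \<le> b \<and> (\<forall>x\<in>S. \<bar>f x\<bar> \<le> b)"
proof -
  have "bounded (f ` S)" by (intro compact_imp_bounded compact_continuous_image assms)
  then obtain b where "\<forall>x\<in>S. \<bar>f x\<bar> \<le> b" by (auto simp: bounded_iff)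
  then show ?thesis by (intro exI[of _ "\<bar>b\<bar>"]) (auto intro: order_trans)
qed

theorem USAC_imp_supports_Michael_Simon:
  fixes \<Psi> :: "real^'n^'n \<Rightarrow> real"
  assumes m: "1 \<le> m" "m < CARD('n)" and U: "USAC m \<Psi>"
  shows "supports_Michael_Simon m \<Psi>"
proof -
  have I: "C1_integrand m \<Psi>" using U by (simp add: USAC_def)
  define KK where "KK = convex hull (B_int m \<Psi> ` grassmannian m)"
  have KK: "compact KK" "convex KK" unfolding KK_def using compact_B_hull[OF I] by auto
  have rank: "dim (rows A) \<ge> m" if "A \<in> KK" for A using USAC_rank[OF m(2) U] that by (simp add: KK_def)
  define Mf :: "'n \<Rightarrow> 'n \<Rightarrow> real^'n^'n \<Rightarrow> real" where "Mf = row_projector m"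
  have "C1_fun KK (Mf k l)" for k l unfolding Mf_def by (rule C1_fun_row_projector[OF rank])
  then have "\<forall>k l. \<exists>D. (\<forall>x\<in>KK. (Mf k l has_derivative D x) (at x)) \<and> (\<forall>v. continuous_on KK (\<lambda>x. D x v))"
    by (simp add: C1_fun_def)
  then obtain D where D: "\<And>k l A. A \<in> KK \<Longrightarrow> (Mf k l has_derivative D k l A) (at A)" "\<And>k l v. continuous_on KK (\<lambda>x. D k l x v)"
    by metis
  have cM: "continuous_on KK (Mf k l)" for k l
    using D(1) by (meson continuous_at_imp_continuous_on has_derivative_continuous)
  have "\<forall>i j. \<exists>b. 0 \<le> b \<and> (\<forall>A\<in>KK. \<bar>A $ i $ j\<bar> \<le> b)"
    by (intro allI compact_bound KK continuous_intros)
  then obtain b1 where b1: "\<And>i j. 0 \<le> b1 i j" "\<And>i j A. A \<in> KK \<Longrightarrow> \<bar>A $ i $ j\<bar> \<le> b1 i j" by metis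
  have "\<forall>i j. \<exists>b. 0 \<le> b \<and> (\<forall>A\<in>KK. \<bar>Mf i j A\<bar> \<le> b)"
    by (intro allI compact_bound KK cM)
  then obtain b2 where b2: "\<And>i j. 0 \<le> b2 i j" "\<And>i j A. A \<in> KK \<Longrightarrow> \<bar>Mf i j A\<bar> \<le> b2 i j" by metis
  have "\<forall>p. \<exists>b. 0 \<le> b \<and> (\<forall>A\<in>KK. \<bar>(case p of (i, j, k, l) \<Rightarrow> D i j A (axis k (axis l 1)))\<bar> \<le> b)"
    by (intro allI compact_bound KK) (auto intro: D(2))
  then obtain b3 where b3: "\<And>p. 0 \<le> b3 p" "\<And>i j k l A. A \<in> KK \<Longrightarrow> \<bar>D i j A (axis k (axis l 1))\<bar> \<le> b3 (i, j, k, l)"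
    by (metis (mono_tags, lifting) case_prod_conv)
  \<comment> \<open>A common bound for the tensors, M and DM that depends on the integrand alone;
    the summand 1 ensures K \<ge> 1.\<close>
  define K where "K = 1 + (\<Sum>p\<in>UNIV. b1 (fst p) (snd p)) + (\<Sum>p\<in>UNIV. b2 (fst p) (snd p)) + (\<Sum>p\<in>UNIV. b3 p)"
  have s: "(\<Sum>p\<in>UNIV. b1 (fst p) (snd p)) \<ge> 0" "(\<Sum>p\<in>UNIV. b2 (fst p) (snd p)) \<ge> 0" "(\<Sum>p\<in>UNIV. b3 p) \<ge> 0"
    by (intro sum_nonneg b1 b2 b3)+
  have K1: "K \<ge> 1" using s by (simp add: K_def)
  have Kb: "b1 i j \<le> K" "b2 i j \<le> K" "b3 p \<le> K" for i j p
    using member_le_sum[of "(i, j)" UNIV "\<lambda>p. b1 (fst p) (snd p)"] member_le_sum[of "(i, j)" UNIV "\<lambda>p. b2 (fst p) (snd p)"]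
      member_le_sum[of p UNIV b3] b1(1) b2(1) b3(1) s by (auto simp: K_def)
  define C where "C = \<bar>ms_const TYPE('n) K m * real CARD('n)\<bar>"
  have main: "measure (weight V) UNIV powr ((real m - 1) / real m) \<le> C * \<theta>\<^sub>0 powr (- 1 / real m) * enn2real (total_variation m \<Psi> V UNIV)"
    if \<theta>: "\<theta>\<^sub>0 > 0" and V: "varifold m V" and fin: "emeasure (weight V) UNIV < \<infinity>" and tv: "total_variation m \<Psi> V UNIV < \<infinity>"
      and dens: "AE x in weight V. \<exists>d\<ge>ennreal \<theta>\<^sub>0. has_density m (weight V) x d" for V \<theta>\<^sub>0
  proof (cases "measure (weight V) UNIV = 0")
    case True
    \<comment> \<open>The left side is \<open>0 powr _\<close>, which is 0 by convention even when m
      = 1 and the exponent is 0.\<close>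
    then show ?thesis by (simp add: C_def)
  next
    case False
    have sV: "sets V = sets (restrict_space borel (UNIV \<times> grassmannian m))" using V by (simp add: varifold_def)
    have spV: "space V = UNIV \<times> grassmannian m" using sets_eq_imp_space_eq[OF sV] by (simp add: space_restrict_space)
    have bm: "f \<in> borel_measurable V" if "continuous_on (UNIV \<times> grassmannian m) f" for f :: "(real^'n) \<times> (real^'n^'n) \<Rightarrow> 'c::topological_space"
      using borel_measurable_continuous_on_restrict[OF that] measurable_cong_sets[OF sV refl] by blast
    have X: "fst \<in> borel_measurable V" by (rule bm) (intro continuous_intros)
    have eV: "emeasure (weight V) UNIV = emeasure V (space V)" unfolding weight_def using X by (simp add: emeasure_distr)
    have mV: "measure (weight V) UNIV = measure V (space V)" by (simp add: measure_def eV)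
    have "space V \<noteq> {}" using False by (auto simp: mV)
    then obtain T0 where T0: "T0 \<in> (grassmannian m :: (real^'n^'n) set)" by (auto simp: spV)
    \<comment> \<open>Off the space of V the tensor gets a default value at a fixed plane, so that
      it lies in \<open>KK\<close> everywhere.\<close>
    define Bf where "Bf w = (if w \<in> space V then B_int m \<Psi> (snd w) else B_int m \<Psi> T0)" for w :: "(real^'n) \<times> (real^'n^'n)"
    have BfK: "Bf w \<in> KK" for w unfolding Bf_def KK_def using T0 by (auto intro!: hull_inc simp: spV)
    have Bfm: "Bf \<in> borel_measurable V"
    proof -
      have "(\<lambda>w. B_int m \<Psi> (snd w)) \<in> borel_measurable V"
        by (rule bm, rule continuous_on_compose2[OF continuous_B_int(1)[OF I]]) (auto intro!: continuous_intros)
      then show ?thesis by (rule measurable_cong[THEN iffD1, rotated]) (simp add: Bf_def)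
    qed
    have fmV: "finite_measure V" using fin by (intro finite_measureI) (simp add: eV)
    interpret tensor_flow V fst Bf KK Mf D K m
    proof (intro tensor_flow.intro mollification.intro fmV mollification_axioms.intro tensor_flow_axioms.intro)
      show "fst \<in> borel_measurable V" by (rule X)
      show "measure V (space V) > 0" using False by (simp add: mV zero_less_measure_iff)
      show "Bf \<in> borel_measurable V" "\<And>w. Bf w \<in> KK" by (fact Bfm BfK)+
      show "compact KK" "convex KK" "K \<ge> 1" by (fact KK K1)+
      show "\<And>A i j. A \<in> KK \<Longrightarrow> \<bar>A $ i $ j\<bar> \<le> K" using b1(2) Kb(1) order_trans by blast
      show "\<And>i l A. A \<in> KK \<Longrightarrow> (Mf i l has_derivative D i l A) (at A)" by (fact D(1))
      show "\<And>i l. continuous_on KK (Mf i l)" by (fact cM)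
      show "\<And>i l v. continuous_on KK (\<lambda>A. D i l A v)" by (fact D(2))
      show "\<And>i l A. A \<in> KK \<Longrightarrow> \<bar>Mf i l A\<bar> \<le> K" using b2(2) Kb(2) order_trans by blast
      show "\<And>i l A a b. A \<in> KK \<Longrightarrow> \<bar>D i l A (axis a (axis b 1))\<bar> \<le> K" using b3(2) Kb(3) order_trans by blast
      show "\<And>A. A \<in> KK \<Longrightarrow> trace (transpose A ** (\<chi> k l. Mf k l A) ** A) = real m"
        unfolding Mf_def using row_projector_trace(1)[OF rank] by blast
      show "\<And>A R. A \<in> KK \<Longrightarrow> (\<And>y. y \<bullet> (R *v y) \<ge> 0) \<Longrightarrow> trace ((transpose A ** (\<chi> k l. Mf k l A) ** A) ** R) \<le> trace R"
        unfolding Mf_def using row_projector_trace(2)[OF rank] by blast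
      show "m \<le> CARD('n)" using m by simp
    qed
    define Dv where "Dv = enn2real (total_variation m \<Psi> V UNIV)"
    have FV: "(\<integral>w. (Bf w $ i) \<bullet> Q (fst w) \<partial>V) \<le> Dv"
      if q: "\<And>z. (q has_derivative (\<lambda>h. Q z \<bullet> h)) (at z)" "continuous_on UNIV Q" "\<And>z. \<bar>q z\<bar> \<le> 1" "\<exists>R. \<forall>z. norm z > R \<longrightarrow> q z = 0"
      for i q Q
    proof -
      obtain R where R: "\<And>z. norm z > R \<Longrightarrow> q z = 0" using q(4) by blast
      let ?g = "\<lambda>z. q z *\<^sub>R (axis i 1 :: real^'n)"
      note tf = test_field_axis[OF q(1,2) R, where i=i]
      have "norm (?g x) \<le> 1" for x using q(3)[of x] by (simp add: norm_axis_1)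
      then have "ennreal (first_variation m \<Psi> V ?g) \<le> total_variation m \<Psi> V UNIV"
        unfolding total_variation_def using tf(1) by (intro SUP_upper) auto
      then have "enn2real (ennreal (first_variation m \<Psi> V ?g)) \<le> Dv"
        unfolding Dv_def using tv by (intro enn2real_mono) auto
      \<comment> \<open>A negative first variation is truncated to 0 by \<open>ennreal\<close>; it
        is then below \<open>Dv\<close> because \<open>Dv\<close> is nonnegative.\<close>
      then have "first_variation m \<Psi> V ?g \<le> Dv" by (simp add: enn2real_ennreal max_def Dv_def split: if_splits) (metis enn2real_nonneg ennreal_neg le_cases order_trans enn2real_ennreal)
      moreover have "first_variation m \<Psi> V ?g = (\<integral>w. (Bf w $ i) \<bullet> Q (fst w) \<partial>V)"
        unfolding first_variation_def by (rule Bochner_Integration.integral_cong) (auto simp: tf(2) Bf_def case_prod_unfold)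
      ultimately show ?thesis by simp
    qed
    have sig: "(\<integral>x. sig t x \<partial>lborel) \<le> real CARD('n) * Dv" if "t > 0" for t
      by (rule integral_sig_le[OF that FV])
    have Dv0: "Dv \<ge> 0" by (simp add: Dv_def)
    have "mass powr ((real m - 1) / real m) \<le> ms_const TYPE('n) K m * \<theta>\<^sub>0 powr (- 1 / real m) * (real CARD('n) * Dv)"
      by (rule michael_simon[OF m(1) \<theta> _ sig dens[unfolded weight_def]]) (use Dv0 in simp_all)
    also have "\<dots> = (ms_const TYPE('n) K m * real CARD('n)) * (\<theta>\<^sub>0 powr (- 1 / real m) * Dv)" by simp
    also have "\<dots> \<le> C * (\<theta>\<^sub>0 powr (- 1 / real m) * Dv)"
      unfolding C_def using Dv0 by (intro mult_right_mono abs_ge_self) auto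
    finally show ?thesis by (simp add: mass_def mV Dv_def mult.assoc)
  qed
  show ?thesis unfolding supports_Michael_Simon_def using I main by blast
qed

section \<open>Planes adapted to a unit vector\<close>

text \<open>The unit circle avoids the origin, so h can be differentiated twice along it by the
  chain rule.\<close>

lemma polar_derivatives:
  assumes h: "C2_on (- {0}) h"
  obtains H1 H2 where "\<And>\<theta>. (polar h has_real_derivative H1 \<theta>) (at \<theta>)" "\<And>\<theta>. (H1 has_real_derivative H2 \<theta>) (at \<theta>)"
    "continuous_on UNIV H2"
proof -
  obtain D where D: "\<And>x. x \<noteq> 0 \<Longrightarrow> (h has_derivative blinfun_apply (D x)) (at x)" and "C1_on (- {0}) D"
    using h by (auto simp: C2_on_def)
  then obtain D2 where D2: "\<And>x. x \<noteq> 0 \<Longrightarrow> (D has_derivative blinfun_apply (D2 x)) (at x)" and c2: "continuous_on (- {0}) D2"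
    by (auto simp: C1_on_def)
  define \<gamma> where "\<gamma> \<theta> = (cos \<theta>, sin \<theta>)" for \<theta> :: real
  define \<gamma>' where "\<gamma>' \<theta> = (- sin \<theta>, cos \<theta>)" for \<theta> :: real
  have nz: "\<gamma> \<theta> \<noteq> 0" for \<theta> using sin_zero_abs_cos_one[of \<theta>] by (auto simp: \<gamma>_def zero_prod_def)
  have g: "(\<gamma> has_vector_derivative \<gamma>' \<theta>) (at \<theta>)" for \<theta>
    unfolding \<gamma>_def[abs_def] \<gamma>'_def by (intro has_vector_derivative_Pair) (auto intro!: derivative_eq_intros simp flip: has_real_derivative_iff_has_vector_derivative)
  have g': "(\<gamma>' has_vector_derivative - \<gamma> \<theta>) (at \<theta>)" for \<theta>
    unfolding \<gamma>_def \<gamma>'_def[abs_def] uminus_prod_def by (auto intro!: has_vector_derivative_Pair derivative_eq_intros simp flip: has_real_derivative_iff_has_vector_derivative)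
  define H1 where "H1 \<theta> = D (\<gamma> \<theta>) (\<gamma>' \<theta>)" for \<theta>
  define H2 where "H2 \<theta> = D (\<gamma> \<theta>) (- \<gamma> \<theta>) + D2 (\<gamma> \<theta>) (\<gamma>' \<theta>) (\<gamma>' \<theta>)" for \<theta>
  have 1: "(polar h has_real_derivative H1 \<theta>) (at \<theta>)" for \<theta>
    using vector_derivative_diff_chain_within[OF g[of \<theta>], of h "blinfun_apply (D (\<gamma> \<theta>))"] D[OF nz[of \<theta>]]
    by (simp add: o_def polar_def[abs_def] H1_def \<gamma>_def has_real_derivative_iff_has_vector_derivative has_derivative_at_withinI)
  have dD: "((\<lambda>\<theta>. D (\<gamma> \<theta>)) has_vector_derivative D2 (\<gamma> \<theta>) (\<gamma>' \<theta>)) (at \<theta>)" for \<theta>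
    using vector_derivative_diff_chain_within[OF g[of \<theta>], of D "blinfun_apply (D2 (\<gamma> \<theta>))"] D2[OF nz[of \<theta>]]
    by (simp add: o_def has_derivative_at_withinI)
  have 2: "(H1 has_real_derivative H2 \<theta>) (at \<theta>)" for \<theta>
    unfolding has_real_derivative_iff_has_vector_derivative H1_def[abs_def] H2_def
    by (rule bounded_bilinear.has_vector_derivative[OF bounded_bilinear_blinfun_apply dD g'])
  have cg: "continuous_on UNIV \<gamma>" "continuous_on UNIV \<gamma>'" unfolding \<gamma>_def[abs_def] \<gamma>'_def[abs_def] by (intro continuous_intros)+
  have "continuous_on UNIV (\<lambda>\<theta>. D (\<gamma> \<theta>))"
    using dD has_vector_derivative_continuous by (blast intro: continuous_at_imp_continuous_on)
  moreover have "continuous_on UNIV (\<lambda>\<theta>. D2 (\<gamma> \<theta>))" by (rule continuous_on_compose2[OF c2 cg(1)]) (use nz in auto)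
  ultimately have "continuous_on UNIV H2" unfolding H2_def[abs_def]
    by (intro continuous_intros bounded_bilinear.continuous_on[OF bounded_bilinear_blinfun_apply] cg)
  with 1 2 show thesis by (rule that)
qed

text \<open>With R = I - Q, the difference trace P - trace (P Q) = trace (R P) is the squared norm
  of \<open>P ** R\<close>.\<close>

lemma trace_projection_mult_le:
  fixes P Q :: "real^'n^'n"
  assumes P: "transpose P = P" "P ** P = P" and Q: "transpose Q = Q" "Q ** Q = Q"
  shows "trace (P ** Q) \<le> trace P"
proof -
  define R where "R = mat 1 - Q"
  have R: "transpose R = R" "R ** R = R"
    using Q by (simp_all add: R_def transpose_diff transpose_mat matrix_sub_ldistrib matrix_sub_rdistrib)
  have "0 \<le> (P ** R) \<bullet> (P ** R)" by simp
  also have "\<dots> = trace (R ** (P ** P) ** R)" by (simp only: inner_eq_trace matrix_transpose_mul P(1) R(1) matrix_mul_assoc)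
  also have "\<dots> = trace (R ** (R ** P))" unfolding P by (rule trace_mul_sym)
  also have "\<dots> = trace (R ** P)" by (simp add: matrix_mul_assoc R)
  also have "\<dots> = trace P - trace (P ** Q)" by (simp add: R_def matrix_sub_rdistrib trace_sub trace_mul_sym[of Q])
  finally show ?thesis by simp
qed

section \<open>Rank-one terms and the pairing of two planes\<close>

lemma mult_outer: "A ** outer u v = outer (A *v u) v" for A :: "real^'n^'n"
  by (simp add: outer_def matrix_matrix_mult_def matrix_vector_mult_def vec_eq_iff sum_distrib_right mult.assoc)

lemma outer_mult: "outer u v ** A = outer u (transpose A *v v)" for A :: "real^'n^'n"
  by (simp add: outer_def matrix_matrix_mult_def matrix_vector_mult_def transpose_def vec_eq_iff sum_distrib_left mult_ac)

lemma outer_add_left: "outer (u + v) w = outer u w + outer v w"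
  and outer_add_right: "outer w (u + v) = outer w u + outer w v"
  and outer_scale_left: "outer (r *\<^sub>R u) w = r *\<^sub>R outer u w"
  and outer_scale_right: "outer w (r *\<^sub>R u) = r *\<^sub>R outer w u"
  by (simp_all add: outer_def vec_eq_iff algebra_simps)

definition adapted :: "real^'n \<Rightarrow> nat \<Rightarrow> real^'n^'n \<Rightarrow> real^'n \<Rightarrow> bool" where
  "adapted e m T' g \<longleftrightarrow> norm g = 1 \<and> g \<bullet> e = 0 \<and> transpose T' = T' \<and> T' ** T' = T' \<and> trace T' = real m - 1 \<and> T' *v e = 0 \<and> T' *v g = 0"

definition frame_plane :: "real^'n^'n \<Rightarrow> real^'n \<Rightarrow> real^'n \<Rightarrow> real \<Rightarrow> real^'n^'n" where
  "frame_plane T' e g \<theta> = T' + outer (cos \<theta> *\<^sub>R e + sin \<theta> *\<^sub>R g) (cos \<theta> *\<^sub>R e + sin \<theta> *\<^sub>R g)"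

lemma add_outer_projection:
  fixes P :: "real^'n^'n"
  assumes P: "transpose P = P" "P ** P = P" and u: "norm u = 1" "P *v u = 0"
  shows "transpose (P + outer u u) = P + outer u u" "(P + outer u u) ** (P + outer u u) = P + outer u u" "trace (P + outer u u) = trace P + 1"
proof -
  have uu: "u \<bullet> u = 1" using u by (simp add: dot_square_norm)
  show "transpose (P + outer u u) = P + outer u u" by (simp add: transpose_add transpose_outer P)
  show "trace (P + outer u u) = trace P + 1" by (simp add: trace_add trace_outer uu)
  have "outer u u ** outer u u = outer u u" by (simp add: mult_outer outer_mult_vec uu)
  moreover have "P ** outer u u = 0" by (simp add: mult_outer u) (simp add: outer_def vec_eq_iff)
  moreover have "outer u u ** P = 0" by (simp add: outer_mult P u) (simp add: outer_def vec_eq_iff)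
  ultimately show "(P + outer u u) ** (P + outer u u) = P + outer u u" by (simp add: matrix_add_ldistrib matrix_add_rdistrib P)
qed

lemma scaleR_matrix_mult:
  "(k *\<^sub>R A) ** B = k *\<^sub>R (A ** B)" "A ** (k *\<^sub>R B) = k *\<^sub>R (A ** B)" for A B :: "real^'n^'n"
  by (simp_all add: matrix_matrix_mult_def vec_eq_iff sum_distrib_left mult_ac)

lemma trace_rank_one_sum:
  fixes S' T' :: "real^'n^'n"
  shows "trace ((k *\<^sub>R S' + outer n' a') ** (l *\<^sub>R T' + outer n a)) =
    k * l * trace (S' ** T') + k * (a \<bullet> (S' *v n)) + l * (a' \<bullet> (T' *v n')) + (a' \<bullet> n) * (a \<bullet> n')"
proof -
  have 1: "trace (S' ** outer n a) = a \<bullet> (S' *v n)" for S' :: "real^'n^'n" and n a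
    by (simp add: mult_outer trace_outer inner_commute)
  have 2: "trace (outer n' a' ** T') = a' \<bullet> (T' *v n')" using 1[of T' n' a'] trace_mul_sym[of T' "outer n' a'"] by simp
  have 3: "trace (outer n' a' ** outer n a) = (a' \<bullet> n) * (a \<bullet> n')" by (simp add: 1 outer_mult_vec)
  have sc: "trace (r *\<^sub>R A) = r * trace A" for r and A :: "real^'n^'n" by (simp add: trace_def sum_distrib_left)
  show ?thesis
    by (simp only: matrix_add_ldistrib matrix_add_rdistrib trace_add scaleR_matrix_mult sc 1 2 3) (simp add: outer_mult_vec algebra_simps)
qed

text \<open>For $X = \cos$, $Y = \sin$, $H = 1$ the left-hand side is half the squared distance of the two planes.\<close>

lemma trace_frame:
  fixes e :: "real^'n"
  assumes e: "norm e = 1" and T: "adapted e m T' g" and S: "adapted e m S' g'"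
    and M: "M = real m - trace (S' ** T')" and \<sigma>: "\<sigma> = g \<bullet> (S' *v g)" and \<tau>: "\<tau> = g' \<bullet> (T' *v g')" and \<mu>: "\<mu> = g \<bullet> g'"
    and H: "c * X + s * Y = H" "c' * X' + s' * Y' = H'"
  shows "real m * H' * H - trace ((H' *\<^sub>R S' + outer (X' *\<^sub>R e + Y' *\<^sub>R g') (c' *\<^sub>R e + s' *\<^sub>R g')) ** (H *\<^sub>R T' + outer (X *\<^sub>R e + Y *\<^sub>R g) (c *\<^sub>R e + s *\<^sub>R g)))
   = (M - 1) * (c * X) * (c' * X') + (M - 1 - \<sigma>) * (s * Y) * (c' * X') + (M - 1 - \<tau>) * (s' * Y') * (c * X) + (M - \<tau> - \<sigma> - \<mu>\<^sup>2) * (s * Y) * (s' * Y')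
     + (1 - \<mu>) * (s' * Y * c * X' + s * Y' * c' * X) + (s * c' - c * s') * (Y * X' - X * Y')"
proof -
  have ee: "e \<bullet> e = 1" using e by (simp add: dot_square_norm)
  have t: "T' *v e = 0" "T' *v g = 0" "g \<bullet> e = 0" "e \<bullet> g = 0" "g \<bullet> g = 1" "transpose T' = T'"
    using T by (auto simp: adapted_def dot_square_norm inner_commute)
  have s: "S' *v e = 0" "S' *v g' = 0" "g' \<bullet> e = 0" "e \<bullet> g' = 0" "g' \<bullet> g' = 1" "transpose S' = S'"
    using S by (auto simp: adapted_def dot_square_norm inner_commute)
  have e1: "e \<bullet> (S' *v x) = 0" "e \<bullet> (T' *v x) = 0" for x using sym_inner[OF s(6), of e x] sym_inner[OF t(6), of e x] s t by simp_all
  have 1: "(c *\<^sub>R e + s *\<^sub>R g) \<bullet> (S' *v (X *\<^sub>R e + Y *\<^sub>R g)) = s * Y * \<sigma>"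
    by (simp add: matrix_vector_right_distrib matrix_vector_mult_scaleR s inner_add_left inner_add_right e1 \<sigma>)
  have 2: "(c' *\<^sub>R e + s' *\<^sub>R g') \<bullet> (T' *v (X' *\<^sub>R e + Y' *\<^sub>R g')) = s' * Y' * \<tau>"
    by (simp add: matrix_vector_right_distrib matrix_vector_mult_scaleR t inner_add_left inner_add_right e1 \<tau>)
  have 3: "(c' *\<^sub>R e + s' *\<^sub>R g') \<bullet> (X *\<^sub>R e + Y *\<^sub>R g) = c' * X + s' * Y * \<mu>"
    by (simp add: inner_add_left inner_add_right ee t s \<mu> inner_commute)
  have 4: "(c *\<^sub>R e + s *\<^sub>R g) \<bullet> (X' *\<^sub>R e + Y' *\<^sub>R g') = c * X' + s * Y' * \<mu>"
    by (simp add: inner_add_left inner_add_right ee t s \<mu>)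
  show ?thesis unfolding trace_rank_one_sum 1 2 3 4 M H[symmetric]
    by (simp add: algebra_simps power2_eq_square)
qed

text \<open>The first four numbers are trace P - trace (P Q) for projections P and Q of the two
  planes, each with or without the rank-one term of g or g'. The last one is the Cauchy-Schwarz
  inequality.\<close>

lemma frame_coefficients:
  fixes e :: "real^'n"
  assumes T: "adapted e m T' g" and S: "adapted e m S' g'"
    and M: "M = real m - trace (S' ** T')" and \<sigma>: "\<sigma> = g \<bullet> (S' *v g)" and \<tau>: "\<tau> = g' \<bullet> (T' *v g')" and \<mu>: "\<mu> = g \<bullet> g'"
  shows "M - 1 \<ge> 0" "M - 1 - \<sigma> \<ge> 0" "M - 1 - \<tau> \<ge> 0" "M - \<tau> - \<sigma> - \<mu>\<^sup>2 \<ge> 0" "1 - \<mu> \<ge> 0"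
proof -
  have t: "transpose T' = T'" "T' ** T' = T'" "trace T' = real m - 1" "T' *v g = 0" "norm g = 1" using T by (auto simp: adapted_def)
  have s: "transpose S' = S'" "S' ** S' = S'" "trace S' = real m - 1" "S' *v g' = 0" "norm g' = 1" using S by (auto simp: adapted_def)
  note tg = add_outer_projection[OF t(1,2,5,4)] and sg = add_outer_projection[OF s(1,2,5,4)]
  have o: "trace (outer u u ** A) = u \<bullet> (A *v u)" "trace (A ** outer u u) = u \<bullet> (A *v u)" for u and A :: "real^'n^'n"
    by (simp_all add: trace_mul_sym[of "outer u u"] mult_outer trace_outer inner_commute)
  show "M - 1 \<ge> 0" using trace_projection_mult_le[OF s(1,2) t(1,2)] s by (simp add: M)
  show "M - 1 - \<sigma> \<ge> 0" using trace_projection_mult_le[OF s(1,2) tg(1,2)] s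
    by (simp add: M \<sigma> matrix_add_ldistrib trace_add o)
  show "M - 1 - \<tau> \<ge> 0" using trace_projection_mult_le[OF t(1,2) sg(1,2)] t
    by (simp add: M \<tau> matrix_add_ldistrib trace_add o trace_mul_sym[of T'])
  have "trace (outer g' g' ** outer g g) = \<mu>\<^sup>2" by (simp add: o outer_mult_vec \<mu> power2_eq_square inner_commute)
  then show "M - \<tau> - \<sigma> - \<mu>\<^sup>2 \<ge> 0" using trace_projection_mult_le[OF sg(1,2) tg(1,2)] sg s
    by (simp add: M \<sigma> \<tau> matrix_add_ldistrib matrix_add_rdistrib trace_add o(1)[of g' T'] o(2)[of S' g] trace_outer)
  show "1 - \<mu> \<ge> 0" using norm_cauchy_schwarz[of g g'] t s by (simp add: \<mu>)
qed

text \<open>If e is oblique to T, then a = Te / |Te|, and g is the normalised part of a orthogonal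
  to e. If e lies in T, then a = e and g is any unit vector orthogonal to T, which exists since m <
  N. If e is orthogonal to T, then a = g is any unit vector of T, which exists since m \<ge>
  1.\<close>

lemma grassmannian_frame:
  fixes e :: "real^'n" and T :: "real^'n^'n"
  assumes e: "norm e = 1" and m: "1 \<le> m" "m < CARD('n)" and T: "T \<in> grassmannian m"
  obtains T' g \<theta> where "adapted e m T' g" "\<theta> \<in> {0..pi/2}" "T = frame_plane T' e g \<theta>"
    "norm (T *v e) = cos \<theta>" "norm (perp T *v e) = sin \<theta>"
proof -
  have sym: "transpose T = T" and idem: "T ** T = T" and tr: "trace T = real m" using T by (auto simp: grassmannian_def)
  have ee: "e \<bullet> e = 1" using e by (simp add: dot_square_norm)
  define v where "v = T *v e"
  have Tv: "T *v v = v" by (simp add: v_def matrix_vector_mul_assoc idem)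
  have ev: "e \<bullet> v = v \<bullet> v" using sym_inner[OF sym, of e v] Tv by (simp add: v_def)
  have pw: "perp T *v e = e - v" by (simp add: perp_def v_def matrix_vector_mult_diff_rdistrib)
  define c where "c = norm v"
  define s where "s = norm (e - v)"
  have cs: "c\<^sup>2 + s\<^sup>2 = 1"
    by (simp add: c_def s_def power2_norm_eq_inner inner_diff_left inner_diff_right ee ev inner_commute[of v e])
  have c0: "c \<ge> 0" "s \<ge> 0" by (auto simp: c_def s_def)
  have c1: "c \<le> 1" using cs c0 by (metis abs_le_square_iff abs_of_nonneg add.commute le_add_same_cancel2 one_power2 zero_le_one zero_le_power2)
  define \<theta> where "\<theta> = arccos c"
  have \<theta>: "cos \<theta> = c" "\<theta> \<in> {0..pi/2}"
    using c0 c1 using arccos_le_pi2[OF c0(1) c1] by (auto simp: \<theta>_def arccos_lbound)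
  have sn: "sin \<theta> = s"
  proof -
    have "sin \<theta> \<ge> 0" using \<theta>(2) by (intro sin_ge_zero) auto
    moreover have "(sin \<theta>)\<^sup>2 = s\<^sup>2" using cs \<theta>(1) sin_cos_squared_add[of \<theta>] by simp
    ultimately show ?thesis using c0 by (simp add: power2_eq_iff_nonneg)
  qed
  have sub: "transpose (T - outer a a) = T - outer a a \<and> (T - outer a a) ** (T - outer a a) = T - outer a a \<and> trace (T - outer a a) = real m - 1 \<and> (T - outer a a) *v a = 0"
    if a: "T *v a = a" "norm a = 1" for a
  proof -
    have aa: "a \<bullet> a = 1" using a by (simp add: dot_square_norm)
    have "outer a a ** outer a a = outer a a" by (simp add: mult_outer outer_mult_vec aa)
    moreover have "outer 0 a = 0" by (simp add: outer_def vec_eq_iff)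
    ultimately show ?thesis
      by (simp add: transpose_diff transpose_outer sym matrix_sub_ldistrib matrix_sub_rdistrib idem mult_outer outer_mult a trace_sub tr trace_outer aa
          matrix_vector_mult_diff_rdistrib outer_mult_vec)
  qed
  have ex: "\<exists>g a. norm a = 1 \<and> T *v a = a \<and> norm g = 1 \<and> g \<bullet> e = 0 \<and> a = c *\<^sub>R e + s *\<^sub>R g \<and> (T - outer a a) *v e = 0 \<and> (T - outer a a) *v g = 0"
  proof -
    consider "c \<noteq> 0" "s \<noteq> 0" | "s = 0" | "c = 0" by blast
    then show ?thesis
    proof cases
      case 1
      define a where "a = v /\<^sub>R c"
      define g where "g = (a - c *\<^sub>R e) /\<^sub>R s"
      have a: "norm a = 1" "T *v a = a" using 1 by (auto simp: a_def c_def matrix_vector_mult_scaleR Tv)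
      have aa: "a \<bullet> a = 1" using a by (simp add: dot_square_norm)
      have ae: "a \<bullet> e = c" using 1 ev by (simp add: a_def inner_commute[of v e] c_def dot_square_norm power2_eq_square)
      have ge: "g \<bullet> e = 0" by (simp add: g_def inner_diff_left ae ee)
      have "(norm (a - c *\<^sub>R e))\<^sup>2 = s\<^sup>2"
        unfolding power2_norm_eq_inner using cs by (simp add: inner_diff_left inner_diff_right aa ee ae inner_commute[of e a] power2_eq_square)
      then have "norm (a - c *\<^sub>R e) = s" using c0 by (simp add: power2_eq_iff_nonneg)
      then have gn: "norm g = 1" using 1 c0 by (simp add: g_def)
      have aeq: "a = c *\<^sub>R e + s *\<^sub>R g" using 1 by (simp add: g_def)
      have Te: "(T - outer a a) *v e = 0" using 1 ae
        by (simp add: matrix_vector_mult_diff_rdistrib outer_mult_vec flip: v_def) (simp add: a_def)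
      have Ta: "(T - outer a a) *v a = 0" using sub[OF a(2,1)] by simp
      have "(T - outer a a) *v g = 0" unfolding g_def
        by (simp only: matrix_vector_mult_scaleR matrix_vector_mult_diff_distrib Te Ta) simp
      then show ?thesis using a gn ge aeq Te by blast
    next
      case 2
      then have ev': "v = e" by (simp add: s_def)
      have c: "c = 1" using ev' e by (simp add: c_def)
      have "perp T \<noteq> 0"
      proof
        assume "perp T = 0"
        then have "trace (perp T) = 0" by (simp add: trace_def)
        then show False using m tr by (simp add: perp_def trace_sub trace_I)
      qed
      then obtain x where x: "perp T *v x \<noteq> 0" by (metis matrix_eq matrix_vector_mult_0)
      define g where "g = (perp T *v x) /\<^sub>R norm (perp T *v x)"
      have gn: "norm g = 1" using x by (simp add: g_def)
      have "T ** perp T = 0" by (simp add: perp_def matrix_sub_ldistrib idem)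
      then have Tg: "T *v g = 0" by (simp add: g_def matrix_vector_mult_scaleR matrix_vector_mul_assoc)
      have Te: "T *v e = e" using ev' by (simp add: v_def)
      have ge: "g \<bullet> e = 0" using sym_inner[OF sym, of g e] Te Tg by simp
      have "(T - outer e e) *v g = 0" using Tg ge by (simp add: matrix_vector_mult_diff_rdistrib outer_mult_vec inner_commute)
      moreover have "(T - outer e e) *v e = 0" using sub[OF Te e] by simp
      ultimately show ?thesis using e Te gn ge c 2 by (intro exI[of _ g] exI[of _ e]) auto
    next
      case 3
      then have v0: "T *v e = 0" by (simp add: c_def v_def)
      have s: "s = 1" using 3 cs c0 by (simp add: power2_eq_1_iff)
      have "T \<noteq> 0" using tr m by (auto simp: trace_def)
      then obtain x where x: "T *v x \<noteq> 0" by (metis matrix_eq matrix_vector_mult_0)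
      define g where "g = (T *v x) /\<^sub>R norm (T *v x)"
      have gn: "norm g = 1" using x by (simp add: g_def)
      have Tg: "T *v g = g" by (simp add: g_def matrix_vector_mult_scaleR matrix_vector_mul_assoc idem)
      have ge: "g \<bullet> e = 0" using sym_inner[OF sym, of g e] v0 Tg by simp
      have "(T - outer g g) *v e = 0" using v0 ge by (simp add: matrix_vector_mult_diff_rdistrib outer_mult_vec)
      moreover have "(T - outer g g) *v g = 0" using sub[OF Tg gn] by simp
      ultimately show ?thesis using gn Tg ge s 3 by (intro exI[of _ g] exI[of _ g]) auto
    qed
  qed
  then obtain g a where ga: "norm a = 1" "T *v a = a" "norm g = 1" "g \<bullet> e = 0" "a = c *\<^sub>R e + s *\<^sub>R g"
    "(T - outer a a) *v e = 0" "(T - outer a a) *v g = 0" by blast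
  have "adapted e m (T - outer a a) g" unfolding adapted_def using sub[OF ga(2,1)] ga by auto
  moreover have "T = frame_plane (T - outer a a) e g \<theta>" unfolding frame_plane_def \<theta>(1) sn ga(5)[symmetric] by simp
  ultimately show thesis using that[of "T - outer a a" g \<theta>] \<theta> sn by (simp add: pw c_def s_def v_def)
qed

section \<open>The integrand of an absolute norm\<close>

lemma tendsto_quotient_derivatives:
  fixes f g :: "real \<Rightarrow> real"
  assumes f: "(f has_real_derivative f') (at a)" "f a = 0" and g: "(g has_real_derivative g') (at a)" "g a = 0" and "g' \<noteq> 0"
  shows "((\<lambda>x. f x / g x) \<longlongrightarrow> f' / g') (at a)"
proof -
  have "((\<lambda>x. (f x / (x - a)) / (g x / (x - a))) \<longlongrightarrow> f' / g') (at a)"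
    using f g assms(5) unfolding has_field_derivative_iff by (intro tendsto_divide) auto
  moreover have "\<forall>\<^sub>F x in at a. (f x / (x - a)) / (g x / (x - a)) = f x / g x"
    by (auto simp: eventually_at_filter)
  ultimately show ?thesis by (rule Lim_transform_eventually)
qed

locale norm_integrand =
  fixes h :: "real \<times> real \<Rightarrow> real" and e :: "real^'n" and H1 H2 :: "real \<Rightarrow> real" and m :: nat
  assumes h: "absolute_norm h" and e: "norm e = 1" and m: "1 \<le> m" "m < CARD('n)"
    and D1: "\<And>\<theta>. (polar h has_real_derivative H1 \<theta>) (at \<theta>)" and D2: "\<And>\<theta>. (H1 has_real_derivative H2 \<theta>) (at \<theta>)"
    and cont2: "continuous_on UNIV H2"
begin

abbreviation H where "H \<equiv> polar h"

lemma H_pos: "H \<theta> > 0"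
proof -
  have "(cos \<theta>, sin \<theta>) \<noteq> 0" using sin_zero_abs_cos_one[of \<theta>] by (auto simp: zero_prod_def)
  then show ?thesis using h by (auto simp: polar_def absolute_norm_def)
qed

text \<open>The norm is invariant under both coordinate reflections, so \<open>H\<close> is even
  about 0 and about pi/2.\<close>

lemma H1_ends: "H1 0 = 0" "H1 (pi/2) = 0"
proof -
  have a: "h (x, y) = h (\<bar>x\<bar>, \<bar>y\<bar>)" for x y using h by (auto simp: absolute_norm_def)
  have even: "H (- \<theta>) = H \<theta>" "H (pi - \<theta>) = H \<theta>" for \<theta>
    using a[of "cos \<theta>" "- sin \<theta>"] a[of "cos \<theta>" "sin \<theta>"] a[of "- cos \<theta>" "sin \<theta>"] by (auto simp: polar_def)
  have "((\<lambda>\<theta>. H (- \<theta>)) has_real_derivative H1 (- 0) * (- 1)) (at 0)"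
    by (rule DERIV_chain2[OF D1]) (auto intro!: derivative_eq_intros)
  then have "H1 0 = H1 (- 0) * (- 1)" unfolding even(1) by (rule DERIV_unique[OF D1])
  then show "H1 0 = 0" by simp
  have "((\<lambda>\<theta>. H (pi - \<theta>)) has_real_derivative H1 (pi - pi/2) * (- 1)) (at (pi/2))"
    by (rule DERIV_chain2[OF D1]) (auto intro!: derivative_eq_intros)
  then have "H1 (pi/2) = H1 (pi - pi/2) * (- 1)" unfolding even(2) by (rule DERIV_unique[OF D1])
  then show "H1 (pi/2) = 0" by simp
qed

text \<open>The derivative of \<open>H\<close> with respect to (cos \<theta>)^2, the variable in
  which the integrand is extended below. At both ends sin (2 \<theta>) vanishes together with H',
  and the values there are the limits of the quotient.\<close>

definition slope :: "real \<Rightarrow> real" where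
  "slope \<theta> = (if \<theta> = 0 then - H2 0 / 2 else if \<theta> = pi/2 then H2 (pi/2) / 2 else - H1 \<theta> / sin (2 * \<theta>))"

lemma slope_eq: "\<theta> \<in> {0..pi/2} \<Longrightarrow> 2 * slope \<theta> * cos \<theta> * sin \<theta> = - H1 \<theta>"
proof -
  assume t: "\<theta> \<in> {0..pi/2}"
  consider "\<theta> = 0" | "\<theta> = pi/2" | "0 < \<theta>" "\<theta> < pi/2" using t by force
  then show ?thesis
  proof cases
    case 3
    then have "sin \<theta> > 0" "cos \<theta> > 0" by (auto intro: sin_gt_zero2 cos_gt_zero)
    moreover have "slope \<theta> = - H1 \<theta> / (2 * sin \<theta> * cos \<theta>)" using 3 by (simp add: slope_def sin_double)
    ultimately show ?thesis by (simp add: field_simps)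
  next
    case 1 show ?thesis unfolding 1 by (simp add: H1_ends)
  next
    case 2 show ?thesis unfolding 2 by (simp add: H1_ends)
  qed
qed

lemma isCont_slope:
  assumes "\<theta> \<in> {0..pi/2}"
  shows "isCont slope \<theta>"
proof -
  have ds: "((\<lambda>\<theta>. sin (2 * \<theta>)) has_real_derivative 2 * cos (2 * a)) (at a)" for a :: real
    by (auto intro!: derivative_eq_intros)
  have dH: "((\<lambda>\<theta>. - H1 \<theta>) has_real_derivative - H2 a) (at a)" for a
    by (rule DERIV_minus[OF D2])
  consider "\<theta> = 0" | "\<theta> = pi/2" | "0 < \<theta>" "\<theta> < pi/2" using assms by force
  then show ?thesis
  proof cases
    case 1
    have "((\<lambda>\<theta>. - H1 \<theta> / sin (2 * \<theta>)) \<longlongrightarrow> - H2 0 / (2 * cos (2 * 0))) (at 0)"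
      by (rule tendsto_quotient_derivatives[OF dH _ ds]) (auto simp: H1_ends)
    moreover have "\<forall>\<^sub>F \<theta> in at 0. - H1 \<theta> / sin (2 * \<theta>) = slope \<theta>"
    proof -
      have "\<forall>\<^sub>F \<theta> in at 0. \<theta> < pi/2" by (rule order_tendstoD(2)[OF tendsto_ident_at]) simp
      then show ?thesis using eventually_neq_at_within[of 0 0 UNIV]
        by eventually_elim (auto simp: slope_def)
    qed
    ultimately show ?thesis unfolding isCont_def 1 using tendsto_cong[of "\<lambda>\<theta>. - H1 \<theta> / sin (2 * \<theta>)" slope "at 0"] by (simp add: slope_def)
  next
    case 2
    have "((\<lambda>\<theta>. - H1 \<theta> / sin (2 * \<theta>)) \<longlongrightarrow> - H2 (pi/2) / (2 * cos (2 * (pi/2)))) (at (pi/2))"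
      by (rule tendsto_quotient_derivatives[OF dH _ ds]) (auto simp: H1_ends)
    moreover have "\<forall>\<^sub>F \<theta> in at (pi/2). - H1 \<theta> / sin (2 * \<theta>) = slope \<theta>"
    proof -
      have "\<forall>\<^sub>F \<theta> in at (pi/2). (0::real) < \<theta>" by (rule order_tendstoD(1)[OF tendsto_ident_at]) simp
      then show ?thesis using eventually_neq_at_within[of "pi/2" "pi/2" UNIV]
        by eventually_elim (auto simp: slope_def)
    qed
    ultimately show ?thesis unfolding isCont_def 2 using tendsto_cong[of "\<lambda>\<theta>. - H1 \<theta> / sin (2 * \<theta>)" slope "at (pi/2)"] by (simp add: slope_def)
  next
    case 3
    have "sin (2 * \<theta>) > 0" using 3 by (intro sin_gt_zero) auto
    then have c: "isCont (\<lambda>\<theta>. - H1 \<theta> / sin (2 * \<theta>)) \<theta>" using DERIV_isCont[OF D2] by (intro continuous_intros) auto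
    have "\<forall>\<^sub>F x in nhds \<theta>. x \<in> {0<..<pi/2}" using 3 by (intro eventually_nhds_in_open) auto
    then have "\<forall>\<^sub>F x in nhds \<theta>. - H1 x / sin (2 * x) = slope x" by eventually_elim (auto simp: slope_def)
    from isCont_cong[OF this] c show ?thesis by simp
  qed
qed

text \<open>On the Grassmannian the integrand depends only on x = e . Te = (cos \<theta>)^2, a
  linear function of T. Although arccos (sqrt x) is singular at 0 and 1, the integrand is C1 in x up
  to the ends because \<open>slope\<close> is continuous there, so an antiderivative of
  \<open>slope\<close> extends it.\<close>

lemma extension_exists:
  obtains F kt where "C1_extension m (Psi_of h e) F (\<lambda>X. kt (e \<bullet> (X *v e)) *\<^sub>R outer e e)"
    "\<And>\<theta>. \<theta> \<in> {0..pi/2} \<Longrightarrow> 2 * kt ((cos \<theta>)\<^sup>2) * cos \<theta> * sin \<theta> = - H1 \<theta>"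
proof -
  \<comment> \<open>Clamping to [0, 1] continues the derivative by constants, hence continuously,
    beyond the values taken on the Grassmannian.\<close>
  define kt where "kt x = slope (arccos (sqrt (max 0 (min 1 x))))" for x
  have rng: "0 \<le> sqrt (max 0 (min 1 x))" "sqrt (max 0 (min 1 x)) \<le> 1" for x :: real by auto
  have rng': "- 1 \<le> sqrt (max 0 (min 1 x))" for x :: real using rng(1)[of x] by linarith
  have ck: "continuous_on UNIV kt"
    unfolding kt_def
  proof (rule continuous_on_compose2[of "{0..pi/2}" slope])
    show "continuous_on {0..pi/2} slope" using isCont_slope by (intro continuous_at_imp_continuous_on) auto
    show "continuous_on UNIV (\<lambda>x::real. arccos (sqrt (max 0 (min 1 x))))"
      by (intro continuous_intros ballI conjI) (use rng rng' in auto)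
    show "(\<lambda>x. arccos (sqrt (max 0 (min 1 x)))) ` UNIV \<subseteq> {0..pi/2}"
      using rng rng' arccos_le_pi2 arccos_lbound by auto
  qed
  have "continuous_on {-1..2} kt" using ck continuous_on_subset by blast
  \<comment> \<open>Integrating over an interval that contains [0, 1] in its interior makes the
    extension differentiable at 0 and 1 as well.\<close>
  then obtain g where g: "\<And>x. x \<in> {-1..2} \<Longrightarrow> (g has_vector_derivative kt x) (at x within {-1..2})"
    using antiderivative_continuous by metis
  have dg: "(g has_real_derivative kt x) (at x)" if "-1 < x" "x < 2" for x
    using g[of x] that at_within_Icc_at[of "-1" x 2] by (simp add: has_real_derivative_iff_has_vector_derivative)
  define Kf where "Kf x = H (arccos (sqrt x))" for x
  \<comment> \<open>Both functions have derivative \<open>kt\<close> in the open interval; at its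
    ends, where the square root and arccos are singular, continuity suffices.\<close>
  have eqK: "Kf x - g x = Kf 0 - g 0" if x: "0 \<le> x" "x \<le> 1" for x
  proof (rule DERIV_isconst2[of 0 1])
    have cH: "continuous_on UNIV H" using DERIV_isCont[OF D1] by (intro continuous_at_imp_continuous_on) auto
    have "continuous_on {0..1} Kf" unfolding Kf_def
    proof (rule continuous_on_compose2[OF cH])
      show "continuous_on {0..1} (\<lambda>x::real. arccos (sqrt x))"
      proof (intro continuous_intros ballI conjI)
        fix x :: real assume "x \<in> {0..1}"
        then have "0 \<le> sqrt x" "sqrt x \<le> 1" by auto
        then show "- 1 \<le> sqrt x" "sqrt x \<le> 1" by linarith+
      qed
    qed simp
    moreover have "continuous_on {0..1} g" using DERIV_isCont[OF dg] by (intro continuous_at_imp_continuous_on) auto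
    ultimately show "continuous_on {0..1} (\<lambda>x. Kf x - g x)" by (intro continuous_intros)
    fix x :: real assume x: "0 < x" "x < 1"
    define \<theta> where "\<theta> = arccos (sqrt x)"
    have sx: "0 < sqrt x" "sqrt x < 1" using x by auto
    have sx': "- 1 < sqrt x" "- 1 \<le> sqrt x" "sqrt x \<le> 1" using sx by linarith+
    have \<theta>: "0 < \<theta>" "\<theta> < pi/2" "cos \<theta> = sqrt x" "sin \<theta> = sqrt (1 - x)"
      using arccos_lt_bounded[OF sx'(1) sx(2)] arccos_less_mono[of "sqrt x" 0] sx cos_arccos[OF sx'(2,3)] sin_arccos[OF sx'(2,3)] x
      by (simp_all add: \<theta>_def)
    have "(Kf has_real_derivative H1 (arccos (sqrt x)) * (inverse (- sqrt (1 - (sqrt x)\<^sup>2)) * (inverse (sqrt x) / 2))) (at x)"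
      unfolding Kf_def using sx x
      by (intro DERIV_chain2[OF D1] DERIV_chain2[OF DERIV_arccos] DERIV_real_sqrt sx' sx x(1))
    moreover have "H1 (arccos (sqrt x)) * (inverse (- sqrt (1 - (sqrt x)\<^sup>2)) * (inverse (sqrt x) / 2)) = kt x"
    proof -
      have "kt x = slope \<theta>" using x by (simp add: kt_def \<theta>_def)
      also have "\<dots> = - H1 \<theta> / (2 * sqrt (1 - x) * sqrt x)" using \<theta> by (simp add: slope_def sin_double)
      also have "\<dots> = H1 \<theta> * (inverse (- sqrt (1 - (sqrt x)\<^sup>2)) * (inverse (sqrt x) / 2))"
      proof -
        have "- u / (2 * a * b) = u * (inverse (- a) * (inverse b / 2))" for u a b :: real by (simp add: inverse_eq_divide)
        moreover have "(sqrt x)\<^sup>2 = x" using x by simp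
        ultimately show ?thesis by presburger
      qed
      finally show ?thesis by (simp only: \<theta>_def)
    qed
    ultimately have "(Kf has_real_derivative kt x) (at x)" by (rule DERIV_cong)
    moreover have "(g has_real_derivative kt x) (at x)" using x by (intro dg) auto
    ultimately have "((\<lambda>x. Kf x - g x) has_real_derivative kt x - kt x) (at x)" by (rule DERIV_diff)
    then show "((\<lambda>x. Kf x - g x) has_real_derivative 0) (at x)" by (simp only: diff_self)
  qed (use x in auto)
  define F where "F X = g (e \<bullet> (X *v e)) + (Kf 0 - g 0)" for X :: "real^'n^'n"
  have lin: "e \<bullet> (X *v e) = X \<bullet> outer e e" for X :: "real^'n^'n" by (simp add: inner_outer)
  have "C1_extension m (Psi_of h e) F (\<lambda>X. kt (e \<bullet> (X *v e)) *\<^sub>R outer e e)"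
    unfolding C1_extension_def
  proof (intro conjI exI[of _ "{X. -1 < e \<bullet> (X *v e)} \<inter> {X. e \<bullet> (X *v e) < 2}"] ballI)
    show "open ({X::real^'n^'n. -1 < e \<bullet> (X *v e)} \<inter> {X. e \<bullet> (X *v e) < 2})"
      unfolding lin by (intro open_Int open_Collect_less continuous_intros)
    have T: "0 \<le> e \<bullet> (T *v e) \<and> e \<bullet> (T *v e) \<le> 1 \<and> Psi_of h e T = Kf (e \<bullet> (T *v e))" if "T \<in> grassmannian m" for T :: "real^'n^'n"
    proof -
      obtain T' g' \<theta> where f: "adapted e m T' g'" "\<theta> \<in> {0..pi/2}" "T = frame_plane T' e g' \<theta>"
        "norm (T *v e) = cos \<theta>" "norm (perp T *v e) = sin \<theta>"
        using grassmannian_frame[OF e m \<open>T \<in> grassmannian m\<close>] .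
      have "transpose T = T" "T ** T = T" using that by (auto simp: grassmannian_def)
      then have "e \<bullet> (T *v e) = (T *v e) \<bullet> (T *v e)" using sym_inner[of T e "T *v e"] by (simp add: matrix_vector_mul_assoc)
      then have x: "e \<bullet> (T *v e) = (cos \<theta>)\<^sup>2" using f(4) by (simp add: dot_square_norm)
      have "cos \<theta> \<ge> 0" using f(2) by (intro cos_ge_zero) auto
      moreover have "arccos (cos \<theta>) = \<theta>" using f(2) by (intro arccos_cos) auto
      ultimately have "Kf (e \<bullet> (T *v e)) = H \<theta>" by (simp add: Kf_def x)
      then show ?thesis using f(4,5) by (simp add: Psi_of_def polar_def x power_le_one_iff abs_square_le_1)
    qed
    show "grassmannian m \<subseteq> {X. -1 < e \<bullet> (X *v e)} \<inter> {X. e \<bullet> (X *v e) < 2}" using T by fastforce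
    show "F T = Psi_of h e T" if "T \<in> grassmannian m" for T
      using T[OF that] eqK[of "e \<bullet> (T *v e)"] by (simp add: F_def)
    show "continuous_on ({X. -1 < e \<bullet> (X *v e)} \<inter> {X. e \<bullet> (X *v e) < 2}) (\<lambda>X. kt (e \<bullet> (X *v e)) *\<^sub>R outer e e)"
      unfolding lin by (intro continuous_intros continuous_on_compose2[OF ck]) auto
    fix X :: "real^'n^'n" assume X: "X \<in> {X. -1 < e \<bullet> (X *v e)} \<inter> {X. e \<bullet> (X *v e) < 2}"
    have "((\<lambda>X. X \<bullet> outer e e) has_derivative (\<lambda>Y. Y \<bullet> outer e e)) (at X)" by (auto intro!: derivative_eq_intros)
    moreover have "(g has_derivative (\<lambda>s. s * kt (X \<bullet> outer e e))) (at (X \<bullet> outer e e))"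
      using dg[of "X \<bullet> outer e e"] X by (simp add: lin has_field_derivative_def mult_commute_abs)
    ultimately have "((\<lambda>X. g (X \<bullet> outer e e)) has_derivative (\<lambda>Y. (Y \<bullet> outer e e) * kt (X \<bullet> outer e e))) (at X)"
      by (rule has_derivative_compose)
    from has_derivative_add_const[OF this] show "GDERIV F X :> kt (e \<bullet> (X *v e)) *\<^sub>R outer e e"
      by (simp add: gderiv_def F_def[abs_def] lin mult.commute)
  qed
  moreover have "2 * kt ((cos \<theta>)\<^sup>2) * cos \<theta> * sin \<theta> = - H1 \<theta>" if t: "\<theta> \<in> {0..pi/2}" for \<theta>
  proof -
    have "cos \<theta> \<ge> 0" using t by (intro cos_ge_zero) auto
    moreover have "arccos (cos \<theta>) = \<theta>" using t by (intro arccos_cos) auto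
    moreover have "max 0 (min 1 ((cos \<theta>)\<^sup>2)) = (cos \<theta>)\<^sup>2" using abs_square_le_1[of "cos \<theta>"] abs_cos_le_one[of \<theta>] by auto
    ultimately have "kt ((cos \<theta>)\<^sup>2) = slope \<theta>" by (simp add: kt_def)
    then show ?thesis using slope_eq[OF t] by simp
  qed
  ultimately show thesis by (rule that)
qed

lemma C1_integrand_Psi: "C1_integrand m (Psi_of h e)"
proof -
  have "Psi_of h e T > 0" if "T \<in> grassmannian m" for T
  proof -
    obtain T' g' \<theta> where f: "adapted e m T' g'" "\<theta> \<in> {0..pi/2}" "T = frame_plane T' e g' \<theta>"
      "norm (T *v e) = cos \<theta>" "norm (perp T *v e) = sin \<theta>"
      using grassmannian_frame[OF e m \<open>T \<in> grassmannian m\<close>] .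
    then have "Psi_of h e T = H \<theta>" by (simp add: Psi_of_def polar_def)
    then show ?thesis using H_pos by simp
  qed
  then show ?thesis unfolding C1_integrand_def using extension_exists by metis
qed

section \<open>The tensor in adapted coordinates\<close>

definition XX where "XX \<theta> = H \<theta> * cos \<theta> - H1 \<theta> * sin \<theta>"
definition YY where "YY \<theta> = H \<theta> * sin \<theta> + H1 \<theta> * cos \<theta>"

lemma B_frame:
  assumes A: "adapted e m T' g" and t: "\<theta> \<in> {0..pi/2}"
  defines "T \<equiv> frame_plane T' e g \<theta>"
  shows "T \<in> grassmannian m" and "Psi_of h e T = H \<theta>"
    and "B_int m (Psi_of h e) T = H \<theta> *\<^sub>R T' + outer (XX \<theta> *\<^sub>R e + YY \<theta> *\<^sub>R g) (cos \<theta> *\<^sub>R e + sin \<theta> *\<^sub>R g)"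
proof -
  have ee: "e \<bullet> e = 1" using e by (simp add: dot_square_norm)
  have a: "norm g = 1" "g \<bullet> e = 0" "transpose T' = T'" "T' ** T' = T'" "trace T' = real m - 1" "T' *v e = 0" "T' *v g = 0"
    using A by (auto simp: adapted_def)
  have gg: "g \<bullet> g = 1" using a by (simp add: dot_square_norm)
  define w where "w = cos \<theta> *\<^sub>R e + sin \<theta> *\<^sub>R g"
  have cs: "(cos \<theta>)\<^sup>2 + (sin \<theta>)\<^sup>2 = 1" by simp
  have ww: "w \<bullet> w = 1" using cs by (simp add: w_def inner_add_left inner_add_right ee gg a inner_commute[of e g] power2_eq_square)
  then have wn: "norm w = 1" by (simp add: norm_eq_1)
  have we: "w \<bullet> e = cos \<theta>" by (simp add: w_def inner_add_left ee a)
  have Tw: "T' *v w = 0" by (simp add: w_def matrix_vector_right_distrib matrix_vector_mult_scaleR a)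
  have T: "T = T' + outer w w" by (simp add: T_def frame_plane_def w_def)
  note pr = add_outer_projection[OF a(3,4) wn Tw, folded T]
  show G: "T \<in> grassmannian m" using pr a by (simp add: grassmannian_def)
  have Te: "T *v e = cos \<theta> *\<^sub>R w" by (simp add: T matrix_vector_mult_add_rdistrib outer_mult_vec a we)
  have c0: "cos \<theta> \<ge> 0" "sin \<theta> \<ge> 0" using t by (auto intro!: cos_ge_zero sin_ge_zero)
  have pe: "perp T *v e = sin \<theta> *\<^sub>R (sin \<theta> *\<^sub>R e - cos \<theta> *\<^sub>R g)"
  proof -
    have "perp T *v e = e - cos \<theta> *\<^sub>R w" by (simp add: perp_def matrix_vector_mult_diff_rdistrib Te)
    also have "\<dots> = (1 - (cos \<theta>)\<^sup>2) *\<^sub>R e - (cos \<theta> * sin \<theta>) *\<^sub>R g" by (simp add: w_def algebra_simps power2_eq_square)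
    also have "1 - (cos \<theta>)\<^sup>2 = sin \<theta> * sin \<theta>" by (simp add: sin_squared_eq flip: power2_eq_square)
    finally show ?thesis by (simp add: scaleR_diff_right mult.commute)
  qed
  have "(norm (sin \<theta> *\<^sub>R e - cos \<theta> *\<^sub>R g))\<^sup>2 = 1"
    unfolding power2_norm_eq_inner by (simp add: inner_diff_left inner_diff_right ee gg a inner_commute[of e g] sin_cos_squared_add[unfolded power2_eq_square])
  then have "norm (sin \<theta> *\<^sub>R e - cos \<theta> *\<^sub>R g) = 1" by (simp add: power2_eq_1_iff) (metis norm_ge_zero neg_0_le_iff_le not_one_le_zero)
  then show P: "Psi_of h e T = H \<theta>" using wn c0 by (simp add: Psi_of_def polar_def Te pe)
  obtain F kt where E: "C1_extension m (Psi_of h e) F (\<lambda>X. kt (e \<bullet> (X *v e)) *\<^sub>R outer e e)"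
    and kt: "\<And>\<theta>. \<theta> \<in> {0..pi/2} \<Longrightarrow> 2 * kt ((cos \<theta>)\<^sup>2) * cos \<theta> * sin \<theta> = - H1 \<theta>" using extension_exists by metis
  have eT: "e \<bullet> (T *v e) = (cos \<theta>)\<^sup>2" by (simp add: Te inner_commute[of e] we power2_eq_square)
  have symT: "transpose T = T" using G by (simp add: grassmannian_def)
  have D: "k *\<^sub>R outer e e + transpose (k *\<^sub>R outer e e) = (2 * k) *\<^sub>R outer e e" for k
    by (simp add: outer_def transpose_def vec_eq_iff)
  \<comment> \<open>The gradient is a multiple of e \<otimes> e, so the off-diagonal block is a
    multiple of the outer product of \<open>perp T *v e\<close> and \<open>T *v e\<close>.\<close>
  have "B_int m (Psi_of h e) T = H \<theta> *\<^sub>R T + (2 * kt ((cos \<theta>)\<^sup>2)) *\<^sub>R outer (perp T *v e) (T *v e)"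
    unfolding B_int_eq[OF E G] P D eT by (simp only: scaleR_matrix_mult mult_outer outer_mult symT)
  also have "(2 * kt ((cos \<theta>)\<^sup>2)) *\<^sub>R outer (perp T *v e) (T *v e) = (2 * kt ((cos \<theta>)\<^sup>2) * cos \<theta> * sin \<theta>) *\<^sub>R outer (sin \<theta> *\<^sub>R e - cos \<theta> *\<^sub>R g) w"
    unfolding pe Te by (simp add: outer_scale_left outer_scale_right)
  also have "\<dots> = outer ((- H1 \<theta>) *\<^sub>R (sin \<theta> *\<^sub>R e - cos \<theta> *\<^sub>R g)) w" unfolding kt[OF t] outer_scale_left ..
  also have "H \<theta> *\<^sub>R T + outer ((- H1 \<theta>) *\<^sub>R (sin \<theta> *\<^sub>R e - cos \<theta> *\<^sub>R g)) w = H \<theta> *\<^sub>R T' + outer (H \<theta> *\<^sub>R w + (- H1 \<theta>) *\<^sub>R (sin \<theta> *\<^sub>R e - cos \<theta> *\<^sub>R g)) w"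
    by (simp only: T scaleR_right_distrib outer_add_left outer_scale_left add.assoc)
  also have "H \<theta> *\<^sub>R w + (- H1 \<theta>) *\<^sub>R (sin \<theta> *\<^sub>R e - cos \<theta> *\<^sub>R g) = XX \<theta> *\<^sub>R e + YY \<theta> *\<^sub>R g"
    by (simp add: w_def XX_def YY_def algebra_simps)
  finally show "B_int m (Psi_of h e) T = H \<theta> *\<^sub>R T' + outer (XX \<theta> *\<^sub>R e + YY \<theta> *\<^sub>R g) (cos \<theta> *\<^sub>R e + sin \<theta> *\<^sub>R g)"
    by (simp add: w_def)
qed

lemma XX_YY: "cos \<theta> * XX \<theta> + sin \<theta> * YY \<theta> = H \<theta>"
proof -
  have "cos \<theta> * XX \<theta> + sin \<theta> * YY \<theta> = ((sin \<theta>)\<^sup>2 + (cos \<theta>)\<^sup>2) * H \<theta>" unfolding XX_def YY_def by algebra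
  then show ?thesis by simp
qed

lemma USAC_form:
  assumes T: "adapted e m T' g" "\<theta> \<in> {0..pi/2}" and S: "adapted e m S' g'" "\<phi> \<in> {0..pi/2}"
  defines "M \<equiv> real m - trace (S' ** T')" and "\<sigma> \<equiv> g \<bullet> (S' *v g)" and "\<tau> \<equiv> g' \<bullet> (T' *v g')" and "\<mu> \<equiv> g \<bullet> g'"
  defines "form \<equiv> \<lambda>X Y X' Y'. (M - 1) * (cos \<theta> * X) * (cos \<phi> * X') + (M - 1 - \<sigma>) * (sin \<theta> * Y) * (cos \<phi> * X')
     + (M - 1 - \<tau>) * (sin \<phi> * Y') * (cos \<theta> * X) + (M - \<tau> - \<sigma> - \<mu>\<^sup>2) * (sin \<theta> * Y) * (sin \<phi> * Y')
     + (1 - \<mu>) * (sin \<phi> * Y * cos \<theta> * X' + sin \<theta> * Y' * cos \<phi> * X) + (sin \<theta> * cos \<phi> - cos \<theta> * sin \<phi>) * (Y * X' - X * Y')"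
  shows "B_int m (Psi_of h e) (frame_plane T' e g \<theta>) \<bullet> B_int (CARD('n) - m) (dual_integrand (Psi_of h e)) (perp (frame_plane S' e g' \<phi>))
      = form (XX \<theta>) (YY \<theta>) (XX \<phi>) (YY \<phi>)"
    and "(norm (frame_plane T' e g \<theta> - frame_plane S' e g' \<phi>))\<^sup>2 = 2 * form (cos \<theta>) (sin \<theta>) (cos \<phi>) (sin \<phi>)"
proof -
  have mN: "m \<le> CARD('n)" using m by simp
  note tf = trace_frame[OF e T(1) S(1) M_def[THEN meta_eq_to_obj_eq] \<sigma>_def[THEN meta_eq_to_obj_eq] \<tau>_def[THEN meta_eq_to_obj_eq] \<mu>_def[THEN meta_eq_to_obj_eq]]
  show "B_int m (Psi_of h e) (frame_plane T' e g \<theta>) \<bullet> B_int (CARD('n) - m) (dual_integrand (Psi_of h e)) (perp (frame_plane S' e g' \<phi>))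
      = form (XX \<theta>) (YY \<theta>) (XX \<phi>) (YY \<phi>)"
    unfolding inner_B_int_dual[OF mN C1_integrand_Psi B_frame(1)[OF S] B_frame(1)[OF T]]
    unfolding B_frame(2)[OF T] B_frame(2)[OF S] B_frame(3)[OF T] B_frame(3)[OF S] form_def
    by (rule tf[OF XX_YY XX_YY])
  have cs: "cos \<theta> * cos \<theta> + sin \<theta> * sin \<theta> = 1" "cos \<phi> * cos \<phi> + sin \<phi> * sin \<phi> = 1" by simp_all
  let ?T = "frame_plane T' e g \<theta>" and ?S = "frame_plane S' e g' \<phi>"
  have gT: "transpose ?T = ?T" "?T ** ?T = ?T" "trace ?T = real m" using B_frame(1)[OF T] by (auto simp: grassmannian_def)
  have gS: "transpose ?S = ?S" "?S ** ?S = ?S" "trace ?S = real m" using B_frame(1)[OF S] by (auto simp: grassmannian_def)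
  have "(norm (?T - ?S))\<^sup>2 = trace (transpose (?T - ?S) ** (?T - ?S))" by (simp add: power2_norm_eq_inner inner_eq_trace)
  also have "\<dots> = trace (?T - ?T ** ?S - (?S ** ?T - ?S))" by (simp add: transpose_diff gT gS matrix_sub_ldistrib matrix_sub_rdistrib algebra_simps)
  also have "\<dots> = 2 * (real m - trace (?S ** ?T))" by (simp add: trace_sub gT gS trace_mul_sym[of ?T ?S])
  also have "real m - trace (?S ** ?T) = form (cos \<theta>) (sin \<theta>) (cos \<phi>) (sin \<phi>)"
    using tf[OF cs] unfolding form_def frame_plane_def by simp
  finally show "(norm (?T - ?S))\<^sup>2 = 2 * form (cos \<theta>) (sin \<theta>) (cos \<phi>) (sin \<phi>)" .
qed

section \<open>Ellipticity of the norm and USAC\<close>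

lemma DERIV_XX: "(XX has_real_derivative - (H \<theta> + H2 \<theta>) * sin \<theta>) (at \<theta>)"
  unfolding XX_def[abs_def] by (rule DERIV_cong, rule DERIV_diff[OF DERIV_mult[OF D1 DERIV_cos] DERIV_mult[OF D2 DERIV_sin]]) (simp add: algebra_simps)

lemma DERIV_YY: "(YY has_real_derivative (H \<theta> + H2 \<theta>) * cos \<theta>) (at \<theta>)"
  unfolding YY_def[abs_def] by (rule DERIV_cong, rule DERIV_add[OF DERIV_mult[OF D1 DERIV_sin] DERIV_mult[OF D2 DERIV_cos]]) (simp add: algebra_simps)

lemma ellipticity_imp_USAC:
  assumes pos: "\<And>\<theta>. \<theta> \<in> {0..pi/2} \<Longrightarrow> H \<theta> + H2 \<theta> > 0"
  shows "USAC m (Psi_of h e)"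
proof -
  have cH: "continuous_on {0..pi/2} (\<lambda>\<theta>. H \<theta> + H2 \<theta>)"
    using DERIV_isCont[OF D1] by (intro continuous_intros continuous_on_subset[OF cont2] continuous_at_imp_continuous_on) auto
  have "{0..pi/2} \<noteq> {}" by simp
  then obtain \<theta>0 where \<theta>0: "\<theta>0 \<in> {0..pi/2}" "\<And>\<theta>. \<theta> \<in> {0..pi/2} \<Longrightarrow> H \<theta>0 + H2 \<theta>0 \<le> H \<theta> + H2 \<theta>"
    using continuous_attains_inf[OF compact_Icc _ cH] by metis
  define k where "k = H \<theta>0 + H2 \<theta>0"
  have k: "k > 0" using pos \<theta>0(1) by (simp add: k_def)
  have kle: "k \<le> H \<theta> + H2 \<theta>" if "\<theta> \<in> {0..pi/2}" for \<theta> using \<theta>0(2)[OF that] by (simp add: k_def)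
  \<comment> \<open>\<open>x\<close> and \<open>y\<close> are the excess over the round integrand k,
    whose components are k cos and k sin. Since H' vanishes at both ends, \<open>x\<close> decreases
    to 0 at pi/2 and \<open>y\<close> increases from 0 at 0.\<close>
  define x where "x \<theta> = XX \<theta> - k * cos \<theta>" for \<theta>
  define y where "y \<theta> = YY \<theta> - k * sin \<theta>" for \<theta>
  have dx: "(x has_real_derivative - ((H \<theta> + H2 \<theta> - k) * sin \<theta>)) (at \<theta>)" for \<theta>
    unfolding x_def[abs_def] by (rule DERIV_cong, rule DERIV_diff[OF DERIV_XX DERIV_cmult[OF DERIV_cos]]) (simp add: algebra_simps)
  have dy: "(y has_real_derivative (H \<theta> + H2 \<theta> - k) * cos \<theta>) (at \<theta>)" for \<theta>
    unfolding y_def[abs_def] by (rule DERIV_cong, rule DERIV_diff[OF DERIV_YY DERIV_cmult[OF DERIV_sin]]) (simp add: algebra_simps)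
  have xdec: "x b \<le> x a" and yinc: "y a \<le> y b" if "a \<in> {0..pi/2}" "b \<in> {0..pi/2}" "a \<le> b" for a b
  proof -
    show "x b \<le> x a"
    proof (rule DERIV_nonpos_imp_nonincreasing[OF that(3)])
      fix \<theta> assume "a \<le> \<theta>" "\<theta> \<le> b"
      then have t: "\<theta> \<in> {0..pi/2}" using that by auto
      have "sin \<theta> \<ge> 0" using t by (intro sin_ge_zero) auto
      then show "\<exists>u. (x has_real_derivative u) (at \<theta>) \<and> u \<le> 0" using dx[of \<theta>] kle[OF t] by (intro exI conjI) (auto intro!: mult_nonneg_nonneg)
    qed
    show "y a \<le> y b"
    proof (rule DERIV_nonneg_imp_nondecreasing[OF that(3)])
      fix \<theta> assume "a \<le> \<theta>" "\<theta> \<le> b"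
      then have t: "\<theta> \<in> {0..pi/2}" using that by auto
      have "cos \<theta> \<ge> 0" using t by (intro cos_ge_zero) auto
      then show "\<exists>u. (y has_real_derivative u) (at \<theta>) \<and> u \<ge> 0" using dy[of \<theta>] kle[OF t] by (intro exI[of _ "(H \<theta> + H2 \<theta> - k) * cos \<theta>"] conjI) (auto intro!: mult_nonneg_nonneg)
    qed
  qed
  have x0: "x \<theta> \<ge> 0" and y0: "y \<theta> \<ge> 0" if t: "\<theta> \<in> {0..pi/2}" for \<theta>
    using xdec[OF t, of "pi/2"] yinc[OF _ t, of 0] t by (auto simp: x_def y_def XX_def YY_def H1_ends)
  \<comment> \<open>Besides k^2 sin (\<theta> - \<phi>), the second factor consists of three
    determinants formed from one nondecreasing and one nonincreasing nonnegative function; each is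
    nonnegative when \<phi> \<le> \<theta>.\<close>
  have cross: "(sin \<theta> * cos \<phi> - cos \<theta> * sin \<phi>) * (YY \<theta> * XX \<phi> - XX \<theta> * YY \<phi>) \<ge> k\<^sup>2 * (sin \<theta> * cos \<phi> - cos \<theta> * sin \<phi>)\<^sup>2"
    if t: "\<theta> \<in> {0..pi/2}" and p: "\<phi> \<in> {0..pi/2}" and le: "\<phi> \<le> \<theta>" for \<theta> \<phi>
  proof -
    have ct: "cos \<theta> \<ge> 0" "sin \<theta> \<ge> 0" "cos \<phi> \<ge> 0" "sin \<phi> \<ge> 0" using t p by (auto intro!: cos_ge_zero sin_ge_zero)
    have mono: "sin \<phi> \<le> sin \<theta>" "cos \<theta> \<le> cos \<phi>" using t p le by (auto intro!: sin_monotone_2pi_le cos_monotone_0_pi_le)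
    have s0: "sin \<theta> * cos \<phi> - cos \<theta> * sin \<phi> \<ge> 0"
      using mono ct mult_mono[of "sin \<phi>" "sin \<theta>" "cos \<theta>" "cos \<phi>"] by (simp add: mult.commute)
    have "sin \<theta> * x \<phi> \<ge> sin \<phi> * x \<theta>" using mono(1) xdec[OF p t le] ct x0[OF t] by (intro mult_mono) auto
    moreover have "y \<theta> * cos \<phi> \<ge> y \<phi> * cos \<theta>" using mono(2) yinc[OF p t le] ct y0[OF t] by (intro mult_mono) auto
    moreover have "y \<theta> * x \<phi> \<ge> y \<phi> * x \<theta>" using yinc[OF p t le] xdec[OF p t le] x0[OF t] y0[OF t] by (intro mult_mono) auto
    ultimately have "k * (sin \<theta> * x \<phi> - sin \<phi> * x \<theta>) + k * (y \<theta> * cos \<phi> - y \<phi> * cos \<theta>) + (y \<theta> * x \<phi> - y \<phi> * x \<theta>) \<ge> 0"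
      using k by (intro add_nonneg_nonneg mult_nonneg_nonneg) auto
    moreover have "YY \<theta> * XX \<phi> - XX \<theta> * YY \<phi> = k\<^sup>2 * (sin \<theta> * cos \<phi> - cos \<theta> * sin \<phi>)
       + (k * (sin \<theta> * x \<phi> - sin \<phi> * x \<theta>) + k * (y \<theta> * cos \<phi> - y \<phi> * cos \<theta>) + (y \<theta> * x \<phi> - y \<phi> * x \<theta>))"
      by (simp add: x_def y_def algebra_simps power2_eq_square)
    ultimately have "YY \<theta> * XX \<phi> - XX \<theta> * YY \<phi> \<ge> k\<^sup>2 * (sin \<theta> * cos \<phi> - cos \<theta> * sin \<phi>)" by linarith
    from mult_left_mono[OF this s0] show ?thesis by (simp add: power2_eq_square mult_ac)
  qed
  have cross': "(sin \<theta> * cos \<phi> - cos \<theta> * sin \<phi>) * (YY \<theta> * XX \<phi> - XX \<theta> * YY \<phi>) \<ge> k\<^sup>2 * (sin \<theta> * cos \<phi> - cos \<theta> * sin \<phi>)\<^sup>2"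
    if t: "\<theta> \<in> {0..pi/2}" and p: "\<phi> \<in> {0..pi/2}" for \<theta> \<phi>
  proof (cases "\<phi> \<le> \<theta>")
    case True then show ?thesis using cross t p by blast
  next
    case False
    then have "(sin \<phi> * cos \<theta> - cos \<phi> * sin \<theta>) * (YY \<phi> * XX \<theta> - XX \<phi> * YY \<theta>) \<ge> k\<^sup>2 * (sin \<phi> * cos \<theta> - cos \<phi> * sin \<theta>)\<^sup>2"
      using cross[OF p t] by simp
    then show ?thesis by (simp add: algebra_simps power2_eq_square)
  qed
  \<comment> \<open>The factor 1/2 appears because the squared distance is twice the form of the
    round integrand.\<close>
  have "B_int m (Psi_of h e) T \<bullet> B_int (CARD('n) - m) (dual_integrand (Psi_of h e)) (perp S) \<ge> k\<^sup>2 / 2 * (norm (T - S))\<^sup>2"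
    if Sg: "S \<in> grassmannian m" and Tg: "T \<in> grassmannian m" for S T
  proof -
    obtain T' g \<theta> where T: "adapted e m T' g" "\<theta> \<in> {0..pi/2}" "T = frame_plane T' e g \<theta>" using grassmannian_frame[OF e m Tg] by metis
    obtain S' g' \<phi> where S: "adapted e m S' g'" "\<phi> \<in> {0..pi/2}" "S = frame_plane S' e g' \<phi>" using grassmannian_frame[OF e m Sg] by metis
    note form = USAC_form[OF T(1,2) S(1,2), folded T(3) S(3)]
    note co = frame_coefficients[OF T(1) S(1) refl refl refl refl]
    have ct: "cos \<theta> \<ge> 0" "sin \<theta> \<ge> 0" "cos \<phi> \<ge> 0" "sin \<phi> \<ge> 0" using T(2) S(2) by (auto intro!: cos_ge_zero sin_ge_zero)
    have X: "XX \<theta> \<ge> k * cos \<theta>" "XX \<phi> \<ge> k * cos \<phi>" "YY \<theta> \<ge> k * sin \<theta>" "YY \<phi> \<ge> k * sin \<phi>"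
      using x0[OF T(2)] x0[OF S(2)] y0[OF T(2)] y0[OF S(2)] by (auto simp: x_def y_def)
    have k0: "k * cos \<theta> \<ge> 0" "k * cos \<phi> \<ge> 0" "k * sin \<theta> \<ge> 0" "k * sin \<phi> \<ge> 0" using ct k by auto
    have mm: "p * (a * z) * (a' * z') \<le> p * (a * u) * (a' * u')"
      if "p \<ge> 0" "a \<ge> 0" "a' \<ge> 0" "z \<le> u" "z' \<le> u'" "0 \<le> z" "0 \<le> z'" for p a z a' z' u u' :: real
    proof -
      have "0 \<le> u" "0 \<le> u'" using that by linarith+
      then show ?thesis using that by (intro mult_mono mult_left_mono mult_nonneg_nonneg) auto
    qed
    have "k\<^sup>2 / 2 * (norm (T - S))\<^sup>2 = (real m - trace (S' ** T') - 1) * (cos \<theta> * (k * cos \<theta>)) * (cos \<phi> * (k * cos \<phi>))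
      + (real m - trace (S' ** T') - 1 - g \<bullet> (S' *v g)) * (sin \<theta> * (k * sin \<theta>)) * (cos \<phi> * (k * cos \<phi>))
      + (real m - trace (S' ** T') - 1 - g' \<bullet> (T' *v g')) * (sin \<phi> * (k * sin \<phi>)) * (cos \<theta> * (k * cos \<theta>))
      + (real m - trace (S' ** T') - g' \<bullet> (T' *v g') - g \<bullet> (S' *v g) - (g \<bullet> g')\<^sup>2) * (sin \<theta> * (k * sin \<theta>)) * (sin \<phi> * (k * sin \<phi>))
      + ((1 - g \<bullet> g') * (sin \<phi> * (k * sin \<theta>)) * (cos \<theta> * (k * cos \<phi>)) + (1 - g \<bullet> g') * (sin \<theta> * (k * sin \<phi>)) * (cos \<phi> * (k * cos \<theta>)))
      + k\<^sup>2 * (sin \<theta> * cos \<phi> - cos \<theta> * sin \<phi>)\<^sup>2"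
      unfolding form(2) by (simp add: algebra_simps power2_eq_square)
    also have "\<dots> \<le> (real m - trace (S' ** T') - 1) * (cos \<theta> * XX \<theta>) * (cos \<phi> * XX \<phi>)
      + (real m - trace (S' ** T') - 1 - g \<bullet> (S' *v g)) * (sin \<theta> * YY \<theta>) * (cos \<phi> * XX \<phi>)
      + (real m - trace (S' ** T') - 1 - g' \<bullet> (T' *v g')) * (sin \<phi> * YY \<phi>) * (cos \<theta> * XX \<theta>)
      + (real m - trace (S' ** T') - g' \<bullet> (T' *v g') - g \<bullet> (S' *v g) - (g \<bullet> g')\<^sup>2) * (sin \<theta> * YY \<theta>) * (sin \<phi> * YY \<phi>)
      + ((1 - g \<bullet> g') * (sin \<phi> * YY \<theta>) * (cos \<theta> * XX \<phi>) + (1 - g \<bullet> g') * (sin \<theta> * YY \<phi>) * (cos \<phi> * XX \<theta>))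
      + (sin \<theta> * cos \<phi> - cos \<theta> * sin \<phi>) * (YY \<theta> * XX \<phi> - XX \<theta> * YY \<phi>)"
      by (intro add_mono mm co ct X k0 cross' T(2) S(2))
    also have "\<dots> = B_int m (Psi_of h e) T \<bullet> B_int (CARD('n) - m) (dual_integrand (Psi_of h e)) (perp S)"
      unfolding form(1) by (simp add: distrib_left mult.assoc)
    finally show ?thesis .
  qed
  then show ?thesis unfolding USAC_def using C1_integrand_Psi k by (intro conjI exI[of _ "k\<^sup>2 / 2"]) auto
qed

text \<open>The orthogonal complement of e has dimension N - 1 \<ge> m. Of m orthonormal vectors in
  it, one becomes g and the others span the range of T'.\<close>

lemma adapted_exists: "\<exists>T' g. adapted e m T' g"
proof -
  let ?U = "{y. orthogonal e y}"
  have "dim {y \<in> UNIV. \<forall>x\<in>span {e}. orthogonal x y} + dim (span {e}) = dim (UNIV :: (real^'n) set)"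
    by (rule dim_subspace_orthogonal_to_vectors) auto
  moreover have "{y \<in> UNIV. \<forall>x\<in>span {e}. orthogonal x y} = ?U"
    by (auto simp: span_singleton orthogonal_def)
  moreover have "dim (span {e}) \<le> 1" using dim_le_card[of "span {e}" "{e}"] by simp
  ultimately have dU: "dim ?U \<ge> m" using m by simp
  have "subspace ?U" by (auto simp: subspace_def orthogonal_def inner_add_right)
  then obtain B where B: "B \<subseteq> ?U" "pairwise orthogonal B" "\<And>x. x \<in> B \<Longrightarrow> norm x = 1"
    "independent B" "card B = dim ?U" by (rule orthonormal_basis_subspace) (rule that; blast)
  have "m \<le> card B" using dU B(5) by simp
  then obtain B' where B': "B' \<subseteq> B" "card B' = m" "finite B'" using obtain_subset_with_card_n by blast
  then obtain g where g: "g \<in> B'" using m by fastforce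
  let ?C = "B' - {g}"
  have C: "finite ?C" "pairwise orthogonal ?C" "\<And>x. x \<in> ?C \<Longrightarrow> norm x = 1" "card ?C = m - 1"
    using B B' g by (auto intro: pairwise_subset)
  define T' where "T' = (\<Sum>b\<in>?C. outer b b)"
  note pr = orthonormal_projection[OF C(1,2,3), folded T'_def]
  have T'v: "T' *v x = (\<Sum>b\<in>?C. (b \<bullet> x) *\<^sub>R b)" for x by (rule pr(2))
  have ge: "g \<bullet> e = 0" using g B' B(1) by (auto simp: orthogonal_def inner_commute)
  have "T' *v e = 0" unfolding T'v
  proof (rule sum.neutral, rule ballI)
    fix b assume "b \<in> ?C"
    then have "b \<bullet> e = 0" using B' B(1) by (auto simp: orthogonal_def inner_commute)
    then show "(b \<bullet> e) *\<^sub>R b = 0" by simp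
  qed
  moreover have "T' *v g = 0" unfolding T'v
  proof (rule sum.neutral, rule ballI)
    fix b assume b: "b \<in> ?C"
    then have "b \<in> B" "g \<in> B" "b \<noteq> g" using B' g by auto
    then have "b \<bullet> g = 0" using pairwiseD[OF B(2)] by (simp add: orthogonal_def)
    then show "(b \<bullet> g) *\<^sub>R b = 0" by simp
  qed
  moreover have "norm g = 1" using g B' B(3) by auto
  ultimately have "adapted e m T' g" using pr(1) ge C(4) m by (simp add: adapted_def grassmannian_def of_nat_diff)
  then show ?thesis by blast
qed

text \<open>Two planes with the same \<open>T'\<close> and \<open>g\<close> differ by a rotation in
  one angle, and all coefficients of the form vanish (M = 1, \<sigma> = \<tau> = 0, \<mu> = 1)
  except that of the cross term. Dividing by sin^2 (x - \<theta>) and letting x tend to \<theta>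
  turns the cross term into (H + H'') H.\<close>

lemma USAC_imp_ellipticity:
  assumes U: "USAC m (Psi_of h e)" and t: "\<theta> \<in> {0..pi/2}"
  shows "H \<theta> + H2 \<theta> > 0"
proof -
  obtain c where c: "c > 0" "\<And>S T. S \<in> grassmannian m \<Longrightarrow> T \<in> grassmannian m \<Longrightarrow>
     B_int m (Psi_of h e) T \<bullet> B_int (CARD('n) - m) (dual_integrand (Psi_of h e)) (perp S) \<ge> c * (norm (T - S))\<^sup>2"
    using U by (auto simp: USAC_def)
  obtain T' g where A: "adapted e m T' g" using adapted_exists by blast
  have a: "trace (T' ** T') = real m - 1" "g \<bullet> (T' *v g) = 0" "g \<bullet> g = 1" using A by (auto simp: adapted_def dot_square_norm)
  have le: "(sin x * cos \<theta> - cos x * sin \<theta>) * (YY x * XX \<theta> - XX x * YY \<theta>) \<ge> c * (2 * (sin x * cos \<theta> - cos x * sin \<theta>)\<^sup>2)"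
    if x: "x \<in> {0..pi/2}" for x
    using c(2)[OF B_frame(1)[OF A t] B_frame(1)[OF A x]] unfolding USAC_form[OF A x A t] a
    by (simp add: power2_eq_square)
  have "((\<lambda>x. (YY x * XX \<theta> - XX x * YY \<theta>) / sin (x - \<theta>)) \<longlongrightarrow> ((H \<theta> + H2 \<theta>) * H \<theta>) / 1) (at \<theta>)"
  proof (rule tendsto_quotient_derivatives)
    show "((\<lambda>x. YY x * XX \<theta> - XX x * YY \<theta>) has_real_derivative (H \<theta> + H2 \<theta>) * H \<theta>) (at \<theta>)"
    proof (rule DERIV_cong[OF DERIV_diff[OF DERIV_cmult_right[OF DERIV_YY] DERIV_cmult_right[OF DERIV_XX]]])
      show "(H \<theta> + H2 \<theta>) * cos \<theta> * XX \<theta> - - (H \<theta> + H2 \<theta>) * sin \<theta> * YY \<theta> = (H \<theta> + H2 \<theta>) * H \<theta>"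
        unfolding XX_YY[symmetric, of \<theta>] by (simp add: algebra_simps)
    qed
    show "((\<lambda>x. sin (x - \<theta>)) has_real_derivative 1) (at \<theta>)" by (auto intro!: derivative_eq_intros)
  qed auto
  \<comment> \<open>The inequality is known only for angles in [0, pi/2], so at the endpoints the
    limit is one-sided.\<close>
  then have lim: "((\<lambda>x. (YY x * XX \<theta> - XX x * YY \<theta>) / sin (x - \<theta>)) \<longlongrightarrow> (H \<theta> + H2 \<theta>) * H \<theta>) (at \<theta> within {0..pi/2})"
    by (simp add: tendsto_within_subset[of _ _ _ UNIV])
  have "\<forall>\<^sub>F x in at \<theta> within {0..pi/2}. 2 * c \<le> (YY x * XX \<theta> - XX x * YY \<theta>) / sin (x - \<theta>)"
    unfolding eventually_at_filter
  proof (rule always_eventually, intro allI impI)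
    fix x assume x: "x \<noteq> \<theta>" "x \<in> {0..pi/2}"
    define s where "s = sin (x - \<theta>)"
    define w where "w = YY x * XX \<theta> - XX x * YY \<theta>"
    have "s \<noteq> 0" using x t sin_eq_0_pi[of "x - \<theta>"] by (auto simp: s_def)
    have "s * w \<ge> c * (2 * s\<^sup>2)" using le[OF x(2)] by (simp add: s_def w_def sin_diff)
    then have "s * w / (s * s) \<ge> c * (2 * s\<^sup>2) / (s * s)" by (intro divide_right_mono) auto
    then have "2 * c \<le> w / s" using \<open>s \<noteq> 0\<close> by (simp add: power2_eq_square)
    then show "2 * c \<le> (YY x * XX \<theta> - XX x * YY \<theta>) / sin (x - \<theta>)" by (simp add: s_def w_def)
  qed
  moreover have "at \<theta> within {0..pi/2} \<noteq> bot" using t islimpt_Icc[of 0 "pi/2" \<theta>] by (simp add: trivial_limit_within)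
  ultimately have "2 * c \<le> (H \<theta> + H2 \<theta>) * H \<theta>" by (intro tendsto_lowerbound[OF lim])
  then have "(H \<theta> + H2 \<theta>) * H \<theta> > 0" using c(1) by linarith
  then show ?thesis using H_pos[of \<theta>] by (simp add: zero_less_mult_iff)
qed

end

theorem theorem1p4:
  fixes m :: nat and e :: "real^'n" and h :: "real \<times> real \<Rightarrow> real"
  assumes "2 \<le> m" and "m < CARD('n)"
    and "norm e = 1"
    and "absolute_norm h" and "C2_on (- {0}) h"
  shows "(USAC m (Psi_of h e) \<longleftrightarrow>
            (\<forall>\<theta>\<in>{0..pi/2}. polar h \<theta> + deriv (deriv (polar h)) \<theta> > 0)) \<and>
         ((\<forall>\<theta>\<in>{0..pi/2}. polar h \<theta> + deriv (deriv (polar h)) \<theta> > 0) \<longrightarrow>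
            supports_Michael_Simon m (Psi_of h e))"
proof -
  obtain H1 H2 where H: "\<And>\<theta>. (polar h has_real_derivative H1 \<theta>) (at \<theta>)" "\<And>\<theta>. (H1 has_real_derivative H2 \<theta>) (at \<theta>)"
    "continuous_on UNIV H2" using polar_derivatives[OF assms(5)] by metis
  interpret norm_integrand h e H1 H2 m
    by unfold_locales (use assms H in auto)
  have "deriv (polar h) = H1" using DERIV_imp_deriv[OF H(1)] by auto
  then have d: "deriv (deriv (polar h)) = H2" using DERIV_imp_deriv[OF H(2)] by auto
  have iff: "USAC m (Psi_of h e) \<longleftrightarrow> (\<forall>\<theta>\<in>{0..pi/2}. polar h \<theta> + deriv (deriv (polar h)) \<theta> > 0)"
    unfolding d using ellipticity_imp_USAC USAC_imp_ellipticity by blast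
  moreover have "supports_Michael_Simon m (Psi_of h e)" if "USAC m (Psi_of h e)"
    using USAC_imp_supports_Michael_Simon[OF _ assms(2) that] assms(1) by simp
  ultimately show ?thesis by blast
qed

end
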